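(* As $\varepsilon\to 0$, the functionals $J^{vK}_\varepsilon:=J^{ext}_\varepsilon+J^{ben}_\varepsilon$ $\Gamma$-converge to the functional $J^{vK}$ in the following sense: (i) (liminf inequality) for every pair of sequences $(y_\varepsilon)\subset W^{1,2}_{\langle 0\rangle}(S;\mathbb{R}^2)$, $(w_\varepsilon)\subset W^{2,2}_{\langle 0\rangle}(S)$, every $y\in BN_{\langle 0\rangle}(S;\mathbb{R}^2)$, $w\in W^{2,2}_{\langle 0\rangle}(I)$ and $\vartheta\in W^{1,2}_{\langle 0\rangle}(I)$ such that $y_\varepsilon\rightharpoonup y$ weakly in $W^{1,2}(S;\mathbb{R}^2)$, $w_\varepsilon\rightharpoonup w$ weakly in $W^{2,2}(S)$ and $\nabla_{\!\varepsilon} w_\varepsilon\rightharpoonup (w',\vartheta)$ weakly in $W^{1,2}(S;\mathbb{R}^2)$, we have $$\liminf_{\varepsilon\to 0} J^{vK}_\varepsilon(y_\varepsilon,w_\varepsilon)\ge J^{vK}(y,w,\vartheta);$$ (ii) (recovery sequence) for every $y\in BN_{\langle 0\rangle}(S;\mathbb{R}^2)$, $w\in W^{2,2}_{\langle 0\rangle}(I)$ and $\vartheta\in W^{1,2}_{\langle 0\rangle}(I)$ there exists a pair of sequences $(y_\varepsilon)\subset W^{1,2}_{\langle 0\rangle}(S;\mathbb{R}^2)$, $(w_\varepsilon)\subset W^{2,2}_{\langle 0\rangle}(S)$ such that $y_\varepsilon\rightharpoonup y$ weakly in $W^{1,2}(S;\mathbb{R}^2)$, $w_\varepsilon\rightharpoonup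 w$ weakly in $W^{2,2}(S)$, $\nabla_{\!\varepsilon} w_\varepsilon\rightharpoonup (w',\vartheta)$ weakly in $W^{1,2}(S;\mathbb{R}^2)$, and $$\limsup_{\varepsilon\to 0} J^{vK}_\varepsilon(y_\varepsilon,w_\varepsilon)\le J^{vK}(y,w,\vartheta).$$
   Context: Let $\ell>0$, $I=(-\ell/2,\ell/2)$ and $S=I\times(-1/2,1/2)\subset\mathbb{R}^2$, with coordinates $x=(x_1,x_2)$. Functions on $I$ are identified with functions on $S$ that are independent of $x_2$. The parameter $\varepsilon>0$ tends to $0$; "sequences" $(y_\varepsilon)$, $(w_\varepsilon)$ are indexed by such $\varepsilon$. $\mathbb{R}^{2\times2}_{\rm sym}$ is the space of symmetric real $2\times 2$ matrices, and $Q_2:\mathbb{R}^{2\times 2}_{\rm sym}\to[0,+\infty)$ is a given positive definite quadratic form. For an open set $\Omega\subset\mathbb{R}^\alpha$, $\alpha=1,2$, $$W^{1,2}_{\langle 0\rangle}(\Omega):=\Big\{g\in W^{1,2}(\Omega): \int_\Omega g\,dx=0\Big\},\qquad W^{2,2}_{\langle 0\rangle}(\Omega):=\Big\{g\in W^{2,2}(\Omega): \int_\Omega g\,dx=0,\ \int_\Omega\nabla g\,dx=0\Big\},$$ and $W^{1,2}_{\langle 0\rangle}(\Omega;\mathbb{R}^2)$ is defined similarly (zero average). For $g\in W^{1,2}(S;\mathbb{R}^2)$, $Eg:=\frac12(\nabla g+\nabla g^T)$. The space of two-dimensional Bernoulli-Navier functions is $$BN_{\langle 0\rangle}(S;\mathbb{R}^2):=\{g\in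 W^{1,2}_{\langle 0\rangle}(S;\mathbb{R}^2): (Eg)_{12}=(Eg)_{22}=0\};$$ equivalently, $g\in W^{1,2}_{\langle 0\rangle}(S;\mathbb{R}^2)$ belongs to it iff there exist $\xi_1\in W^{1,2}_{\langle 0\rangle}(I)$ and $\xi_2\in W^{1,2}_{\langle 0\rangle}(I)\cap W^{2,2}(I)$ with $g_1(x)=\xi_1(x_1)-x_2\xi_2'(x_1)$, $g_2(x)=\xi_2(x_1)$. Scaled differential operators: for $y\in W^{1,2}(S;\mathbb{R}^2)$ and $w\in W^{2,2}(S)$, $$E^\varepsilon y:=\begin{pmatrix}\partial_1y_1&\frac1{2\varepsilon}(\partial_1y_2+\partial_2y_1)\\ \frac1{2\varepsilon}(\partial_2y_1+\partial_1y_2)&\frac1{\varepsilon^2}\partial_2y_2\end{pmatrix},$$ $$\nabla_{\!\varepsilon} w:=\Big(\partial_1 w,\tfrac1\varepsilon\partial_2 w\Big),\qquad \nabla^2_\varepsilon w:=\begin{pmatrix}\partial^2_{11}w & \frac1\varepsilon\partial^2_{12}w\\ \frac1\varepsilon\partial^2_{21}w & \frac1{\varepsilon^2}\partial^2_{22}w\end{pmatrix}.$$ Scaled extensional and bending energies, for $y\in W^{1,2}_{\langle 0\rangle}(S;\mathbb{R}^2)$ and $w\in W^{2,2}_{\langle 0\rangle}(S)$: $$J^{ext}_\varepsilon(y,w):=\frac12\int_S Q_2\Big(E^\varepsilon y+\frac12\nabla_{\!\varepsilon} w\otimes\nabla_{\!\varepsilon} w\Big)dx,\qquad J^{ben}_\varepsilon(w):=\frac1{24}\int_S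 Q_2(\nabla^2_\varepsilon w)\,dx,$$ and $J^{vK}_\varepsilon(y,w):=J^{ext}_\varepsilon(y,w)+J^{ben}_\varepsilon(w)$. Limit densities $Q_1:\mathbb{R}\times\mathbb{R}\to[0,+\infty)$ and $Q_0:\mathbb{R}\to[0,+\infty)$: $$Q_1(\kappa,\tau):=\min_{\gamma\in\mathbb{R}} Q_2\begin{pmatrix}\kappa&\tau\\ \tau&\gamma\end{pmatrix},\qquad Q_0(\mu):=\min_{z\in\mathbb{R}}Q_1(\mu,z)=\min_{(z_1,z_2)\in\mathbb{R}^2}Q_2\begin{pmatrix}\mu&z_1\\ z_1&z_2\end{pmatrix}.$$ Limit functional $J^{vK}:BN_{\langle 0\rangle}(S;\mathbb{R}^2)\times W^{2,2}_{\langle 0\rangle}(I)\times W^{1,2}_{\langle 0\rangle}(I)\to\mathbb{R}$: $$J^{vK}(y,w,\vartheta):=\frac12\int_S Q_0\Big(\partial_1y_1+\frac{|w'|^2}{2}\Big)dx+\frac1{24}\int_I Q_1(w'',\vartheta')\,dx_1.$$ *)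

theory Defs
  imports "HOL-Analysis.Analysis"
begin

section \<open>Sobolev spaces\<close>

text \<open>Elements of Lebesgue and Sobolev spaces are represented by functions, not by classes of
  functions; every notion below is invariant under modification on a null set.\<close>

definition locally_integrable ::
    "'a::euclidean_space set \<Rightarrow> ('a \<Rightarrow> 'b::euclidean_space) \<Rightarrow> bool" where
  "locally_integrable \<Omega> f \<longleftrightarrow> (\<forall>K. compact K \<and> K \<subseteq> \<Omega> \<longrightarrow> set_integrable lebesgue K f)"

definition L2 :: "'a::euclidean_space set \<Rightarrow> ('a \<Rightarrow> 'b::euclidean_space) set" where
  "L2 \<Omega> = {f. set_borel_measurable lebesgue \<Omega> f \<and>
              set_integrable lebesgue \<Omega> (\<lambda>x. (norm (f x))\<^sup>2)}"

primrec C_k :: "nat \<Rightarrow> ('a::euclidean_space \<Rightarrow> real) \<Rightarrow> bool" where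
  "C_k 0 f \<longleftrightarrow> continuous_on UNIV f"
| "C_k (Suc k) f \<longleftrightarrow> (\<forall>x. f differentiable (at x)) \<and>
     (\<forall>b\<in>Basis. C_k k (\<lambda>x. frechet_derivative f (at x) b))"

definition test_functions :: "'a::euclidean_space set \<Rightarrow> ('a \<Rightarrow> real) set" where
  "test_functions \<Omega> =
     {\<phi>. (\<forall>k. C_k k \<phi>) \<and> (\<exists>K. compact K \<and> K \<subseteq> \<Omega> \<and> (\<forall>x. x \<notin> K \<longrightarrow> \<phi> x = 0))}"

definition has_weak_deriv ::
    "'a::euclidean_space set \<Rightarrow> 'a \<Rightarrow> ('a \<Rightarrow> 'b::euclidean_space) \<Rightarrow> ('a \<Rightarrow> 'b) \<Rightarrow> bool" where
  "has_weak_deriv \<Omega> b f g \<longleftrightarrow> locally_integrable \<Omega> f \<and> locally_integrable \<Omega> g \<and>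
     (\<forall>\<phi>\<in>test_functions \<Omega>.
        (LINT x:\<Omega>|lebesgue. frechet_derivative \<phi> (at x) b *\<^sub>R f x)
          = - (LINT x:\<Omega>|lebesgue. \<phi> x *\<^sub>R g x))"

text \<open>On an open set a weak derivative is unique up to null sets; \<open>wderiv\<close> picks a representative
  and is only meaningful where a weak derivative exists.\<close>

definition wderiv ::
    "'a::euclidean_space set \<Rightarrow> 'a \<Rightarrow> ('a \<Rightarrow> 'b::euclidean_space) \<Rightarrow> 'a \<Rightarrow> 'b" where
  "wderiv \<Omega> b f = (SOME g. has_weak_deriv \<Omega> b f g)"

definition W12 :: "'a::euclidean_space set \<Rightarrow> ('a \<Rightarrow> 'b::euclidean_space) set" where
  "W12 \<Omega> = {f \<in> L2 \<Omega>. \<forall>b\<in>Basis. \<exists>g\<in>L2 \<Omega>. has_weak_deriv \<Omega> b f g}"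

definition W22 :: "'a::euclidean_space set \<Rightarrow> ('a \<Rightarrow> 'b::euclidean_space) set" where
  "W22 \<Omega> = {f \<in> W12 \<Omega>. \<forall>b\<in>Basis. wderiv \<Omega> b f \<in> W12 \<Omega>}"

definition W12_0 :: "'a::euclidean_space set \<Rightarrow> ('a \<Rightarrow> 'b::euclidean_space) set" where
  "W12_0 \<Omega> = {f \<in> W12 \<Omega>. (LINT x:\<Omega>|lebesgue. f x) = 0}"

definition W22_0 :: "'a::euclidean_space set \<Rightarrow> ('a \<Rightarrow> 'b::euclidean_space) set" where
  "W22_0 \<Omega> = {f \<in> W22 \<Omega>. (LINT x:\<Omega>|lebesgue. f x) = 0 \<and>
                (\<forall>b\<in>Basis. (LINT x:\<Omega>|lebesgue. wderiv \<Omega> b f x) = 0)}"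

definition norm_W12 :: "'a::euclidean_space set \<Rightarrow> ('a \<Rightarrow> 'b::euclidean_space) \<Rightarrow> real" where
  "norm_W12 \<Omega> f = sqrt ((LINT x:\<Omega>|lebesgue. (norm (f x))\<^sup>2) +
     (\<Sum>b\<in>Basis. LINT x:\<Omega>|lebesgue. (norm (wderiv \<Omega> b f x))\<^sup>2))"

definition norm_W22 :: "'a::euclidean_space set \<Rightarrow> ('a \<Rightarrow> 'b::euclidean_space) \<Rightarrow> real" where
  "norm_W22 \<Omega> f = sqrt ((LINT x:\<Omega>|lebesgue. (norm (f x))\<^sup>2) +
     (\<Sum>b\<in>Basis. LINT x:\<Omega>|lebesgue. (norm (wderiv \<Omega> b f x))\<^sup>2) +
     (\<Sum>b\<in>Basis. \<Sum>c\<in>Basis. LINT x:\<Omega>|lebesgue. (norm (wderiv \<Omega> b (wderiv \<Omega> c f) x))\<^sup>2))"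

text \<open>Weak convergence in a function space \<open>V\<close> with (semi)norm \<open>N\<close>: convergence against all
  bounded linear functionals on \<open>V\<close>. The behaviour of \<open>T\<close> outside \<open>V\<close> is irrelevant.\<close>

definition bounded_functional ::
    "('a \<Rightarrow> 'b::real_vector) set \<Rightarrow> (('a \<Rightarrow> 'b) \<Rightarrow> real) \<Rightarrow> (('a \<Rightarrow> 'b) \<Rightarrow> real) \<Rightarrow> bool" where
  "bounded_functional V N T \<longleftrightarrow>
     (\<forall>f\<in>V. \<forall>g\<in>V. T (\<lambda>x. f x + g x) = T f + T g) \<and>
     (\<forall>c. \<forall>f\<in>V. T (\<lambda>x. c *\<^sub>R f x) = c * T f) \<and>
     (\<exists>C. \<forall>f\<in>V. \<bar>T f\<bar> \<le> C * N f)"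

definition weakly_converges ::
    "('a \<Rightarrow> 'b::real_vector) set \<Rightarrow> (('a \<Rightarrow> 'b) \<Rightarrow> real) \<Rightarrow>
     ('i \<Rightarrow> 'a \<Rightarrow> 'b) \<Rightarrow> ('a \<Rightarrow> 'b) \<Rightarrow> 'i filter \<Rightarrow> bool" where
  "weakly_converges V N u v F \<longleftrightarrow> (\<forall>\<^sub>F i in F. u i \<in> V) \<and> v \<in> V \<and>
     (\<forall>T. bounded_functional V N T \<longrightarrow> ((\<lambda>i. T (u i)) \<longlongrightarrow> T v) F)"

section \<open>Quadratic forms on symmetric matrices\<close>

definition mat22 :: "real \<Rightarrow> real \<Rightarrow> real \<Rightarrow> real \<Rightarrow> real^2^2" where
  "mat22 a b c d = vector [vector [a, b], vector [c, d]]"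

definition tensor :: "real \<times> real \<Rightarrow> real \<times> real \<Rightarrow> real^2^2" where
  "tensor a b = mat22 (fst a * fst b) (fst a * snd b) (snd a * fst b) (snd a * snd b)"

text \<open>The values of \<open>Q\<close> at non-symmetric matrices are unconstrained. Bilinear forms on
  the subspace of symmetric matrices are exactly the restrictions of bilinear forms on
  all matrices.\<close>

definition pos_def_quadratic_form_sym :: "(real^2^2 \<Rightarrow> real) \<Rightarrow> bool" where
  "pos_def_quadratic_form_sym Q \<longleftrightarrow>
     (\<exists>B. bilinear B \<and> (\<forall>A. transpose A = A \<longrightarrow> Q A = B A A)) \<and>
     (\<forall>A. transpose A = A \<and> A \<noteq> 0 \<longrightarrow> Q A > 0)"

text \<open>\<open>LEAST\<close> on the reals is the minimum, which is attained when \<open>Q2\<close> is positive definite.\<close>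

definition Q1 :: "(real^2^2 \<Rightarrow> real) \<Rightarrow> real \<Rightarrow> real \<Rightarrow> real" where
  "Q1 Q2 \<kappa> \<tau> = (LEAST m. \<exists>\<gamma>. m = Q2 (mat22 \<kappa> \<tau> \<tau> \<gamma>))"

definition Q0 :: "(real^2^2 \<Rightarrow> real) \<Rightarrow> real \<Rightarrow> real" where
  "Q0 Q2 \<mu> = (LEAST m. \<exists>z. m = Q1 Q2 \<mu> z)"

section \<open>The functionals\<close>

text \<open>The plane is \<open>real \<times> real\<close>, so that \<open>S\<close> is literally a product of intervals.\<close>

definition I_dom :: "real \<Rightarrow> real set" where
  "I_dom l = {-l/2<..<l/2}"

definition S_dom :: "real \<Rightarrow> (real \<times> real) set" where
  "S_dom l = I_dom l \<times> {-1/2<..<1/2}"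

abbreviation D1 :: "real \<Rightarrow> (real \<times> real \<Rightarrow> 'b::euclidean_space) \<Rightarrow> real \<times> real \<Rightarrow> 'b" where
  "D1 l \<equiv> wderiv (S_dom l) (1, 0)"

abbreviation D2 :: "real \<Rightarrow> (real \<times> real \<Rightarrow> 'b::euclidean_space) \<Rightarrow> real \<times> real \<Rightarrow> 'b" where
  "D2 l \<equiv> wderiv (S_dom l) (0, 1)"

abbreviation DI :: "real \<Rightarrow> (real \<Rightarrow> real) \<Rightarrow> real \<Rightarrow> real" where
  "DI l \<equiv> wderiv (I_dom l) 1"

definition sym_grad :: "real \<Rightarrow> (real \<times> real \<Rightarrow> real \<times> real) \<Rightarrow> real \<times> real \<Rightarrow> real^2^2" where
  "sym_grad l g x =
     (let G = mat22 (fst (D1 l g x)) (fst (D2 l g x)) (snd (D1 l g x)) (snd (D2 l g x))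
      in (1/2) *\<^sub>R (G + transpose G))"

definition BN_0 :: "real \<Rightarrow> (real \<times> real \<Rightarrow> real \<times> real) set" where
  "BN_0 l = {g \<in> W12_0 (S_dom l).
     AE x in lebesgue. x \<in> S_dom l \<longrightarrow> sym_grad l g x $ 1 $ 2 = 0 \<and> sym_grad l g x $ 2 $ 2 = 0}"

definition E_eps :: "real \<Rightarrow> real \<Rightarrow> (real \<times> real \<Rightarrow> real \<times> real) \<Rightarrow> real \<times> real \<Rightarrow> real^2^2" where
  "E_eps l \<epsilon> y x = mat22
     (fst (D1 l y x))
     (1 / (2 * \<epsilon>) * (snd (D1 l y x) + fst (D2 l y x)))
     (1 / (2 * \<epsilon>) * (fst (D2 l y x) + snd (D1 l y x)))
     (1 / \<epsilon>\<^sup>2 * snd (D2 l y x))"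

definition grad_eps :: "real \<Rightarrow> real \<Rightarrow> (real \<times> real \<Rightarrow> real) \<Rightarrow> real \<times> real \<Rightarrow> real \<times> real" where
  "grad_eps l \<epsilon> w x = (D1 l w x, 1 / \<epsilon> * D2 l w x)"

definition hess_eps :: "real \<Rightarrow> real \<Rightarrow> (real \<times> real \<Rightarrow> real) \<Rightarrow> real \<times> real \<Rightarrow> real^2^2" where
  "hess_eps l \<epsilon> w x = mat22
     (D1 l (D1 l w) x)           (1 / \<epsilon> * D1 l (D2 l w) x)
     (1 / \<epsilon> * D2 l (D1 l w) x)  (1 / \<epsilon>\<^sup>2 * D2 l (D2 l w) x)"

text \<open>The integrands are nonnegative (almost everywhere), so the energies are defined as integrals
  with values in \<open>[0, \<infinity>]\<close>; no convention for non-integrable functions is involved.\<close>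

definition J_ext :: "(real^2^2 \<Rightarrow> real) \<Rightarrow> real \<Rightarrow> real \<Rightarrow>
    (real \<times> real \<Rightarrow> real \<times> real) \<Rightarrow> (real \<times> real \<Rightarrow> real) \<Rightarrow> ennreal" where
  "J_ext Q2 l \<epsilon> y w = (1/2) * (\<integral>\<^sup>+x\<in>S_dom l. ennreal
     (Q2 (E_eps l \<epsilon> y x + (1/2) *\<^sub>R tensor (grad_eps l \<epsilon> w x) (grad_eps l \<epsilon> w x))) \<partial>lebesgue)"

definition J_ben :: "(real^2^2 \<Rightarrow> real) \<Rightarrow> real \<Rightarrow> real \<Rightarrow> (real \<times> real \<Rightarrow> real) \<Rightarrow> ennreal" where
  "J_ben Q2 l \<epsilon> w = (1/24) * (\<integral>\<^sup>+x\<in>S_dom l. ennreal (Q2 (hess_eps l \<epsilon> w x)) \<partial>lebesgue)"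

definition J_vK_eps :: "(real^2^2 \<Rightarrow> real) \<Rightarrow> real \<Rightarrow> real \<Rightarrow>
    (real \<times> real \<Rightarrow> real \<times> real) \<Rightarrow> (real \<times> real \<Rightarrow> real) \<Rightarrow> ennreal" where
  "J_vK_eps Q2 l \<epsilon> y w = J_ext Q2 l \<epsilon> y w + J_ben Q2 l \<epsilon> w"

definition J_vK :: "(real^2^2 \<Rightarrow> real) \<Rightarrow> real \<Rightarrow>
    (real \<times> real \<Rightarrow> real \<times> real) \<Rightarrow> (real \<Rightarrow> real) \<Rightarrow> (real \<Rightarrow> real) \<Rightarrow> ennreal" where
  "J_vK Q2 l y w \<theta> =
     (1/2) * (\<integral>\<^sup>+x\<in>S_dom l. ennreal
        (Q0 Q2 (fst (D1 l y x) + \<bar>DI l w (fst x)\<bar>\<^sup>2 / 2)) \<partial>lebesgue) +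
     (1/24) * (\<integral>\<^sup>+t\<in>I_dom l. ennreal (Q1 Q2 (DI l (DI l w) t) (DI l \<theta> t)) \<partial>lebesgue)"

text \<open>The convergence underlying the Gamma-limit; functions of the first variable are
  regarded as functions on \<open>S\<close>.\<close>

definition vK_converges :: "real \<Rightarrow>
    (real \<Rightarrow> real \<times> real \<Rightarrow> real \<times> real) \<Rightarrow> (real \<Rightarrow> real \<times> real \<Rightarrow> real) \<Rightarrow>
    (real \<times> real \<Rightarrow> real \<times> real) \<Rightarrow> (real \<Rightarrow> real) \<Rightarrow> (real \<Rightarrow> real) \<Rightarrow> bool" where
  "vK_converges l ys ws y w \<theta> \<longleftrightarrow>
     weakly_converges (W12 (S_dom l)) (norm_W12 (S_dom l)) ys y (at_right 0) \<and>
     weakly_converges (W22 (S_dom l)) (norm_W22 (S_dom l)) ws (\<lambda>x. w (fst x)) (at_right 0) \<and>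
     weakly_converges (W12 (S_dom l)) (norm_W12 (S_dom l))
       (\<lambda>\<epsilon>. grad_eps l \<epsilon> (ws \<epsilon>)) (\<lambda>x. (DI l w (fst x), \<theta> (fst x))) (at_right 0)"

end

theory Submission
  imports Defs
begin

text \<open>
  Completing squares writes the form at the symmetric matrix with entries \<open>a, b, d\<close> as
  \<open>D (d - g1 a - g2 b)\<^sup>2 + B (b - k a)\<^sup>2 + q a\<^sup>2\<close>, so that minimising over \<open>d\<close>, or over \<open>b\<close> and \<open>d\<close>, just deletes
  squares. The liminf inequality then is weak lower semicontinuity of squares of \<open>L\<^sup>2\<close> norms, once the
  products of first derivatives of \<open>w\<^sub>\<epsilon>\<close> pass to the limit; this follows from strong convergence of \<open>\<partial>\<^sub>1 w\<^sub>\<epsilon>\<close>,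
  a consequence of \<open>\<partial>\<^sub>2 \<partial>\<^sub>1 w\<^sub>\<epsilon> = O(\<epsilon>)\<close> and of compactness in one dimension. For the recovery sequence one corrects
  \<open>w\<close> by \<open>\<epsilon> x\<^sub>2 \<theta> + \<epsilon>\<^sup>2 (x\<^sub>2\<^sup>2/2 - 1/24) \<gamma>\<close> and \<open>y\<close> by vertical primitives of the optimal strains, all data being replaced by
  polynomials whose derivatives grow slowly compared to \<open>1/\<epsilon>\<close>.
\<close>


subsection \<open>Smooth bump functions\<close>

text \<open>The membrane strain contains \<open>(D1 w)^2\<close>, a product of two \<open>L2\<close>
  functions, so its convergence is available only against bounded test functions, while the squared
  norm of the limit strain must be recovered from a pairing with that strain itself. This is why the
  limit strain is truncated, the estimate proved at each level, and the level sent to infinity at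
  the end. In the opposite direction, a vertical primitive of a desired shear or transverse strain
  also has a horizontal derivative, and for a strain that is merely in \<open>L2\<close> this
  derivative need not exist. Approximating the strain creates it, with no uniform bound, but it
  always enters the energy with a surplus power of \<epsilon>. Only the correctors are approximated:
  \<open>y\<close> and \<open>w\<close> stay as they are, so the Bernoulli-Navier constraint keeps
  cancelling the singular terms exactly, and all three convergences hold in norm. Polynomials suit
  this purpose because primitives and derivatives stay in the class and are continuous on the whole
  plane, so that no boundary of the strip is ever seen.\<close>

lemma C_k_continuous:
  assumes "C_k k f"
  shows "continuous_on UNIV f"
proof (cases k)
  case (Suc n)
  then have "f differentiable (at x)" for x using assms by simp
  then show ?thesis
    by (intro continuous_at_imp_continuous_on ballI differentiable_imp_continuous_within)
qed (use assms in simp)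

lemma C_k_Suc_imp: "C_k (Suc k) f \<Longrightarrow> C_k k f"
proof (induction k arbitrary: f)
  case 0
  then show ?case using C_k_continuous[OF 0] by simp
next
  case (Suc k)
  then show ?case by (metis C_k.simps(2))
qed

lemma C_k_const: "C_k k (\<lambda>x. c)"
  by (induction k arbitrary: c) auto

lemma C_k_add: "C_k k f \<Longrightarrow> C_k k g \<Longrightarrow> C_k k (\<lambda>x. f x + g x)"
proof (induction k arbitrary: f g)
  case 0
  then show ?case by (simp add: continuous_on_add)
next
  case (Suc k)
  have "frechet_derivative (\<lambda>x. f x + g x) (at x) =
      (\<lambda>h. frechet_derivative f (at x) h + frechet_derivative g (at x) h)" for x
    using Suc.prems
    by (intro frechet_derivative_at[symmetric] has_derivative_add)
       (auto simp: frechet_derivative_works[symmetric])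
  then show ?case using Suc by auto
qed

lemma C_k_mult: "C_k k f \<Longrightarrow> C_k k g \<Longrightarrow> C_k k (\<lambda>x. f x * g x)"
proof (induction k arbitrary: f g)
  case 0
  then show ?case by (simp add: continuous_on_mult)
next
  case (Suc k)
  have "frechet_derivative (\<lambda>x. f x * g x) (at x) =
      (\<lambda>h. f x * frechet_derivative g (at x) h + frechet_derivative f (at x) h * g x)" for x
    using Suc.prems
    by (intro frechet_derivative_at[symmetric] has_derivative_mult)
       (auto simp: frechet_derivative_works[symmetric])
  then show ?case using Suc C_k_Suc_imp[OF Suc.prems(1)] C_k_Suc_imp[OF Suc.prems(2)]
    by (auto intro!: C_k_add)
qed

lemma C_k_sum: "(\<And>i. i \<in> A \<Longrightarrow> C_k k (f i)) \<Longrightarrow> C_k k (\<lambda>x. \<Sum>i\<in>A. f i x)"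
  by (induction A rule: infinite_finite_induct) (auto intro: C_k_const C_k_add)

lemma C_k_prod: "(\<And>i. i \<in> A \<Longrightarrow> C_k k (f i)) \<Longrightarrow> C_k k (\<lambda>x. \<Prod>i\<in>A. f i x)"
  by (induction A rule: infinite_finite_induct) (auto intro: C_k_const C_k_mult)

lemma frechet_derivative_affine:
  fixes f :: "'a::real_normed_vector \<Rightarrow> real" and L :: "'c::real_normed_vector \<Rightarrow> 'a"
  assumes "f differentiable (at (L x + v))" "bounded_linear L"
  shows "((\<lambda>x. f (L x + v)) has_derivative (\<lambda>h. frechet_derivative f (at (L x + v)) (L h))) (at x)"
proof -
  have "(f \<circ> (\<lambda>x. L x + v) has_derivative (frechet_derivative f (at (L x + v)) \<circ> (\<lambda>h. L h + 0))) (at x)"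
    using assms
    by (intro diff_chain_at has_derivative_add has_derivative_const bounded_linear_imp_has_derivative)
       (auto simp: frechet_derivative_works[symmetric])
  then show ?thesis by (simp add: o_def)
qed

lemma C_k_affine:
  fixes L :: "'c::euclidean_space \<Rightarrow> 'a::euclidean_space"
  assumes "bounded_linear L"
  shows "C_k k f \<Longrightarrow> C_k k (\<lambda>x. f (L x + v))"
proof (induction k arbitrary: f)
  case 0
  have "continuous_on UNIV (\<lambda>x. L x + v)"
    by (intro continuous_on_add continuous_on_const linear_continuous_on assms)
  then show ?case using 0 continuous_on_compose2[of UNIV f UNIV] by auto
next
  case (Suc k)
  have d: "f differentiable (at x)" for x using Suc.prems by simp
  have D: "((\<lambda>x. f (L x + v)) has_derivative (\<lambda>h. frechet_derivative f (at (L x + v)) (L h))) (at x)" for x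
    by (rule frechet_derivative_affine[OF d assms])
  \<comment> \<open>\<open>C_k\<close> speaks only of derivatives in basis directions, whereas the
    chain rule produces the direction \<open>L b\<close>. Expanding \<open>L b\<close> in the basis
    gives a combination of partial derivatives with constant coefficients, to which the induction
    hypothesis applies.\<close>
  have eq: "frechet_derivative (\<lambda>x. f (L x + v)) (at x) b =
      (\<Sum>j\<in>Basis. (L b \<bullet> j) * frechet_derivative f (at (L x + v)) j)" for x b :: 'c
  proof -
    have lin: "linear (frechet_derivative f (at (L x + v)))"
      using d linear_frechet_derivative by blast
    have "frechet_derivative (\<lambda>x. f (L x + v)) (at x) b = frechet_derivative f (at (L x + v)) (L b)"
      using frechet_derivative_at[OF D[of x]] by metis
    also have "\<dots> = frechet_derivative f (at (L x + v)) (\<Sum>j\<in>Basis. (L b \<bullet> j) *\<^sub>R j)"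
      by (simp add: euclidean_representation)
    finally show ?thesis by (simp add: linear_sum[OF lin] linear_cmul[OF lin])
  qed
  have "C_k k (\<lambda>x. (L b \<bullet> j) * frechet_derivative f (at (L x + v)) j)" if "j \<in> Basis" for b j
    using Suc.prems that by (intro C_k_mult C_k_const Suc.IH[of "\<lambda>y. frechet_derivative f (at y) j"]) auto
  then show ?case using D by (auto simp: eq differentiable_def intro!: C_k_sum)
qed

text \<open>The powers of \<open>1/t\<close> are included to obtain a family closed under
  differentiation: the derivative of \<open>flat m\<close> is a combination of
  \<open>flat (m + 1)\<close> and \<open>flat (m + 2)\<close>, so smoothness of all members follows
  by one induction. The member \<open>flat 0\<close> is the usual cutoff
  \<open>exp (-1/t)\<close>.\<close>

definition flat :: "nat \<Rightarrow> real \<Rightarrow> real" where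
  "flat m t = (if t > 0 then inverse t ^ m * exp (- inverse t) else 0)"

lemma flat_tendsto_0: "(flat m \<longlongrightarrow> 0) (at_right 0)"
proof -
  have "((\<lambda>t::real. inverse t ^ m / exp (inverse t)) \<longlongrightarrow> 0) (at_right 0)"
    using filterlim_compose[OF tendsto_power_div_exp_0[of m] filterlim_inverse_at_top_right] .
  then show ?thesis
    by (rule Lim_transform_eventually)
       (auto simp: eventually_at_right_field flat_def exp_minus divide_inverse intro!: exI[of _ 1])
qed

lemma flat_has_derivative:
  "(flat m has_field_derivative (- real m * flat (Suc m) t + flat (Suc (Suc m)) t)) (at t)"
proof -
  consider "t > 0" | "t < 0" | "t = 0" by linarith
  then show ?thesis
  proof cases
    case 1
    have "((\<lambda>t. inverse t ^ m * exp (- inverse t)) has_field_derivative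
        (- real m * flat (Suc m) t + flat (Suc (Suc m)) t)) (at t)"
    proof (cases m)
      case 0
      then show ?thesis using 1 by (auto intro!: derivative_eq_intros simp: flat_def field_simps power2_eq_square)
    next
      case (Suc k)
      have "((\<lambda>t. inverse t ^ Suc k) has_field_derivative (real (Suc k) * (- (inverse t ^ 2) * inverse t ^ k))) (at t)"
        using DERIV_power[OF DERIV_inverse, of t "Suc k" UNIV] 1 by (simp add: power2_eq_square)
      moreover have "((\<lambda>t. exp (- inverse t)) has_field_derivative (exp (- inverse t) * inverse t ^ 2)) (at t)"
        using 1 by (auto intro!: derivative_eq_intros simp: power2_eq_square)
      ultimately have "((\<lambda>t. inverse t ^ Suc k * exp (- inverse t)) has_field_derivative
         (real (Suc k) * (- (inverse t ^ 2) * inverse t ^ k)) * exp (- inverse t) +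
         (exp (- inverse t) * inverse t ^ 2) * inverse t ^ Suc k) (at t)"
        by (rule DERIV_mult)
      then show ?thesis using 1 unfolding Suc
        by (simp add: flat_def power2_eq_square algebra_simps)
    qed
    then show ?thesis
      by (rule has_field_derivative_transform_within_open[of _ _ _ "{0<..}"])
         (use 1 in \<open>auto simp: flat_def\<close>)
  next
    case 2
    have "((\<lambda>t. 0) has_field_derivative (- real m * flat (Suc m) t + flat (Suc (Suc m)) t)) (at t)"
      using 2 by (auto simp: flat_def)
    then show ?thesis
      by (rule has_field_derivative_transform_within_open[of _ _ _ "{..<0}"])
         (use 2 in \<open>auto simp: flat_def\<close>)
  next
    case 3
    \<comment> \<open>At the origin the difference quotient of \<open>flat m\<close> is
      \<open>flat (Suc m)\<close> to the right and zero to the left, so differentiability is again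
      the limit \<open>flat_tendsto_0\<close>.\<close>
    have "((\<lambda>h. (flat m h - flat m 0) / h) \<longlongrightarrow> 0) (at_right 0)"
      by (rule Lim_transform_eventually[OF flat_tendsto_0[of "Suc m"]])
         (auto simp: eventually_at_right_field flat_def divide_inverse intro!: exI[of _ 1])
    moreover have "((\<lambda>h. (flat m h - flat m 0) / h) \<longlongrightarrow> 0) (at_left 0)"
      by (rule Lim_transform_eventually[OF tendsto_const])
         (auto simp: eventually_at_left_field flat_def intro!: exI[of _ "-1"])
    ultimately have "((\<lambda>h. (flat m h - flat m 0) / h) \<longlongrightarrow> 0) (at 0)"
      by (simp add: filterlim_at_split)
    then show ?thesis using 3 by (simp add: has_field_derivative_iff flat_def)
  qed
qed

lemma C_k_flat: "C_k k (flat m)"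
proof (induction k arbitrary: m)
  case 0
  have "isCont (flat m) t" for t using flat_has_derivative DERIV_isCont by blast
  then show ?case by (simp add: continuous_at_imp_continuous_on)
next
  case (Suc k)
  have D: "(flat m has_derivative (*) (- real m * flat (Suc m) t + flat (Suc (Suc m)) t)) (at t)" for t
    using flat_has_derivative[of m t] by (simp add: has_field_derivative_def)
  have "frechet_derivative (flat m) (at t) = (*) (- real m * flat (Suc m) t + flat (Suc (Suc m)) t)" for t
    using frechet_derivative_at[OF D[of t]] by simp
  moreover have "flat m differentiable (at t)" for t using D differentiableI by blast
  moreover have "C_k k (\<lambda>t. - real m * flat (Suc m) t + flat (Suc (Suc m)) t)"
    by (intro C_k_add C_k_mult C_k_const Suc.IH)
  ultimately show ?case by simp
qed

text \<open>The parameter \<open>c\<close> is a steepness: as it grows, each factor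
  \<open>exp (-1/(c t))\<close> with \<open>t > 0\<close> tends to 1, so the bumps increase to the
  indicator of the open box without any normalising constant.\<close>

definition bump :: "'a::euclidean_space \<Rightarrow> 'a \<Rightarrow> real \<Rightarrow> 'a \<Rightarrow> real" where
  "bump a b c x = (\<Prod>i\<in>Basis. flat 0 (c * (x \<bullet> i - a \<bullet> i)) * flat 0 (c * (b \<bullet> i - x \<bullet> i)))"

lemma flat0_bounds: "0 \<le> flat 0 t" "flat 0 t \<le> 1"
  by (auto simp: flat_def)

lemma bump_bounds: "0 \<le> bump a b c x" "bump a b c x \<le> 1"
  unfolding bump_def by (auto intro!: prod_nonneg prod_le_1 mult_le_one mult_nonneg_nonneg flat0_bounds)

lemma C_k_bump: "C_k k (bump a b c)"
proof -
  have "C_k k (\<lambda>x. flat 0 (c * (x \<bullet> i - a \<bullet> i)))" "C_k k (\<lambda>x. flat 0 (c * (b \<bullet> i - x \<bullet> i)))" for i :: 'a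
  proof -
    have "bounded_linear (\<lambda>x. c * (x \<bullet> i))" "bounded_linear (\<lambda>x. - c * (x \<bullet> i))"
      by (intro bounded_linear_const_mult bounded_linear_inner_left)+
    from C_k_affine[OF this(1) C_k_flat, of k 0 "- c * (a \<bullet> i)"] 
      C_k_affine[OF this(2) C_k_flat, of k 0 "c * (b \<bullet> i)"]
    show "C_k k (\<lambda>x. flat 0 (c * (x \<bullet> i - a \<bullet> i)))" "C_k k (\<lambda>x. flat 0 (c * (b \<bullet> i - x \<bullet> i)))"
      by (simp_all add: algebra_simps)
  qed
  then show ?thesis unfolding bump_def by (intro C_k_prod C_k_mult)
qed

lemma bump_outside: "c > 0 \<Longrightarrow> x \<notin> box a b \<Longrightarrow> bump a b c x = 0"
  unfolding bump_def mem_box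
  by (rule prod_zero) (auto simp: flat_def zero_less_mult_iff)

lemma bump_test: 
  assumes "c > 0" "cbox a b \<subseteq> \<Omega>"
  shows "bump a b c \<in> test_functions \<Omega>"
  unfolding test_functions_def using assms bump_outside[of c _ a b] box_subset_cbox[of a b]
  by (auto simp: C_k_bump intro!: exI[of _ "cbox a b"] compact_cbox)

lemma flat0_tendsto: "(\<lambda>n. flat 0 (real (Suc n) * t)) \<longlonglongrightarrow> (if t > 0 then 1 else 0)"
proof (cases "t > 0")
  case True
  have "(\<lambda>n. exp (- (inverse (real (Suc n)) * inverse t))) \<longlonglongrightarrow> exp (- (0 * inverse t))"
    by (intro tendsto_intros LIMSEQ_inverse_real_of_nat)
  then show ?thesis using True by (simp add: flat_def zero_less_mult_iff)
next
  case False
  then show ?thesis by (simp add: flat_def zero_less_mult_iff)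
qed

lemma bump_tendsto: "(\<lambda>n. bump a b (real (Suc n)) x) \<longlonglongrightarrow> indicator (box a b) x"
proof -
  have "(\<lambda>n. bump a b (real (Suc n)) x) \<longlonglongrightarrow>
     (\<Prod>i\<in>Basis. (if x \<bullet> i - a \<bullet> i > 0 then 1 else 0) * (if b \<bullet> i - x \<bullet> i > 0 then 1 else 0))"
    unfolding bump_def by (intro tendsto_intros flat0_tendsto)
  also have "(\<Prod>i\<in>Basis. (if x \<bullet> i - a \<bullet> i > 0 then 1 else 0) * (if b \<bullet> i - x \<bullet> i > 0 then 1 else 0)) =
      (indicator (box a b) x :: real)"
    by (auto simp: indicator_def mem_box intro!: prod.neutral)
  finally show ?thesis .
qed


subsection \<open>The fundamental lemma\<close>

lemma borel_measurable_lebesgueI: "f \<in> borel_measurable borel \<Longrightarrow> f \<in> borel_measurable lebesgue"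
  by (rule measurable_completion) simp

lemma test_functionsD:
  assumes "\<phi> \<in> test_functions \<Omega>"
  shows "C_k k \<phi>" "continuous_on UNIV \<phi>" "\<phi> \<in> borel_measurable borel"
    "(\<phi> has_derivative frechet_derivative \<phi> (at x)) (at x)"
proof -
  show "C_k k \<phi>" for k using assms by (simp add: test_functions_def)
  from C_k_continuous[OF this] show "continuous_on UNIV \<phi>" .
  then show "\<phi> \<in> borel_measurable borel" by (rule borel_measurable_continuous_onI)
  show "(\<phi> has_derivative frechet_derivative \<phi> (at x)) (at x)"
    using \<open>\<And>k. C_k k \<phi>\<close>[of 1] by (simp add: frechet_derivative_works[symmetric])
qed

lemma test_function_support:
  assumes "\<phi> \<in> test_functions \<Omega>"
  obtains K B where "compact K" "K \<subseteq> \<Omega>" "\<And>x. x \<notin> K \<Longrightarrow> \<phi> x = 0" "\<And>x. \<bar>\<phi> x\<bar> \<le> B" "0 \<le> B"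
proof -
  obtain K where K: "compact K" "K \<subseteq> \<Omega>" "\<And>x. x \<notin> K \<Longrightarrow> \<phi> x = 0"
    using assms by (auto simp: test_functions_def)
  have "compact (\<phi> ` K)"
    using K test_functionsD(2)[OF assms] by (auto intro: compact_continuous_image continuous_on_subset)
  then obtain B where B: "\<And>x. x \<in> K \<Longrightarrow> \<bar>\<phi> x\<bar> \<le> B"
    using compact_imp_bounded[of "\<phi> ` K"] by (auto simp: bounded_iff)
  have "\<bar>\<phi> x\<bar> \<le> max B 0" for x
    using B[of x] K(3)[of x] by (cases "x \<in> K") auto
  then show ?thesis using K that[of K "max B 0"] by auto
qed

lemma test_function_deriv:
  assumes "\<phi> \<in> test_functions \<Omega>" "b \<in> Basis"
  shows "(\<lambda>x. frechet_derivative \<phi> (at x) b) \<in> test_functions \<Omega>"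
proof -
  obtain K where K: "compact K" "K \<subseteq> \<Omega>" "\<And>x. x \<notin> K \<Longrightarrow> \<phi> x = 0"
    using assms by (auto simp: test_functions_def)
  have "frechet_derivative \<phi> (at x) b = 0" if "x \<notin> K" for x
  proof -
    have "((\<lambda>x. 0) has_derivative frechet_derivative \<phi> (at x)) (at x)"
      by (rule has_derivative_transform_within_open[OF test_functionsD(4)[OF assms(1)], of "- K"])
         (use K that in \<open>auto simp: compact_imp_closed\<close>)
    then have "frechet_derivative \<phi> (at x) = (\<lambda>x. 0)"
      using has_derivative_unique has_derivative_const by blast
    then show ?thesis by simp
  qed
  moreover have "C_k k (\<lambda>x. frechet_derivative \<phi> (at x) b)" for k
    using test_functionsD(1)[OF assms(1), of "Suc k"] assms(2) by simp
  ultimately show ?thesis using K by (auto simp: test_functions_def)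
qed

text \<open>In the weak formula for a translate the shift is moved from the function onto the test
  function; the inclusion hypothesis keeps the shifted support inside the larger domain.\<close>

lemma test_function_shift:
  assumes "\<phi> \<in> test_functions \<Omega>'" "\<And>x. x \<in> \<Omega>' \<Longrightarrow> x + v \<in> \<Omega>"
  shows "(\<lambda>x. \<phi> (x - v)) \<in> test_functions \<Omega>"
    "frechet_derivative (\<lambda>x. \<phi> (x - v)) (at x) b = frechet_derivative \<phi> (at (x - v)) b"
proof -
  obtain K where K: "compact K" "K \<subseteq> \<Omega>'" "\<And>x. x \<notin> K \<Longrightarrow> \<phi> x = 0"
    using assms by (auto simp: test_functions_def)
  have "C_k k (\<lambda>x. \<phi> (x - v))" for k
    using C_k_affine[OF bounded_linear_ident test_functionsD(1)[OF assms(1)], of k "- v"] by simp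
  moreover have "\<phi> (x - v) = 0" if "x \<notin> (+) v ` K" for x
  proof (rule K(3))
    show "x - v \<notin> K" using that by (auto simp: image_iff dest: bspec[of _ _ "x - v"])
  qed
  ultimately show "(\<lambda>x. \<phi> (x - v)) \<in> test_functions \<Omega>"
    unfolding test_functions_def using K assms(2)
    by (auto intro!: exI[of _ "(+) v ` K"] compact_translation simp: add.commute)
  have "\<phi> differentiable (at (x - v))"
    using test_functionsD(4)[OF assms(1)] differentiableI by blast
  then have "((\<lambda>x. \<phi> (x - v)) has_derivative frechet_derivative \<phi> (at (x - v))) (at x)"
    using frechet_derivative_affine[of \<phi> "\<lambda>x. x" x "- v"] by simp
  from frechet_derivative_at[OF this]
  show "frechet_derivative (\<lambda>x. \<phi> (x - v)) (at x) b = frechet_derivative \<phi> (at (x - v)) b"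
    by metis
qed

lemma locally_integrable_test_integrable:
  fixes f :: "'a::euclidean_space \<Rightarrow> 'b::euclidean_space"
  assumes "locally_integrable \<Omega> f" "\<phi> \<in> test_functions \<Omega>" "open \<Omega>"
  shows "integrable (lebesgue_on \<Omega>) (\<lambda>x. \<phi> x *\<^sub>R f x)"
    "set_integrable lebesgue \<Omega> (\<lambda>x. \<phi> x *\<^sub>R f x)"
proof -
  obtain K B where K: "compact K" "K \<subseteq> \<Omega>" "\<And>x. x \<notin> K \<Longrightarrow> \<phi> x = 0" "\<And>x. \<bar>\<phi> x\<bar> \<le> B" "0 \<le> B"
    using test_function_support[OF assms(2)] by blast
  have f: "integrable lebesgue (\<lambda>x. indicator K x *\<^sub>R f x)"
    using assms K by (auto simp: locally_integrable_def set_integrable_def)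
  have "\<phi> \<in> borel_measurable lebesgue"
    using test_functionsD(3)[OF assms(2)] by (rule borel_measurable_lebesgueI)
  have "integrable lebesgue (\<lambda>x. \<phi> x *\<^sub>R (indicator K x *\<^sub>R f x))"
  proof (rule Bochner_Integration.integrable_bound[OF integrable_scaleR_right[OF f, of B]])
    show "(\<lambda>x. \<phi> x *\<^sub>R (indicator K x *\<^sub>R f x)) \<in> borel_measurable lebesgue"
      by (rule borel_measurable_scaleR[OF \<open>\<phi> \<in> borel_measurable lebesgue\<close> borel_measurable_integrable[OF f]])
    show "AE x in lebesgue. norm (\<phi> x *\<^sub>R indicat_real K x *\<^sub>R f x) \<le> norm (B *\<^sub>R indicat_real K x *\<^sub>R f x)"
      unfolding norm_scaleR using K(4,5) by (intro AE_I2 mult_right_mono) auto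
  qed
  also have "(\<lambda>x. \<phi> x *\<^sub>R (indicator K x *\<^sub>R f x)) = (\<lambda>x. indicator \<Omega> x *\<^sub>R (\<phi> x *\<^sub>R f x))"
    using K by (fastforce simp: indicator_def)
  finally show "set_integrable lebesgue \<Omega> (\<lambda>x. \<phi> x *\<^sub>R f x)"
    by (simp add: set_integrable_def)
  then show "integrable (lebesgue_on \<Omega>) (\<lambda>x. \<phi> x *\<^sub>R f x)"
    using assms(3) by (subst set_integrable_eq[symmetric]) (auto simp: lmeasurable_open borel_open sets_completionI_sets)
qed

text \<open>Bumps turn the hypothesis into vanishing integrals over all boxes inside \<Omega>, and
  Lebesgue differentiation along shrinking cubes recovers the values of \<open>f\<close>. The
  argument is carried out box by box because \<open>f\<close> is only locally integrable.\<close>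

theorem fundamental_lemma_real:
  fixes f :: "'a::euclidean_space \<Rightarrow> real"
  assumes "open \<Omega>" and f: "locally_integrable \<Omega> f"
    and zero: "\<And>\<phi>. \<phi> \<in> test_functions \<Omega> \<Longrightarrow> (LINT x:\<Omega>|lebesgue. \<phi> x * f x) = 0"
  shows "AE x in lebesgue. x \<in> \<Omega> \<longrightarrow> f x = 0"
proof -
  have box0: "integral\<^sup>L lebesgue (\<lambda>x. indicator (cbox a b) x * f x) = 0" if ab: "cbox a b \<subseteq> \<Omega>" for a b
  proof -
    have int: "integrable lebesgue (\<lambda>x. indicator (cbox a b) x * f x)"
      using f ab by (auto simp: locally_integrable_def set_integrable_def compact_cbox)
    have lim: "(\<lambda>n. integral\<^sup>L lebesgue (\<lambda>x. bump a b (real (Suc n)) x * (indicator (cbox a b) x * f x)))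
        \<longlonglongrightarrow> integral\<^sup>L lebesgue (\<lambda>x. indicator (box a b) x * (indicator (cbox a b) x * f x))"
    proof (rule integral_dominated_convergence[where w = "\<lambda>x. norm (indicator (cbox a b) x * f x)"])
      show "(\<lambda>x. indicat_real (box a b) x * (indicat_real (cbox a b) x * f x)) \<in> borel_measurable lebesgue"
        by (rule borel_measurable_times[OF _ borel_measurable_integrable[OF int]])
           (rule borel_measurable_lebesgueI, simp)
      show "(\<lambda>x. bump a b (real (Suc n)) x * (indicat_real (cbox a b) x * f x)) \<in> borel_measurable lebesgue" for n
        by (rule borel_measurable_times[OF _ borel_measurable_integrable[OF int]])
           (intro borel_measurable_lebesgueI borel_measurable_continuous_onI C_k_continuous[OF C_k_bump])
      show "integrable lebesgue (\<lambda>x. norm (indicat_real (cbox a b) x * f x))"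
        using int by (rule integrable_norm)
      show "AE x in lebesgue. (\<lambda>n. bump a b (real (Suc n)) x * (indicat_real (cbox a b) x * f x))
          \<longlonglongrightarrow> indicat_real (box a b) x * (indicat_real (cbox a b) x * f x)"
        by (intro AE_I2 tendsto_intros bump_tendsto)
      show "AE x in lebesgue. norm (bump a b (real (Suc n)) x * (indicat_real (cbox a b) x * f x))
          \<le> norm (indicat_real (cbox a b) x * f x)" for n
        using bump_bounds[of a b "real (Suc n)"]
        by (intro AE_I2) (auto simp: abs_mult intro!: mult_left_le_one_le)
    qed
    have "integral\<^sup>L lebesgue (\<lambda>x. bump a b (real (Suc n)) x * (indicator (cbox a b) x * f x)) = 0" for n
    proof -
      have "(\<lambda>x. bump a b (real (Suc n)) x * (indicator (cbox a b) x * f x)) =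
          (\<lambda>x. indicator \<Omega> x * (bump a b (real (Suc n)) x * f x))"
      proof
        fix x
        show "bump a b (real (Suc n)) x * (indicator (cbox a b) x * f x) =
          indicator \<Omega> x * (bump a b (real (Suc n)) x * f x)"
          using bump_outside[of "real (Suc n)" x a b] box_subset_cbox[of a b] ab
          by (cases "x \<in> box a b") (auto simp: indicator_def)
      qed
      then show ?thesis
        using zero[OF bump_test[OF _ ab, of "real (Suc n)"]] by (simp add: set_lebesgue_integral_def)
    qed
    with lim have "integral\<^sup>L lebesgue (\<lambda>x. indicator (box a b) x * (indicator (cbox a b) x * f x)) = 0"
      by (simp add: LIMSEQ_const_iff)
    \<comment> \<open>The bumps converge to the indicator of the open box; replacing it by the
      closed box costs only the boundary, a null set.\<close>
    moreover have "integral\<^sup>L lebesgue (\<lambda>x. indicator (box a b) x * (indicator (cbox a b) x * f x)) =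
       integral\<^sup>L lebesgue (\<lambda>x. indicator (cbox a b) x * f x)"
    proof (rule integral_cong_AE)
      have "negligible (cbox a b - box a b)" by (rule negligible_frontier_interval)
      then have "AE x in lebesgue. x \<notin> cbox a b - box a b"
        by (intro AE_not_in) (simp add: negligible_iff_null_sets)
      then show "AE x in lebesgue. indicat_real (box a b) x * (indicat_real (cbox a b) x * f x) =
          indicat_real (cbox a b) x * f x"
        by eventually_elim (auto simp: indicator_def)
      have "indicat_real (box a b) \<in> borel_measurable lebesgue"
        by (rule borel_measurable_lebesgueI, simp)
      then show "(\<lambda>x. indicat_real (box a b) x * (indicat_real (cbox a b) x * f x)) \<in> borel_measurable lebesgue"
        by (rule borel_measurable_times[OF _ borel_measurable_integrable[OF int]])
    qed (rule borel_measurable_integrable[OF int])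
    ultimately show ?thesis by simp
  qed
  have local0: "AE x in lebesgue. x \<in> cbox u v \<longrightarrow> f x = 0" if uv: "cbox u v \<subseteq> \<Omega>" for u v
  proof -
    define F where "F = (\<lambda>x. indicator (cbox u v) x * f x)"
    have F: "integrable lebesgue F"
      using f uv by (auto simp: locally_integrable_def set_integrable_def compact_cbox F_def)
    have F_on: "integral (cbox a b) F = integral\<^sup>L lebesgue (\<lambda>x. indicator (cbox a b) x * F x)"
        "F integrable_on cbox a b" for a b
    proof -
      have "set_integrable lebesgue (cbox a b) F"
        using integrable_mult_indicator[OF _ F, of "cbox a b"] by (simp add: set_integrable_def)
      from set_lebesgue_integral_eq_integral[OF this]
      show "integral (cbox a b) F = integral\<^sup>L lebesgue (\<lambda>x. indicator (cbox a b) x * F x)" 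
        "F integrable_on cbox a b"
        by (simp_all add: set_lebesgue_integral_def)
    qed
    \<comment> \<open>Lebesgue differentiation in its one-sided form: averages over cubes having
      \<open>x\<close> as lower corner converge to \<open>F x\<close> for almost every
      \<open>x\<close>.\<close>
    obtain N where N: "negligible N" "\<And>x e. \<lbrakk>x \<notin> N; 0 < e\<rbrakk> \<Longrightarrow>
        \<exists>d>0. \<forall>h. 0 < h \<and> h < d \<longrightarrow> norm (integral (cbox x (x + h *\<^sub>R One)) F /\<^sub>R h ^ DIM('a) - F x) < e"
      using integrable_ccontinuous_explicit[of F] F_on(2) by blast
    have "F x = 0" if "x \<notin> N" "x \<in> box u v" for x
    proof -
      have "\<bar>F x\<bar> < e" if "e > 0" for e
      proof -
        obtain d where d: "d > 0" "\<And>h. 0 < h \<Longrightarrow> h < d \<Longrightarrow>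
            norm (integral (cbox x (x + h *\<^sub>R One)) F /\<^sub>R h ^ DIM('a) - F x) < e"
          using N(2)[OF \<open>x \<notin> N\<close> \<open>e > 0\<close>] by blast
        \<comment> \<open>The smallest distance from \<open>x\<close> to the upper faces of the box;
          cubes of side at most \<open>m\<close> that start at \<open>x\<close> stay inside, so
          their integrals vanish by \<open>box0\<close>.\<close>
        define m where "m = Min ((\<lambda>i. v \<bullet> i - x \<bullet> i) ` (Basis :: 'a set))"
        have m: "m > 0" "\<And>i. i \<in> Basis \<Longrightarrow> m \<le> v \<bullet> i - x \<bullet> i"
          using \<open>x \<in> box u v\<close> by (auto simp: m_def mem_box)
        define h where "h = min d m / 2"
        have h: "0 < h" "h < d" "h \<le> m" using d m by (auto simp: h_def)
        have sub: "cbox x (x + h *\<^sub>R One) \<subseteq> cbox u v"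
        proof
          fix y assume y: "y \<in> cbox x (x + h *\<^sub>R One)"
          show "y \<in> cbox u v" unfolding mem_box
          proof
            fix i :: 'a assume i: "i \<in> Basis"
            have "x \<bullet> i \<le> y \<bullet> i" "y \<bullet> i \<le> x \<bullet> i + h"
              using y i by (auto simp: mem_box inner_add_left)
            moreover have "u \<bullet> i < x \<bullet> i" using \<open>x \<in> box u v\<close> i by (auto simp: mem_box)
            ultimately show "u \<bullet> i \<le> y \<bullet> i \<and> y \<bullet> i \<le> v \<bullet> i" using m(2)[OF i] h by linarith
          qed
        qed
        have "integral (cbox x (x + h *\<^sub>R One)) F =
            integral\<^sup>L lebesgue (\<lambda>y. indicator (cbox x (x + h *\<^sub>R One)) y * f y)"
          unfolding F_on(1) using sub
          by (intro Bochner_Integration.integral_cong) (auto simp: F_def indicator_def)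
        also have "\<dots> = 0" using box0 sub uv by auto
        finally show ?thesis using d(2)[OF h(1,2)] by simp
      qed
      then show ?thesis by (metis abs_le_zero_iff linorder_not_less less_irrefl)
    qed
    then have z: "f x = 0" if "x \<notin> N \<union> (cbox u v - box u v)" "x \<in> cbox u v" for x
      using that \<open>\<And>x. x \<notin> N \<Longrightarrow> x \<in> box u v \<Longrightarrow> F x = 0\<close>[of x] by (simp add: F_def)
    have "negligible (N \<union> (cbox u v - box u v))"
      using N(1) negligible_frontier_interval by (rule negligible_Un)
    then have "AE x in lebesgue. x \<notin> N \<union> (cbox u v - box u v)"
      by (intro AE_not_in) (simp only: negligible_iff_null_sets)
    then show ?thesis by eventually_elim (use z in blast)
  qed
  obtain D where D: "countable D" "D \<subseteq> Pow \<Omega>" "\<And>X. X \<in> D \<Longrightarrow> \<exists>a b. X = cbox a b" "\<Union>D = \<Omega>"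
    using open_countable_Union_open_cbox[OF \<open>open \<Omega>\<close>] by metis
  have "AE x in lebesgue. \<forall>X\<in>D. x \<in> X \<longrightarrow> f x = 0"
  proof (rule AE_ball_countable[THEN iffD2, OF D(1)], rule ballI)
    fix X assume "X \<in> D"
    then show "AE x in lebesgue. x \<in> X \<longrightarrow> f x = 0" using D(2,3) local0 by (metis PowD subsetD)
  qed
  then show ?thesis by eventually_elim (use D(4) in blast)
qed


subsection \<open>Weak derivatives\<close>

lemma open_sets_lebesgue: "open \<Omega> \<Longrightarrow> \<Omega> \<inter> space lebesgue \<in> sets lebesgue"
  by (simp add: borel_open)

lemma AE_lebesgue_on:
  "open \<Omega> \<Longrightarrow> (AE x in lebesgue_on \<Omega>. P x) \<longleftrightarrow> (AE x in lebesgue. x \<in> \<Omega> \<longrightarrow> P x)"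
  by (rule AE_restrict_space_iff[OF open_sets_lebesgue])

lemma set_integral_lebesgue_on:
  fixes f :: "'a::euclidean_space \<Rightarrow> 'b::euclidean_space"
  assumes "open \<Omega>"
  shows "(LINT x:\<Omega>|lebesgue. f x) = integral\<^sup>L (lebesgue_on \<Omega>) f"
    "set_integrable lebesgue \<Omega> f \<longleftrightarrow> integrable (lebesgue_on \<Omega>) f"
    "set_borel_measurable lebesgue \<Omega> f \<longleftrightarrow> f \<in> borel_measurable (lebesgue_on \<Omega>)"
  using open_sets_lebesgue[OF assms]
  by (simp_all add: set_lebesgue_integral_def integral_restrict_space set_integrable_eq
       set_borel_measurable_def borel_measurable_restrict_space_iff)

text \<open>Completeness of Lebesgue measure: a change on a null set cannot destroy measurability.
  This is what lets representatives be exchanged freely from here on.\<close>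

lemma AE_eq_borel_measurable_lebesgue_on:
  fixes f :: "'a::euclidean_space \<Rightarrow> 'b::euclidean_space"
  assumes "open \<Omega>" "f \<in> borel_measurable (lebesgue_on \<Omega>)" "AE x in lebesgue_on \<Omega>. f x = g x"
  shows "g \<in> borel_measurable (lebesgue_on \<Omega>)"
proof -
  have "(\<lambda>x. indicator \<Omega> x *\<^sub>R f x) \<in> borel_measurable lebesgue"
    using assms(1,2) set_integral_lebesgue_on(3) set_borel_measurable_def by metis
  moreover have "AE x in lebesgue. indicator \<Omega> x *\<^sub>R f x = indicator \<Omega> x *\<^sub>R g x"
    using assms(3) unfolding AE_lebesgue_on[OF assms(1)] by eventually_elim (auto simp: indicator_def)
  ultimately have "(\<lambda>x. indicator \<Omega> x *\<^sub>R g x) \<in> borel_measurable lebesgue"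
    by (rule borel_measurable_AE)
  then show ?thesis
    using assms(1) set_integral_lebesgue_on(3) set_borel_measurable_def by metis
qed

lemma locally_integrable_bounded_linear:
  fixes f :: "'a::euclidean_space \<Rightarrow> 'b::euclidean_space" and L :: "'b \<Rightarrow> 'c::euclidean_space"
  assumes "locally_integrable \<Omega> f" "bounded_linear L"
  shows "locally_integrable \<Omega> (\<lambda>x. L (f x))"
  unfolding locally_integrable_def set_integrable_def
proof (intro allI impI)
  fix K :: "'a set" assume "compact K \<and> K \<subseteq> \<Omega>"
  then have "integrable lebesgue (\<lambda>x. indicator K x *\<^sub>R f x)"
    using assms(1) by (simp add: locally_integrable_def set_integrable_def)
  from integrable_bounded_linear[OF assms(2) this]
  show "integrable lebesgue (\<lambda>x. indicator K x *\<^sub>R L (f x))"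
    by (simp only: linear_simps(5)[OF assms(2)])
qed

lemma locally_integrable_add:
  assumes "locally_integrable \<Omega> f" "locally_integrable \<Omega> g"
  shows "locally_integrable \<Omega> (\<lambda>x. f x + g x)"
  using assms set_integral_add(1) unfolding locally_integrable_def by blast

lemma locally_integrable_AE:
  assumes "open \<Omega>" "locally_integrable \<Omega> f" "AE x in lebesgue_on \<Omega>. f x = g x"
  shows "locally_integrable \<Omega> g"
  unfolding locally_integrable_def
proof (intro allI impI)
  fix K assume K: "compact K \<and> K \<subseteq> \<Omega>"
  then have f: "integrable lebesgue (\<lambda>x. indicator K x *\<^sub>R f x)"
    using assms(2) by (auto simp: locally_integrable_def set_integrable_def)
  have ae: "AE x in lebesgue. indicator K x *\<^sub>R f x = indicator K x *\<^sub>R g x"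
    using assms(3) unfolding AE_lebesgue_on[OF assms(1)]
    by eventually_elim (use K in \<open>auto simp: indicator_def\<close>)
  show "set_integrable lebesgue K g"
    unfolding set_integrable_def
    by (rule integrable_cong_AE_imp[OF f borel_measurable_AE[OF borel_measurable_integrable[OF f] ae]])
       (use ae in \<open>eventually_elim, simp\<close>)
qed

lemma has_weak_deriv_iff:
  fixes f g :: "'a::euclidean_space \<Rightarrow> 'b::euclidean_space"
  assumes "open \<Omega>"
  shows "has_weak_deriv \<Omega> b f g \<longleftrightarrow> locally_integrable \<Omega> f \<and> locally_integrable \<Omega> g \<and>
     (\<forall>\<phi>\<in>test_functions \<Omega>. (\<integral>x. frechet_derivative \<phi> (at x) b *\<^sub>R f x \<partial>lebesgue_on \<Omega>)
        = - (\<integral>x. \<phi> x *\<^sub>R g x \<partial>lebesgue_on \<Omega>))"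
  unfolding has_weak_deriv_def set_integral_lebesgue_on(1)[OF assms] ..

text \<open>Bounded linear maps commute with the integral. This single fact covers components, inner
  products with a fixed vector, scalar multiples and the embeddings of a factor into a
  product.\<close>

lemma has_weak_deriv_bounded_linear:
  fixes f g :: "'a::euclidean_space \<Rightarrow> 'b::euclidean_space" and L :: "'b \<Rightarrow> 'c::euclidean_space"
  assumes "open \<Omega>" "b \<in> Basis" "has_weak_deriv \<Omega> b f g" "bounded_linear L"
  shows "has_weak_deriv \<Omega> b (\<lambda>x. L (f x)) (\<lambda>x. L (g x))"
proof -
  note d = assms(3)[unfolded has_weak_deriv_iff[OF assms(1)]]
  have "(\<integral>x. frechet_derivative \<phi> (at x) b *\<^sub>R L (f x) \<partial>lebesgue_on \<Omega>)
        = - (\<integral>x. \<phi> x *\<^sub>R L (g x) \<partial>lebesgue_on \<Omega>)" if "\<phi> \<in> test_functions \<Omega>" for \<phi>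
  proof -
    have 1: "integrable (lebesgue_on \<Omega>) (\<lambda>x. frechet_derivative \<phi> (at x) b *\<^sub>R f x)"
      using d locally_integrable_test_integrable[OF _ test_function_deriv[OF that assms(2)] assms(1)] by auto
    have 2: "integrable (lebesgue_on \<Omega>) (\<lambda>x. \<phi> x *\<^sub>R g x)"
      using d locally_integrable_test_integrable[OF _ that assms(1)] by auto
    have "(\<integral>x. frechet_derivative \<phi> (at x) b *\<^sub>R L (f x) \<partial>lebesgue_on \<Omega>) =
        L (\<integral>x. frechet_derivative \<phi> (at x) b *\<^sub>R f x \<partial>lebesgue_on \<Omega>)"
      by (simp only: integral_bounded_linear[OF assms(4) 1, symmetric] linear_simps(5)[OF assms(4)])
    also have "\<dots> = - L (\<integral>x. \<phi> x *\<^sub>R g x \<partial>lebesgue_on \<Omega>)"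
      using d that by (simp add: linear_neg[OF bounded_linear.linear[OF assms(4)]])
    also have "L (\<integral>x. \<phi> x *\<^sub>R g x \<partial>lebesgue_on \<Omega>) = (\<integral>x. \<phi> x *\<^sub>R L (g x) \<partial>lebesgue_on \<Omega>)"
      by (simp only: integral_bounded_linear[OF assms(4) 2, symmetric] linear_simps(5)[OF assms(4)])
    finally show ?thesis .
  qed
  then show ?thesis
    unfolding has_weak_deriv_iff[OF assms(1)]
    using locally_integrable_bounded_linear[OF _ assms(4), of \<Omega> f] 
      locally_integrable_bounded_linear[OF _ assms(4), of \<Omega> g] d by simp
qed

lemma has_weak_deriv_add:
  fixes f g :: "'a::euclidean_space \<Rightarrow> 'b::euclidean_space"
  assumes "open \<Omega>" "b \<in> Basis" "has_weak_deriv \<Omega> b f g" "has_weak_deriv \<Omega> b f' g'"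
  shows "has_weak_deriv \<Omega> b (\<lambda>x. f x + f' x) (\<lambda>x. g x + g' x)"
proof -
  note d = assms(3)[unfolded has_weak_deriv_iff[OF assms(1)]] and d' = assms(4)[unfolded has_weak_deriv_iff[OF assms(1)]]
  have "(\<integral>x. frechet_derivative \<phi> (at x) b *\<^sub>R (f x + f' x) \<partial>lebesgue_on \<Omega>)
        = - (\<integral>x. \<phi> x *\<^sub>R (g x + g' x) \<partial>lebesgue_on \<Omega>)" if t: "\<phi> \<in> test_functions \<Omega>" for \<phi>
  proof -
    note ti = locally_integrable_test_integrable(1)[OF _ test_function_deriv[OF t assms(2)] assms(1)]
      locally_integrable_test_integrable(1)[OF _ t assms(1)]
    have "(\<integral>x. frechet_derivative \<phi> (at x) b *\<^sub>R (f x + f' x) \<partial>lebesgue_on \<Omega>) =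
        (\<integral>x. frechet_derivative \<phi> (at x) b *\<^sub>R f x \<partial>lebesgue_on \<Omega>) +
        (\<integral>x. frechet_derivative \<phi> (at x) b *\<^sub>R f' x \<partial>lebesgue_on \<Omega>)"
      unfolding scaleR_add_right
      by (rule Bochner_Integration.integral_add[OF ti(1)[OF conjunct1[OF d]] ti(1)[OF conjunct1[OF d']]])
    also have "\<dots> = - (\<integral>x. \<phi> x *\<^sub>R g x \<partial>lebesgue_on \<Omega>) + - (\<integral>x. \<phi> x *\<^sub>R g' x \<partial>lebesgue_on \<Omega>)"
      by (intro arg_cong2[of _ _ _ _ "(+)"] bspec[OF conjunct2[OF conjunct2[OF d]] t] bspec[OF conjunct2[OF conjunct2[OF d']] t])
    also have "\<dots> = - (\<integral>x. \<phi> x *\<^sub>R (g x + g' x) \<partial>lebesgue_on \<Omega>)"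
      unfolding scaleR_add_right
      by (subst Bochner_Integration.integral_add[OF ti(2)[OF conjunct1[OF conjunct2[OF d]]] ti(2)[OF conjunct1[OF conjunct2[OF d']]]]) simp
    finally show ?thesis .
  qed
  then show ?thesis
    unfolding has_weak_deriv_iff[OF assms(1)] using locally_integrable_add[of \<Omega> f f'] locally_integrable_add[of \<Omega> g g'] d d' by simp
qed

lemma has_weak_deriv_cmult:
  fixes f g :: "'a::euclidean_space \<Rightarrow> 'b::euclidean_space"
  assumes "open \<Omega>" "b \<in> Basis" "has_weak_deriv \<Omega> b f g"
  shows "has_weak_deriv \<Omega> b (\<lambda>x. c *\<^sub>R f x) (\<lambda>x. c *\<^sub>R g x)"
  by (rule has_weak_deriv_bounded_linear[OF assms bounded_linear_scaleR_right])

lemma has_weak_deriv_diff: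
  fixes f g :: "'a::euclidean_space \<Rightarrow> 'b::euclidean_space"
  assumes "open \<Omega>" "b \<in> Basis" "has_weak_deriv \<Omega> b f g" "has_weak_deriv \<Omega> b f' g'"
  shows "has_weak_deriv \<Omega> b (\<lambda>x. f x - f' x) (\<lambda>x. g x - g' x)"
  using has_weak_deriv_add[OF assms(1-3) has_weak_deriv_cmult[OF assms(1,2,4), of "-1"]] by simp

lemma has_weak_deriv_AE:
  fixes f g :: "'a::euclidean_space \<Rightarrow> 'b::euclidean_space"
  assumes "open \<Omega>" "has_weak_deriv \<Omega> b f g"
    "AE x in lebesgue_on \<Omega>. f x = f' x" "AE x in lebesgue_on \<Omega>. g x = g' x"
  shows "has_weak_deriv \<Omega> b f' g'"
proof -
  have "integral\<^sup>L (lebesgue_on \<Omega>) (\<lambda>x. h x *\<^sub>R f x) = integral\<^sup>L (lebesgue_on \<Omega>) (\<lambda>x. h x *\<^sub>R f' x)"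
    if "AE x in lebesgue_on \<Omega>. f x = f' x" for h :: "'a \<Rightarrow> real" and f f' :: "'a \<Rightarrow> 'b"
  \<comment> \<open>The factor \<open>h\<close> is arbitrary, so the product may fail to be
    measurable. Then its counterpart fails as well, and both integrals have the default value
    0.\<close>
  proof (cases "(\<lambda>x. h x *\<^sub>R f x) \<in> borel_measurable (lebesgue_on \<Omega>)")
    case True
    have ae: "AE x in lebesgue_on \<Omega>. h x *\<^sub>R f x = h x *\<^sub>R f' x"
      using that by eventually_elim simp
    show ?thesis
      by (rule integral_cong_AE[OF True AE_eq_borel_measurable_lebesgue_on[OF assms(1) True ae] ae])
  next
    case False
    have ae: "AE x in lebesgue_on \<Omega>. h x *\<^sub>R f' x = h x *\<^sub>R f x"
      using that by eventually_elim simp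
    have "(\<lambda>x. h x *\<^sub>R f' x) \<notin> borel_measurable (lebesgue_on \<Omega>)"
      using AE_eq_borel_measurable_lebesgue_on[OF assms(1) _ ae] False by blast
    with False show ?thesis
      using not_integrable_integral_eq borel_measurable_integrable by metis
  qed
  from this[OF assms(3)] this[OF assms(4)] show ?thesis
    using assms(2) locally_integrable_AE[OF assms(1) _ assms(3)] locally_integrable_AE[OF assms(1) _ assms(4)]
    unfolding has_weak_deriv_iff[OF assms(1)] by auto
qed

theorem fundamental_lemma:
  fixes f :: "'a::euclidean_space \<Rightarrow> 'b::euclidean_space"
  assumes "open \<Omega>" and f: "locally_integrable \<Omega> f"
    and zero: "\<And>\<phi>. \<phi> \<in> test_functions \<Omega> \<Longrightarrow> integral\<^sup>L (lebesgue_on \<Omega>) (\<lambda>x. \<phi> x *\<^sub>R f x) = 0"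
  shows "AE x in lebesgue_on \<Omega>. f x = 0"
proof -
  have "AE x in lebesgue_on \<Omega>. f x \<bullet> i = 0" for i
    unfolding AE_lebesgue_on[OF assms(1)]
  proof (rule fundamental_lemma_real[OF assms(1)])
    show "locally_integrable \<Omega> (\<lambda>x. f x \<bullet> i)"
      by (rule locally_integrable_bounded_linear[OF f bounded_linear_inner_left])
    fix \<phi> assume t: "\<phi> \<in> test_functions \<Omega>"
    have "integrable (lebesgue_on \<Omega>) (\<lambda>x. \<phi> x *\<^sub>R f x)"
      by (rule locally_integrable_test_integrable[OF f t assms(1)])
    from integral_bounded_linear[OF bounded_linear_inner_left this, of i]
    show "(LINT x:\<Omega>|lebesgue. \<phi> x * (f x \<bullet> i)) = 0"
      using zero[OF t] by (simp add: set_integral_lebesgue_on[OF assms(1)])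
  qed
  then have "AE x in lebesgue_on \<Omega>. \<forall>i\<in>Basis. f x \<bullet> i = 0"
    by (simp add: AE_ball_countable countable_finite)
  then show ?thesis by eventually_elim (auto intro: euclidean_eqI)
qed

lemma has_weak_deriv_unique:
  fixes f g :: "'a::euclidean_space \<Rightarrow> 'b::euclidean_space"
  assumes "open \<Omega>" "b \<in> Basis" "has_weak_deriv \<Omega> b f g" "has_weak_deriv \<Omega> b f g'"
  shows "AE x in lebesgue_on \<Omega>. g x = g' x"
proof -
  have "has_weak_deriv \<Omega> b (\<lambda>x. f x - f x) (\<lambda>x. g x - g' x)"
    by (rule has_weak_deriv_diff[OF assms])
  then have "locally_integrable \<Omega> (\<lambda>x. g x - g' x)"
    "\<And>\<phi>. \<phi> \<in> test_functions \<Omega> \<Longrightarrow> integral\<^sup>L (lebesgue_on \<Omega>) (\<lambda>x. \<phi> x *\<^sub>R (g x - g' x)) = 0"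
    unfolding has_weak_deriv_iff[OF assms(1)] by auto
  from fundamental_lemma[OF assms(1) this] show ?thesis by simp
qed

text \<open>Since \<open>wderiv\<close> is a choice, later computations exhibit some weak derivative
  explicitly and transfer it to \<open>wderiv\<close> by uniqueness, at the price of an equality
  that holds almost everywhere only.\<close>

lemma wderiv_eq:
  fixes f g :: "'a::euclidean_space \<Rightarrow> 'b::euclidean_space"
  assumes "open \<Omega>" "b \<in> Basis" "has_weak_deriv \<Omega> b f g"
  shows "has_weak_deriv \<Omega> b f (wderiv \<Omega> b f)" "AE x in lebesgue_on \<Omega>. wderiv \<Omega> b f x = g x"
proof -
  show *: "has_weak_deriv \<Omega> b f (wderiv \<Omega> b f)"
    unfolding wderiv_def by (rule someI[of "has_weak_deriv \<Omega> b f", OF assms(3)])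
  show "AE x in lebesgue_on \<Omega>. wderiv \<Omega> b f x = g x"
    by (rule has_weak_deriv_unique[OF assms(1,2) * assms(3)])
qed

lemma L2_iff:
  fixes f :: "'a::euclidean_space \<Rightarrow> 'b::euclidean_space"
  assumes "open \<Omega>"
  shows "f \<in> L2 \<Omega> \<longleftrightarrow> f \<in> borel_measurable (lebesgue_on \<Omega>) \<and> integrable (lebesgue_on \<Omega>) (\<lambda>x. (norm (f x))\<^sup>2)"
  using set_integral_lebesgue_on[OF assms, of "\<lambda>x. (norm (f x))\<^sup>2"]
  by (simp add: L2_def set_integral_lebesgue_on[OF assms])

lemma L2_AE:
  fixes f :: "'a::euclidean_space \<Rightarrow> 'b::euclidean_space"
  assumes "open \<Omega>" "f \<in> L2 \<Omega>" "AE x in lebesgue_on \<Omega>. f x = g x"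
  shows "g \<in> L2 \<Omega>"
proof -
  have g: "g \<in> borel_measurable (lebesgue_on \<Omega>)"
    using assms AE_eq_borel_measurable_lebesgue_on L2_iff by blast
  have "integrable (lebesgue_on \<Omega>) (\<lambda>x. (norm (g x))\<^sup>2)"
    by (rule integrable_cong_AE_imp[of _ "\<lambda>x. (norm (f x))\<^sup>2"])
       (use assms g in \<open>auto simp: L2_iff\<close>)
  then show ?thesis using g assms(1) by (simp add: L2_iff)
qed

lemma L2_bounded_linear:
  fixes f :: "'a::euclidean_space \<Rightarrow> 'b::euclidean_space" and L :: "'b \<Rightarrow> 'c::euclidean_space"
  assumes "open \<Omega>" "f \<in> L2 \<Omega>" "bounded_linear L"
  shows "(\<lambda>x. L (f x)) \<in> L2 \<Omega>"
proof -
  obtain K where K: "\<And>x. norm (L x) \<le> norm x * K"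
    using bounded_linear.bounded[OF assms(3)] by blast
  have [measurable]: "L \<in> borel_measurable borel"
    by (intro borel_measurable_continuous_onI linear_continuous_on assms)
  have [measurable]: "f \<in> borel_measurable (lebesgue_on \<Omega>)" and 
    f: "integrable (lebesgue_on \<Omega>) (\<lambda>x. (norm (f x))\<^sup>2)"
    using assms by (auto simp: L2_iff)
  have "integrable (lebesgue_on \<Omega>) (\<lambda>x. (norm (L (f x)))\<^sup>2)"
  proof (rule Bochner_Integration.integrable_bound)
    show "integrable (lebesgue_on \<Omega>) (\<lambda>x. K\<^sup>2 * (norm (f x))\<^sup>2)" using f by simp
    have "(norm (L y))\<^sup>2 \<le> K\<^sup>2 * (norm y)\<^sup>2" for y
      using power_mono[OF K[of y], of 2] by (simp add: power_mult_distrib mult.commute)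
    then show "AE x in lebesgue_on \<Omega>. norm ((norm (L (f x)))\<^sup>2) \<le> norm (K\<^sup>2 * (norm (f x))\<^sup>2)"
      by simp
  qed simp
  then show ?thesis using assms(1) by (simp add: L2_iff)
qed

lemma L2_add:
  fixes f g :: "'a::euclidean_space \<Rightarrow> 'b::euclidean_space"
  assumes "open \<Omega>" "f \<in> L2 \<Omega>" "g \<in> L2 \<Omega>"
  shows "(\<lambda>x. f x + g x) \<in> L2 \<Omega>"
proof -
  have [measurable]: "f \<in> borel_measurable (lebesgue_on \<Omega>)" "g \<in> borel_measurable (lebesgue_on \<Omega>)"
    and fg: "integrable (lebesgue_on \<Omega>) (\<lambda>x. (norm (f x))\<^sup>2)" "integrable (lebesgue_on \<Omega>) (\<lambda>x. (norm (g x))\<^sup>2)"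
    using assms by (auto simp: L2_iff)
  have "integrable (lebesgue_on \<Omega>) (\<lambda>x. (norm (f x + g x))\<^sup>2)"
  proof (rule Bochner_Integration.integrable_bound)
    show "integrable (lebesgue_on \<Omega>) (\<lambda>x. 2 * (norm (f x))\<^sup>2 + 2 * (norm (g x))\<^sup>2)" using fg by simp
    have "(norm (y + z))\<^sup>2 \<le> 2 * (norm y)\<^sup>2 + 2 * (norm z)\<^sup>2" for y z :: 'b
      using power_mono[OF norm_triangle_ineq[of y z], of 2] sum_squares_bound[of "norm y" "norm z"]
      by (simp add: power2_sum)
    then show "AE x in lebesgue_on \<Omega>. norm ((norm (f x + g x))\<^sup>2) \<le> norm (2 * (norm (f x))\<^sup>2 + 2 * (norm (g x))\<^sup>2)"
      by simp
  qed simp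
  then show ?thesis using assms(1) by (simp add: L2_iff)
qed

lemma L2_cmult:
  fixes f :: "'a::euclidean_space \<Rightarrow> 'b::euclidean_space"
  assumes "open \<Omega>" "f \<in> L2 \<Omega>"
  shows "(\<lambda>x. c *\<^sub>R f x) \<in> L2 \<Omega>"
  by (rule L2_bounded_linear[OF assms bounded_linear_scaleR_right])

lemma L2_diff:
  fixes f g :: "'a::euclidean_space \<Rightarrow> 'b::euclidean_space"
  assumes "open \<Omega>" "f \<in> L2 \<Omega>" "g \<in> L2 \<Omega>"
  shows "(\<lambda>x. f x - g x) \<in> L2 \<Omega>"
  using L2_add[OF assms(1,2) L2_cmult[OF assms(1,3), of "-1"]] by simp

lemma finite_measure_lebesgue_on:
  assumes "open \<Omega>" "bounded \<Omega>"
  shows "finite_measure (lebesgue_on \<Omega>)"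
proof
  have "emeasure lborel \<Omega> < \<infinity>" by (rule emeasure_bounded_finite[OF assms(2)])
  then show "emeasure (lebesgue_on \<Omega>) (space (lebesgue_on \<Omega>)) \<noteq> \<infinity>"
    using assms(1) by (simp add: emeasure_restrict_space borel_open)
qed

lemma L2_integrable:
  fixes f :: "'a::euclidean_space \<Rightarrow> 'b::euclidean_space"
  assumes "open \<Omega>" "bounded \<Omega>" "f \<in> L2 \<Omega>"
  shows "integrable (lebesgue_on \<Omega>) f" "locally_integrable \<Omega> f"
proof -
  interpret finite_measure "lebesgue_on \<Omega>" by (rule finite_measure_lebesgue_on[OF assms(1,2)])
  have [measurable]: "f \<in> borel_measurable (lebesgue_on \<Omega>)" and
    f: "integrable (lebesgue_on \<Omega>) (\<lambda>x. (norm (f x))\<^sup>2)"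
    using assms by (auto simp: L2_iff)
  have "integrable (lebesgue_on \<Omega>) (\<lambda>x. norm (f x))"
    by (rule square_integrable_imp_integrable[OF _ f]) measurable
  then show i: "integrable (lebesgue_on \<Omega>) f" by (subst (asm) integrable_norm_iff) auto
  show "locally_integrable \<Omega> f"
    unfolding locally_integrable_def
    using i by (auto intro: set_integrable_subset simp: set_integral_lebesgue_on(2)[OF assms(1), symmetric]
         compact_imp_closed borel_closed)
qed

lemma W12D:
  fixes f :: "'a::euclidean_space \<Rightarrow> 'b::euclidean_space"
  assumes "open \<Omega>" "f \<in> W12 \<Omega>"
  shows "f \<in> L2 \<Omega>" "b \<in> Basis \<Longrightarrow> has_weak_deriv \<Omega> b f (wderiv \<Omega> b f)"
    "b \<in> Basis \<Longrightarrow> wderiv \<Omega> b f \<in> L2 \<Omega>"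
proof -
  show "f \<in> L2 \<Omega>" using assms by (simp add: W12_def)
  assume b: "b \<in> Basis"
  then obtain g where g: "g \<in> L2 \<Omega>" "has_weak_deriv \<Omega> b f g" using assms by (auto simp: W12_def)
  note w = wderiv_eq[OF assms(1) b g(2)]
  show "has_weak_deriv \<Omega> b f (wderiv \<Omega> b f)" by (rule w)
  show "wderiv \<Omega> b f \<in> L2 \<Omega>"
    by (rule L2_AE[OF assms(1) g(1)]) (use w(2) in \<open>eventually_elim, simp\<close>)
qed

lemma W12I:
  fixes f :: "'a::euclidean_space \<Rightarrow> 'b::euclidean_space"
  assumes "f \<in> L2 \<Omega>" "\<And>b. b \<in> Basis \<Longrightarrow> has_weak_deriv \<Omega> b f (g b)" "\<And>b. b \<in> Basis \<Longrightarrow> g b \<in> L2 \<Omega>"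
  shows "f \<in> W12 \<Omega>"
  using assms by (auto simp: W12_def)

lemma W12_AE:
  fixes f :: "'a::euclidean_space \<Rightarrow> 'b::euclidean_space"
  assumes "open \<Omega>" "f \<in> W12 \<Omega>" "AE x in lebesgue_on \<Omega>. f x = f' x"
  shows "f' \<in> W12 \<Omega>"
  by (rule W12I[where g = "\<lambda>b. wderiv \<Omega> b f"])
     (use assms W12D[OF assms(1,2)] in \<open>auto intro: L2_AE has_weak_deriv_AE\<close>)

lemma has_weak_deriv_Pair:
  fixes f1 g1 :: "'a::euclidean_space \<Rightarrow> 'b::euclidean_space" and f2 g2 :: "'a \<Rightarrow> 'c::euclidean_space"
  assumes "open \<Omega>" "b \<in> Basis" "has_weak_deriv \<Omega> b f1 g1" "has_weak_deriv \<Omega> b f2 g2"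
  shows "has_weak_deriv \<Omega> b (\<lambda>x. (f1 x, f2 x)) (\<lambda>x. (g1 x, g2 x))"
proof -
  have "bounded_linear (\<lambda>x. (x, 0::'c))" "bounded_linear (\<lambda>x. (0::'b, x))"
    by (auto intro!: bounded_linear_Pair bounded_linear_ident bounded_linear_zero)
  from has_weak_deriv_add[OF assms(1,2) has_weak_deriv_bounded_linear[OF assms(1,2,3) this(1)]
     has_weak_deriv_bounded_linear[OF assms(1,2,4) this(2)]]
  show ?thesis by simp
qed

lemma L2_Pair:
  fixes f1 :: "'a::euclidean_space \<Rightarrow> 'b::euclidean_space" and f2 :: "'a \<Rightarrow> 'c::euclidean_space"
  assumes "open \<Omega>" "f1 \<in> L2 \<Omega>" "f2 \<in> L2 \<Omega>"
  shows "(\<lambda>x. (f1 x, f2 x)) \<in> L2 \<Omega>"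
proof -
  have "bounded_linear (\<lambda>x. (x, 0::'c))" "bounded_linear (\<lambda>x. (0::'b, x))"
    by (auto intro!: bounded_linear_Pair bounded_linear_ident bounded_linear_zero)
  from L2_add[OF assms(1) L2_bounded_linear[OF assms(1,2) this(1)] L2_bounded_linear[OF assms(1,3) this(2)]]
  show ?thesis by simp
qed


subsection \<open>Weak derivatives along segments\<close>

text \<open>Functions extended by zero outside \<Omega> are moved to \<open>lborel\<close> on the
  whole space, where translation invariance and Fubini apply directly.\<close>

lemma integral_lebesgue_on_borel:
  fixes h :: "'a::euclidean_space \<Rightarrow> real"
  assumes "open \<Omega>" "h \<in> borel_measurable borel" "\<And>x. x \<notin> \<Omega> \<Longrightarrow> h x = 0"
  shows "integral\<^sup>L (lebesgue_on \<Omega>) h = integral\<^sup>L lborel h"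
    "integrable (lebesgue_on \<Omega>) h \<longleftrightarrow> integrable lborel h"
proof -
  have "(\<lambda>x. indicator \<Omega> x *\<^sub>R h x) = h" using assms(3) by (auto simp: indicator_def fun_eq_iff)
  then show "integral\<^sup>L (lebesgue_on \<Omega>) h = integral\<^sup>L lborel h"
    "integrable (lebesgue_on \<Omega>) h \<longleftrightarrow> integrable lborel h"
    using assms(2) by (simp_all add: integral_restrict_space[OF open_sets_lebesgue[OF assms(1)]]
      integrable_restrict_space[OF open_sets_lebesgue[OF assms(1)]] integral_completion integrable_completion)
qed

lemma AE_lebesgue_on_lborel:
  assumes "open \<Omega>" "AE x in lborel. x \<in> \<Omega> \<longrightarrow> P x"
  shows "AE x in lebesgue_on \<Omega>. P x"
  unfolding AE_lebesgue_on[OF assms(1)] using assms(2) by (rule AE_completion)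

text \<open>Slices of a Borel function, and its shears taken jointly in the point and the parameter,
  are measurable, which is what Fubini requires. Hence each argument along lines begins by passing
  to such a representative.\<close>

lemma lebesgue_on_borel_representative:
  fixes f :: "'a::euclidean_space \<Rightarrow> real"
  assumes "open \<Omega>" "f \<in> borel_measurable (lebesgue_on \<Omega>)"
  obtains f' where "f' \<in> borel_measurable borel" "\<And>x. x \<notin> \<Omega> \<Longrightarrow> f' x = 0"
    "AE x in lebesgue_on \<Omega>. f x = f' x" 
proof -
  have "(\<lambda>x. indicator \<Omega> x * f x) \<in> borel_measurable lebesgue"
    using set_integral_lebesgue_on(3)[OF assms(1), of f] assms(2) by (simp add: set_borel_measurable_def)
  from completion_ex_borel_measurable_real[OF this]
  obtain f1 where f1: "f1 \<in> borel_measurable lborel" "AE x in lborel. indicator \<Omega> x * f x = f1 x"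
    by blast
  have [measurable]: "\<Omega> \<in> sets borel" using assms(1) by simp
  have [measurable]: "f1 \<in> borel_measurable borel" using f1(1) by simp
  show ?thesis
  proof (rule that[of "\<lambda>x. indicator \<Omega> x * f1 x"])
    have "AE x in lborel. x \<in> \<Omega> \<longrightarrow> f x = indicator \<Omega> x * f1 x"
      using f1(2) by eventually_elim (auto simp: indicator_def)
    then show "AE x in lebesgue_on \<Omega>. f x = indicator \<Omega> x * f1 x"
      by (rule AE_lebesgue_on_lborel[OF assms(1)])
  qed (auto simp: indicator_def)
qed

section \<open>Translations and integration by parts\<close>

lemma lborel_translate:
  fixes f :: "'a::euclidean_space \<Rightarrow> real"
  assumes [measurable]: "f \<in> borel_measurable borel"
  shows "integral\<^sup>L lborel (\<lambda>x. f (x + v)) = integral\<^sup>L lborel f"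
    "integrable lborel (\<lambda>x. f (x + v)) \<longleftrightarrow> integrable lborel f"
    "(\<integral>\<^sup>+x. ennreal (f (x + v)) \<partial>lborel) = (\<integral>\<^sup>+x. ennreal (f x) \<partial>lborel)"
proof -
  have "integral\<^sup>L (distr lborel borel ((+) v)) f = integral\<^sup>L lborel (\<lambda>x. f (v + x))"
    by (rule integral_distr) auto
  then show "integral\<^sup>L lborel (\<lambda>x. f (x + v)) = integral\<^sup>L lborel f"
    by (simp add: lborel_distr_plus add.commute)
  have "integrable (distr lborel borel ((+) v)) f = integrable lborel (\<lambda>x. f (v + x))"
    by (rule integrable_distr_eq) auto
  then show "integrable lborel (\<lambda>x. f (x + v)) \<longleftrightarrow> integrable lborel f"
    by (simp add: lborel_distr_plus add.commute)
  have "(\<integral>\<^sup>+x. ennreal (f x) \<partial>distr lborel borel ((+) v)) = (\<integral>\<^sup>+x. ennreal (f (v + x)) \<partial>lborel)"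
    by (rule nn_integral_distr) auto
  then show "(\<integral>\<^sup>+x. ennreal (f (x + v)) \<partial>lborel) = (\<integral>\<^sup>+x. ennreal (f x) \<partial>lborel)"
    by (simp add: lborel_distr_plus add.commute)
qed

lemma AE_lborel_translate:
  fixes v :: "'a::euclidean_space"
  assumes "AE x in lborel. P x" "Measurable.pred borel P"
  shows "AE x in lborel. P (x + v)"
proof -
  have "AE x in distr lborel borel ((+) v). P x" unfolding lborel_distr_plus by (rule assms(1))
  then have "AE x in lborel. P (v + x)"
    using assms(2) by (subst (asm) AE_distr_iff) (auto simp: pred_def)
  then show ?thesis by (simp add: add.commute)
qed

text \<open>For fixed \<open>s\<close> translation invariance makes the integral in \<open>x\<close>
  equal to \<open>k s\<close> times that of \<open>g\<close> in absolute value, so integrating in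
  \<open>x\<close> first settles integrability; the factors are swapped afterwards. The direction
  \<open>b = 0\<close> gives ordinary tensor products.\<close>

lemma integrable_shear:
  fixes g :: "'a::euclidean_space \<Rightarrow> real" and k :: "real \<Rightarrow> real"
  assumes [measurable]: "g \<in> borel_measurable borel" and g: "integrable lborel g" and k: "integrable lborel k"
  shows "integrable (lborel \<Otimes>\<^sub>M lborel) (\<lambda>(x, s). k s * g (x + s *\<^sub>R b))"
proof -
  have [measurable]: "k \<in> borel_measurable borel" using borel_measurable_integrable[OF k] by simp
  have "integrable (lborel \<Otimes>\<^sub>M lborel) (\<lambda>(s, x). k s * g (x + s *\<^sub>R b))"
  proof (rule lborel_pair.Fubini_integrable)
    show "(\<lambda>(s, x). k s * g (x + s *\<^sub>R b)) \<in> borel_measurable (lborel \<Otimes>\<^sub>M lborel)"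
      by measurable
    have "(LINT x|lborel. norm (case (s, x) of (s, x) \<Rightarrow> k s * g (x + s *\<^sub>R b))) =
        \<bar>k s\<bar> * (LINT x|lborel. \<bar>g x\<bar>)" for s
      by (simp add: abs_mult lborel_translate(1)[of "\<lambda>x. \<bar>g x\<bar>" "s *\<^sub>R b"])
    then show "integrable lborel (\<lambda>s. LINT x|lborel. norm (case (s, x) of (s, x) \<Rightarrow> k s * g (x + s *\<^sub>R b)))"
      using k by simp
    show "AE s in lborel. integrable lborel (\<lambda>x. case (s, x) of (s, x) \<Rightarrow> k s * g (x + s *\<^sub>R b))"
      using g by (simp add: lborel_translate(2))
  qed
  from lborel_pair.integrable_product_swap[OF this] show ?thesis
    by (simp add: case_prod_unfold)
qed

lemma line_FTC:
  fixes p :: "'a::euclidean_space \<Rightarrow> real"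
  assumes "\<And>x. (p has_derivative p' x) (at x)" "continuous_on UNIV (\<lambda>x. p' x b)" "0 \<le> h"
  shows "(\<integral>s. indicator {0..h} s * p' (x + s *\<^sub>R b) b \<partial>lborel) = p (x + h *\<^sub>R b) - p x"
proof -
  have "(\<integral>s. p' (x + s *\<^sub>R b) b * indicator {0..h} s \<partial>lborel) = p (x + h *\<^sub>R b) - p (x + 0 *\<^sub>R b)"
  proof (rule integral_FTC_Icc_real[OF assms(3)])
    fix s
    have "((\<lambda>s. x + s *\<^sub>R b) has_derivative (\<lambda>t. t *\<^sub>R b)) (at s)"
      by (auto intro!: derivative_eq_intros)
    from diff_chain_at[OF this assms(1)[of "x + s *\<^sub>R b"]]
    have "((\<lambda>s. p (x + s *\<^sub>R b)) has_derivative (\<lambda>t. p' (x + s *\<^sub>R b) (t *\<^sub>R b))) (at s)"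
      by (simp add: o_def)
    moreover have "p' (x + s *\<^sub>R b) (t *\<^sub>R b) = t * p' (x + s *\<^sub>R b) b" for t
      using linear_cmul[OF has_derivative_linear[OF assms(1)], of "x + s *\<^sub>R b" t b] by simp
    ultimately show "((\<lambda>s. p (x + s *\<^sub>R b)) has_real_derivative p' (x + s *\<^sub>R b) b) (at s)"
      by (simp add: has_field_derivative_def mult.commute[of _ "p' _ _"])
    have "continuous_on UNIV (\<lambda>s. p' (x + s *\<^sub>R b) b)"
      by (rule continuous_on_compose2[OF assms(2)]) (auto intro!: continuous_intros)
    then show "isCont (\<lambda>s. p' (x + s *\<^sub>R b) b) s"
      by (simp add: continuous_on_eq_continuous_at)
  qed
  then show ?thesis by (simp add: mult.commute)
qed

lemma continuous_compact_support_integrable: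
  fixes f :: "'a::euclidean_space \<Rightarrow> real"
  assumes "continuous_on UNIV f" "compact K" "\<And>x. x \<notin> K \<Longrightarrow> f x = 0"
  shows "integrable lborel f"
proof -
  have "integrable lborel (\<lambda>x. indicator K x *\<^sub>R f x)"
    by (rule borel_integrable_compact) (use assms in \<open>auto intro: continuous_on_subset\<close>)
  also have "(\<lambda>x. indicator K x *\<^sub>R f x) = f" using assms(3) by (auto simp: indicator_def fun_eq_iff)
  finally show ?thesis .
qed

text \<open>The integral of the derivative is unchanged under translation along \<open>b\<close>.
  Averaging it over shifts in \<open>[0, 1]\<close> and exchanging the integrals turns it into the
  integral of \<open>p (x + b) - p x\<close>, which vanishes. No slicing into coordinates is
  involved.\<close>

lemma integral_deriv_compact_support:
  fixes p :: "'a::euclidean_space \<Rightarrow> real"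
  assumes p: "\<And>x. (p has_derivative p' x) (at x)" and c: "continuous_on UNIV (\<lambda>x. p' x b)"
    and K: "compact K" "\<And>x. x \<notin> K \<Longrightarrow> p x = 0" "\<And>x. x \<notin> K \<Longrightarrow> p' x b = 0"
  shows "integral\<^sup>L lborel (\<lambda>x. p' x b) = 0"
proof -
  have pc: "continuous_on UNIV p"
    using p by (intro continuous_at_imp_continuous_on) (auto intro: has_derivative_continuous)
  have [measurable]: "p \<in> borel_measurable borel" "(\<lambda>x. p' x b) \<in> borel_measurable borel"
    by (intro borel_measurable_continuous_onI pc c)+
  have ip: "integrable lborel p" "integrable lborel (\<lambda>x. p' x b)"
    using continuous_compact_support_integrable[OF pc K(1,2)] continuous_compact_support_integrable[OF c K(1,3)] by auto
  have ii: "integrable lborel (indicator {0..1} :: real \<Rightarrow> real)" by simp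
  note F = lborel_pair.Fubini_integral[OF integrable_shear[OF _ ip(2) ii, of b]]
  have "integral\<^sup>L lborel (\<lambda>x. p' x b) =
      (\<integral>s. indicator {0..1} s * integral\<^sup>L lborel (\<lambda>x. p' x b) \<partial>(lborel :: real measure))"
    by simp
  also have "\<dots> = (\<integral>s. (\<integral>x. indicator {0..1} s * p' (x + s *\<^sub>R b) b \<partial>lborel) \<partial>(lborel :: real measure))"
    by (simp add: lborel_translate(1)[of "\<lambda>x. p' x b"])
  also have "\<dots> = (\<integral>x. (\<integral>s. indicator {0..1} s * p' (x + s *\<^sub>R b) b \<partial>lborel) \<partial>lborel)"
    using F by simp
  also have "\<dots> = (\<integral>x. p (x + b) - p x \<partial>lborel)"
    using line_FTC[OF p c, of 1] by simp
  also have "\<dots> = 0"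
    using ip(1) by (simp add: lborel_translate)
  finally show ?thesis .
qed

text \<open>The product of \<open>p\<close> with a test function has compact support, so the
  previous lemma applied to it is integration by parts. Having \<open>p\<close> differentiable on
  the whole space keeps the boundary of \<Omega> out of sight.\<close>

theorem C1_has_weak_deriv:
  fixes p :: "'a::euclidean_space \<Rightarrow> real"
  assumes "open \<Omega>" "b \<in> Basis"
    and p: "\<And>x. (p has_derivative p' x) (at x)" and c: "continuous_on UNIV (\<lambda>x. p' x b)"
  shows "has_weak_deriv \<Omega> b p (\<lambda>x. p' x b)"
proof -
  have pc: "continuous_on UNIV p"
    using p by (intro continuous_at_imp_continuous_on) (auto intro: has_derivative_continuous)
  have [measurable]: "p \<in> borel_measurable borel" "(\<lambda>x. p' x b) \<in> borel_measurable borel"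
    by (intro borel_measurable_continuous_onI pc c)+
  have li: "locally_integrable \<Omega> q" if "continuous_on UNIV q" for q :: "'a \<Rightarrow> real"
    unfolding locally_integrable_def set_integrable_def
  proof (intro allI impI)
    fix K assume "compact K \<and> K \<subseteq> \<Omega>"
    then have i: "integrable lborel (\<lambda>x. indicator K x *\<^sub>R q x)"
      using that by (intro borel_integrable_compact) (auto intro: continuous_on_subset)
    show "integrable lebesgue (\<lambda>x. indicator K x *\<^sub>R q x)"
      using integrable_completion[OF borel_measurable_integrable[OF i]] i by simp
  qed
  have "(\<integral>x. frechet_derivative \<phi> (at x) b *\<^sub>R p x \<partial>lebesgue_on \<Omega>)
        = - (\<integral>x. \<phi> x *\<^sub>R p' x b \<partial>lebesgue_on \<Omega>)" if t: "\<phi> \<in> test_functions \<Omega>" for \<phi>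
  proof -
    define d where "d x = frechet_derivative \<phi> (at x) b" for x
    have dt: "d \<in> test_functions \<Omega>" unfolding d_def by (rule test_function_deriv[OF t assms(2)])
    obtain K where K: "compact K" "K \<subseteq> \<Omega>" "\<And>x. x \<notin> K \<Longrightarrow> \<phi> x = 0" using test_function_support[OF t] by metis
    obtain K' where K': "compact K'" "K' \<subseteq> \<Omega>" "\<And>x. x \<notin> K' \<Longrightarrow> d x = 0" using test_function_support[OF dt] by metis
    note [measurable] = test_functionsD(3)[OF t] test_functionsD(3)[OF dt]
    have i1: "integrable lborel (\<lambda>x. d x * p x)" "integrable lborel (\<lambda>x. \<phi> x * p' x b)"
      by (rule continuous_compact_support_integrable[OF _ compact_Un[OF K(1) K'(1)]];
          use K K' in \<open>auto intro!: continuous_on_mult pc c test_functionsD(2)[OF t] test_functionsD(2)[OF dt]\<close>)+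
    have "integral\<^sup>L lborel (\<lambda>x. \<phi> x * p' x b + frechet_derivative \<phi> (at x) b * p x) = 0"
    proof (rule integral_deriv_compact_support[where p = "\<lambda>x. \<phi> x * p x" and K = "K \<union> K'" and
          p' = "\<lambda>x v. \<phi> x * p' x v + frechet_derivative \<phi> (at x) v * p x" and b = b])
      show "((\<lambda>x. \<phi> x * p x) has_derivative (\<lambda>v. \<phi> x * p' x v + frechet_derivative \<phi> (at x) v * p x)) (at x)" for x
        by (rule has_derivative_mult[OF test_functionsD(4)[OF t] p])
      show "continuous_on UNIV (\<lambda>x. \<phi> x * p' x b + frechet_derivative \<phi> (at x) b * p x)"
        using test_functionsD(2)[OF dt] unfolding d_def
        by (intro continuous_intros pc c test_functionsD(2)[OF t])
    qed (use K K' in \<open>auto simp: d_def\<close>)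
    then have "integral\<^sup>L lborel (\<lambda>x. \<phi> x * p' x b) + integral\<^sup>L lborel (\<lambda>x. d x * p x) = 0"
      using i1 by (simp add: d_def)
    moreover have "integral\<^sup>L (lebesgue_on \<Omega>) (\<lambda>x. \<phi> x * p' x b) = integral\<^sup>L lborel (\<lambda>x. \<phi> x * p' x b)"
      by (rule integral_lebesgue_on_borel[OF assms(1)]) (use K in auto)
    moreover have "integral\<^sup>L (lebesgue_on \<Omega>) (\<lambda>x. d x * p x) = integral\<^sup>L lborel (\<lambda>x. d x * p x)"
      by (rule integral_lebesgue_on_borel[OF assms(1)]) (use K' in auto)
    ultimately show ?thesis by (simp add: d_def)
  qed
  then show ?thesis unfolding has_weak_deriv_iff[OF assms(1)] using li[OF pc] li[OF c] by blast
qed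

text \<open>Both sides are compared after integration against a test function supported where
  \<open>x\<close> and \<open>x + h b\<close> lie in \<Omega>. The difference quotient is moved onto
  the test function, written as an integral of its derivative over \<open>s\<close>, and for each
  \<open>s\<close> the weak formula is used with the translated test function; convexity keeps all
  these translates inside \<Omega>.\<close>

theorem weak_deriv_translate:
  fixes f g :: "'a::euclidean_space \<Rightarrow> real"
  assumes "open \<Omega>" "convex \<Omega>" "b \<in> Basis" "0 \<le> h"
    and [measurable]: "f \<in> borel_measurable borel" "g \<in> borel_measurable borel"
    and f: "integrable lborel f" and g: "integrable lborel g"
    and outside: "\<And>x. x \<notin> \<Omega> \<Longrightarrow> f x = 0" "\<And>x. x \<notin> \<Omega> \<Longrightarrow> g x = 0"
    and wd: "has_weak_deriv \<Omega> b f g"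
  shows "AE x in lborel. x \<in> \<Omega> \<and> x + h *\<^sub>R b \<in> \<Omega> \<longrightarrow>
    f (x + h *\<^sub>R b) - f x = (\<integral>s. indicator {0..h} s * g (x + s *\<^sub>R b) \<partial>lborel)"
proof -
  define k :: "real \<Rightarrow> real" where "k = indicator {0..h}"
  have k: "integrable lborel k" using assms(4) by (simp add: k_def integrable_indicator_iff)
  have [measurable]: "k \<in> borel_measurable borel" by (simp add: k_def)
  have wd': "(\<integral>x. frechet_derivative \<phi> (at x) b * f x \<partial>lborel) = - (\<integral>x. \<phi> x * g x \<partial>lborel)"
    if t: "\<phi> \<in> test_functions \<Omega>" for \<phi>
  proof -
    note [measurable] = test_functionsD(3)[OF t] test_functionsD(3)[OF test_function_deriv[OF t assms(3)]]
    have "integral\<^sup>L (lebesgue_on \<Omega>) (\<lambda>x. frechet_derivative \<phi> (at x) b * f x) =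
        integral\<^sup>L lborel (\<lambda>x. frechet_derivative \<phi> (at x) b * f x)"
      by (rule integral_lebesgue_on_borel[OF assms(1)]) (auto simp: outside)
    moreover have "integral\<^sup>L (lebesgue_on \<Omega>) (\<lambda>x. \<phi> x * g x) = integral\<^sup>L lborel (\<lambda>x. \<phi> x * g x)"
      by (rule integral_lebesgue_on_borel[OF assms(1)]) (auto simp: outside)
    ultimately show ?thesis using wd t unfolding has_weak_deriv_iff[OF assms(1)] by simp
  qed
  \<comment> \<open>Both endpoints in \<Omega> force the whole segment into \<Omega> by convexity,
    so a test function on this set may be shifted by \<open>s b\<close> for every \<open>s\<close>
    in \<open>[0, h]\<close>.\<close>
  define \<Omega>' where "\<Omega>' = \<Omega> \<inter> (\<lambda>x. x + h *\<^sub>R b) -` \<Omega>"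
  have "open ((\<lambda>x. x + h *\<^sub>R b) -` \<Omega>)"
    using assms(1) by (intro continuous_open_vimage) (auto intro!: continuous_intros)
  then have o': "open \<Omega>'" using assms(1) by (auto simp: \<Omega>'_def)
  have seg: "x + s *\<^sub>R b \<in> \<Omega>" if "x \<in> \<Omega>'" "0 \<le> s" "s \<le> h" for x s
  proof (cases "h = 0")
    case False
    then have "h > 0" using assms(4) by simp
    have "(1 - s / h) *\<^sub>R x + (s / h) *\<^sub>R (x + h *\<^sub>R b) \<in> \<Omega>"
      using that \<open>h > 0\<close> by (intro convexD_alt[OF assms(2)]) (auto simp: \<Omega>'_def)
    also have "(1 - s / h) *\<^sub>R x + (s / h) *\<^sub>R (x + h *\<^sub>R b) = x + s *\<^sub>R b"
      using \<open>h > 0\<close> by (simp add: algebra_simps)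
    finally show ?thesis .
  qed (use that in \<open>auto simp: \<Omega>'_def\<close>)
  note sh = integrable_shear[OF _ g k, of b]
  define G where "G x = (\<integral>s. k s * g (x + s *\<^sub>R b) \<partial>lborel)" for x
  have G: "integrable lborel G" unfolding G_def using lborel_pair.integrable_fst[OF sh] by simp
  have [measurable]: "G \<in> borel_measurable borel" using borel_measurable_integrable[OF G] by simp
  define F where "F = (\<lambda>x. f (x + h *\<^sub>R b) - f x - G x)"
  have F: "integrable lborel F" unfolding F_def using f G by (simp add: lborel_translate(2))
  have [measurable]: "F \<in> borel_measurable borel" by (simp add: F_def)
  have zero: "(\<integral>x. \<psi> x * F x \<partial>lborel) = 0" if t: "\<psi> \<in> test_functions \<Omega>'" for \<psi>
  proof -
    define d where "d x = frechet_derivative \<psi> (at x) b" for x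
    have dt: "d \<in> test_functions \<Omega>'" unfolding d_def by (rule test_function_deriv[OF t assms(3)])
    note [measurable] = test_functionsD(3)[OF t] test_functionsD(3)[OF dt]
    obtain B where B: "\<And>x. \<bar>\<psi> x\<bar> \<le> B" "0 \<le> B" using test_function_support[OF t] by metis
    obtain B' where B': "\<And>x. \<bar>d x\<bar> \<le> B'" "0 \<le> B'" using test_function_support[OF dt] by metis
    have bi: "integrable lborel (\<lambda>x. q x * u x)" if "integrable lborel u" "q \<in> borel_measurable borel"
      "\<And>x. \<bar>q x\<bar> \<le> C" for q u :: "'a \<Rightarrow> real" and C
    proof (rule Bochner_Integration.integrable_bound)
      show "integrable lborel (\<lambda>x. C * u x)" using that by simp
      show "(\<lambda>x. q x * u x) \<in> borel_measurable lborel"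
        using that(2) borel_measurable_integrable[OF that(1)] by simp
      have "0 \<le> C" using that(3)[of undefined] by linarith
      then show "AE x in lborel. norm (q x * u x) \<le> norm (C * u x)"
        using that(3) by (auto simp: abs_mult intro!: mult_right_mono)
    qed
    have tr: "(\<integral>x. \<psi> x * u (x + v) \<partial>lborel) = (\<integral>x. \<psi> (x - v) * u x \<partial>lborel)" 
      if [measurable]: "u \<in> borel_measurable borel" for u :: "'a \<Rightarrow> real" and v
      using lborel_translate(1)[of "\<lambda>x. \<psi> (x - v) * u x" v] by simp
    \<comment> \<open>The fundamental theorem gives the integral starting from the point
      \<open>x - h b\<close>; the substitution \<open>h - s\<close> for \<open>s\<close> rewrites it
      through backward shifts, the form in which translated test functions occur.\<close>
    have sub: "\<psi> x - \<psi> (x - h *\<^sub>R b) = (\<integral>s. k s * d (x - s *\<^sub>R b) \<partial>lborel)" for x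
    proof -
      have "(\<integral>s. indicator {0..h} s * d (x - h *\<^sub>R b + s *\<^sub>R b) \<partial>lborel) = \<psi> x - \<psi> (x - h *\<^sub>R b)"
        using line_FTC[OF test_functionsD(4)[OF t], of b h "x - h *\<^sub>R b"] test_functionsD(2)[OF dt] assms(4)
        by (simp add: d_def)
      also have "(\<integral>s. indicator {0..h} s * d (x - h *\<^sub>R b + s *\<^sub>R b) \<partial>lborel) =
          (\<integral>s. indicator {0..h} (h - s) * d (x - h *\<^sub>R b + (h - s) *\<^sub>R b) \<partial>lborel)"
        using lborel_integral_real_affine[of "-1" "\<lambda>s. indicator {0..h} s * d (x - h *\<^sub>R b + s *\<^sub>R b)" h] by simp
      also have "\<dots> = (\<integral>s. k s * d (x - s *\<^sub>R b) \<partial>lborel)"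
        by (intro Bochner_Integration.integral_cong) (auto simp: k_def indicator_def algebra_simps)
      finally show ?thesis by simp
    qed
    \<comment> \<open>Bounding the derivative of the test function by \<open>B'\<close> leaves the
      plain product of \<open>k s\<close> and \<open>f x\<close>, which is the shear estimate in
      direction 0. This licenses the exchange of integrals below.\<close>
    have sh2: "integrable (lborel \<Otimes>\<^sub>M lborel) (\<lambda>(x, s). k s * (d (x - s *\<^sub>R b) * f x))"
    proof (rule Bochner_Integration.integrable_bound)
      show "integrable (lborel \<Otimes>\<^sub>M lborel) (\<lambda>(x, s). B' * (k s * f (x + s *\<^sub>R 0)))"
        using integrable_shear[OF _ f k, of 0] integrable_mult_right[of B' "lborel \<Otimes>\<^sub>M lborel" "\<lambda>(x, s). k s * f (x + s *\<^sub>R 0)"] 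
        by (simp add: case_prod_unfold)
      show "(\<lambda>(x, s). k s * (d (x - s *\<^sub>R b) * f x)) \<in> borel_measurable (lborel \<Otimes>\<^sub>M lborel)" by measurable
      have "\<bar>k s\<bar> * (\<bar>d (x - s *\<^sub>R b)\<bar> * \<bar>f x\<bar>) \<le> B' * (\<bar>k s\<bar> * \<bar>f x\<bar>)" for x s
        using mult_right_mono[OF B'(1)[of "x - s *\<^sub>R b"], of "\<bar>k s\<bar> * \<bar>f x\<bar>"] by (simp add: mult.left_commute)
      then show "AE p in lborel \<Otimes>\<^sub>M lborel. norm (case p of (x, s) \<Rightarrow> k s * (d (x - s *\<^sub>R b) * f x))
          \<le> norm (case p of (x, s) \<Rightarrow> B' * (k s * f (x + s *\<^sub>R 0)))"
        using B'(2) by (auto simp: abs_mult)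
    qed
    have sh3: "integrable (lborel \<Otimes>\<^sub>M lborel) (\<lambda>(x, s). k s * (\<psi> x * g (x + s *\<^sub>R b)))"
    proof (rule Bochner_Integration.integrable_bound)
      show "integrable (lborel \<Otimes>\<^sub>M lborel) (\<lambda>(x, s). B * (k s * g (x + s *\<^sub>R b)))"
        using sh integrable_mult_right[of B "lborel \<Otimes>\<^sub>M lborel" "\<lambda>(x, s). k s * g (x + s *\<^sub>R b)"] 
        by (simp add: case_prod_unfold)
      show "(\<lambda>(x, s). k s * (\<psi> x * g (x + s *\<^sub>R b))) \<in> borel_measurable (lborel \<Otimes>\<^sub>M lborel)" by measurable
      have "\<bar>k s\<bar> * (\<bar>\<psi> x\<bar> * \<bar>g (x + s *\<^sub>R b)\<bar>) \<le> B * (\<bar>k s\<bar> * \<bar>g (x + s *\<^sub>R b)\<bar>)" for x s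
        using mult_right_mono[OF B(1)[of "x"], of "\<bar>k s\<bar> * \<bar>g (x + s *\<^sub>R b)\<bar>"] by (simp add: mult.left_commute)
      then show "AE p in lborel \<Otimes>\<^sub>M lborel. norm (case p of (x, s) \<Rightarrow> k s * (\<psi> x * g (x + s *\<^sub>R b)))
          \<le> norm (case p of (x, s) \<Rightarrow> B * (k s * g (x + s *\<^sub>R b)))"
        using B(2) by (auto simp: abs_mult)
    qed
    \<comment> \<open>Here the weak derivative is used, once for each shift \<open>s\<close> in
      \<open>[0, h]\<close>; outside that interval the weight \<open>k s\<close> is zero.\<close>
    have inner: "k s * (\<integral>x. d (x - s *\<^sub>R b) * f x \<partial>lborel) = - (k s * (\<integral>x. \<psi> x * g (x + s *\<^sub>R b) \<partial>lborel))" for s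
    proof (cases "s \<in> {0..h}")
      case True
      then have "\<And>x. x \<in> \<Omega>' \<Longrightarrow> x + s *\<^sub>R b \<in> \<Omega>" using seg by simp
      note ts = test_function_shift[OF t this]
      have "(\<integral>x. d (x - s *\<^sub>R b) * f x \<partial>lborel) = - (\<integral>x. \<psi> (x - s *\<^sub>R b) * g x \<partial>lborel)"
        using wd'[OF ts(1)] by (simp add: ts(2) d_def)
      then show ?thesis using tr[of g "s *\<^sub>R b"] by simp
    qed (simp add: k_def)
    have "(\<integral>x. \<psi> x * (f (x + h *\<^sub>R b) - f x) \<partial>lborel) = (\<integral>x. \<psi> x * f (x + h *\<^sub>R b) \<partial>lborel) - (\<integral>x. \<psi> x * f x \<partial>lborel)"
      unfolding right_diff_distrib
      by (intro Bochner_Integration.integral_diff bi[OF _ _ B(1)]) (simp_all add: lborel_translate(2) f)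
    also have "\<dots> = (\<integral>x. \<psi> (x - h *\<^sub>R b) * f x \<partial>lborel) - (\<integral>x. \<psi> x * f x \<partial>lborel)"
      using tr[of f "h *\<^sub>R b"] by simp
    also have "\<dots> = (\<integral>x. (\<psi> (x - h *\<^sub>R b) - \<psi> x) * f x \<partial>lborel)"
      unfolding left_diff_distrib
      by (intro Bochner_Integration.integral_diff[symmetric] bi[OF _ _ B(1)]) (simp_all add: f)
    also have "\<dots> = - (\<integral>x. (\<integral>s. k s * (d (x - s *\<^sub>R b) * f x) \<partial>lborel) \<partial>lborel)"
    proof -
      have "(\<psi> (x - h *\<^sub>R b) - \<psi> x) * f x = - (\<integral>s. k s * (d (x - s *\<^sub>R b) * f x) \<partial>lborel)" for x
      proof -
        have "(\<integral>s. k s * (d (x - s *\<^sub>R b) * f x) \<partial>lborel) = (\<integral>s. k s * d (x - s *\<^sub>R b) \<partial>lborel) * f x"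
          unfolding mult.assoc[symmetric] by simp
        then show ?thesis unfolding sub[of x, symmetric] by (simp add: algebra_simps)
      qed
      then show ?thesis by simp
    qed
    also have "\<dots> = - (\<integral>s. (\<integral>x. k s * (d (x - s *\<^sub>R b) * f x) \<partial>lborel) \<partial>lborel)"
      using lborel_pair.Fubini_integral[OF sh2] by simp
    also have "\<dots> = (\<integral>s. (\<integral>x. k s * (\<psi> x * g (x + s *\<^sub>R b)) \<partial>lborel) \<partial>lborel)"
      by (simp add: inner)
    also have "\<dots> = (\<integral>x. (\<integral>s. k s * (\<psi> x * g (x + s *\<^sub>R b)) \<partial>lborel) \<partial>lborel)"
      using lborel_pair.Fubini_integral[OF sh3] by simp
    also have "\<dots> = (\<integral>x. \<psi> x * G x \<partial>lborel)"
      by (simp add: G_def mult.left_commute[of "k _"])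
    finally have "(\<integral>x. \<psi> x * (f (x + h *\<^sub>R b) - f x) \<partial>lborel) = (\<integral>x. \<psi> x * G x \<partial>lborel)" .
    moreover have "(\<integral>x. \<psi> x * F x \<partial>lborel) =
        (\<integral>x. \<psi> x * (f (x + h *\<^sub>R b) - f x) \<partial>lborel) - (\<integral>x. \<psi> x * G x \<partial>lborel)"
      unfolding F_def right_diff_distrib[of _ _ "G _"]
      by (intro Bochner_Integration.integral_diff bi[OF _ _ B(1)]) (simp_all add: lborel_translate(2) f G)
    ultimately show ?thesis by simp
  qed
  have "AE x in lebesgue. x \<in> \<Omega>' \<longrightarrow> F x = 0"
  proof (rule fundamental_lemma_real[OF o'])
    have Fl: "integrable lebesgue F" using F by (simp add: integrable_completion)
    show "locally_integrable \<Omega>' F"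
      unfolding locally_integrable_def set_integrable_def
      using integrable_mult_indicator[OF _ Fl] by (auto simp: compact_imp_closed borel_closed)
    fix \<psi> assume t: "\<psi> \<in> test_functions \<Omega>'"
    note [measurable] = test_functionsD(3)[OF t]
    obtain K where K: "K \<subseteq> \<Omega>'" "\<And>x. x \<notin> K \<Longrightarrow> \<psi> x = 0" using test_function_support[OF t] by metis
    have "integral\<^sup>L (lebesgue_on \<Omega>') (\<lambda>x. \<psi> x * F x) = integral\<^sup>L lborel (\<lambda>x. \<psi> x * F x)"
      by (rule integral_lebesgue_on_borel[OF o']) (use K in auto)
    then show "(LINT x:\<Omega>'|lebesgue. \<psi> x * F x) = 0"
      using zero[OF t] by (simp add: set_integral_lebesgue_on[OF o'])
  qed
  then have "AE x in lborel. x \<in> \<Omega>' \<longrightarrow> F x = 0" by (simp add: AE_completion_iff)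
  then show ?thesis by eventually_elim (auto simp: \<Omega>'_def F_def G_def k_def)
qed


section \<open>Cauchy-Schwarz and the fundamental theorem along almost every segment\<close>

lemma Cauchy_Schwarz_integral:
  fixes f g :: "'a \<Rightarrow> real"
  assumes [measurable]: "f \<in> borel_measurable M" "g \<in> borel_measurable M"
    and f: "integrable M (\<lambda>x. (f x)\<^sup>2)" and g: "integrable M (\<lambda>x. (g x)\<^sup>2)"
  shows "integrable M (\<lambda>x. f x * g x)"
    "(integral\<^sup>L M (\<lambda>x. f x * g x))\<^sup>2 \<le> integral\<^sup>L M (\<lambda>x. (f x)\<^sup>2) * integral\<^sup>L M (\<lambda>x. (g x)\<^sup>2)"
    "\<bar>integral\<^sup>L M (\<lambda>x. f x * g x)\<bar> \<le> sqrt (integral\<^sup>L M (\<lambda>x. (f x)\<^sup>2)) * sqrt (integral\<^sup>L M (\<lambda>x. (g x)\<^sup>2))"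
proof -
  show fg: "integrable M (\<lambda>x. f x * g x)"
  proof (rule Bochner_Integration.integrable_bound)
    show "integrable M (\<lambda>x. (f x)\<^sup>2 + (g x)\<^sup>2)" using f g by simp
    have "\<bar>a * b\<bar> \<le> a\<^sup>2 + b\<^sup>2" for a b :: real
    proof -
      have "2 * (\<bar>a\<bar> * \<bar>b\<bar>) \<le> a\<^sup>2 + b\<^sup>2" using sum_squares_bound[of "\<bar>a\<bar>" "\<bar>b\<bar>"] by (simp add: mult.assoc)
      moreover have "0 \<le> \<bar>a\<bar> * \<bar>b\<bar>" by simp
      ultimately show ?thesis unfolding abs_mult by linarith
    qed
    then show "AE x in M. norm (f x * g x) \<le> norm ((f x)\<^sup>2 + (g x)\<^sup>2)" by simp
  qed simp
  define A B C where "A = integral\<^sup>L M (\<lambda>x. (f x)\<^sup>2)" "B = integral\<^sup>L M (\<lambda>x. f x * g x)" "C = integral\<^sup>L M (\<lambda>x. (g x)\<^sup>2)"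
  have A: "0 \<le> A" "0 \<le> C" by (simp_all add: A_B_C_def)
  \<comment> \<open>The integral of \<open>(t f + g)^2\<close> is a nonnegative quadratic polynomial
    in \<open>t\<close>; the inequality is its discriminant condition.\<close>
  have q: "0 \<le> A * t\<^sup>2 + 2 * t * B + C" for t
  proof -
    have "0 \<le> integral\<^sup>L M (\<lambda>x. (t * f x + g x)\<^sup>2)" by simp
    also have "(\<lambda>x. (t * f x + g x)\<^sup>2) = (\<lambda>x. t\<^sup>2 * (f x)\<^sup>2 + 2 * t * (f x * g x) + (g x)\<^sup>2)"
      by (simp add: power2_eq_square algebra_simps)
    finally show ?thesis using f g fg by (simp add: A_B_C_def mult.commute)
  qed
  show "(integral\<^sup>L M (\<lambda>x. f x * g x))\<^sup>2 \<le> integral\<^sup>L M (\<lambda>x. (f x)\<^sup>2) * integral\<^sup>L M (\<lambda>x. (g x)\<^sup>2)"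
  proof (cases "A = 0")
    case True
    have "B = 0"
    proof (rule ccontr)
      assume "B \<noteq> 0"
      \<comment> \<open>If the leading coefficient is zero, a nonzero linear coefficient is
        impossible: at this \<open>t\<close> the remaining affine function takes the value
        -1.\<close>
      then show False using q[of "- (C + 1) / (2 * B)"] True by (simp add: field_simps)
    qed
    then show ?thesis using A by (simp add: A_B_C_def)
  next
    case False
    then have "A > 0" using A by simp
    have "0 \<le> A * (A * (- B / A)\<^sup>2 + 2 * (- B / A) * B + C)" using q[of "- B / A"] A by (intro mult_nonneg_nonneg)
    also have "\<dots> = A * C - B\<^sup>2" using \<open>A > 0\<close> by (simp add: power2_eq_square field_simps)
    finally show ?thesis by (simp add: A_B_C_def)
  qed
  then have "sqrt ((integral\<^sup>L M (\<lambda>x. f x * g x))\<^sup>2) \<le> sqrt (integral\<^sup>L M (\<lambda>x. (f x)\<^sup>2) * integral\<^sup>L M (\<lambda>x. (g x)\<^sup>2))"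
    by (rule real_sqrt_le_mono)
  then show "\<bar>integral\<^sup>L M (\<lambda>x. f x * g x)\<bar> \<le> sqrt (integral\<^sup>L M (\<lambda>x. (f x)\<^sup>2)) * sqrt (integral\<^sup>L M (\<lambda>x. (g x)\<^sup>2))"
    by (simp add: real_sqrt_mult)
qed

text \<open>In \<open>weak_deriv_translate\<close> the exceptional null set of points depends on
  \<open>h\<close>. Fubini exchanges the quantifiers, so that for almost every starting point the
  formula holds for almost every length. Conditionals replace indicators so that measurability in
  both variables is found automatically.\<close>

lemma weak_deriv_segment:
  fixes f g :: "'a::euclidean_space \<Rightarrow> real"
  assumes "open \<Omega>" "convex \<Omega>" "b \<in> Basis"
    and [measurable]: "f \<in> borel_measurable borel" "g \<in> borel_measurable borel"
    and "integrable lborel f" "integrable lborel g"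
    and "\<And>x. x \<notin> \<Omega> \<Longrightarrow> f x = 0" "\<And>x. x \<notin> \<Omega> \<Longrightarrow> g x = 0"
    and "has_weak_deriv \<Omega> b f g"
  shows "AE x in lborel. AE h in lborel. 0 \<le> h \<and> x \<in> \<Omega> \<and> x + h *\<^sub>R b \<in> \<Omega> \<longrightarrow>
    f (x + h *\<^sub>R b) - f x = (\<integral>s. (if 0 \<le> s \<and> s \<le> h then g (x + s *\<^sub>R b) else 0) \<partial>lborel)"
proof -
  have [measurable]: "\<Omega> \<in> sets borel" using assms(1) by simp
  have ind: "(if 0 \<le> s \<and> s \<le> h then y else 0) = indicator {0..h} s * y" for s h y :: real
    by (auto simp: indicator_def)
  have "AE h in lborel. AE x in lborel. 0 \<le> h \<and> x \<in> \<Omega> \<and> x + h *\<^sub>R b \<in> \<Omega> \<longrightarrow>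
    f (x + h *\<^sub>R b) - f x = (\<integral>s. (if 0 \<le> s \<and> s \<le> h then g (x + s *\<^sub>R b) else 0) \<partial>lborel)"
  proof (rule AE_I2)
    fix h :: real
    show "AE x in lborel. 0 \<le> h \<and> x \<in> \<Omega> \<and> x + h *\<^sub>R b \<in> \<Omega> \<longrightarrow>
      f (x + h *\<^sub>R b) - f x = (\<integral>s. (if 0 \<le> s \<and> s \<le> h then g (x + s *\<^sub>R b) else 0) \<partial>lborel)"
    proof (cases "0 \<le> h")
      case True
      have "AE x in lborel. x \<in> \<Omega> \<and> x + h *\<^sub>R b \<in> \<Omega> \<longrightarrow>
          f (x + h *\<^sub>R b) - f x = (\<integral>s. indicator {0..h} s * g (x + s *\<^sub>R b) \<partial>lborel)"
        by (rule weak_deriv_translate; fact)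
      then show ?thesis unfolding ind by eventually_elim simp
    qed simp
  qed
  then show ?thesis
    by (subst lborel_pair.AE_commute) measurable
qed

text \<open>The signed indicator of the oriented segment from \<open>s\<close> to \<open>r\<close>, so that \<open>u r - u s\<close> is the integral of
  \<open>kern s r x * u' x\<close>.\<close>

definition kern :: "real \<Rightarrow> real \<Rightarrow> real \<Rightarrow> real" where
  "kern s r x = (if s \<le> x \<and> x \<le> r then 1 else 0) - (if r \<le> x \<and> x \<le> s then 1 else 0)"

lemma kern_measurable [measurable]:
  "(\<lambda>x. kern s r x) \<in> borel_measurable borel"
  "(\<lambda>(r, x). kern s r x) \<in> borel_measurable (borel \<Otimes>\<^sub>M borel)"
  unfolding kern_def by measurable

lemma kern_bound: "\<bar>kern s r x\<bar> \<le> 1"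
  by (auto simp: kern_def)

text \<open>The translate formula covers pairs with \<open>s\<close> at most \<open>r\<close>.
  Exchanging the two almost everywhere quantifiers gives the pairs in the other order, and the sign
  built into \<open>kern\<close> merges both cases.\<close>

lemma segment_symmetric:
  fixes u g :: "real \<Rightarrow> real"
  assumes [measurable]: "u \<in> borel_measurable borel" "g \<in> borel_measurable borel" "J \<in> sets borel"
    and seg: "AE s in lborel. AE h in lborel. 0 \<le> h \<and> s \<in> J \<and> s + h \<in> J \<longrightarrow>
      u (s + h) - u s = (\<integral>x. (if 0 \<le> x \<and> x \<le> h then g (s + x) else 0) \<partial>lborel)"
  shows "AE s in lborel. AE r in lborel. s \<in> J \<and> r \<in> J \<longrightarrow> u r - u s = (\<integral>x. kern s r x * g x \<partial>lborel)"
proof -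
  define R where "R s r \<longleftrightarrow> (s \<le> r \<and> s \<in> J \<and> r \<in> J \<longrightarrow>
      u r - u s = (\<integral>x. (if s \<le> x \<and> x \<le> r then g x else 0) \<partial>lborel))" for s r
  have [measurable]: "Measurable.pred (lborel \<Otimes>\<^sub>M lborel) (\<lambda>p. R (fst p) (snd p))"
    unfolding R_def by measurable
  have 1: "AE s in lborel. AE r in lborel. R s r"
    using seg
  proof eventually_elim
    case (elim s)
    have "AE r in lborel. 0 \<le> r + - s \<and> s \<in> J \<and> s + (r + - s) \<in> J \<longrightarrow>
      u (s + (r + - s)) - u s = (\<integral>x. (if 0 \<le> x \<and> x \<le> r + - s then g (s + x) else 0) \<partial>lborel)"
      by (rule AE_lborel_translate[OF elim]) measurable
    then show ?case
    proof eventually_elim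
      case (elim r)
      have "(\<integral>x. (if 0 \<le> x \<and> x \<le> r + - s then g (s + x) else 0) \<partial>lborel) =
          (\<integral>x. (if 0 \<le> x + - s \<and> x + - s \<le> r + - s then g (s + (x + - s)) else 0) \<partial>lborel)"
        using lborel_translate(1)[of "\<lambda>x. (if 0 \<le> x \<and> x \<le> r + - s then g (s + x) else 0)" "- s"] by simp
      also have "(\<lambda>x. if 0 \<le> x + - s \<and> x + - s \<le> r + - s then g (s + (x + - s)) else 0) =
          (\<lambda>x. if s \<le> x \<and> x \<le> r then g x else 0)"
        by (auto simp: fun_eq_iff)
      finally show ?case using elim by (simp add: R_def)
    qed
  qed
  then have 2: "AE r in lborel. AE s in lborel. R s r"
    by (subst (asm) lborel_pair.AE_commute) measurable
  show ?thesis using 1 2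
  proof eventually_elim
    case (elim s)
    show ?case using elim(1) elim(2)
    proof eventually_elim
      case (elim r)
      show ?case
      proof
        assume J: "s \<in> J \<and> r \<in> J"
        show "u r - u s = (\<integral>x. kern s r x * g x \<partial>lborel)"
        proof (cases s r rule: linorder_cases)
          case less
          then have "(\<lambda>x. kern s r x * g x) = (\<lambda>x. if s \<le> x \<and> x \<le> r then g x else 0)"
            by (auto simp: kern_def)
          then show ?thesis using elim(1) J less by (simp add: R_def)
        next
          case greater
          then have "(\<lambda>x. kern s r x * g x) = (\<lambda>x. - (if r \<le> x \<and> x \<le> s then g x else 0))"
            by (auto simp: kern_def)
          then show ?thesis using elim(2) J greater by (simp add: R_def)
        qed (simp add: kern_def)
      qed
    qed
  qed
qed

text \<open>Integrating \<open>u r = u s + ...\<close> over \<open>r\<close> in the interval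
  compares a value of \<open>u\<close> with its mean. The identity serves pointwise limits, the
  estimates are a Poincare inequality in the supremum norm.\<close>

lemma mean_deviation:
  fixes u g :: "real \<Rightarrow> real"
  assumes [measurable]: "u \<in> borel_measurable borel" "g \<in> borel_measurable borel"
    and u: "integrable lborel u" and g: "integrable lborel g" and ab: "a < b" and J: "J = {a<..<b}"
    and out: "\<And>x. x \<notin> J \<Longrightarrow> u x = 0"
    and s: "s \<in> J" "AE r in lborel. s \<in> J \<and> r \<in> J \<longrightarrow> u r - u s = (\<integral>x. kern s r x * g x \<partial>lborel)"
  shows "(b - a) * u s - integral\<^sup>L lborel u = - (\<integral>r. indicator J r * (\<integral>x. kern s r x * g x \<partial>lborel) \<partial>lborel)"
    "\<bar>(b - a) * u s - integral\<^sup>L lborel u\<bar> \<le> (b - a) * integral\<^sup>L lborel (\<lambda>x. \<bar>g x\<bar>)"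
    "\<bar>\<integral>x. kern s r x * g x \<partial>lborel\<bar> \<le> integral\<^sup>L lborel (\<lambda>x. \<bar>g x\<bar>)"
proof -
  have Jm: "emeasure lborel J = ennreal (b - a)" "J \<in> sets borel" using ab by (auto simp: J)
  then have iJ: "integrable lborel (indicator J :: real \<Rightarrow> real)" "integral\<^sup>L lborel (indicator J :: real \<Rightarrow> real) = b - a"
    using ab by (auto simp: integrable_indicator_iff measure_def)
  have bd: "\<bar>\<integral>x. kern s r x * g x \<partial>lborel\<bar> \<le> integral\<^sup>L lborel (\<lambda>x. \<bar>g x\<bar>)" for r
  proof -
    have "\<bar>\<integral>x. kern s r x * g x \<partial>lborel\<bar> \<le> (\<integral>x. \<bar>kern s r x * g x\<bar> \<partial>lborel)"
      by (rule integral_abs_bound)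
    also have "\<dots> \<le> integral\<^sup>L lborel (\<lambda>x. \<bar>g x\<bar>)"
      by (rule Bochner_Integration.integral_mono')
         (use g kern_bound in \<open>auto simp: abs_mult intro!: mult_left_le_one_le\<close>)
    finally show ?thesis .
  qed
  show "\<bar>\<integral>x. kern s r x * g x \<partial>lborel\<bar> \<le> integral\<^sup>L lborel (\<lambda>x. \<bar>g x\<bar>)" by (rule bd)
  have "integral\<^sup>L lborel u = (\<integral>r. indicator J r * u s + indicator J r * (\<integral>x. kern s r x * g x \<partial>lborel) \<partial>lborel)"
  proof (rule integral_cong_AE)
    show "AE r in lborel. u r = indicator J r * u s + indicator J r * (\<integral>x. kern s r x * g x \<partial>lborel)"
      using s(2) by eventually_elim (use out s(1) in \<open>auto simp: indicator_def\<close>)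
  qed (use Jm in measurable)
  also have "\<dots> = (\<integral>r. indicator J r * u s \<partial>lborel) + (\<integral>r. indicator J r * (\<integral>x. kern s r x * g x \<partial>lborel) \<partial>lborel)"
  proof (rule Bochner_Integration.integral_add)
    show "integrable lborel (\<lambda>r. indicator J r * u s)" using iJ by simp
    show "integrable lborel (\<lambda>r. indicator J r * (\<integral>x. kern s r x * g x \<partial>lborel))"
    proof (rule Bochner_Integration.integrable_bound[OF integrable_mult_left[OF iJ(1), of "integral\<^sup>L lborel (\<lambda>x. \<bar>g x\<bar>)"]])
      show "AE r in lborel. norm (indicator J r * (\<integral>x. kern s r x * g x \<partial>lborel)) \<le> norm (indicator J r * integral\<^sup>L lborel (\<lambda>x. \<bar>g x\<bar>))"
        using bd by (auto simp: indicator_def)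
    qed (use Jm in measurable)
  qed
  also have "(\<integral>r. indicator J r * u s \<partial>lborel) = (b - a) * u s" using iJ by simp
  finally show eq: "(b - a) * u s - integral\<^sup>L lborel u = - (\<integral>r. indicator J r * (\<integral>x. kern s r x * g x \<partial>lborel) \<partial>lborel)"
    by simp
  have "\<bar>\<integral>r. indicator J r * (\<integral>x. kern s r x * g x \<partial>lborel) \<partial>lborel\<bar> \<le>
     (\<integral>r. \<bar>indicator J r * (\<integral>x. kern s r x * g x \<partial>lborel)\<bar> \<partial>lborel)"
    by (rule integral_abs_bound)
  also have "\<dots> \<le> (\<integral>r. indicator J r * integral\<^sup>L lborel (\<lambda>x. \<bar>g x\<bar>) \<partial>lborel)"
    by (rule Bochner_Integration.integral_mono') (use iJ bd in \<open>auto split: split_indicator\<close>)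
  also have "\<dots> = (b - a) * integral\<^sup>L lborel (\<lambda>x. \<bar>g x\<bar>)" using iJ by simp
  finally show "\<bar>(b - a) * u s - integral\<^sup>L lborel u\<bar> \<le> (b - a) * integral\<^sup>L lborel (\<lambda>x. \<bar>g x\<bar>)"
    by (simp add: eq)
qed


subsection \<open>Compactness on the strip\<close>

text \<open>The cross section has length one, so integrals over it are averages and functions of the
  first variable have the same integral over the strip as over the interval.\<close>

definition J_dom :: "real set" where "J_dom = {-1/2<..<1/2}"

lemma S_dom_eq: "S_dom l = I_dom l \<times> J_dom"
  by (simp add: S_dom_def J_dom_def)

lemma domains [simp]:
  "open (I_dom l)" "bounded (I_dom l)" "convex (I_dom l)" "I_dom l \<in> sets borel"
  "open J_dom" "bounded J_dom" "convex J_dom" "J_dom \<in> sets borel"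
  "open (S_dom l)" "bounded (S_dom l)" "convex (S_dom l)" "S_dom l \<in> sets borel"
proof -
  show 1: "open (I_dom l)" "bounded (I_dom l)" "convex (I_dom l)" "open J_dom" "bounded J_dom" "convex J_dom"
    by (auto simp: I_dom_def J_dom_def)
  then show 2: "open (S_dom l)" "bounded (S_dom l)" "convex (S_dom l)"
    unfolding S_dom_eq by (auto intro: open_Times bounded_Times convex_Times)
  show "I_dom l \<in> sets borel" "J_dom \<in> sets borel" "S_dom l \<in> sets borel"
    using 1 2 by (auto intro: borel_open)
qed

lemma Basis_S [simp]: "(1, 0) \<in> (Basis :: (real \<times> real) set)" "(0, 1) \<in> (Basis :: (real \<times> real) set)"
  by (auto simp: Basis_prod_def)

lemma fst_snd_borel [measurable]:
  "fst \<in> borel_measurable (borel :: (real \<times> real) measure)"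
  "snd \<in> borel_measurable (borel :: (real \<times> real) measure)"
  by (auto intro!: borel_measurable_continuous_onI continuous_intros)

lemma integrable_bounded_mult:
  fixes q u :: "'a \<Rightarrow> real"
  assumes "integrable M u" "q \<in> borel_measurable M" "\<And>x. \<bar>q x\<bar> \<le> C"
  shows "integrable M (\<lambda>x. q x * u x)"
proof (rule Bochner_Integration.integrable_bound)
  show "integrable M (\<lambda>x. C * u x)" using assms by simp
  show "(\<lambda>x. q x * u x) \<in> borel_measurable M"
    using assms(2) borel_measurable_integrable[OF assms(1)] by simp
  have "0 \<le> C" using assms(3)[of undefined] by linarith
  then show "AE x in M. norm (q x * u x) \<le> norm (C * u x)"
    using assms(3) by (auto simp: abs_mult intro!: mult_right_mono)
qed

lemma weak_deriv_interval:
  fixes u g :: "real \<Rightarrow> real"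
  assumes "a < b" and J: "J = {a<..<b}"
    and [measurable]: "u \<in> borel_measurable borel" "g \<in> borel_measurable borel"
    and "integrable lborel u" "integrable lborel g"
    and "\<And>x. x \<notin> J \<Longrightarrow> u x = 0" "\<And>x. x \<notin> J \<Longrightarrow> g x = 0"
    and "has_weak_deriv J 1 u g"
  shows "AE s in lborel. AE r in lborel. s \<in> J \<and> r \<in> J \<longrightarrow> u r - u s = (\<integral>x. kern s r x * g x \<partial>lborel)"
proof (rule segment_symmetric)
  have "AE x in lborel. AE h in lborel. 0 \<le> h \<and> x \<in> J \<and> x + h *\<^sub>R 1 \<in> J \<longrightarrow>
    u (x + h *\<^sub>R 1) - u x = (\<integral>s. (if 0 \<le> s \<and> s \<le> h then g (x + s *\<^sub>R 1) else 0) \<partial>lborel)"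
    by (rule weak_deriv_segment; (fact | simp add: J))
  then show "AE s in lborel. AE h in lborel. 0 \<le> h \<and> s \<in> J \<and> s + h \<in> J \<longrightarrow>
      u (s + h) - u s = (\<integral>x. (if 0 \<le> x \<and> x \<le> h then g (s + x) else 0) \<partial>lborel)"
    by (simp cong: if_cong)
qed (simp_all add: J)

text \<open>For mean zero, \<open>mean_deviation\<close> bounds \<open>v\<close> by the
  \<open>L1\<close> norm of its derivative, and Cauchy-Schwarz against the constant 1 on an interval
  of length \<open>l\<close> gives the factor \<open>sqrt l\<close>. It supplies both the
  boundedness of the limit fields and uniform convergence of their approximations.\<close>

lemma sup_bound:
  fixes v g :: "real \<Rightarrow> real"
  assumes l: "0 < l" and v: "v \<in> L2 (I_dom l)" and g: "g \<in> L2 (I_dom l)"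
    and wd: "has_weak_deriv (I_dom l) 1 v g" and mean: "integral\<^sup>L (lebesgue_on (I_dom l)) v = 0"
  shows "AE x in lebesgue_on (I_dom l). \<bar>v x\<bar> \<le> sqrt l * sqrt (integral\<^sup>L (lebesgue_on (I_dom l)) (\<lambda>x. (g x)\<^sup>2))"
proof -
  let ?I = "I_dom l" and ?M = "lebesgue_on (I_dom l)"
  have meas: "v \<in> borel_measurable ?M" "g \<in> borel_measurable ?M" using v g by (auto simp: L2_iff)
  obtain u where u [measurable]: "u \<in> borel_measurable borel" and u0: "\<And>x. x \<notin> ?I \<Longrightarrow> u x = 0"
    and uv: "AE x in ?M. v x = u x" using lebesgue_on_borel_representative[OF domains(1) meas(1)] by metis
  obtain k where k [measurable]: "k \<in> borel_measurable borel" and k0: "\<And>x. x \<notin> ?I \<Longrightarrow> k x = 0"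
    and kg: "AE x in ?M. g x = k x" using lebesgue_on_borel_representative[OF domains(1) meas(2)] by metis
  have uL: "u \<in> L2 ?I" "k \<in> L2 ?I" using L2_AE[OF domains(1) v uv] L2_AE[OF domains(1) g kg] by auto
  have int: "integrable lborel u" "integrable lborel k"
    using L2_integrable(1)[OF domains(1,2) uL(1)] L2_integrable(1)[OF domains(1,2) uL(2)]
      integral_lebesgue_on_borel(2)[OF domains(1) u u0] integral_lebesgue_on_borel(2)[OF domains(1) k k0] by auto
  have wd': "has_weak_deriv ?I 1 u k" by (rule has_weak_deriv_AE[OF domains(1) wd uv kg])
  have int0: "integral\<^sup>L lborel u = 0"
  proof -
    have "integral\<^sup>L ?M u = integral\<^sup>L ?M v"
      using uv uL v by (intro integral_cong_AE) (auto simp: L2_iff)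
    then show ?thesis using mean integral_lebesgue_on_borel(1)[OF domains(1) u u0] by simp
  qed
  have k2: "integrable ?M (\<lambda>x. (k x)\<^sup>2)" using uL by (simp add: L2_iff)
  interpret finite_measure ?M by (rule finite_measure_lebesgue_on) auto
  have "measure ?M (space ?M) = l"
    using l by (simp add: measure_restrict_space I_dom_def)
  then have c1: "integrable ?M (\<lambda>x. 1\<^sup>2 :: real)" "integral\<^sup>L ?M (\<lambda>x. 1\<^sup>2 :: real) = l"
    by simp_all
  have km: "k \<in> borel_measurable ?M" using uL by (simp add: L2_iff)
  have "integral\<^sup>L lborel (\<lambda>x. \<bar>k x\<bar>) = integral\<^sup>L ?M (\<lambda>x. 1 * \<bar>k x\<bar>)"
    using integral_lebesgue_on_borel(1)[of ?I "\<lambda>x. \<bar>k x\<bar>"] k0 by simp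
  also have "\<dots> \<le> sqrt (integral\<^sup>L ?M (\<lambda>x. 1\<^sup>2)) * sqrt (integral\<^sup>L ?M (\<lambda>x. \<bar>k x\<bar>\<^sup>2))"
    using Cauchy_Schwarz_integral(3)[of "\<lambda>x. 1" ?M "\<lambda>x. \<bar>k x\<bar>"] c1 k2 km by simp
  also have "integral\<^sup>L ?M (\<lambda>x. \<bar>k x\<bar>\<^sup>2) = integral\<^sup>L ?M (\<lambda>x. (g x)\<^sup>2)"
    using kg meas km by (intro integral_cong_AE) auto
  finally have A: "integral\<^sup>L lborel (\<lambda>x. \<bar>k x\<bar>) \<le> sqrt l * sqrt (integral\<^sup>L ?M (\<lambda>x. (g x)\<^sup>2))"
    using c1 by simp
  have Ieq: "?I = {-l/2<..<l/2}" "-l/2 < l/2" using l by (auto simp: I_dom_def)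
  have "AE s in lborel. AE r in lborel. s \<in> ?I \<and> r \<in> ?I \<longrightarrow> u r - u s = (\<integral>x. kern s r x * k x \<partial>lborel)"
    by (rule weak_deriv_interval[OF Ieq(2,1) u k int u0 k0 wd'])
  then have "AE s in lborel. s \<in> ?I \<longrightarrow> \<bar>u s\<bar> \<le> sqrt l * sqrt (integral\<^sup>L ?M (\<lambda>x. (g x)\<^sup>2))"
  proof eventually_elim
    case (elim s)
    show ?case
    proof
      assume s: "s \<in> ?I"
      have "\<bar>(l/2 - -l/2) * u s - integral\<^sup>L lborel u\<bar> \<le> (l/2 - -l/2) * integral\<^sup>L lborel (\<lambda>x. \<bar>k x\<bar>)"
        by (rule mean_deviation(2)[OF u k int Ieq(2,1) u0 s elim])
      then have "l * \<bar>u s\<bar> \<le> l * integral\<^sup>L lborel (\<lambda>x. \<bar>k x\<bar>)" using int0 l by (simp add: abs_mult)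
      then have "\<bar>u s\<bar> \<le> integral\<^sup>L lborel (\<lambda>x. \<bar>k x\<bar>)" using l by simp
      then show "\<bar>u s\<bar> \<le> sqrt l * sqrt (integral\<^sup>L ?M (\<lambda>x. (g x)\<^sup>2))" using A by linarith
    qed
  qed
  from AE_lebesgue_on_lborel[OF domains(1) this] uv show ?thesis by eventually_elim simp
qed

text \<open>By \<open>mean_deviation\<close>, the value of \<open>u n\<close> at almost every point
  is its mean minus an average of pairings of the derivative with \<open>kern\<close>. Hence weak
  convergence tested on these step functions alone gives pointwise convergence, and the
  \<open>L1\<close> bound on the derivatives supplies the domination.\<close>

lemma interval_strong_convergence:
  fixes u g :: "nat \<Rightarrow> real \<Rightarrow> real"
  assumes "a < b" and J: "J = {a<..<b}"
    and u [measurable]: "\<And>n. u n \<in> borel_measurable borel" and g [measurable]: "\<And>n. g n \<in> borel_measurable borel"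
    and iu: "\<And>n. integrable lborel (u n)" and ig: "\<And>n. integrable lborel (g n)"
    and u0: "\<And>n x. x \<notin> J \<Longrightarrow> u n x = 0" and g0: "\<And>n x. x \<notin> J \<Longrightarrow> g n x = 0"
    and wd: "\<And>n. has_weak_deriv J 1 (u n) (g n)"
    and C: "\<And>n. integral\<^sup>L lborel (\<lambda>x. \<bar>g n x\<bar>) \<le> C"
    and weak: "\<And>s r. (\<lambda>n. \<integral>x. kern s r x * g n x \<partial>lborel) \<longlonglongrightarrow> 0"
    and mean: "(\<lambda>n. integral\<^sup>L lborel (u n)) \<longlonglongrightarrow> 0"
  shows "(\<lambda>n. integral\<^sup>L lborel (\<lambda>x. (u n x)\<^sup>2)) \<longlonglongrightarrow> 0" "integrable lborel (\<lambda>x. (u n x)\<^sup>2)"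
proof -
  have Jm: "emeasure lborel J = ennreal (b - a)" "J \<in> sets borel" using \<open>a < b\<close> by (auto simp: J)
  then have iJ: "integrable lborel (indicator J :: real \<Rightarrow> real)" by (simp add: integrable_indicator_iff)
  have "C \<ge> 0" using C[of 0] by (smt (verit) integral_nonneg_AE AE_I2 abs_ge_zero)
  obtain K where K: "\<And>n. \<bar>integral\<^sup>L lborel (u n)\<bar> \<le> K"
    using convergent_imp_Bseq[OF convergentI[OF mean]] by (auto simp: Bseq_def)
  \<comment> \<open>Countably many indices share one null set; this is one reason to work with
    sequences.\<close>
  have "AE s in lborel. \<forall>n. AE r in lborel. s \<in> J \<and> r \<in> J \<longrightarrow> u n r - u n s = (\<integral>x. kern s r x * g n x \<partial>lborel)"
    unfolding AE_all_countable using weak_deriv_interval[OF \<open>a < b\<close> J u g iu ig u0 g0 wd] by blast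
  then have *: "AE s in lborel. (\<forall>n. \<bar>u n s\<bar> \<le> indicator J s * (C + K / (b - a))) \<and> (\<lambda>n. u n s) \<longlonglongrightarrow> 0"
  proof eventually_elim
    case (elim s)
    show ?case
    proof (cases "s \<in> J")
      case True
      note md = mean_deviation[OF u g iu ig \<open>a < b\<close> J u0 True elim[rule_format]]
      have bound: "\<bar>u n s\<bar> \<le> C + K / (b - a)" for n
      proof -
        have "\<bar>(b - a) * u n s\<bar> \<le> (b - a) * C + K"
          using md(2)[of n] K[of n] mult_left_mono[OF C[of n], of "b - a"] \<open>a < b\<close> by linarith
        then show ?thesis using \<open>a < b\<close> by (simp add: abs_mult field_simps)
      qed
      \<comment> \<open>The inner pairings vanish for each \<open>r\<close> and are bounded by
        \<open>C\<close>, so their average over \<open>r\<close> vanishes as well.\<close>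
      have "(\<lambda>n. \<integral>r. indicator J r * (\<integral>x. kern s r x * g n x \<partial>lborel) \<partial>lborel) \<longlonglongrightarrow> (\<integral>r. 0 \<partial>(lborel :: real measure))"
      proof (rule integral_dominated_convergence[where w = "\<lambda>r. indicator J r * C"])
        show "integrable lborel (\<lambda>r. indicator J r * C)" using iJ by simp
        show "AE r in lborel. (\<lambda>n. indicator J r * (\<integral>x. kern s r x * g n x \<partial>lborel)) \<longlonglongrightarrow> 0"
          by (intro AE_I2 tendsto_mult_right_zero weak)
        show "AE r in lborel. norm (indicator J r * (\<integral>x. kern s r x * g n x \<partial>lborel)) \<le> indicator J r * C" for n
          using order_trans[OF md(3) C] by (auto split: split_indicator)
      qed (use Jm in measurable)
      then have "(\<lambda>n. (integral\<^sup>L lborel (u n) - (\<integral>r. indicator J r * (\<integral>x. kern s r x * g n x \<partial>lborel) \<partial>lborel)) / (b - a)) \<longlonglongrightarrow> (0 - 0) / (b - a)"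
        using \<open>a < b\<close> by (intro tendsto_intros mean) auto
      moreover have "(integral\<^sup>L lborel (u n) - (\<integral>r. indicator J r * (\<integral>x. kern s r x * g n x \<partial>lborel) \<partial>lborel)) / (b - a) = u n s" for n
        using md(1)[of n] \<open>a < b\<close> by (simp add: field_simps)
      ultimately show ?thesis using True bound by simp
    qed (simp add: u0)
  qed
  define W where "W = (\<lambda>s. indicator J s * (C + K / (b - a))\<^sup>2)"
  have W: "integrable lborel W" using iJ by (simp add: W_def)
  have dom: "AE s in lborel. norm ((u n s)\<^sup>2) \<le> W s" for n
    using * 
  proof eventually_elim
    case (elim s)
    then have "\<bar>u n s\<bar>\<^sup>2 \<le> (indicator J s * (C + K / (b - a)))\<^sup>2" by (intro power_mono) auto
    then show ?case by (simp add: W_def power_mult_distrib split: split_indicator_asm)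
  qed
  have "(\<lambda>n. integral\<^sup>L lborel (\<lambda>x. (u n x)\<^sup>2)) \<longlonglongrightarrow> (\<integral>x. 0 \<partial>(lborel :: real measure))"
  proof (rule integral_dominated_convergence[OF _ _ W _ dom])
    show "AE x in lborel. (\<lambda>n. (u n x)\<^sup>2) \<longlonglongrightarrow> 0"
      using * by eventually_elim (auto intro!: tendsto_eq_intros)
  qed measurable
  then show "(\<lambda>n. integral\<^sup>L lborel (\<lambda>x. (u n x)\<^sup>2)) \<longlonglongrightarrow> 0" by simp
  show "integrable lborel (\<lambda>x. (u n x)\<^sup>2)"
    by (rule Bochner_Integration.integrable_bound[OF W]) (use dom[of n] in \<open>auto elim: eventually_mono\<close>)
qed

section \<open>Averages over the cross section\<close>

lemma test_functions_prod:
  fixes \<psi> \<eta> :: "real \<Rightarrow> real"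
  assumes "\<psi> \<in> test_functions A" "\<eta> \<in> test_functions B"
  shows "(\<lambda>x. \<psi> (fst x) * \<eta> (snd x)) \<in> test_functions (A \<times> B)"
    "frechet_derivative (\<lambda>x. \<psi> (fst x) * \<eta> (snd x)) (at x) (1, 0) = frechet_derivative \<psi> (at (fst x)) 1 * \<eta> (snd x)"
proof -
  obtain K where K: "compact K" "K \<subseteq> A" "\<And>x. x \<notin> K \<Longrightarrow> \<psi> x = 0" using test_function_support[OF assms(1)] by metis
  obtain K' where K': "compact K'" "K' \<subseteq> B" "\<And>x. x \<notin> K' \<Longrightarrow> \<eta> x = 0" using test_function_support[OF assms(2)] by metis
  have "C_k k (\<lambda>x::real \<times> real. \<psi> (fst x + 0))" "C_k k (\<lambda>x::real \<times> real. \<eta> (snd x + 0))" for k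
    by (rule C_k_affine[OF _ test_functionsD(1)[OF assms(1)]] C_k_affine[OF _ test_functionsD(1)[OF assms(2)]];
        rule bounded_linear_fst bounded_linear_snd)+
  from C_k_mult[OF this] have "C_k k (\<lambda>x::real \<times> real. \<psi> (fst x) * \<eta> (snd x))" for k
    by simp
  moreover have "\<psi> (fst x) * \<eta> (snd x) = 0" if "x \<notin> K \<times> K'" for x
    using that K(3)[of "fst x"] K'(3)[of "snd x"] by (auto simp: mem_Times_iff)
  then have "\<exists>K0. compact K0 \<and> K0 \<subseteq> A \<times> B \<and> (\<forall>x. x \<notin> K0 \<longrightarrow> \<psi> (fst x) * \<eta> (snd x) = 0)"
    using K(1,2) K'(1,2) by (intro exI[of _ "K \<times> K'"] conjI compact_Times Sigma_mono) auto
  ultimately show "(\<lambda>x. \<psi> (fst x) * \<eta> (snd x)) \<in> test_functions (A \<times> B)"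
    unfolding test_functions_def by (intro CollectI conjI allI)
  have "((\<lambda>x. \<psi> (fst x) * \<eta> (snd x)) has_derivative
     (\<lambda>h. \<psi> (fst x) * frechet_derivative \<eta> (at (snd x)) (snd h) + frechet_derivative \<psi> (at (fst x)) (fst h) * \<eta> (snd x))) (at x)"
    using has_derivative_mult[OF diff_chain_at[OF has_derivative_fst[OF has_derivative_ident] test_functionsD(4)[OF assms(1)]]
       diff_chain_at[OF has_derivative_snd[OF has_derivative_ident] test_functionsD(4)[OF assms(2)]]]
    by (simp add: o_def)
  from fun_cong[OF frechet_derivative_at[OF this], of "(1, 0)"]
  have "frechet_derivative (\<lambda>x. \<psi> (fst x) * \<eta> (snd x)) (at x) (1, 0) =
      \<psi> (fst x) * frechet_derivative \<eta> (at (snd x)) 0 + frechet_derivative \<psi> (at (fst x)) 1 * \<eta> (snd x)"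
    by simp
  moreover have "frechet_derivative \<eta> (at (snd x)) 0 = 0"
    using has_derivative_linear[OF test_functionsD(4)[OF assms(2)]] linear_0 by blast
  ultimately show "frechet_derivative (\<lambda>x. \<psi> (fst x) * \<eta> (snd x)) (at x) (1, 0) = frechet_derivative \<psi> (at (fst x)) 1 * \<eta> (snd x)"
    by simp
qed

lemma integral_lborel_pair:
  fixes f :: "real \<times> real \<Rightarrow> real"
  assumes "integrable lborel f"
  shows "integral\<^sup>L lborel f = (\<integral>t. (\<integral>s. f (t, s) \<partial>lborel) \<partial>lborel)"
    "integral\<^sup>L lborel f = (\<integral>s. (\<integral>t. f (t, s) \<partial>lborel) \<partial>lborel)"
    "integrable lborel (\<lambda>t. \<integral>s. f (t, s) \<partial>lborel)"
    "integrable lborel (\<lambda>s. \<integral>t. f (t, s) \<partial>lborel)"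
    "AE t in lborel. integrable lborel (\<lambda>s. f (t, s))"
    "AE s in lborel. integrable lborel (\<lambda>t. f (t, s))"
proof -
  have i: "integrable (lborel \<Otimes>\<^sub>M lborel) (case_prod (\<lambda>t s. f (t, s)))"
    using assms by (simp add: lborel_prod)
  show "integral\<^sup>L lborel f = (\<integral>t. (\<integral>s. f (t, s) \<partial>lborel) \<partial>lborel)"
    "integral\<^sup>L lborel f = (\<integral>s. (\<integral>t. f (t, s) \<partial>lborel) \<partial>lborel)"
    using lborel_pair.integral_fst[OF i] lborel_pair.integral_snd[OF i] by (simp_all add: lborel_prod)
  show "integrable lborel (\<lambda>t. \<integral>s. f (t, s) \<partial>lborel)"
    "integrable lborel (\<lambda>s. \<integral>t. f (t, s) \<partial>lborel)"
    "AE t in lborel. integrable lborel (\<lambda>s. f (t, s))"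
    "AE s in lborel. integrable lborel (\<lambda>t. f (t, s))"
    using lborel_pair.integrable_fst[OF i] lborel_pair.integrable_snd[OF i]
      lborel_pair.AE_integrable_fst[OF i] lborel_pair.AE_integrable_snd[OF i] by auto
qed

text \<open>A test function of the first variable alone is not compactly supported in the strip. It
  is multiplied by a second test function \<eta> of the vertical variable; arbitrariness of \<eta>
  shows that the weak formula holds on almost every horizontal line, and integrating over these
  lines gives the formula for the averages.\<close>

lemma average_weak_deriv:
  fixes d d1 :: "real \<times> real \<Rightarrow> real"
  assumes [measurable]: "d \<in> borel_measurable borel" "d1 \<in> borel_measurable borel"
    and d: "integrable lborel d" and d1: "integrable lborel d1"
    and out: "\<And>x. x \<notin> S_dom l \<Longrightarrow> d x = 0" "\<And>x. x \<notin> S_dom l \<Longrightarrow> d1 x = 0"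
    and wd: "has_weak_deriv (S_dom l) (1, 0) d d1"
  shows "has_weak_deriv (I_dom l) 1 (\<lambda>t. \<integral>s. d (t, s) \<partial>lborel) (\<lambda>t. \<integral>s. d1 (t, s) \<partial>lborel)"
proof -
  define v v1 where "v t = (\<integral>s. d (t, s) \<partial>lborel)" and "v1 t = (\<integral>s. d1 (t, s) \<partial>lborel)" for t
  have iv: "integrable lborel v" "integrable lborel v1"
    unfolding v_def v1_def using integral_lborel_pair(3)[OF d] integral_lborel_pair(3)[OF d1] by auto
  have mv [measurable]: "v \<in> borel_measurable borel" "v1 \<in> borel_measurable borel"
    using borel_measurable_integrable[OF iv(1)] borel_measurable_integrable[OF iv(2)] by auto
  have v0: "v t = 0" "v1 t = 0" if "t \<notin> I_dom l" for t
    using that out by (simp_all add: v_def v1_def S_dom_eq)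
  have li: "locally_integrable (I_dom l) q" if "integrable lborel q" for q :: "real \<Rightarrow> real"
  proof -
    have "integrable lebesgue q" using integrable_completion[OF borel_measurable_integrable[OF that]] that by simp
    then show ?thesis unfolding locally_integrable_def set_integrable_def
      using integrable_mult_indicator[of _ lebesgue q] by (auto simp: compact_imp_closed borel_closed)
  qed
  have "(\<integral>x. frechet_derivative \<psi> (at x) 1 *\<^sub>R v x \<partial>lebesgue_on (I_dom l)) = - (\<integral>x. \<psi> x *\<^sub>R v1 x \<partial>lebesgue_on (I_dom l))"
    if t: "\<psi> \<in> test_functions (I_dom l)" for \<psi>
  proof -
    define \<psi>' where "\<psi>' x = frechet_derivative \<psi> (at x) 1" for x
    have t': "\<psi>' \<in> test_functions (I_dom l)" unfolding \<psi>'_def by (rule test_function_deriv[OF t]) simp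
    note [measurable] = test_functionsD(3)[OF t] test_functionsD(3)[OF t']
    obtain B where B: "\<And>x. \<bar>\<psi> x\<bar> \<le> B" using test_function_support[OF t] by metis
    obtain B' where B': "\<And>x. \<bar>\<psi>' x\<bar> \<le> B'" using test_function_support[OF t'] by metis
    \<comment> \<open>The integrand of the weak formula tested by \<psi> in the horizontal
      direction. Its integral over the horizontal line at height \<open>s\<close> is
      \<open>H s\<close>, to be shown zero for almost every \<open>s\<close>.\<close>
    define f where "f x = \<psi>' (fst x) * d x + \<psi> (fst x) * d1 x" for x
    have f: "integrable lborel f" unfolding f_def
      by (intro Bochner_Integration.integrable_add integrable_bounded_mult[OF d, of _ B'] integrable_bounded_mult[OF d1, of _ B])
         (auto simp: B B')
    define H where "H s = (\<integral>t. f (t, s) \<partial>lborel)" for s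
    have H: "integrable lborel H" unfolding H_def by (rule integral_lborel_pair(4)[OF f])
    have [measurable]: "H \<in> borel_measurable borel" using borel_measurable_integrable[OF H] by simp
    have "AE s in lebesgue. s \<in> J_dom \<longrightarrow> H s = 0"
    proof (rule fundamental_lemma_real[OF domains(5)])
      show "locally_integrable J_dom H"
      proof -
        have "integrable lebesgue H" using integrable_completion[OF borel_measurable_integrable[OF H]] H by simp
        then show ?thesis unfolding locally_integrable_def set_integrable_def
          using integrable_mult_indicator[of _ lebesgue H] by (auto simp: compact_imp_closed borel_closed)
      qed
      fix \<eta> assume tc: "\<eta> \<in> test_functions J_dom"
      note [measurable] = test_functionsD(3)[OF tc]
      obtain Bc where Bc: "\<And>x. \<bar>\<eta> x\<bar> \<le> Bc" using test_function_support[OF tc] by metis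
      note tp = test_functions_prod[OF t tc, folded S_dom_eq]
      have "integrable lborel (\<lambda>x. \<eta> (snd x) * f x)"
        by (intro integrable_bounded_mult[OF f, of _ Bc]) (auto simp: Bc)
      from integral_lborel_pair(2)[OF this]
      have 1: "(\<integral>s. \<eta> s * H s \<partial>lborel) = (\<integral>x. \<eta> (snd x) * f x \<partial>lborel)"
        by (simp add: H_def)
      have i: "integrable lborel (\<lambda>x. (\<psi>' (fst x) * \<eta> (snd x)) * d x)" "integrable lborel (\<lambda>x. (\<psi> (fst x) * \<eta> (snd x)) * d1 x)"
        by (rule integrable_bounded_mult[OF d, of _ "B' * Bc"] integrable_bounded_mult[OF d1, of _ "B * Bc"];
            use B B' Bc order_trans[OF abs_ge_zero B] order_trans[OF abs_ge_zero B'] in \<open>auto simp: abs_mult intro!: mult_mono\<close>)+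
      have "(\<integral>x. \<eta> (snd x) * f x \<partial>lborel) = (\<integral>x. (\<psi>' (fst x) * \<eta> (snd x)) * d x + (\<psi> (fst x) * \<eta> (snd x)) * d1 x \<partial>lborel)"
        by (simp add: f_def algebra_simps)
      also have "\<dots> = (\<integral>x. (\<psi>' (fst x) * \<eta> (snd x)) * d x \<partial>lborel) + (\<integral>x. (\<psi> (fst x) * \<eta> (snd x)) * d1 x \<partial>lborel)"
        using i by (rule Bochner_Integration.integral_add)
      also have "(\<integral>x. (\<psi>' (fst x) * \<eta> (snd x)) * d x \<partial>lborel) = (\<integral>x. (\<psi>' (fst x) * \<eta> (snd x)) * d x \<partial>lebesgue_on (S_dom l))"
        by (rule integral_lebesgue_on_borel(1)[symmetric]) (auto simp: out)
      also have "(\<integral>x. (\<psi> (fst x) * \<eta> (snd x)) * d1 x \<partial>lborel) = (\<integral>x. (\<psi> (fst x) * \<eta> (snd x)) * d1 x \<partial>lebesgue_on (S_dom l))"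
        by (rule integral_lebesgue_on_borel(1)[symmetric]) (auto simp: out)
      finally have "(\<integral>s. \<eta> s * H s \<partial>lborel) = 0"
        using 1 bspec[OF conjunct2[OF conjunct2[OF wd[unfolded has_weak_deriv_iff[OF domains(9)]]]] tp(1)]
        by (simp add: tp(2) \<psi>'_def)
      moreover obtain K where "K \<subseteq> J_dom" "\<And>x. x \<notin> K \<Longrightarrow> \<eta> x = 0" using test_function_support[OF tc] by metis
      ultimately show "(LINT x:J_dom|lebesgue. \<eta> x * H x) = 0"
        unfolding set_integral_lebesgue_on(1)[OF domains(5)]
        by (subst integral_lebesgue_on_borel(1)) auto
    qed
    then have "AE s in lborel. s \<in> J_dom \<longrightarrow> H s = 0" by (simp add: AE_completion_iff)
    then have "AE s in lborel. H s = 0"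
    proof eventually_elim
      case (elim s)
      show ?case using elim by (cases "s \<in> J_dom") (auto simp: H_def f_def out S_dom_eq)
    qed
    then have "integral\<^sup>L lborel H = 0" by (intro integral_eq_zero_AE)
    then have "integral\<^sup>L lborel f = 0" using integral_lborel_pair(2)[OF f, folded H_def] by simp
    moreover have "integral\<^sup>L lborel f = (\<integral>t. (\<integral>s. f (t, s) \<partial>lborel) \<partial>lborel)"
      by (rule integral_lborel_pair(1)[OF f])
    moreover have "\<dots> = (\<integral>t. \<psi>' t * v t + \<psi> t * v1 t \<partial>lborel)"
    proof (rule integral_cong_AE)
      show "AE t in lborel. (\<integral>s. f (t, s) \<partial>lborel) = \<psi>' t * v t + \<psi> t * v1 t"
        using integral_lborel_pair(5)[OF d] integral_lborel_pair(5)[OF d1]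
        by eventually_elim (simp add: f_def v_def v1_def)
    next
      show "(\<lambda>t. \<integral>s. f (t, s) \<partial>lborel) \<in> borel_measurable lborel"
        using integral_lborel_pair(3)[OF f] by (rule borel_measurable_integrable)
    qed measurable
    moreover have "\<dots> = (\<integral>t. \<psi>' t * v t \<partial>lborel) + (\<integral>t. \<psi> t * v1 t \<partial>lborel)"
      by (intro Bochner_Integration.integral_add integrable_bounded_mult[OF iv(1), of _ B'] integrable_bounded_mult[OF iv(2), of _ B])
         (auto simp: B B')
    moreover have "(\<integral>t. \<psi>' t * v t \<partial>lborel) = (\<integral>t. \<psi>' t * v t \<partial>lebesgue_on (I_dom l))"
       "(\<integral>t. \<psi> t * v1 t \<partial>lborel) = (\<integral>t. \<psi> t * v1 t \<partial>lebesgue_on (I_dom l))"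
      by (subst integral_lebesgue_on_borel(1); auto simp: v0)+
    ultimately show ?thesis by (simp add: \<psi>'_def)
  qed
  then show ?thesis
    unfolding has_weak_deriv_iff[OF domains(1)] v_def[symmetric] v1_def[symmetric]
    using li[OF iv(1)] li[OF iv(2)] by blast
qed


lemma L2_borel_representative:
  fixes f :: "'a::euclidean_space \<Rightarrow> real"
  assumes "open \<Omega>" "bounded \<Omega>" "f \<in> L2 \<Omega>"
  shows "\<exists>e. e \<in> borel_measurable borel \<and> (\<forall>x. x \<notin> \<Omega> \<longrightarrow> e x = 0) \<and>
    (AE x in lebesgue_on \<Omega>. f x = e x) \<and> integrable lborel e \<and> integrable lborel (\<lambda>x. (e x)\<^sup>2)"
proof -
  have "f \<in> borel_measurable (lebesgue_on \<Omega>)" using assms by (simp add: L2_iff)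
  then obtain e where e [measurable]: "e \<in> borel_measurable borel" and e0: "\<And>x. x \<notin> \<Omega> \<Longrightarrow> e x = 0"
    and ef: "AE x in lebesgue_on \<Omega>. f x = e x" using lebesgue_on_borel_representative[OF assms(1)] by metis
  have eL: "e \<in> L2 \<Omega>" using L2_AE[OF assms(1,3) ef] .
  have "integrable lborel e"
    using L2_integrable(1)[OF assms(1,2) eL] integral_lebesgue_on_borel(2)[OF assms(1) e e0] by simp
  moreover have "integrable lborel (\<lambda>x. (e x)\<^sup>2)"
    using eL integral_lebesgue_on_borel(2)[OF assms(1), of "\<lambda>x. (e x)\<^sup>2"] e0 assms(1) by (simp add: L2_iff)
  ultimately show ?thesis using e e0 ef by blast
qed

text \<open>On almost every vertical line, of length one, the deviation from the average is at most
  the integral of the vertical derivative in absolute value; Cauchy-Schwarz squares this without a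
  constant. The factors 2 come from splitting \<open>d\<close> into deviation and average.\<close>

lemma vertical_deviation:
  fixes d d2 :: "real \<times> real \<Rightarrow> real"
  assumes [measurable]: "d \<in> borel_measurable borel" "d2 \<in> borel_measurable borel"
    and d: "integrable lborel d" "integrable lborel (\<lambda>x. (d x)\<^sup>2)"
    and d2: "integrable lborel d2" "integrable lborel (\<lambda>x. (d2 x)\<^sup>2)"
    and out: "\<And>x. x \<notin> S_dom l \<Longrightarrow> d x = 0" "\<And>x. x \<notin> S_dom l \<Longrightarrow> d2 x = 0"
    and wd: "has_weak_deriv (S_dom l) (0, 1) d d2"
    and v: "integrable lborel (\<lambda>t. (\<integral>s. d (t, s) \<partial>lborel)\<^sup>2)"
  shows "integral\<^sup>L lborel (\<lambda>x. (d x)\<^sup>2) \<le>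
    2 * integral\<^sup>L lborel (\<lambda>x. (d2 x)\<^sup>2) + 2 * (\<integral>t. (\<integral>s. d (t, s) \<partial>lborel)\<^sup>2 \<partial>lborel)"
proof -
  have Jeq: "J_dom = {-1/2<..<1/2}" "-1/2 < (1/2 :: real)" by (simp_all add: J_dom_def)
  have iJ: "integrable lborel (indicator J_dom :: real \<Rightarrow> real)" "integral\<^sup>L lborel (indicator J_dom :: real \<Rightarrow> real) = 1"
    by (auto simp: J_dom_def integrable_indicator_iff)
  have ind2: "(\<lambda>x. (indicator J_dom x :: real)\<^sup>2) = indicator J_dom"
    by (auto simp: fun_eq_iff indicator_def)
  define E where "E t = (\<integral>u. (d2 (t, u))\<^sup>2 \<partial>lborel)" for t
  define v where "v t = (\<integral>s. d (t, s) \<partial>lborel)" for t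
  have sl [measurable]: "(\<lambda>s. d (t, s)) \<in> borel_measurable borel" "(\<lambda>s. d2 (t, s)) \<in> borel_measurable borel" for t
    by (rule measurable_compose[OF _ assms(1)] measurable_compose[OF _ assms(2)];
        intro borel_measurable_continuous_onI continuous_intros)+
  have "AE p in lborel. AE h in lborel. 0 \<le> h \<and> p \<in> S_dom l \<and> p + h *\<^sub>R (0, 1) \<in> S_dom l \<longrightarrow>
    d (p + h *\<^sub>R (0, 1)) - d p = (\<integral>s. (if 0 \<le> s \<and> s \<le> h then d2 (p + s *\<^sub>R (0, 1)) else 0) \<partial>lborel)"
    by (rule weak_deriv_segment; (fact | simp))
  then have "AE p in lborel \<Otimes>\<^sub>M lborel. AE h in lborel. 0 \<le> h \<and> p \<in> S_dom l \<and> p + h *\<^sub>R (0, 1) \<in> S_dom l \<longrightarrow>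
    d (p + h *\<^sub>R (0, 1)) - d p = (\<integral>s. (if 0 \<le> s \<and> s \<le> h then d2 (p + s *\<^sub>R (0, 1)) else 0) \<partial>lborel)"
    by (simp only: lborel_prod)
  \<comment> \<open>The segment formula holds at almost every point of the plane, hence on almost
    every vertical line at almost every height.\<close>
  from lborel_pair.AE_pair[OF this]
  have main: "AE t in lborel. AE s in lborel. (d (t, s))\<^sup>2 \<le> indicator J_dom s * (2 * E t + 2 * (v t)\<^sup>2)"
    using integral_lborel_pair(5)[OF d(1)] integral_lborel_pair(5)[OF d2(1)] integral_lborel_pair(5)[OF d2(2)]
  proof eventually_elim
    case (elim t)
    show ?case
    proof (cases "t \<in> I_dom l")
      case False
      then have "d (t, s) = 0" for s using out(1)[of "(t, s)"] by (simp add: S_dom_eq)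
      moreover have "E t \<ge> 0" by (simp add: E_def)
      ultimately show ?thesis by (intro AE_I2) simp
    next
      case True
      have o: "d (t, s) = 0" "d2 (t, s) = 0" if "s \<notin> J_dom" for s using out that by (auto simp: S_dom_eq)
      have "AE s in lborel. AE h in lborel. 0 \<le> h \<and> s \<in> J_dom \<and> s + h \<in> J_dom \<longrightarrow>
          d (t, s + h) - d (t, s) = (\<integral>x. (if 0 \<le> x \<and> x \<le> h then d2 (t, s + x) else 0) \<partial>lborel)"
        using elim(1) True by (simp add: S_dom_eq cong: if_cong)
      from segment_symmetric[OF sl domains(8) this]
      show ?thesis
      proof eventually_elim
        case (elim s)
        show ?case
        proof (cases "s \<in> J_dom")
          case True
          define A where "A = integral\<^sup>L lborel (\<lambda>x. \<bar>d2 (t, x)\<bar>)"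
          have "\<bar>(1/2 - -1/2) * d (t, s) - integral\<^sup>L lborel (\<lambda>s. d (t, s))\<bar> \<le> (1/2 - -1/2) * A"
            unfolding A_def
            by (rule mean_deviation(2)[OF sl(1) sl(2) _ _ Jeq(2,1) _ True elim])
               (use o \<open>integrable lborel (\<lambda>s. d (t, s))\<close> \<open>integrable lborel (\<lambda>s. d2 (t, s))\<close> in auto)
          then have dv: "\<bar>d (t, s) - v t\<bar> \<le> A" by (simp add: v_def)
          have "A = integral\<^sup>L lborel (\<lambda>x. indicator J_dom x * \<bar>d2 (t, x)\<bar>)"
            unfolding A_def by (intro Bochner_Integration.integral_cong) (auto simp: indicator_def o)
          also have "\<dots>\<^sup>2 \<le> integral\<^sup>L lborel (\<lambda>x. (indicator J_dom x :: real)\<^sup>2) * integral\<^sup>L lborel (\<lambda>x. \<bar>d2 (t, x)\<bar>\<^sup>2)"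
            by (rule Cauchy_Schwarz_integral(2))
               (use iJ \<open>integrable lborel (\<lambda>s. (d2 (t, s))\<^sup>2)\<close> in \<open>auto simp: ind2\<close>)
          finally have AE: "A\<^sup>2 \<le> E t" using iJ by (simp add: E_def ind2)
          have "(d (t, s))\<^sup>2 \<le> 2 * (d (t, s) - v t)\<^sup>2 + 2 * (v t)\<^sup>2"
            using sum_squares_bound[of "d (t, s) - v t" "v t"] zero_le_power2[of "d (t, s) - 2 * v t"]
            by (simp add: power2_eq_square algebra_simps)
          moreover have "(d (t, s) - v t)\<^sup>2 \<le> A\<^sup>2" using power_mono[OF dv abs_ge_zero, of 2] by simp
          ultimately show ?thesis using AE True by simp
        qed (simp add: o)
      qed
    qed
  qed
  have iE: "integrable lborel E" unfolding E_def by (rule integral_lborel_pair(3)[OF d2(2)])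
  have "integral\<^sup>L lborel (\<lambda>x. (d x)\<^sup>2) = (\<integral>t. (\<integral>s. (d (t, s))\<^sup>2 \<partial>lborel) \<partial>lborel)"
    by (rule integral_lborel_pair(1)[OF d(2)])
  also have "\<dots> \<le> (\<integral>t. 2 * E t + 2 * (v t)\<^sup>2 \<partial>lborel)"
  proof (rule integral_mono_AE)
    show "integrable lborel (\<lambda>t. \<integral>s. (d (t, s))\<^sup>2 \<partial>lborel)" by (rule integral_lborel_pair(3)[OF d(2)])
    show "integrable lborel (\<lambda>t. 2 * E t + 2 * (v t)\<^sup>2)" using iE v by (simp add: v_def)
    show "AE t in lborel. (\<integral>s. (d (t, s))\<^sup>2 \<partial>lborel) \<le> 2 * E t + 2 * (v t)\<^sup>2"
      using main integral_lborel_pair(5)[OF d(2)]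
    proof eventually_elim
      case (elim t)
      have "(\<integral>s. (d (t, s))\<^sup>2 \<partial>lborel) \<le> (\<integral>s. indicator J_dom s * (2 * E t + 2 * (v t)\<^sup>2) \<partial>lborel)"
        by (rule integral_mono_AE) (use elim iJ in auto)
      also have "\<dots> = 2 * E t + 2 * (v t)\<^sup>2" using iJ by simp
      finally show ?case .
    qed
  qed
  also have "\<dots> = 2 * integral\<^sup>L lborel E + 2 * (\<integral>t. (v t)\<^sup>2 \<partial>lborel)"
    using iE v by (simp add: v_def)
  also have "integral\<^sup>L lborel E = integral\<^sup>L lborel (\<lambda>x. (d2 x)\<^sup>2)"
    unfolding E_def by (rule integral_lborel_pair(1)[OF d2(2), symmetric])
  finally show ?thesis by (simp add: v_def)
qed

text \<open>The vertical averages converge by a one-dimensional argument, and the deviation from them is controlled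
  by the vertical derivative. This replaces the Rellich theorem.\<close>

theorem strong_convergence:
  fixes d d1 d2 :: "nat \<Rightarrow> real \<times> real \<Rightarrow> real"
  assumes l: "0 < l"
    and L: "\<And>n. d n \<in> L2 (S_dom l)" "\<And>n. d1 n \<in> L2 (S_dom l)" "\<And>n. d2 n \<in> L2 (S_dom l)"
    and wd: "\<And>n. has_weak_deriv (S_dom l) (1, 0) (d n) (d1 n)" "\<And>n. has_weak_deriv (S_dom l) (0, 1) (d n) (d2 n)"
    and C: "\<And>n. integral\<^sup>L (lebesgue_on (S_dom l)) (\<lambda>x. (d1 n x)\<^sup>2) \<le> C"
    and lim2: "(\<lambda>n. integral\<^sup>L (lebesgue_on (S_dom l)) (\<lambda>x. (d2 n x)\<^sup>2)) \<longlonglongrightarrow> 0"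
    and mean: "(\<lambda>n. integral\<^sup>L (lebesgue_on (S_dom l)) (d n)) \<longlonglongrightarrow> 0"
    and weak: "\<And>s r. (\<lambda>n. integral\<^sup>L (lebesgue_on (S_dom l)) (\<lambda>x. kern s r (fst x) * d1 n x)) \<longlonglongrightarrow> 0"
  shows "(\<lambda>n. integral\<^sup>L (lebesgue_on (S_dom l)) (\<lambda>x. (d n x)\<^sup>2)) \<longlonglongrightarrow> 0"
proof -
  let ?M = "lebesgue_on (S_dom l)"
  have "\<exists>e. \<forall>n. e n \<in> borel_measurable borel \<and> (\<forall>x. x \<notin> S_dom l \<longrightarrow> e n x = 0) \<and>
    (AE x in ?M. d n x = e n x) \<and> integrable lborel (e n) \<and> integrable lborel (\<lambda>x. (e n x)\<^sup>2)"
    by (rule choice, rule allI, rule L2_borel_representative[OF domains(9,10) L(1)])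
  then obtain e where E1: "\<forall>n. e n \<in> borel_measurable borel \<and> (\<forall>x. x \<notin> S_dom l \<longrightarrow> e n x = 0) \<and>
    (AE x in ?M. d n x = e n x) \<and> integrable lborel (e n) \<and> integrable lborel (\<lambda>x. (e n x)\<^sup>2)" ..
  have e [measurable]: "\<And>n. e n \<in> borel_measurable borel" and e0: "\<And>n x. x \<notin> S_dom l \<Longrightarrow> e n x = 0"
    and ee: "\<And>n. AE x in ?M. d n x = e n x" and ie: "\<And>n. integrable lborel (e n)" "\<And>n. integrable lborel (\<lambda>x. (e n x)\<^sup>2)"
    using E1 by blast+
  have "\<exists>e. \<forall>n. e n \<in> borel_measurable borel \<and> (\<forall>x. x \<notin> S_dom l \<longrightarrow> e n x = 0) \<and>
    (AE x in ?M. d1 n x = e n x) \<and> integrable lborel (e n) \<and> integrable lborel (\<lambda>x. (e n x)\<^sup>2)"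
    by (rule choice, rule allI, rule L2_borel_representative[OF domains(9,10) L(2)])
  then obtain e1 where E2: "\<forall>n. e1 n \<in> borel_measurable borel \<and> (\<forall>x. x \<notin> S_dom l \<longrightarrow> e1 n x = 0) \<and>
    (AE x in ?M. d1 n x = e1 n x) \<and> integrable lborel (e1 n) \<and> integrable lborel (\<lambda>x. (e1 n x)\<^sup>2)" ..
  have e1 [measurable]: "\<And>n. e1 n \<in> borel_measurable borel" and e10: "\<And>n x. x \<notin> S_dom l \<Longrightarrow> e1 n x = 0"
    and ee1: "\<And>n. AE x in ?M. d1 n x = e1 n x" and ie1: "\<And>n. integrable lborel (e1 n)" "\<And>n. integrable lborel (\<lambda>x. (e1 n x)\<^sup>2)"
    using E2 by blast+
  have "\<exists>e. \<forall>n. e n \<in> borel_measurable borel \<and> (\<forall>x. x \<notin> S_dom l \<longrightarrow> e n x = 0) \<and>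
    (AE x in ?M. d2 n x = e n x) \<and> integrable lborel (e n) \<and> integrable lborel (\<lambda>x. (e n x)\<^sup>2)"
    by (rule choice, rule allI, rule L2_borel_representative[OF domains(9,10) L(3)])
  then obtain e2 where E3: "\<forall>n. e2 n \<in> borel_measurable borel \<and> (\<forall>x. x \<notin> S_dom l \<longrightarrow> e2 n x = 0) \<and>
    (AE x in ?M. d2 n x = e2 n x) \<and> integrable lborel (e2 n) \<and> integrable lborel (\<lambda>x. (e2 n x)\<^sup>2)" ..
  have e2 [measurable]: "\<And>n. e2 n \<in> borel_measurable borel" and e20: "\<And>n x. x \<notin> S_dom l \<Longrightarrow> e2 n x = 0"
    and ee2: "\<And>n. AE x in ?M. d2 n x = e2 n x" and ie2: "\<And>n. integrable lborel (e2 n)" "\<And>n. integrable lborel (\<lambda>x. (e2 n x)\<^sup>2)"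
    using E3 by blast+
  \<comment> \<open>Carries an integral functional of an \<open>L2\<close> function over to its
    Borel representative. The argument \<open>h\<close> covers squares, weights by
    \<open>kern\<close> and plain means at once.\<close>
  have transfer: "integral\<^sup>L ?M (\<lambda>x. h x (f x)) = integral\<^sup>L lborel (\<lambda>x. h x (k x))"
    if "f \<in> L2 (S_dom l)" "AE x in ?M. f x = k x" "\<And>x. x \<notin> S_dom l \<Longrightarrow> h x (k x) = 0" 
      "(\<lambda>x. h x (k x)) \<in> borel_measurable borel" for f k :: "real \<times> real \<Rightarrow> real" and h :: "real \<times> real \<Rightarrow> real \<Rightarrow> real"
  proof -
    have ae: "AE x in ?M. h x (k x) = h x (f x)" using that(2) by eventually_elim simp
    have m: "(\<lambda>x. h x (k x)) \<in> borel_measurable ?M"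
      using borel_measurable_lebesgueI[OF that(4)] by (rule measurable_restrict_space1)
    have "integral\<^sup>L ?M (\<lambda>x. h x (k x)) = integral\<^sup>L ?M (\<lambda>x. h x (f x))"
      by (rule integral_cong_AE[OF m AE_eq_borel_measurable_lebesgue_on[OF domains(9) m ae] ae])
    then show ?thesis using integral_lebesgue_on_borel(1)[OF domains(9) that(4,3)] by simp
  qed
  have wde: "has_weak_deriv (S_dom l) (1, 0) (e n) (e1 n)" "has_weak_deriv (S_dom l) (0, 1) (e n) (e2 n)" for n
    by (rule has_weak_deriv_AE[OF domains(9) wd(1) ee ee1], rule has_weak_deriv_AE[OF domains(9) wd(2) ee ee2])
  define v v1 where "v n t = (\<integral>s. e n (t, s) \<partial>lborel)" and "v1 n t = (\<integral>s. e1 n (t, s) \<partial>lborel)" for n t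
  have iv: "integrable lborel (v n)" "integrable lborel (v1 n)" for n
    unfolding v_def v1_def using integral_lborel_pair(3)[OF ie(1)] integral_lborel_pair(3)[OF ie1(1)] by auto
  have mv [measurable]: "v n \<in> borel_measurable borel" "v1 n \<in> borel_measurable borel" for n
    using borel_measurable_integrable[OF iv(1)] borel_measurable_integrable[OF iv(2)] by auto
  have v0: "v n t = 0" "v1 n t = 0" if "t \<notin> I_dom l" for t n
    using that e0 e10 by (simp_all add: v_def v1_def S_dom_eq)
  have Ieq: "I_dom l = {-l/2<..<l/2}" "-l/2 < l/2" using l by (auto simp: I_dom_def)
  have wv: "has_weak_deriv (I_dom l) 1 (v n) (v1 n)" for n
    unfolding v_def v1_def by (rule average_weak_deriv[OF e e1 ie(1) ie1(1) e0 e10 wde(1)])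
  have iS: "integrable lborel (indicator (S_dom l) :: real \<times> real \<Rightarrow> real)"
    using emeasure_bounded_finite[OF domains(10)] by (simp add: integrable_indicator_iff)
  \<comment> \<open>An \<open>L2\<close> bound gives the required \<open>L1\<close> bound on the
    bounded strip through the inequality of \<open>y\<close> in absolute value with
    \<open>1 + y^2\<close>.\<close>
  have Cv: "integral\<^sup>L lborel (\<lambda>t. \<bar>v1 n t\<bar>) \<le> measure lborel (S_dom l) + C" for n
  proof -
    have ia: "integrable lborel (\<lambda>x. \<bar>e1 n x\<bar>)" using ie1(1) by simp
    have "integral\<^sup>L lborel (\<lambda>t. \<bar>v1 n t\<bar>) \<le> (\<integral>t. (\<integral>s. \<bar>e1 n (t, s)\<bar> \<partial>lborel) \<partial>lborel)"
      unfolding v1_def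
      by (rule Bochner_Integration.integral_mono')
         (use integral_lborel_pair(3)[OF ia] in \<open>auto intro: integral_abs_bound\<close>)
    also have "\<dots> = integral\<^sup>L lborel (\<lambda>x. \<bar>e1 n x\<bar>)" by (rule integral_lborel_pair(1)[OF ia, symmetric])
    also have "\<dots> \<le> integral\<^sup>L lborel (\<lambda>x. indicator (S_dom l) x + (e1 n x)\<^sup>2)"
    proof (rule integral_mono[OF ia])
      show "integrable lborel (\<lambda>x. indicator (S_dom l) x + (e1 n x)\<^sup>2)" using iS ie1(2) by simp
      have "\<bar>y\<bar> \<le> 1 + y\<^sup>2" for y :: real
        using sum_squares_bound[of "\<bar>y\<bar>" 1] by simp
      then show "\<bar>e1 n x\<bar> \<le> indicator (S_dom l) x + (e1 n x)\<^sup>2" for x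
        using e10 by (cases "x \<in> S_dom l") auto
    qed
    also have "\<dots> = measure lborel (S_dom l) + integral\<^sup>L lborel (\<lambda>x. (e1 n x)\<^sup>2)"
      using iS ie1(2) by simp
    also have "integral\<^sup>L lborel (\<lambda>x. (e1 n x)\<^sup>2) = integral\<^sup>L ?M (\<lambda>x. (d1 n x)\<^sup>2)"
      by (rule transfer[OF L(2) ee1, of "\<lambda>x y. y\<^sup>2", symmetric]) (auto simp: e10)
    finally show ?thesis using C[of n] by linarith
  qed
  \<comment> \<open>The kernel depends on the first variable only, so pairing it with the average
    equals pairing it with the function on the strip.\<close>
  have weakv: "(\<lambda>n. \<integral>t. kern s r t * v1 n t \<partial>lborel) \<longlonglongrightarrow> 0" for s r
  proof -
    have "integrable lborel (\<lambda>x. kern s r (fst x) * e1 n x)" for n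
      by (rule integrable_bounded_mult[OF ie1(1), of _ 1]) (auto simp: kern_bound)
    from integral_lborel_pair(1)[OF this]
    have "(\<integral>t. kern s r t * v1 n t \<partial>lborel) = integral\<^sup>L lborel (\<lambda>x. kern s r (fst x) * e1 n x)" for n
      by (simp add: v1_def)
    also have "\<dots> n = integral\<^sup>L ?M (\<lambda>x. kern s r (fst x) * d1 n x)" for n
      by (rule transfer[OF L(2) ee1, of "\<lambda>x y. kern s r (fst x) * y", symmetric]) (auto simp: e10)
    finally show ?thesis using weak by simp
  qed
  have meanv: "(\<lambda>n. integral\<^sup>L lborel (v n)) \<longlonglongrightarrow> 0"
  proof -
    have "integral\<^sup>L lborel (v n) = integral\<^sup>L lborel (e n)" for n
      unfolding v_def by (rule integral_lborel_pair(1)[OF ie(1), symmetric])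
    also have "\<dots> n = integral\<^sup>L ?M (d n)" for n
      by (rule transfer[OF L(1) ee, of "\<lambda>x y. y", symmetric]) (auto simp: e0)
    finally show ?thesis using mean by simp
  qed
  note isc = interval_strong_convergence[OF Ieq(2,1) mv(1) mv(2) iv(1) iv(2) v0(1) v0(2) wv Cv weakv meanv]
  have bound: "integral\<^sup>L ?M (\<lambda>x. (d n x)\<^sup>2) \<le> 2 * integral\<^sup>L ?M (\<lambda>x. (d2 n x)\<^sup>2) + 2 * integral\<^sup>L lborel (\<lambda>t. (v n t)\<^sup>2)" for n
  proof -
    have "integral\<^sup>L ?M (\<lambda>x. (d n x)\<^sup>2) = integral\<^sup>L lborel (\<lambda>x. (e n x)\<^sup>2)"
      by (rule transfer[OF L(1) ee, of "\<lambda>x y. y\<^sup>2"]) (auto simp: e0)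
    also have "\<dots> \<le> 2 * integral\<^sup>L lborel (\<lambda>x. (e2 n x)\<^sup>2) + 2 * integral\<^sup>L lborel (\<lambda>t. (v n t)\<^sup>2)"
      using vertical_deviation[OF e e2 ie ie2 e0 e20 wde(2)] isc(2)[of n] by (simp add: v_def)
    also have "integral\<^sup>L lborel (\<lambda>x. (e2 n x)\<^sup>2) = integral\<^sup>L ?M (\<lambda>x. (d2 n x)\<^sup>2)"
      by (rule transfer[OF L(3) ee2, of "\<lambda>x y. y\<^sup>2", symmetric]) (auto simp: e20)
    finally show ?thesis .
  qed
  have "(\<lambda>n. 2 * integral\<^sup>L ?M (\<lambda>x. (d2 n x)\<^sup>2) + 2 * integral\<^sup>L lborel (\<lambda>t. (v n t)\<^sup>2)) \<longlonglongrightarrow> 2 * 0 + 2 * 0"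
    by (intro tendsto_intros lim2 isc(1))
  then have lim: "(\<lambda>n. 2 * integral\<^sup>L ?M (\<lambda>x. (d2 n x)\<^sup>2) + 2 * integral\<^sup>L lborel (\<lambda>t. (v n t)\<^sup>2)) \<longlonglongrightarrow> 0"
    by simp
  show ?thesis
    by (rule tendsto_sandwich[OF _ _ tendsto_const lim]) (auto simp: bound)
qed


subsection \<open>Density of polynomials\<close>

lemma continuous_L2:
  fixes f :: "'a::euclidean_space \<Rightarrow> real"
  assumes "open \<Omega>" "bounded \<Omega>" "continuous_on UNIV f"
  shows "f \<in> L2 \<Omega>"
proof -
  interpret finite_measure "lebesgue_on \<Omega>" by (rule finite_measure_lebesgue_on[OF assms(1,2)])
  have m: "f \<in> borel_measurable (lebesgue_on \<Omega>)"
    by (intro measurable_restrict_space1 borel_measurable_lebesgueI borel_measurable_continuous_onI assms)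
  have "compact (f ` closure \<Omega>)"
    using assms by (intro compact_continuous_image) (auto simp: compact_closure intro: continuous_on_subset)
  then obtain B where B: "\<And>x. x \<in> \<Omega> \<Longrightarrow> \<bar>f x\<bar> \<le> B"
    using compact_imp_bounded[of "f ` closure \<Omega>"] closure_subset[of \<Omega>] by (auto simp: bounded_iff)
  have "integrable (lebesgue_on \<Omega>) (\<lambda>x. (f x)\<^sup>2)"
  proof (rule integrable_const_bound[of _ "B\<^sup>2"])
    show "AE x in lebesgue_on \<Omega>. norm ((f x)\<^sup>2) \<le> B\<^sup>2"
      using power_mono[OF B abs_ge_zero, of _ 2] by (auto intro!: AE_I2)
  qed (use m in measurable)
  then show ?thesis using m assms(1) by (simp add: L2_iff)
qed

lemma L2_sq_add_le:
  fixes f g :: "'a::euclidean_space \<Rightarrow> real"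
  assumes "open \<Omega>" "f \<in> L2 \<Omega>" "g \<in> L2 \<Omega>"
  shows "integral\<^sup>L (lebesgue_on \<Omega>) (\<lambda>x. (f x + g x)\<^sup>2) \<le>
    2 * integral\<^sup>L (lebesgue_on \<Omega>) (\<lambda>x. (f x)\<^sup>2) + 2 * integral\<^sup>L (lebesgue_on \<Omega>) (\<lambda>x. (g x)\<^sup>2)"
proof -
  have i: "integrable (lebesgue_on \<Omega>) (\<lambda>x. (f x)\<^sup>2)" "integrable (lebesgue_on \<Omega>) (\<lambda>x. (g x)\<^sup>2)"
    "integrable (lebesgue_on \<Omega>) (\<lambda>x. (f x + g x)\<^sup>2)"
    using assms L2_add[OF assms] by (auto simp: L2_iff)
  have "(a + b)\<^sup>2 \<le> 2 * a\<^sup>2 + 2 * b\<^sup>2" for a b :: real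
    using sum_squares_bound[of a b] by (simp add: power2_sum)
  then have "integral\<^sup>L (lebesgue_on \<Omega>) (\<lambda>x. (f x + g x)\<^sup>2) \<le>
      integral\<^sup>L (lebesgue_on \<Omega>) (\<lambda>x. 2 * (f x)\<^sup>2 + 2 * (g x)\<^sup>2)"
    using i by (intro integral_mono) auto
  then show ?thesis using i by simp
qed

lemma L2_AE_integral:
  fixes f g :: "'a::euclidean_space \<Rightarrow> real"
  assumes "open \<Omega>" "f \<in> L2 \<Omega>" "AE x in lebesgue_on \<Omega>. f x = g x"
  shows "integral\<^sup>L (lebesgue_on \<Omega>) (\<lambda>x. (f x)\<^sup>2) = integral\<^sup>L (lebesgue_on \<Omega>) (\<lambda>x. (g x)\<^sup>2)"
  using assms(2,3) L2_AE[OF assms] assms(1) by (intro integral_cong_AE) (auto simp: L2_iff)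

text \<open>Squared distances are used throughout; the triangle inequality then costs the factor 2
  of \<open>L2_sq_add_le\<close>, which explains the quarters in the estimates that follow.\<close>

definition poly_approximable :: "'a::euclidean_space set \<Rightarrow> ('a \<Rightarrow> real) \<Rightarrow> bool" where
  "poly_approximable \<Omega> f \<longleftrightarrow> f \<in> L2 \<Omega> \<and>
    (\<forall>e>0. \<exists>p. real_polynomial_function p \<and> integral\<^sup>L (lebesgue_on \<Omega>) (\<lambda>x. (f x - p x)\<^sup>2) < e)"

lemma polynomial_L2:
  fixes p :: "'a::euclidean_space \<Rightarrow> real"
  assumes "open \<Omega>" "bounded \<Omega>" "real_polynomial_function p"
  shows "p \<in> L2 \<Omega>"
  using assms by (intro continuous_L2 continuous_on_polymonial_function) (auto simp: real_polynomial_function_eq)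

lemma poly_approximable_limit:
  fixes f :: "'a::euclidean_space \<Rightarrow> real"
  assumes \<Omega>: "open \<Omega>" "bounded \<Omega>" and f: "f \<in> L2 \<Omega>"
    and lim: "\<And>e. e > 0 \<Longrightarrow> \<exists>g. poly_approximable \<Omega> g \<and> integral\<^sup>L (lebesgue_on \<Omega>) (\<lambda>x. (f x - g x)\<^sup>2) < e"
  shows "poly_approximable \<Omega> f"
  unfolding poly_approximable_def
proof (intro conjI f allI impI)
  fix e :: real assume "e > 0"
  then obtain g where g: "poly_approximable \<Omega> g" "integral\<^sup>L (lebesgue_on \<Omega>) (\<lambda>x. (f x - g x)\<^sup>2) < e / 4"
    using lim[of "e/4"] by auto
  then obtain p where p: "real_polynomial_function p" "integral\<^sup>L (lebesgue_on \<Omega>) (\<lambda>x. (g x - p x)\<^sup>2) < e / 4"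
    using \<open>e > 0\<close> by (auto simp: poly_approximable_def dest: spec[of _ "e/4"])
  have "g \<in> L2 \<Omega>" using g by (simp add: poly_approximable_def)
  then have "integral\<^sup>L (lebesgue_on \<Omega>) (\<lambda>x. ((f x - g x) + (g x - p x))\<^sup>2) < e"
    using L2_sq_add_le[OF \<Omega>(1) L2_diff[OF \<Omega>(1) f] L2_diff[OF \<Omega>(1) _ polynomial_L2[OF \<Omega> p(1)]], of g g] g(2) p(2)
    by linarith
  then show "\<exists>p. real_polynomial_function p \<and> integral\<^sup>L (lebesgue_on \<Omega>) (\<lambda>x. (f x - p x)\<^sup>2) < e"
    using p(1) by auto
qed

lemma poly_approximable_add:
  fixes f g :: "'a::euclidean_space \<Rightarrow> real"
  assumes \<Omega>: "open \<Omega>" "bounded \<Omega>" and f: "poly_approximable \<Omega> f" and g: "poly_approximable \<Omega> g"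
  shows "poly_approximable \<Omega> (\<lambda>x. f x + g x)"
  unfolding poly_approximable_def
proof (intro conjI allI impI)
  have L: "f \<in> L2 \<Omega>" "g \<in> L2 \<Omega>" using f g by (auto simp: poly_approximable_def)
  then show "(\<lambda>x. f x + g x) \<in> L2 \<Omega>" by (intro L2_add \<Omega>)
  fix e :: real assume "e > 0"
  then have "e / 4 > 0" by simp
  then obtain p q where p: "real_polynomial_function p" "integral\<^sup>L (lebesgue_on \<Omega>) (\<lambda>x. (f x - p x)\<^sup>2) < e / 4"
    and q: "real_polynomial_function q" "integral\<^sup>L (lebesgue_on \<Omega>) (\<lambda>x. (g x - q x)\<^sup>2) < e / 4"
    using f g unfolding poly_approximable_def by meson
  have "integral\<^sup>L (lebesgue_on \<Omega>) (\<lambda>x. ((f x - p x) + (g x - q x))\<^sup>2) < e"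
    using L2_sq_add_le[OF \<Omega>(1) L2_diff[OF \<Omega>(1) L(1) polynomial_L2[OF \<Omega> p(1)]] L2_diff[OF \<Omega>(1) L(2) polynomial_L2[OF \<Omega> q(1)]]] p(2) q(2)
    by linarith
  also have "(\<lambda>x. ((f x - p x) + (g x - q x))\<^sup>2) = (\<lambda>x. ((f x + g x) - (p x + q x))\<^sup>2)"
    by (simp add: algebra_simps)
  finally show "\<exists>p. real_polynomial_function p \<and> integral\<^sup>L (lebesgue_on \<Omega>) (\<lambda>x. ((f x + g x) - p x)\<^sup>2) < e"
    using p(1) q(1) real_polynomial_function.intros(3) by blast
qed

lemma poly_approximable_poly:
  fixes p :: "'a::euclidean_space \<Rightarrow> real"
  assumes "open \<Omega>" "bounded \<Omega>" "real_polynomial_function p"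
  shows "poly_approximable \<Omega> p"
  using polynomial_L2[OF assms] assms(3) by (auto simp: poly_approximable_def intro!: exI[of _ p])

lemma poly_approximable_cmult:
  fixes f :: "'a::euclidean_space \<Rightarrow> real"
  assumes \<Omega>: "open \<Omega>" "bounded \<Omega>" and f: "poly_approximable \<Omega> f"
  shows "poly_approximable \<Omega> (\<lambda>x. c * f x)"
proof (cases "c = 0")
  case True
  then show ?thesis using poly_approximable_poly[OF \<Omega> real_polynomial_function.intros(2)[of 0]] by simp
next
  case False
  show ?thesis unfolding poly_approximable_def
  proof (intro conjI allI impI)
    have L: "f \<in> L2 \<Omega>" using f by (auto simp: poly_approximable_def)
    then show "(\<lambda>x. c * f x) \<in> L2 \<Omega>" using L2_cmult[OF \<Omega>(1), of f c] by simp
    fix e :: real assume "e > 0"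
    then have "e / c\<^sup>2 > 0" using False by simp
    then obtain p where p: "real_polynomial_function p" "integral\<^sup>L (lebesgue_on \<Omega>) (\<lambda>x. (f x - p x)\<^sup>2) < e / c\<^sup>2"
      using f unfolding poly_approximable_def by meson
    have "(\<lambda>x. (c * f x - c * p x)\<^sup>2) = (\<lambda>x. c\<^sup>2 * (f x - p x)\<^sup>2)"
      by (simp add: power_mult_distrib[symmetric] algebra_simps)
    then have "integral\<^sup>L (lebesgue_on \<Omega>) (\<lambda>x. (c * f x - c * p x)\<^sup>2) < e"
      using p(2) False by (simp add: field_simps)
    then show "\<exists>p. real_polynomial_function p \<and> integral\<^sup>L (lebesgue_on \<Omega>) (\<lambda>x. (c * f x - p x)\<^sup>2) < e"
      using p(1) real_polynomial_function.intros(4)[OF real_polynomial_function.intros(2)[of c] p(1)] by blast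
  qed
qed

lemma poly_approximable_sum:
  fixes f :: "'i \<Rightarrow> 'a::euclidean_space \<Rightarrow> real"
  assumes \<Omega>: "open \<Omega>" "bounded \<Omega>" and f: "\<And>i. i \<in> A \<Longrightarrow> poly_approximable \<Omega> (f i)"
  shows "poly_approximable \<Omega> (\<lambda>x. \<Sum>i\<in>A. f i x)"
  using f
proof (induction A rule: infinite_finite_induct)
  case (insert a A)
  then have "poly_approximable \<Omega> (\<lambda>x. f a x + (\<Sum>i\<in>A. f i x))"
    by (intro poly_approximable_add[OF \<Omega>]) auto
  then show ?case using insert by simp
qed (use poly_approximable_poly[OF \<Omega> real_polynomial_function.intros(2)[of 0]] in simp_all)

lemma poly_approximable_continuous:
  fixes f :: "'a::euclidean_space \<Rightarrow> real"
  assumes \<Omega>: "open \<Omega>" "bounded \<Omega>" and f: "continuous_on UNIV f"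
  shows "poly_approximable \<Omega> f"
  unfolding poly_approximable_def
proof (intro conjI allI impI)
  show L: "f \<in> L2 \<Omega>" by (rule continuous_L2[OF \<Omega> f])
  interpret finite_measure "lebesgue_on \<Omega>" by (rule finite_measure_lebesgue_on[OF \<Omega>])
  fix e :: real assume "e > 0"
  define m where "m = measure (lebesgue_on \<Omega>) \<Omega>"
  have m: "m \<ge> 0" by (simp add: m_def)
  \<comment> \<open>A uniform error \<delta> contributes at most \<open>\<delta>^2 * m\<close> to
    the squared distance. Dividing by \<open>m + 1\<close> makes this less than \<open>e\<close>
    even for a domain of measure zero.\<close>
  define \<delta> where "\<delta> = sqrt (e / (m + 1))"
  have \<delta>: "\<delta> > 0" "\<delta>\<^sup>2 = e / (m + 1)" using \<open>e > 0\<close> m by (auto simp: \<delta>_def)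
  obtain p where p: "real_polynomial_function p" "\<And>x. x \<in> closure \<Omega> \<Longrightarrow> \<bar>f x - p x\<bar> < \<delta>"
    using Stone_Weierstrass_real_polynomial_function[of "closure \<Omega>" f \<delta>] \<Omega> f \<delta>(1)
    by (metis compact_closure continuous_on_subset subset_UNIV)
  have "integral\<^sup>L (lebesgue_on \<Omega>) (\<lambda>x. (f x - p x)\<^sup>2) \<le> integral\<^sup>L (lebesgue_on \<Omega>) (\<lambda>x. \<delta>\<^sup>2)"
  proof (rule integral_mono)
    show "integrable (lebesgue_on \<Omega>) (\<lambda>x. (f x - p x)\<^sup>2)"
      using L2_diff[OF \<Omega>(1) L polynomial_L2[OF \<Omega> p(1)]] \<Omega>(1) by (simp add: L2_iff)
    fix x assume "x \<in> space (lebesgue_on \<Omega>)"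
    then have "\<bar>f x - p x\<bar> \<le> \<delta>" using p(2)[of x] closure_subset[of \<Omega>] by auto
    then show "(f x - p x)\<^sup>2 \<le> \<delta>\<^sup>2" using power_mono[OF _ abs_ge_zero, of "f x - p x" \<delta> 2] by simp
  qed simp
  also have "\<dots> = e * (m / (m + 1))" by (simp add: \<delta>(2) m_def)
  also have "\<dots> < e * 1" using \<open>e > 0\<close> m by (intro mult_strict_left_mono) auto
  finally show "\<exists>p. real_polynomial_function p \<and> integral\<^sup>L (lebesgue_on \<Omega>) (\<lambda>x. (f x - p x)\<^sup>2) < e"
    using p(1) by auto
qed

text \<open>The engine of the extension from continuous to measurable functions: the class is closed
  under dominated limits, with the squared dominating function integrable.\<close>

lemma poly_approximable_dominated:
  fixes f :: "'a::euclidean_space \<Rightarrow> real"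
  assumes \<Omega>: "open \<Omega>" "bounded \<Omega>" and g: "\<And>n. poly_approximable \<Omega> (g n)" and f: "f \<in> borel_measurable (lebesgue_on \<Omega>)"
    and lim: "AE x in lebesgue_on \<Omega>. (\<lambda>n. g n x) \<longlonglongrightarrow> f x"
    and W: "W \<in> L2 \<Omega>" and bd: "\<And>n x. x \<in> \<Omega> \<Longrightarrow> \<bar>g n x\<bar> \<le> W x" "\<And>x. x \<in> \<Omega> \<Longrightarrow> \<bar>f x\<bar> \<le> W x"
  shows "poly_approximable \<Omega> f"
proof (rule poly_approximable_limit[OF \<Omega>])
  have iW: "integrable (lebesgue_on \<Omega>) (\<lambda>x. (W x)\<^sup>2)" using W \<Omega>(1) by (simp add: L2_iff)
  have "integrable (lebesgue_on \<Omega>) (\<lambda>x. (f x)\<^sup>2)"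
  proof (rule Bochner_Integration.integrable_bound[OF iW])
    show "AE x in lebesgue_on \<Omega>. norm ((f x)\<^sup>2) \<le> norm ((W x)\<^sup>2)"
      using power_mono[OF bd(2) abs_ge_zero, of _ 2] by (auto intro!: AE_I2)
  qed (use f in measurable)
  then show "f \<in> L2 \<Omega>" using f \<Omega>(1) by (simp add: L2_iff)
  fix e :: real assume "e > 0"
  have gm: "g n \<in> borel_measurable (lebesgue_on \<Omega>)" for n
    using g[of n] \<Omega>(1) by (simp add: poly_approximable_def L2_iff)
  have "(\<lambda>n. integral\<^sup>L (lebesgue_on \<Omega>) (\<lambda>x. (f x - g n x)\<^sup>2)) \<longlonglongrightarrow> integral\<^sup>L (lebesgue_on \<Omega>) (\<lambda>x. 0)"
  proof (rule integral_dominated_convergence[where w = "\<lambda>x. 4 * (W x)\<^sup>2"])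
    show "AE x in lebesgue_on \<Omega>. (\<lambda>n. (f x - g n x)\<^sup>2) \<longlonglongrightarrow> 0"
      using lim by eventually_elim (auto intro!: tendsto_eq_intros)
    show "AE x in lebesgue_on \<Omega>. norm ((f x - g n x)\<^sup>2) \<le> 4 * (W x)\<^sup>2" for n
    proof (rule AE_I2)
      fix x assume "x \<in> space (lebesgue_on \<Omega>)"
      then have "\<bar>f x - g n x\<bar> \<le> 2 * W x" using bd(1)[of x n] bd(2)[of x] by auto
      from power_mono[OF this abs_ge_zero, of 2] show "norm ((f x - g n x)\<^sup>2) \<le> 4 * (W x)\<^sup>2"
        by (simp add: power_mult_distrib)
    qed
  qed (use iW f gm in \<open>simp_all\<close>)
  then have "eventually (\<lambda>n. integral\<^sup>L (lebesgue_on \<Omega>) (\<lambda>x. (f x - g n x)\<^sup>2) < e) sequentially"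
    using \<open>e > 0\<close> by (intro order_tendstoD) auto
  then show "\<exists>g. poly_approximable \<Omega> g \<and> integral\<^sup>L (lebesgue_on \<Omega>) (\<lambda>x. (f x - g x)\<^sup>2) < e"
    using g by (auto simp: eventually_sequentially)
qed

lemma const_L2: "open \<Omega> \<Longrightarrow> bounded \<Omega> \<Longrightarrow> (\<lambda>x::'a::euclidean_space. c::real) \<in> L2 \<Omega>"
  by (rule continuous_L2) auto

lemma indicator_measurable_lebesgue_on:
  "A \<in> sets borel \<Longrightarrow> (indicator A :: 'a::euclidean_space \<Rightarrow> real) \<in> borel_measurable (lebesgue_on \<Omega>)"
  by (intro measurable_restrict_space1 borel_measurable_lebesgueI) simp

text \<open>Dynkin's argument. Open boxes form a generator stable under intersection, and their
  indicators are limits of bumps; complements subtract from 1, and disjoint unions are limits of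
  partial sums, which disjointness keeps bounded by 1.\<close>

lemma poly_approximable_indicator:
  fixes A :: "'a::euclidean_space set"
  assumes \<Omega>: "open \<Omega>" "bounded \<Omega>" and A: "A \<in> sets borel"
  shows "poly_approximable \<Omega> (indicator A)"
proof -
  let ?G = "range (\<lambda>(a, b). box a b :: 'a set)"
  have "Int_stable ?G"
    by (auto simp: Int_stable_def box_Int_box)
  moreover have "?G \<subseteq> Pow UNIV" by simp
  moreover have "A \<in> sigma_sets UNIV ?G" using A unfolding borel_eq_box by simp
  ultimately show ?thesis
  proof (induction rule: sigma_sets_induct_disjoint[consumes 3])
    case (basic A)
    then obtain a b where A: "A = box a b" by auto
    show ?case
    proof (rule poly_approximable_dominated[OF \<Omega>, where W = "\<lambda>_. 1"])
      show "poly_approximable \<Omega> (bump a b (real (Suc n)))" for n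
        by (rule poly_approximable_continuous[OF \<Omega> C_k_continuous[OF C_k_bump]])
      show "AE x in lebesgue_on \<Omega>. (\<lambda>n. bump a b (real (Suc n)) x) \<longlonglongrightarrow> indicator A x"
        unfolding A by (intro AE_I2 bump_tendsto)
      show "\<bar>bump a b (real (Suc n)) x\<bar> \<le> 1" for n x
        using bump_bounds[of a b "real (Suc n)" x] by simp
    qed (auto simp: A indicator_measurable_lebesgue_on const_L2 \<Omega> split: split_indicator)
  next
    case empty
    show ?case using poly_approximable_poly[OF \<Omega> real_polynomial_function.intros(2)[of 0]] by (simp add: indicator_def)
  next
    case (compl A)
    have "poly_approximable \<Omega> (\<lambda>x. 1 + (-1) * indicator A x)"
      by (rule poly_approximable_add[OF \<Omega> poly_approximable_poly[OF \<Omega> real_polynomial_function.intros(2)] poly_approximable_cmult[OF \<Omega> compl(2)]])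
    also have "(\<lambda>x. 1 + (-1) * indicator A x) = (indicator (UNIV - A) :: 'a \<Rightarrow> real)"
      by (auto simp: indicator_def fun_eq_iff)
    finally show ?case .
  next
    case (union A)
    have Ab: "A i \<in> sets borel" for i using union(2) by (auto simp: borel_eq_box)
    have eq: "(\<Sum>i<n. indicator (A i) x) = (indicator (\<Union>i<n. A i) x :: real)" for n x
      by (rule indicator_UN_disjoint[symmetric]) (auto intro: disjoint_family_on_mono[OF _ union(1)])
    show ?case
    proof (rule poly_approximable_dominated[OF \<Omega>, where W = "\<lambda>_. 1" and g = "\<lambda>n x. \<Sum>i<n. indicator (A i) x"])
      show "poly_approximable \<Omega> (\<lambda>x. \<Sum>i<n. indicator (A i) x)" for n
        by (rule poly_approximable_sum[OF \<Omega> union(3)])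
      show "AE x in lebesgue_on \<Omega>. (\<lambda>n. \<Sum>i<n. indicator (A i) x) \<longlonglongrightarrow> (indicator (\<Union>i. A i) x :: real)"
        unfolding eq by (intro AE_I2 LIMSEQ_indicator_UN)
      from eq show "\<bar>\<Sum>i<n. indicator (A i) x :: real\<bar> \<le> 1" for n x by (simp split: split_indicator)
      show "indicat_real (\<Union> (range A)) \<in> borel_measurable (lebesgue_on \<Omega>)"
        using Ab by (intro indicator_measurable_lebesgue_on) auto
    qed (auto simp: const_L2 \<Omega> split: split_indicator)
  qed
qed

theorem L2_polynomials_dense:
  fixes f :: "'a::euclidean_space \<Rightarrow> real"
  assumes \<Omega>: "open \<Omega>" "bounded \<Omega>" and f: "f \<in> L2 \<Omega>"
  shows "poly_approximable \<Omega> f"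
proof -
  obtain e where e: "e \<in> borel_measurable borel" "AE x in lebesgue_on \<Omega>. f x = e x"
    using L2_borel_representative[OF \<Omega> f] by blast
  have eL: "e \<in> L2 \<Omega>" by (rule L2_AE[OF \<Omega>(1) f e(2)])
  \<comment> \<open>Simple functions converging pointwise and dominated by
    \<open>2 * \<bar>e\<bar>\<close>, which is in \<open>L2\<close>; each is a finite combination of
    indicators of level sets.\<close>
  obtain F where F: "\<And>i. simple_function borel (F i)" "\<And>x. (\<lambda>i. F i x) \<longlonglongrightarrow> e x" "\<And>i x. \<bar>F i x\<bar> \<le> 2 * \<bar>e x\<bar>"
    using borel_measurable_implies_sequence_metric[OF e(1), of 0] by (auto simp: dist_real_def)
  have pF: "poly_approximable \<Omega> (F i)" for i
  proof -
    have fin: "finite (range (F i))" and s: "\<And>y. y \<in> range (F i) \<Longrightarrow> F i -` {y} \<in> sets borel"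
      using F(1)[of i] by (auto simp: simple_function_def)
    have "poly_approximable \<Omega> (\<lambda>x. \<Sum>y\<in>range (F i). y * indicator (F i -` {y}) x)"
      by (intro poly_approximable_sum[OF \<Omega>] poly_approximable_cmult[OF \<Omega>] poly_approximable_indicator[OF \<Omega>] s)
    also have "(\<lambda>x. \<Sum>y\<in>range (F i). y * indicator (F i -` {y}) x) = F i"
    proof
      fix x
      have "(\<Sum>y\<in>range (F i). y * indicator (F i -` {y}) x) = (\<Sum>y\<in>range (F i). if y = F i x then y else 0)"
        by (intro sum.cong) (auto simp: indicator_def)
      then show "(\<Sum>y\<in>range (F i). y * indicator (F i -` {y}) x) = F i x" using fin by simp
    qed
    finally show ?thesis .
  qed
  have "poly_approximable \<Omega> e"
  proof (rule poly_approximable_dominated[OF \<Omega>, where g = F, OF pF])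
    show "(\<lambda>x. 2 * \<bar>e x\<bar>) \<in> L2 \<Omega>"
    proof -
      have [measurable]: "e \<in> borel_measurable (lebesgue_on \<Omega>)" using eL \<Omega>(1) by (simp add: L2_iff)
      show ?thesis using eL \<Omega>(1) by (simp add: L2_iff power_mult_distrib)
    qed
  qed (use F(2,3) eL \<Omega>(1) in \<open>auto simp: L2_iff\<close>)
  moreover have "integral\<^sup>L (lebesgue_on \<Omega>) (\<lambda>x. (f x - e x)\<^sup>2) = 0"
    by (rule integral_eq_zero_AE) (use e(2) in \<open>eventually_elim, simp\<close>)
  ultimately show ?thesis by (intro poly_approximable_limit[OF \<Omega> f]) (metis (no_types))
qed

text \<open>Traversing the approximating sequence slowly enough beats any prescribed cost \<open>m\<close>; here \<open>m\<close> will bound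
  the polynomial and its derivatives.\<close>

theorem L2_polynomial_family:
  fixes f :: "'a::euclidean_space \<Rightarrow> real" and m :: "('a \<Rightarrow> real) \<Rightarrow> real"
  assumes \<Omega>: "open \<Omega>" "bounded \<Omega>" and f: "f \<in> L2 \<Omega>"
  obtains p where "\<And>\<epsilon>. real_polynomial_function (p \<epsilon>)"
    "((\<lambda>\<epsilon>. integral\<^sup>L (lebesgue_on \<Omega>) (\<lambda>x. (p \<epsilon> x - f x)\<^sup>2)) \<longlongrightarrow> 0) (at_right 0)"
    "((\<lambda>\<epsilon>::real. \<epsilon> * m (p \<epsilon>)) \<longlongrightarrow> 0) (at_right 0)"
proof -
  have "\<forall>n. \<exists>p. real_polynomial_function p \<and> integral\<^sup>L (lebesgue_on \<Omega>) (\<lambda>x. (f x - p x)\<^sup>2) < inverse (real (Suc n))"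
    using L2_polynomials_dense[OF \<Omega> f] unfolding poly_approximable_def by simp
  from choice[OF this] obtain q where q: "\<And>n. real_polynomial_function (q n)"
    "\<And>n. integral\<^sup>L (lebesgue_on \<Omega>) (\<lambda>x. (f x - q n x)\<^sup>2) < inverse (real (Suc n))" by blast
  \<comment> \<open>The admissible indices at \<epsilon>: the cost must be small relative to
    \<epsilon>. The bound by \<open>1 / \<epsilon>\<close> keeps the set finite and index 0 keeps it
    nonempty, so the maximum exists. Every fixed index is eventually admissible, hence the maximum
    tends to infinity.\<close>
  define A where "A \<epsilon> = {n. (n::nat) = 0 \<or> (real n \<le> 1 / \<epsilon> \<and> \<bar>\<epsilon> * m (q n)\<bar> \<le> inverse (real (Suc n)))}" for \<epsilon>
  define N where "N \<epsilon> = Max (A \<epsilon>)" for \<epsilon>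
  have fin: "finite (A \<epsilon>)" for \<epsilon>
  proof (rule finite_subset)
    show "A \<epsilon> \<subseteq> insert 0 {n. n \<le> nat \<lceil>1 / \<epsilon>\<rceil>}" by (auto simp: A_def) linarith
  qed simp
  have NA: "N \<epsilon> \<in> A \<epsilon>" for \<epsilon> unfolding N_def using fin by (intro Max_in) (auto simp: A_def)
  have Nk: "eventually (\<lambda>\<epsilon>. k \<le> N \<epsilon>) (at_right 0)" for k
  proof -
    have "((\<lambda>\<epsilon>. \<bar>\<epsilon> * m (q k)\<bar>) \<longlongrightarrow> \<bar>0 * m (q k)\<bar>) (at_right 0)" by (intro tendsto_intros)
    then have "eventually (\<lambda>\<epsilon>. \<bar>\<epsilon> * m (q k)\<bar> < inverse (real (Suc k))) (at_right 0)"
      by (intro order_tendstoD) auto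
    moreover have "eventually (\<lambda>\<epsilon>::real. \<epsilon> < 1 / (real k + 1)) (at_right 0)"
      by (rule eventually_at_rightI[of 0 "1 / (real k + 1)"]) auto
    ultimately show ?thesis using eventually_at_right_less
    proof eventually_elim
      case (elim \<epsilon>)
      then have "\<epsilon> * (real k + 1) < 1" by (simp add: field_simps)
      then have "real k \<le> 1 / \<epsilon>" using elim by (simp add: field_simps)
      then have "k \<in> A \<epsilon>" using elim by (simp add: A_def)
      then show ?case unfolding N_def using fin by (intro Max_ge)
    qed
  qed
  have small: "((\<lambda>\<epsilon>. h \<epsilon>) \<longlongrightarrow> 0) (at_right 0)" 
    if "\<And>\<epsilon>. N \<epsilon> > 0 \<Longrightarrow> \<bar>h \<epsilon>\<bar> \<le> inverse (real (Suc (N \<epsilon>)))" for h :: "real \<Rightarrow> real"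
  proof (rule tendstoI)
    fix e :: real assume "e > 0"
    then obtain k where k: "inverse (real (Suc k)) < e" using reals_Archimedean by blast
    show "eventually (\<lambda>\<epsilon>. dist (h \<epsilon>) 0 < e) (at_right 0)"
      using Nk[of "Suc k"]
    proof eventually_elim
      case (elim \<epsilon>)
      have "inverse (real (Suc (N \<epsilon>))) \<le> inverse (real (Suc k))" using elim by (intro le_imp_inverse_le) auto
      moreover have "0 < N \<epsilon>" using elim by simp
      ultimately have "\<bar>h \<epsilon>\<bar> < e" using that[of \<epsilon>] k by linarith
      then show ?case by simp
    qed
  qed
  show ?thesis
  proof (rule that[of "\<lambda>\<epsilon>. q (N \<epsilon>)"])
    show "((\<lambda>\<epsilon>. integral\<^sup>L (lebesgue_on \<Omega>) (\<lambda>x. (q (N \<epsilon>) x - f x)\<^sup>2)) \<longlongrightarrow> 0) (at_right 0)"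
      using q(2) by (intro small) (simp add: power2_commute less_imp_le)
    show "((\<lambda>\<epsilon>. \<epsilon> * m (q (N \<epsilon>))) \<longlongrightarrow> 0) (at_right 0)"
    proof (rule small)
      fix \<epsilon> assume "0 < N \<epsilon>"
      then show "\<bar>\<epsilon> * m (q (N \<epsilon>))\<bar> \<le> inverse (real (Suc (N \<epsilon>)))"
        using NA[of \<epsilon>] by (simp add: A_def)
    qed
  qed (use q in auto)
qed


subsection \<open>Quadratic forms\<close>

lemma mat22_nth [simp]:
  "mat22 a b c d $ 1 $ 1 = a" "mat22 a b c d $ 1 $ 2 = b" "mat22 a b c d $ 2 $ 1 = c" "mat22 a b c d $ 2 $ 2 = d"
  by (simp_all add: mat22_def)

lemma mat22_eqI: "A $ 1 $ 1 = a \<Longrightarrow> A $ 1 $ 2 = b \<Longrightarrow> A $ 2 $ 1 = c \<Longrightarrow> A $ 2 $ 2 = d \<Longrightarrow> A = mat22 a b c d"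
  by (simp add: vec_eq_iff forall_2)

text \<open>Two completions of squares on the three-dimensional space of symmetric matrices. Here
  \<open>g1 a + g2 b\<close> is the minimising lower right entry and \<open>k a\<close> the
  minimising off-diagonal entry, so the limit densities, and the strains that attain them, can be
  read off.\<close>

lemma quadratic_form_LDL:
  assumes "pos_def_quadratic_form_sym Q"
  obtains D B q g1 g2 k :: real where "D > 0" "B > 0" "q > 0"
    "\<And>a b d. Q (mat22 a b b d) = D * (d - g1 * a - g2 * b)\<^sup>2 + B * (b - k * a)\<^sup>2 + q * a\<^sup>2"
proof -
  obtain F where F: "bilinear F" "\<And>A. transpose A = A \<Longrightarrow> Q A = F A A"
    and pos: "\<And>A. transpose A = A \<Longrightarrow> A \<noteq> 0 \<Longrightarrow> Q A > 0"
    using assms by (auto simp: pos_def_quadratic_form_sym_def)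
  define E1 E2 E3 where "E1 = mat22 1 0 0 0" and "E2 = mat22 0 1 1 0" and "E3 = mat22 0 0 0 1"
  have sym: "transpose (mat22 a b b d) = mat22 a b b d" for a b d
    by (simp add: vec_eq_iff forall_2 transpose_def)
  have dec: "mat22 a b b d = a *\<^sub>R E1 + b *\<^sub>R E2 + d *\<^sub>R E3" for a b d
    by (simp add: vec_eq_iff forall_2 E1_def E2_def E3_def)
  define A P C R S D where "A = F E1 E1" and "P = F E1 E2 + F E2 E1" and "C = F E2 E2"
    and "R = F E1 E3 + F E3 E1" and "S = F E2 E3 + F E3 E2" and "D = F E3 E3"
  have Q: "Q (mat22 a b b d) = A * a\<^sup>2 + P * (a * b) + C * b\<^sup>2 + R * (a * d) + S * (b * d) + D * d\<^sup>2" for a b d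
    unfolding F(2)[OF sym] unfolding dec
    by (simp add: bilinear_ladd[OF F(1)] bilinear_radd[OF F(1)] bilinear_lmul[OF F(1)] bilinear_rmul[OF F(1)]
       A_def P_def C_def R_def S_def D_def power2_eq_square algebra_simps)
  have Qpos: "Q (mat22 a b b d) > 0" if "a \<noteq> 0 \<or> b \<noteq> 0 \<or> d \<noteq> 0" for a b d
  proof (rule pos[OF sym])
    have "mat22 a b b d $ 1 $ 1 = a" "mat22 a b b d $ 1 $ 2 = b" "mat22 a b b d $ 2 $ 2 = d" by simp_all
    then show "mat22 a b b d \<noteq> 0" using that by (metis zero_index)
  qed
  have D: "D > 0" using Qpos[of 0 0 1] Q[of 0 0 1] by simp
  define g1 g2 where "g1 = - R / (2 * D)" and "g2 = - S / (2 * D)"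
  define B where "B = C - S\<^sup>2 / (4 * D)"
  define p where "p = P - R * S / (2 * D)"
  have Q1: "Q (mat22 a b b d) = D * (d - g1 * a - g2 * b)\<^sup>2 + B * b\<^sup>2 + p * (a * b) + (A - R\<^sup>2 / (4 * D)) * a\<^sup>2" for a b d
    unfolding Q g1_def g2_def B_def p_def using D by (simp add: field_simps power2_eq_square)
  \<comment> \<open>Each pivot is the value of the form at a nonzero matrix chosen to annihilate the
    square already split off; the same device gives \<open>q > 0\<close> below.\<close>
  have B: "B > 0" using Qpos[of 0 1 g2] Q1[of 0 1 g2] by simp
  define k where "k = - p / (2 * B)"
  define q where "q = A - R\<^sup>2 / (4 * D) - p\<^sup>2 / (4 * B)"
  have Q2: "Q (mat22 a b b d) = D * (d - g1 * a - g2 * b)\<^sup>2 + B * (b - k * a)\<^sup>2 + q * a\<^sup>2" for a b d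
  proof -
    have "B * b\<^sup>2 + p * (a * b) + (A - R\<^sup>2 / (4 * D)) * a\<^sup>2 = B * (b - k * a)\<^sup>2 + q * a\<^sup>2"
      unfolding k_def q_def using B by (simp add: field_simps power2_eq_square)
    then show ?thesis unfolding Q1 by simp
  qed
  have "q > 0" using Qpos[of 1 k "g1 + g2 * k"] Q2[of 1 k "g1 + g2 * k"] by simp
  then show ?thesis using that D B Q2 by blast
qed

lemma Q1_Q0_eq:
  assumes "D > 0" "B > 0"
    "\<And>a b d. Q (mat22 a b b d) = D * (d - g1 * a - g2 * b)\<^sup>2 + B * (b - k * a)\<^sup>2 + q * (a::real)\<^sup>2"
  shows "Q1 Q a b = B * (b - k * a)\<^sup>2 + q * a\<^sup>2" "Q0 Q a = q * a\<^sup>2"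
proof -
  show 1: "Q1 Q a b = B * (b - k * a)\<^sup>2 + q * a\<^sup>2" for a b
    unfolding Q1_def
  proof (rule Least_equality)
    show "\<exists>\<gamma>. B * (b - k * a)\<^sup>2 + q * a\<^sup>2 = Q (mat22 a b b \<gamma>)"
      by (rule exI[of _ "g1 * a + g2 * b"]) (simp add: assms(3))
  qed (use assms in auto)
  show "Q0 Q a = q * a\<^sup>2"
    unfolding Q0_def
  proof (rule Least_equality)
    show "\<exists>z. q * a\<^sup>2 = Q1 Q a z" by (rule exI[of _ "k * a"]) (simp add: 1)
  qed (use assms in \<open>auto simp: 1\<close>)
qed

subsection \<open>Functions of one variable on the strip\<close>

lemma AE_lift_fst:
  assumes "AE t in lebesgue_on (I_dom l). P t"
  shows "AE x in lebesgue_on (S_dom l). P (fst x)"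
proof -
  have "AE t in lborel. t \<in> I_dom l \<longrightarrow> P t"
    using assms by (simp add: AE_lebesgue_on AE_completion_iff)
  then obtain N where N: "N \<in> null_sets lborel" "{t. \<not> (t \<in> I_dom l \<longrightarrow> P t)} \<subseteq> N"
    by (auto simp: eventually_ae_filter)
  then have "N \<times> UNIV \<in> null_sets (lborel \<Otimes>\<^sub>M (lborel :: real measure))"
    by (intro lborel.times_in_null_sets1) auto
  then have "N \<times> UNIV \<in> null_sets (lborel :: (real \<times> real) measure)" by (simp only: lborel_prod)
  from AE_not_in[OF this] have "AE x in lborel. x \<in> S_dom l \<longrightarrow> P (fst x)"
    by eventually_elim (use N(2) in \<open>auto simp: S_dom_eq\<close>)
  then show ?thesis by (intro AE_lebesgue_on_lborel) auto
qed

text \<open>A function of the first variable is not integrable over the plane unless it is zero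
  almost everywhere; cutting it off vertically by the cross section repairs this, and the unit
  length preserves the integral.\<close>

lemma integrable_lift_fst:
  fixes u :: "real \<Rightarrow> real"
  assumes u [measurable]: "u \<in> borel_measurable borel" and iu: "integrable lborel u"
  shows "integrable lborel (\<lambda>x. indicator J_dom (snd x) * u (fst x))"
    "integral\<^sup>L lborel (\<lambda>x. indicator J_dom (snd x) * u (fst x)) = integral\<^sup>L lborel u"
proof -
  have iJ: "integrable lborel (indicator J_dom :: real \<Rightarrow> real)" "integral\<^sup>L lborel (indicator J_dom :: real \<Rightarrow> real) = 1"
    by (auto simp: J_dom_def integrable_indicator_iff)
  show i: "integrable lborel (\<lambda>x. indicator J_dom (snd x) * u (fst x))"
    using integrable_shear[OF u iu iJ(1), of 0] by (simp add: lborel_prod case_prod_unfold)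
  show "integral\<^sup>L lborel (\<lambda>x. indicator J_dom (snd x) * u (fst x)) = integral\<^sup>L lborel u"
    using iJ(2) by (simp add: integral_lborel_pair(1)[OF i])
qed

lemma lift_fst:
  fixes w :: "real \<Rightarrow> real"
  assumes w: "w \<in> L2 (I_dom l)"
  shows "(\<lambda>x. w (fst x)) \<in> L2 (S_dom l)"
    "integral\<^sup>L (lebesgue_on (S_dom l)) (\<lambda>x. w (fst x)) = integral\<^sup>L (lebesgue_on (I_dom l)) w"
    "integral\<^sup>L (lebesgue_on (S_dom l)) (\<lambda>x. (w (fst x))\<^sup>2) = integral\<^sup>L (lebesgue_on (I_dom l)) (\<lambda>t. (w t)\<^sup>2)"
proof -
  obtain u where u [measurable]: "u \<in> borel_measurable borel" and u0: "\<And>x. x \<notin> I_dom l \<Longrightarrow> u x = 0"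
    and wu: "AE x in lebesgue_on (I_dom l). w x = u x" and iu: "integrable lborel u" and iu2: "integrable lborel (\<lambda>x. (u x)\<^sup>2)"
    using L2_borel_representative[OF domains(1,2) w] by blast
  have uw: "AE x in lebesgue_on (I_dom l). u x = w x" using wu by eventually_elim simp
  let ?u = "\<lambda>x :: real \<times> real. indicator J_dom (snd x) * u (fst x)"
  have U0: "?u x = 0" if "x \<notin> S_dom l" for x
    using that u0 by (cases x) (auto simp: S_dom_eq indicator_def)
  have ae: "AE x in lebesgue_on (S_dom l). ?u x = w (fst x)"
  proof -
    have "AE x in lebesgue_on (S_dom l). x \<in> S_dom l" by (rule AE_I2) simp
    with AE_lift_fst[OF wu] show ?thesis by eventually_elim (auto simp: S_dom_eq)
  qed
  have sq: "(\<lambda>x. (?u x)\<^sup>2) = (\<lambda>x. indicator J_dom (snd x) * (u (fst x))\<^sup>2)"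
    by (auto simp: fun_eq_iff indicator_def)
  have uL: "u \<in> L2 (I_dom l)" by (rule L2_AE[OF domains(1) w wu])
  have m: "?u \<in> borel_measurable borel"
    using borel_measurable_integrable[OF integrable_lift_fst(1)[OF u iu]] by simp
  then have m2: "(\<lambda>x. (?u x)\<^sup>2) \<in> borel_measurable borel" by (rule borel_measurable_power)
  have um: "u \<in> borel_measurable (lebesgue_on (I_dom l))" "w \<in> borel_measurable (lebesgue_on (I_dom l))"
    using uL w by (auto simp: L2_iff)
  have "integrable (lebesgue_on (S_dom l)) (\<lambda>x. (?u x)\<^sup>2)"
    using integrable_lift_fst(1)[of "\<lambda>t. (u t)\<^sup>2", OF _ iu2] U0
    by (subst integral_lebesgue_on_borel(2)[OF domains(9) m2]) (simp_all add: sq)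
  then have UL: "?u \<in> L2 (S_dom l)"
    using measurable_restrict_space1[OF borel_measurable_lebesgueI[OF m]] by (simp add: L2_iff)
  show "(\<lambda>x. w (fst x)) \<in> L2 (S_dom l)" by (rule L2_AE[OF domains(9) UL ae])
  then have Sm: "?u \<in> borel_measurable (lebesgue_on (S_dom l))" "(\<lambda>x. w (fst x)) \<in> borel_measurable (lebesgue_on (S_dom l))"
    using UL by (auto simp: L2_iff)
  have "integral\<^sup>L (lebesgue_on (S_dom l)) (\<lambda>x. w (fst x)) = integral\<^sup>L (lebesgue_on (S_dom l)) ?u"
    using ae Sm by (intro integral_cong_AE) auto
  also have "\<dots> = integral\<^sup>L lborel u"
    using integral_lebesgue_on_borel(1)[OF domains(9) m U0] integrable_lift_fst(2)[OF u iu] by simp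
  also have "\<dots> = integral\<^sup>L (lebesgue_on (I_dom l)) u"
    using integral_lebesgue_on_borel(1)[OF domains(1) u u0] by simp
  also have "\<dots> = integral\<^sup>L (lebesgue_on (I_dom l)) w"
    using um uw by (intro integral_cong_AE)
  finally show "integral\<^sup>L (lebesgue_on (S_dom l)) (\<lambda>x. w (fst x)) = integral\<^sup>L (lebesgue_on (I_dom l)) w" .
  have "integral\<^sup>L (lebesgue_on (S_dom l)) (\<lambda>x. (w (fst x))\<^sup>2) = integral\<^sup>L (lebesgue_on (S_dom l)) (\<lambda>x. (?u x)\<^sup>2)"
    using L2_AE_integral[OF domains(9) UL ae] by simp
  also have "\<dots> = integral\<^sup>L lborel (\<lambda>x. (?u x)\<^sup>2)"
    using U0 by (intro integral_lebesgue_on_borel(1)[OF domains(9) m2]) simp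
  also have "\<dots> = integral\<^sup>L lborel (\<lambda>t. (u t)\<^sup>2)"
    unfolding sq by (rule integrable_lift_fst(2)[OF _ iu2]) simp
  also have "\<dots> = integral\<^sup>L (lebesgue_on (I_dom l)) (\<lambda>t. (u t)\<^sup>2)"
    using u0 by (intro integral_lebesgue_on_borel(1)[symmetric]) auto
  also have "\<dots> = integral\<^sup>L (lebesgue_on (I_dom l)) (\<lambda>t. (w t)\<^sup>2)"
    by (rule L2_AE_integral[OF domains(1) uL uw])
  finally show "integral\<^sup>L (lebesgue_on (S_dom l)) (\<lambda>x. (w (fst x))\<^sup>2) = integral\<^sup>L (lebesgue_on (I_dom l)) (\<lambda>t. (w t)\<^sup>2)" .
qed

text \<open>Projections of the compact support are compact supports for the slices. This reduces
  weak formulas on the strip to weak formulas on intervals.\<close>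

lemma test_function_slice:
  fixes \<phi> :: "real \<times> real \<Rightarrow> real"
  assumes "\<phi> \<in> test_functions (A \<times> B)"
  shows "(\<lambda>t. \<phi> (t, s)) \<in> test_functions A"
    "frechet_derivative (\<lambda>t. \<phi> (t, s)) (at t) 1 = frechet_derivative \<phi> (at (t, s)) (1, 0)"
    "(\<lambda>s. \<phi> (t, s)) \<in> test_functions B"
    "frechet_derivative (\<lambda>s. \<phi> (t, s)) (at s) 1 = frechet_derivative \<phi> (at (t, s)) (0, 1)"
proof -
  obtain K where K: "compact K" "K \<subseteq> A \<times> B" "\<And>x. x \<notin> K \<Longrightarrow> \<phi> x = 0" using test_function_support[OF assms] by metis
  have bl: "bounded_linear (\<lambda>t::real. (t, 0::real))" "bounded_linear (\<lambda>t::real. (0::real, t))"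
    by (auto intro!: bounded_linear_Pair bounded_linear_ident bounded_linear_zero)
  have c: "C_k k (\<lambda>t. \<phi> (t, s))" "C_k k (\<lambda>s. \<phi> (t, s))" for k
    using C_k_affine[OF bl(1) test_functionsD(1)[OF assms], of k "(0, s)"]
      C_k_affine[OF bl(2) test_functionsD(1)[OF assms], of k "(t, 0)"] by simp_all
  have K1: "compact (fst ` K)" "compact (snd ` K)" "fst ` K \<subseteq> A" "snd ` K \<subseteq> B"
    using K by (auto intro!: compact_continuous_image continuous_intros)
  have "\<exists>K. compact K \<and> K \<subseteq> A \<and> (\<forall>t. t \<notin> K \<longrightarrow> \<phi> (t, s) = 0)"
  proof (intro exI[of _ "fst ` K"] conjI allI impI K1 K(3))
    fix t assume "t \<notin> fst ` K" then show "(t, s) \<notin> K" by force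
  qed
  then show "(\<lambda>t. \<phi> (t, s)) \<in> test_functions A"
    unfolding test_functions_def using c(1) by blast
  have "\<exists>K. compact K \<and> K \<subseteq> B \<and> (\<forall>s. s \<notin> K \<longrightarrow> \<phi> (t, s) = 0)"
  proof (intro exI[of _ "snd ` K"] conjI allI impI K1 K(3))
    fix s assume "s \<notin> snd ` K" then show "(t, s) \<notin> K" by force
  qed
  then show "(\<lambda>s. \<phi> (t, s)) \<in> test_functions B"
    unfolding test_functions_def using c(2) by blast
  have d: "\<phi> differentiable (at x)" for x using test_functionsD(4)[OF assms] differentiableI by blast
  have "((\<lambda>t. \<phi> (t, s)) has_derivative (\<lambda>h. frechet_derivative \<phi> (at (t, s)) (h, 0))) (at t)"
    using frechet_derivative_affine[of \<phi> "\<lambda>t. (t, 0)" t "(0, s)", OF d bl(1)] by simp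
  from fun_cong[OF frechet_derivative_at[OF this], of 1]
  show "frechet_derivative (\<lambda>t. \<phi> (t, s)) (at t) 1 = frechet_derivative \<phi> (at (t, s)) (1, 0)" by simp
  have "((\<lambda>s. \<phi> (t, s)) has_derivative (\<lambda>h. frechet_derivative \<phi> (at (t, s)) (0, h))) (at s)"
    using frechet_derivative_affine[of \<phi> "\<lambda>s. (0, s)" s "(t, 0)", OF d bl(2)] by simp
  from fun_cong[OF frechet_derivative_at[OF this], of 1]
  show "frechet_derivative (\<lambda>s. \<phi> (t, s)) (at s) 1 = frechet_derivative \<phi> (at (t, s)) (0, 1)" by simp
qed

text \<open>For the horizontal derivative the one-dimensional formula is applied to each horizontal
  slice of the test function and integrated over heights. For the vertical one, the function is
  constant along vertical lines and the vertical derivative of a test function integrates to zero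
  there.\<close>

lemma has_weak_deriv_lift_fst:
  fixes w g :: "real \<Rightarrow> real"
  assumes w: "w \<in> L2 (I_dom l)" and g: "g \<in> L2 (I_dom l)" and wd: "has_weak_deriv (I_dom l) 1 w g"
  shows "has_weak_deriv (S_dom l) (1, 0) (\<lambda>x. w (fst x)) (\<lambda>x. g (fst x))"
    "has_weak_deriv (S_dom l) (0, 1) (\<lambda>x. w (fst x)) (\<lambda>x. 0)"
proof -
  obtain u where u [measurable]: "u \<in> borel_measurable borel" and u0: "\<And>x. x \<notin> I_dom l \<Longrightarrow> u x = 0"
    and wu: "AE x in lebesgue_on (I_dom l). w x = u x" and iu: "integrable lborel u"
    using L2_borel_representative[OF domains(1,2) w] by blast
  obtain k where k [measurable]: "k \<in> borel_measurable borel" and k0: "\<And>x. x \<notin> I_dom l \<Longrightarrow> k x = 0"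
    and gk: "AE x in lebesgue_on (I_dom l). g x = k x" and ik: "integrable lborel k"
    using L2_borel_representative[OF domains(1,2) g] by blast
  let ?U = "\<lambda>x :: real \<times> real. indicator J_dom (snd x) * u (fst x)" and ?K = "\<lambda>x :: real \<times> real. indicator J_dom (snd x) * k (fst x)"
  have U0: "?U x = 0" "?K x = 0" if "x \<notin> S_dom l" for x
    using that u0 k0 by (cases x; auto simp: S_dom_eq indicator_def)+
  have inS: "AE x in lebesgue_on (S_dom l). x \<in> S_dom l" by (rule AE_I2) simp
  have ae: "AE x in lebesgue_on (S_dom l). ?U x = w (fst x)" "AE x in lebesgue_on (S_dom l). ?K x = g (fst x)"
  proof -
    show "AE x in lebesgue_on (S_dom l). ?U x = w (fst x)"
      using AE_lift_fst[OF wu] inS by eventually_elim (auto simp: S_dom_eq)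
    show "AE x in lebesgue_on (S_dom l). ?K x = g (fst x)"
      using AE_lift_fst[OF gk] inS by eventually_elim (auto simp: S_dom_eq)
  qed
  note iU = integrable_lift_fst(1)[OF u iu] and iK = integrable_lift_fst(1)[OF k ik]
  have mUK: "?U \<in> borel_measurable borel" "?K \<in> borel_measurable borel"
    using borel_measurable_integrable[OF iU] borel_measurable_integrable[OF iK] by simp_all
  have li: "locally_integrable (S_dom l) (\<lambda>x. w (fst x))" "locally_integrable (S_dom l) (\<lambda>x. g (fst x))"
    using L2_integrable(2)[OF domains(9,10) lift_fst(1)] w g by auto
  have liU: "locally_integrable (S_dom l) ?U" "locally_integrable (S_dom l) ?K"
    by (rule locally_integrable_AE[OF domains(9) li(1)], use ae(1) in eventually_elim, simp)
       (rule locally_integrable_AE[OF domains(9) li(2)], use ae(2) in eventually_elim, simp)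
  have wd': "has_weak_deriv (I_dom l) 1 u k" by (rule has_weak_deriv_AE[OF domains(1) wd wu gk])
  have sl: "\<And>\<phi> t. \<phi> \<in> test_functions (S_dom l) \<Longrightarrow> t \<notin> J_dom \<Longrightarrow> \<phi> (s, t) = 0" for s
    by (metis S_dom_eq SigmaD2 test_function_support subsetD)
  have parts: "(\<integral>x. frechet_derivative \<phi> (at x) (1, 0) * ?U x \<partial>lborel) = - (\<integral>x. \<phi> x * ?K x \<partial>lborel)"
    "(\<integral>x. frechet_derivative \<phi> (at x) (0, 1) * ?U x \<partial>lborel) = 0"
    if t: "\<phi> \<in> test_functions (S_dom l)" for \<phi>
  proof -
    define d1 d2 where "d1 x = frechet_derivative \<phi> (at x) (1, 0)" and "d2 x = frechet_derivative \<phi> (at x) (0, 1)" for x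
    have td: "d1 \<in> test_functions (S_dom l)" "d2 \<in> test_functions (S_dom l)"
      unfolding d1_def d2_def using test_function_deriv[OF t] by auto
    note [measurable] = test_functionsD(3)[OF t] test_functionsD(3)[OF td(1)] test_functionsD(3)[OF td(2)]
    obtain B B1 B2 where B: "\<And>x. \<bar>\<phi> x\<bar> \<le> B" "\<And>x. \<bar>d1 x\<bar> \<le> B1" "\<And>x. \<bar>d2 x\<bar> \<le> B2"
      using test_function_support[OF t] test_function_support[OF td(1)] test_function_support[OF td(2)] by metis
    have i: "integrable lborel (\<lambda>x. d1 x * ?U x)" "integrable lborel (\<lambda>x. d2 x * ?U x)" "integrable lborel (\<lambda>x. \<phi> x * ?K x)"
      by (rule integrable_bounded_mult[OF iU _ B(2)] integrable_bounded_mult[OF iU _ B(3)] integrable_bounded_mult[OF iK _ B(1)]; simp)+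
    have slice: "(\<integral>t. d1 (t, s) * u t \<partial>lborel) = - (\<integral>t. \<phi> (t, s) * k t \<partial>lborel)" for s
    proof -
      note ts = test_function_slice(1,2)[OF t[unfolded S_dom_eq], where s = s]
      note [measurable] = test_functionsD(3)[OF ts(1)] test_functionsD(3)[OF test_function_deriv[OF ts(1), of 1], simplified]
      have "(\<integral>t. frechet_derivative (\<lambda>t. \<phi> (t, s)) (at t) 1 * u t \<partial>lebesgue_on (I_dom l)) = - (\<integral>t. \<phi> (t, s) * k t \<partial>lebesgue_on (I_dom l))"
        using bspec[OF conjunct2[OF conjunct2[OF wd'[unfolded has_weak_deriv_iff[OF domains(1)]]]] ts(1)] by simp
      also have "(\<integral>t. frechet_derivative (\<lambda>t. \<phi> (t, s)) (at t) 1 * u t \<partial>lebesgue_on (I_dom l)) =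
          (\<integral>t. frechet_derivative (\<lambda>t. \<phi> (t, s)) (at t) 1 * u t \<partial>lborel)"
        by (rule integral_lebesgue_on_borel(1)) (auto simp: u0)
      also have "(\<integral>t. \<phi> (t, s) * k t \<partial>lebesgue_on (I_dom l)) = (\<integral>t. \<phi> (t, s) * k t \<partial>lborel)"
        by (rule integral_lebesgue_on_borel(1)) (auto simp: k0)
      finally show ?thesis by (simp add: ts(2) d1_def)
    qed
    have "(\<integral>x. d1 x * ?U x \<partial>lborel) = (\<integral>s. indicator J_dom s * (\<integral>t. d1 (t, s) * u t \<partial>lborel) \<partial>lborel)"
      by (simp add: integral_lborel_pair(2)[OF i(1)] mult.left_commute)
    also have "\<dots> = - (\<integral>s. indicator J_dom s * (\<integral>t. \<phi> (t, s) * k t \<partial>lborel) \<partial>lborel)"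
      unfolding slice by simp
    also have "(\<integral>s. indicator J_dom s * (\<integral>t. \<phi> (t, s) * k t \<partial>lborel) \<partial>lborel) = (\<integral>x. \<phi> x * ?K x \<partial>lborel)"
      by (simp add: integral_lborel_pair(2)[OF i(3)] mult.left_commute)
    finally show "(\<integral>x. frechet_derivative \<phi> (at x) (1, 0) * ?U x \<partial>lborel) = - (\<integral>x. \<phi> x * ?K x \<partial>lborel)"
      by (simp add: d1_def)
    have z: "(\<integral>s. d2 (t, s) \<partial>lborel) = 0" for t
    proof -
      note ts = test_function_slice(3,4)[OF t[unfolded S_dom_eq], where t = t]
      have tds: "(\<lambda>s. frechet_derivative (\<lambda>s. \<phi> (t, s)) (at s) 1) \<in> test_functions J_dom"
        by (rule test_function_deriv[OF ts(1)]) simp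
      obtain K where K: "compact K" "\<And>s. s \<notin> K \<Longrightarrow> \<phi> (t, s) = 0" using test_function_support[OF ts(1)] by metis
      obtain K' where K': "compact K'" "\<And>s. s \<notin> K' \<Longrightarrow> frechet_derivative (\<lambda>s. \<phi> (t, s)) (at s) 1 = 0"
        using test_function_support[OF tds] by metis
      have "integral\<^sup>L lborel (\<lambda>s. frechet_derivative (\<lambda>s. \<phi> (t, s)) (at s) 1) = 0"
        by (rule integral_deriv_compact_support[OF test_functionsD(4)[OF ts(1)] test_functionsD(2)[OF tds] compact_Un[OF K(1) K'(1)]])
           (use K K' in auto)
      then show ?thesis by (simp add: ts(2) d2_def)
    qed
    have "(\<integral>x. d2 x * ?U x \<partial>lborel) = (\<integral>t. (\<integral>s. d2 (t, s) * u t \<partial>lborel) \<partial>lborel)"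
    proof -
      \<comment> \<open>The cutoff may be dropped because the test function already vanishes outside
        the cross section.\<close>
      have "d2 (t, s) * (indicator J_dom s * u t) = d2 (t, s) * u t" for t s
        using sl[OF td(2), of s t] by (auto simp: indicator_def)
      then show ?thesis using integral_lborel_pair(1)[OF i(2)] by (simp only: fst_conv snd_conv)
    qed
    also have "\<dots> = 0" by (simp add: z)
    finally show "(\<integral>x. frechet_derivative \<phi> (at x) (0, 1) * ?U x \<partial>lborel) = 0" by (simp add: d2_def)
  qed
  have on: "integral\<^sup>L (lebesgue_on (S_dom l)) (\<lambda>x. \<phi> x * ?U x) = integral\<^sup>L lborel (\<lambda>x. \<phi> x * ?U x)"
    "integral\<^sup>L (lebesgue_on (S_dom l)) (\<lambda>x. \<phi> x * ?K x) = integral\<^sup>L lborel (\<lambda>x. \<phi> x * ?K x)"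
    if "\<phi> \<in> test_functions (S_dom l)" for \<phi>
    using borel_measurable_times[OF test_functionsD(3)[OF that] mUK(1)] borel_measurable_times[OF test_functionsD(3)[OF that] mUK(2)] U0
    by (simp_all add: integral_lebesgue_on_borel(1))
  have b: "(1, 0) \<in> (Basis :: (real \<times> real) set)" "(0, 1) \<in> (Basis :: (real \<times> real) set)" by auto
  have "has_weak_deriv (S_dom l) (1, 0) ?U ?K"
    unfolding has_weak_deriv_iff[OF domains(9)]
    using liU parts(1) on(1)[OF test_function_deriv[OF _ b(1)]] on(2) by simp
  then show "has_weak_deriv (S_dom l) (1, 0) (\<lambda>x. w (fst x)) (\<lambda>x. g (fst x))"
    by (rule has_weak_deriv_AE[OF domains(9) _ ae])
  have "locally_integrable (S_dom l) (\<lambda>x::real \<times> real. 0 :: real)" by (simp add: locally_integrable_def set_integrable_def)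
  then have "has_weak_deriv (S_dom l) (0, 1) ?U (\<lambda>x. 0)"
    unfolding has_weak_deriv_iff[OF domains(9)]
    using liU parts(2) on(1)[OF test_function_deriv[OF _ b(2)]] by simp
  then show "has_weak_deriv (S_dom l) (0, 1) (\<lambda>x. w (fst x)) (\<lambda>x. 0)"
    by (rule has_weak_deriv_AE[OF domains(9) _ ae(1)]) simp
qed


subsection \<open>Polynomials of two variables\<close>

text \<open>A normal form as sums of monomials. The original polynomial functions are generated by
  products, through which a primitive cannot be passed in an induction; on monomials derivatives and
  vertical primitives are explicit.\<close>

inductive bipoly :: "(real \<times> real \<Rightarrow> real) \<Rightarrow> bool" where
  monomial: "bipoly (\<lambda>x. c * fst x ^ i * snd x ^ j)"
| sum: "bipoly p \<Longrightarrow> bipoly q \<Longrightarrow> bipoly (\<lambda>x. p x + q x)"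

lemma bipoly_mult:
  assumes "bipoly p" "bipoly q"
  shows "bipoly (\<lambda>x. p x * q x)"
proof -
  have mono: "bipoly (\<lambda>x. (c * fst x ^ i * snd x ^ j) * q x)" if "bipoly q" for c i j q
    using that
  proof induction
    case (monomial d m n)
    have "bipoly (\<lambda>x. (c * d) * fst x ^ (i + m) * snd x ^ (j + n))" by (rule bipoly.monomial)
    then show ?case by (simp add: power_add mult_ac)
  next
    case (sum p q)
    from bipoly.sum[OF sum.IH] show ?case by (simp add: distrib_left)
  qed
  from assms(1) show ?thesis
  proof induction
    case (monomial c i j)
    show ?case by (rule mono[OF assms(2)])
  next
    case (sum p p')
    from bipoly.sum[OF sum.IH] show ?case by (simp add: distrib_right)
  qed
qed

lemma polynomial_bipoly:
  fixes p :: "real \<times> real \<Rightarrow> real"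
  assumes "real_polynomial_function p"
  shows "bipoly p"
  using assms
proof induction
  case (linear f)
  note l = bounded_linear.linear[OF linear]
  define a b where "a = f (1, 0)" and "b = f (0, 1)"
  have "bipoly (\<lambda>x. a * fst x ^ 1 * snd x ^ 0 + b * fst x ^ 0 * snd x ^ 1)"
    by (rule bipoly.sum[OF bipoly.monomial bipoly.monomial])
  also have "(\<lambda>x. a * fst x ^ 1 * snd x ^ 0 + b * fst x ^ 0 * snd x ^ 1) = f"
  proof
    fix x :: "real \<times> real"
    have "fst x *\<^sub>R (1, 0) + snd x *\<^sub>R (0, 1) = x" by (simp add: prod_eq_iff)
    then have "f x = f (fst x *\<^sub>R (1, 0) + snd x *\<^sub>R (0, 1))" by (simp only:)
    also have "\<dots> = fst x * a + snd x * b"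
      by (simp only: linear_add[OF l] linear_cmul[OF l] real_scaleR_def a_def b_def)
    finally show "a * fst x ^ 1 * snd x ^ 0 + b * fst x ^ 0 * snd x ^ 1 = f x" by simp
  qed
  finally show ?case .
next
  case (const c)
  show ?case using bipoly.monomial[of c 0 0] by simp
next
  case (add f g)
  then show ?case by (intro bipoly.sum)
next
  case (mult f g)
  then show ?case by (intro bipoly_mult)
qed

lemma bipoly_continuous: "bipoly p \<Longrightarrow> continuous_on A p"
  by (induction rule: bipoly.induct) (auto intro!: continuous_intros)

text \<open>A single function \<open>p12\<close> serves for both mixed derivatives. This builds in
  Schwarz symmetry, which for monomials is the commutation of two integer factors.\<close>

lemma bipoly_deriv:
  assumes "bipoly p"
  obtains p1 p2 p11 p12 p22 where "bipoly p1" "bipoly p2" "bipoly p11" "bipoly p12" "bipoly p22"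
    "\<And>x. (p has_derivative (\<lambda>h. fst h * p1 x + snd h * p2 x)) (at x)"
    "\<And>x. (p1 has_derivative (\<lambda>h. fst h * p11 x + snd h * p12 x)) (at x)"
    "\<And>x. (p2 has_derivative (\<lambda>h. fst h * p12 x + snd h * p22 x)) (at x)"
proof -
  have monod: "((\<lambda>x. c * fst x ^ i * snd x ^ j) has_derivative
      (\<lambda>h. fst h * ((c * real i) * fst x ^ (i - 1) * snd x ^ j) + snd h * ((c * real j) * fst x ^ i * snd x ^ (j - 1)))) (at x)"
    for c i j and x :: "real \<times> real"
  proof -
    have "((\<lambda>x. c * (fst x ^ i * snd x ^ j)) has_derivative
      (\<lambda>h. c * (fst x ^ i * (real j * snd h * snd x ^ (j - 1)) + (real i * fst h * fst x ^ (i - 1)) * snd x ^ j))) (at x)"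
      by (intro has_derivative_mult_right has_derivative_mult has_derivative_power has_derivative_fst has_derivative_snd has_derivative_ident)
    then show ?thesis by (simp add: algebra_simps)
  qed
  have addd: "((\<lambda>x. p x + q x) has_derivative (\<lambda>h. fst h * (p1 x + q1 x) + snd h * (p2 x + q2 x))) (at x)"
    if "(p has_derivative (\<lambda>h. fst h * p1 x + snd h * p2 x)) (at x)" "(q has_derivative (\<lambda>h. fst h * q1 x + snd h * q2 x)) (at x)"
    for p q p1 p2 q1 q2 :: "real \<times> real \<Rightarrow> real" and x
    using has_derivative_add[OF that] by (simp add: algebra_simps)
  from assms have "\<exists>p1 p2 p11 p12 p22. bipoly p1 \<and> bipoly p2 \<and> bipoly p11 \<and> bipoly p12 \<and> bipoly p22 \<and>
    (\<forall>x. (p has_derivative (\<lambda>h. fst h * p1 x + snd h * p2 x)) (at x)) \<and>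
    (\<forall>x. (p1 has_derivative (\<lambda>h. fst h * p11 x + snd h * p12 x)) (at x)) \<and>
    (\<forall>x. (p2 has_derivative (\<lambda>h. fst h * p12 x + snd h * p22 x)) (at x))"
  proof induction
    case (monomial c i j)
    have com: "c * real j * real i = c * real i * real j" by simp
    show ?case
      by (rule exI[of _ "\<lambda>x. (c * real i) * fst x ^ (i - 1) * snd x ^ j"],
          rule exI[of _ "\<lambda>x. (c * real j) * fst x ^ i * snd x ^ (j - 1)"],
          rule exI[of _ "\<lambda>x. (c * real i * real (i - 1)) * fst x ^ (i - 1 - 1) * snd x ^ j"],
          rule exI[of _ "\<lambda>x. (c * real i * real j) * fst x ^ (i - 1) * snd x ^ (j - 1)"],
          rule exI[of _ "\<lambda>x. (c * real j * real (j - 1)) * fst x ^ i * snd x ^ (j - 1 - 1)"],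
          intro conjI allI)
         (rule bipoly.monomial monod[of c i j] monod[of "c * real i" "i - 1" j] monod[of "c * real j" i "j - 1", unfolded com])+
  next
    case (sum p q)
    from sum.IH(1) obtain p1 p2 p11 p12 p22 where p: "bipoly p1" "bipoly p2" "bipoly p11" "bipoly p12" "bipoly p22"
      "\<And>x. (p has_derivative (\<lambda>h. fst h * p1 x + snd h * p2 x)) (at x)"
      "\<And>x. (p1 has_derivative (\<lambda>h. fst h * p11 x + snd h * p12 x)) (at x)"
      "\<And>x. (p2 has_derivative (\<lambda>h. fst h * p12 x + snd h * p22 x)) (at x)"
      by (elim exE conjE) (rule that; (assumption | erule spec))
    from sum.IH(2) obtain q1 q2 q11 q12 q22 where q: "bipoly q1" "bipoly q2" "bipoly q11" "bipoly q12" "bipoly q22"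
      "\<And>x. (q has_derivative (\<lambda>h. fst h * q1 x + snd h * q2 x)) (at x)"
      "\<And>x. (q1 has_derivative (\<lambda>h. fst h * q11 x + snd h * q12 x)) (at x)"
      "\<And>x. (q2 has_derivative (\<lambda>h. fst h * q12 x + snd h * q22 x)) (at x)"
      by (elim exE conjE) (rule that; (assumption | erule spec))
    show ?case
      by (rule exI[of _ "\<lambda>x. p1 x + q1 x"], rule exI[of _ "\<lambda>x. p2 x + q2 x"], rule exI[of _ "\<lambda>x. p11 x + q11 x"],
          rule exI[of _ "\<lambda>x. p12 x + q12 x"], rule exI[of _ "\<lambda>x. p22 x + q22 x"], intro conjI allI)
         (rule bipoly.sum[OF p(1) q(1)] bipoly.sum[OF p(2) q(2)] bipoly.sum[OF p(3) q(3)] bipoly.sum[OF p(4) q(4)]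
           bipoly.sum[OF p(5) q(5)] addd[OF p(6) q(6)] addd[OF p(7) q(7)] addd[OF p(8) q(8)])+
  qed
  then show ?thesis
    by (elim exE conjE) (rule that; (assumption | erule spec))
qed

text \<open>The horizontal derivative of the primitive is recorded too: it reappears as an error
  term in the strains of the recovery sequence and has to be bounded.\<close>

lemma bipoly_vertical_antiderivative:
  assumes "bipoly q"
  obtains p p1 where "bipoly p" "bipoly p1" "\<And>x. (p has_derivative (\<lambda>h. fst h * p1 x + snd h * q x)) (at x)"
proof -
  from assms have "\<exists>p p1. bipoly p \<and> bipoly p1 \<and> (\<forall>x. (p has_derivative (\<lambda>h. fst h * p1 x + snd h * q x)) (at x))"
  proof induction
    case (monomial c i j)
    have "((\<lambda>x. (c / real (Suc j)) * fst x ^ i * snd x ^ Suc j) has_derivative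
      (\<lambda>h. fst h * ((c / real (Suc j) * real i) * fst x ^ (i - 1) * snd x ^ Suc j) + snd h * (c * fst x ^ i * snd x ^ j))) (at x)"
      for x :: "real \<times> real"
    proof -
      have "((\<lambda>x. (c / real (Suc j)) * (fst x ^ i * snd x ^ Suc j)) has_derivative
        (\<lambda>h. (c / real (Suc j)) * (fst x ^ i * (real (Suc j) * snd h * snd x ^ (Suc j - 1)) + (real i * fst h * fst x ^ (i - 1)) * snd x ^ Suc j))) (at x)"
        by (intro has_derivative_mult_right has_derivative_mult has_derivative_power has_derivative_fst has_derivative_snd has_derivative_ident)
      then show ?thesis by (simp add: field_simps del: of_nat_Suc power_Suc)
    qed
    then show ?case
      by (intro exI[of _ "\<lambda>x. (c / real (Suc j)) * fst x ^ i * snd x ^ Suc j"] exI conjI allI)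
         (rule bipoly.monomial, rule bipoly.monomial, assumption)
  next
    case (sum q q')
    from sum.IH(1) obtain p p1 where p: "bipoly p" "bipoly p1" "\<And>x. (p has_derivative (\<lambda>h. fst h * p1 x + snd h * q x)) (at x)"
      by (elim exE conjE) (rule that; (assumption | erule spec))
    from sum.IH(2) obtain p' p1' where p': "bipoly p'" "bipoly p1'" "\<And>x. (p' has_derivative (\<lambda>h. fst h * p1' x + snd h * q' x)) (at x)"
      by (elim exE conjE) (rule that; (assumption | erule spec))
    have "((\<lambda>x. p x + p' x) has_derivative (\<lambda>h. fst h * (p1 x + p1' x) + snd h * (q x + q' x))) (at x)" for x
      using has_derivative_add[OF p(3)[of x] p'(3)[of x]] by (simp add: algebra_simps)
    then show ?case
      by (intro exI[of _ "\<lambda>x. p x + p' x"] exI conjI allI) (rule bipoly.sum[OF p(1) p'(1)], rule bipoly.sum[OF p(2) p'(2)], assumption)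
  qed
  then show ?thesis
    by (elim exE conjE) (rule that; (assumption | erule spec))
qed

lemma plane_C1_has_weak_deriv:
  fixes p :: "real \<times> real \<Rightarrow> real"
  assumes "\<And>x. (p has_derivative (\<lambda>h. fst h * p1 x + snd h * p2 x)) (at x)"
    "continuous_on UNIV p1" "continuous_on UNIV p2"
  shows "has_weak_deriv (S_dom l) (1, 0) p p1" "has_weak_deriv (S_dom l) (0, 1) p p2"
  using C1_has_weak_deriv[of "S_dom l" "(1, 0)", OF domains(9) _ assms(1)]
    C1_has_weak_deriv[of "S_dom l" "(0, 1)", OF domains(9) _ assms(1)] assms(2,3) by auto

lemma weak_deriv_test:
  fixes f g :: "'a::euclidean_space \<Rightarrow> real"
  assumes "open \<Omega>" "has_weak_deriv \<Omega> b f g" "\<phi> \<in> test_functions \<Omega>"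
  shows "(\<integral>x. frechet_derivative \<phi> (at x) b * f x \<partial>lebesgue_on \<Omega>) = - (\<integral>x. \<phi> x * g x \<partial>lebesgue_on \<Omega>)"
  using assms(2,3) unfolding has_weak_deriv_iff[OF assms(1)] by simp

lemma test_functions_L2:
  "open \<Omega> \<Longrightarrow> bounded \<Omega> \<Longrightarrow> \<phi> \<in> test_functions \<Omega>' \<Longrightarrow> \<phi> \<in> L2 \<Omega>"
  by (rule continuous_L2[OF _ _ test_functionsD(2)])

lemma L2_inner_integrable:
  fixes f g :: "'a::euclidean_space \<Rightarrow> real"
  assumes "open \<Omega>" "f \<in> L2 \<Omega>" "g \<in> L2 \<Omega>"
  shows "integrable (lebesgue_on \<Omega>) (\<lambda>x. f x * g x)"
    "\<bar>integral\<^sup>L (lebesgue_on \<Omega>) (\<lambda>x. f x * g x)\<bar> \<le>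
      sqrt (integral\<^sup>L (lebesgue_on \<Omega>) (\<lambda>x. (f x)\<^sup>2)) * sqrt (integral\<^sup>L (lebesgue_on \<Omega>) (\<lambda>x. (g x)\<^sup>2))"
  using Cauchy_Schwarz_integral(1,3)[of f "lebesgue_on \<Omega>" g] assms by (auto simp: L2_iff)

text \<open>Pairing with polynomials avoids the pointwise symmetry of second derivatives.\<close>

lemma test_function_mixed_partials:
  assumes t: "\<phi> \<in> test_functions (S_dom l)"
  defines "d1 \<equiv> \<lambda>x. frechet_derivative \<phi> (at x) (1, 0)" and "d2 \<equiv> \<lambda>x. frechet_derivative \<phi> (at x) (0, 1)"
  shows "AE x in lebesgue_on (S_dom l). frechet_derivative d1 (at x) (0, 1) = frechet_derivative d2 (at x) (1, 0)"
proof -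
  let ?M = "lebesgue_on (S_dom l)" and ?S = "S_dom l"
  define d12 d21 where "d12 x = frechet_derivative d1 (at x) (0, 1)" and "d21 x = frechet_derivative d2 (at x) (1, 0)" for x
  have td: "d1 \<in> test_functions ?S" "d2 \<in> test_functions ?S" unfolding d1_def d2_def by (rule test_function_deriv[OF t], simp)+
  have td2: "d12 \<in> test_functions ?S" "d21 \<in> test_functions ?S"
    unfolding d12_def d21_def using test_function_deriv[OF td(1)] test_function_deriv[OF td(2)] by auto
  note TL = test_functions_L2[OF domains(9,10)]
  define u where "u x = d12 x - d21 x" for x
  have uL: "u \<in> L2 ?S" unfolding u_def using L2_diff[OF domains(9) TL[OF td2(1)] TL[OF td2(2)]] .
  have zero: "integral\<^sup>L ?M (\<lambda>x. u x * p x) = 0" if p: "real_polynomial_function p" for p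
  proof -
    obtain p1 p2 p11 p12 p22 where bp: "bipoly p1" "bipoly p2" "bipoly p11" "bipoly p12" "bipoly p22"
      and d: "\<And>x. (p has_derivative (\<lambda>h. fst h * p1 x + snd h * p2 x)) (at x)"
       "\<And>x. (p1 has_derivative (\<lambda>h. fst h * p11 x + snd h * p12 x)) (at x)"
       "\<And>x. (p2 has_derivative (\<lambda>h. fst h * p12 x + snd h * p22 x)) (at x)"
      by (rule bipoly_deriv[OF polynomial_bipoly[OF p]]) (rule that)
    note c = bp[THEN bipoly_continuous, of UNIV]
    note w = plane_C1_has_weak_deriv[OF d(1) c(1,2), of l]
    note w1 = plane_C1_has_weak_deriv[OF d(2) c(3,4), of l]
    note w2 = plane_C1_has_weak_deriv[OF d(3) c(4,5), of l]
    have pL: "p \<in> L2 ?S" by (rule polynomial_L2[OF domains(9,10) p])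
    have "integral\<^sup>L ?M (\<lambda>x. d12 x * p x) = integral\<^sup>L ?M (\<lambda>x. \<phi> x * p12 x)"
      using weak_deriv_test[OF domains(9) w(2) td(1)] weak_deriv_test[OF domains(9) w2(1) t]
      by (simp add: d12_def d1_def)
    moreover have "integral\<^sup>L ?M (\<lambda>x. d21 x * p x) = integral\<^sup>L ?M (\<lambda>x. \<phi> x * p12 x)"
      using weak_deriv_test[OF domains(9) w(1) td(2)] weak_deriv_test[OF domains(9) w1(2) t]
      by (simp add: d21_def d2_def)
    ultimately show ?thesis
      using L2_inner_integrable(1)[OF domains(9) TL[OF td2(1)] pL] L2_inner_integrable(1)[OF domains(9) TL[OF td2(2)] pL]
      by (simp add: u_def left_diff_distrib)
  qed
  \<comment> \<open>Orthogonality to all polynomials gives that the squared norm \<open>U\<close> of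
    \<open>u\<close> equals its pairing with \<open>u - p\<close>. Cauchy-Schwarz then bounds
    \<open>U\<close> by the squared distance \<open>V\<close> to \<open>p\<close>, which density
    makes arbitrarily small.\<close>
  have small: "integral\<^sup>L ?M (\<lambda>x. (u x)\<^sup>2) \<le> e" if e0: "e > 0" for e
  proof -
    obtain p where p: "real_polynomial_function p" "integral\<^sup>L ?M (\<lambda>x. (u x - p x)\<^sup>2) < e"
      using conjunct2[OF L2_polynomials_dense[OF domains(9,10) uL, unfolded poly_approximable_def], rule_format, OF e0]
      by (elim exE conjE) (rule that)
    have pL: "p \<in> L2 ?S" by (rule polynomial_L2[OF domains(9,10) p(1)])
    have dL: "(\<lambda>x. u x - p x) \<in> L2 ?S" by (rule L2_diff[OF domains(9) uL pL])
    define U V where "U = integral\<^sup>L ?M (\<lambda>x. (u x)\<^sup>2)" and "V = integral\<^sup>L ?M (\<lambda>x. (u x - p x)\<^sup>2)"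
    have "U = integral\<^sup>L ?M (\<lambda>x. u x * (u x - p x) + u x * p x)"
      by (simp add: U_def power2_eq_square algebra_simps)
    also have "\<dots> = integral\<^sup>L ?M (\<lambda>x. u x * (u x - p x))"
      using L2_inner_integrable(1)[OF domains(9) uL dL] L2_inner_integrable(1)[OF domains(9) uL pL] zero[OF p(1)] by simp
    also have "\<dots> \<le> sqrt U * sqrt V"
      using L2_inner_integrable(2)[OF domains(9) uL dL] by (simp add: U_def V_def)
    finally have "sqrt U * sqrt U \<le> sqrt U * sqrt V" by (simp add: U_def)
    moreover have "0 \<le> U" "0 \<le> V" by (simp_all add: U_def V_def)
    ultimately have "U \<le> V"
      by (metis mult_le_cancel_left_pos order_le_less real_sqrt_gt_0_iff real_sqrt_le_iff)
    then show ?thesis using p(2) by (simp add: U_def V_def)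
  qed
  have "integral\<^sup>L ?M (\<lambda>x. (u x)\<^sup>2) \<le> 0" by (rule field_le_epsilon) (use small in simp)
  then have "integral\<^sup>L ?M (\<lambda>x. (u x)\<^sup>2) = 0" by (simp add: antisym)
  then have "AE x in ?M. (u x)\<^sup>2 = 0"
    using uL by (subst (asm) integral_nonneg_eq_0_iff_AE) (auto simp: L2_iff)
  then show ?thesis by eventually_elim (simp add: u_def d12_def d21_def)
qed

text \<open>Both derivatives are moved onto the test function, exchanged there, and moved back in
  the other order. Then \<open>w12\<close> is a weak horizontal derivative of \<open>w2\<close>, and
  uniqueness identifies it with \<open>w21\<close>.\<close>

lemma weak_mixed_partials:
  fixes w :: "real \<times> real \<Rightarrow> real"
  assumes "has_weak_deriv (S_dom l) (1, 0) w w1" "has_weak_deriv (S_dom l) (0, 1) w w2"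
    "has_weak_deriv (S_dom l) (0, 1) w1 w12" "has_weak_deriv (S_dom l) (1, 0) w2 w21" "w \<in> L2 (S_dom l)"
  shows "AE x in lebesgue_on (S_dom l). w12 x = w21 x"
proof -
  let ?M = "lebesgue_on (S_dom l)"
  have "(\<integral>x. frechet_derivative \<phi> (at x) (1, 0) * w2 x \<partial>?M) = - (\<integral>x. \<phi> x * w12 x \<partial>?M)"
    if t: "\<phi> \<in> test_functions (S_dom l)" for \<phi>
  proof -
    define d1 d2 where "d1 = (\<lambda>x. frechet_derivative \<phi> (at x) (1, 0))" and "d2 = (\<lambda>x. frechet_derivative \<phi> (at x) (0, 1))"
    have td: "d1 \<in> test_functions (S_dom l)" "d2 \<in> test_functions (S_dom l)"
      unfolding d1_def d2_def by (rule test_function_deriv[OF t], simp)+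
    have m: "(\<lambda>x. frechet_derivative d1 (at x) (0, 1)) \<in> borel_measurable ?M"
      "(\<lambda>x. frechet_derivative d2 (at x) (1, 0)) \<in> borel_measurable ?M" "w \<in> borel_measurable ?M"
      using test_functions_L2[OF domains(9,10) test_function_deriv[OF td(1)]]
        test_functions_L2[OF domains(9,10) test_function_deriv[OF td(2)]] assms(5) by (auto simp: L2_iff)
    have "(\<integral>x. d1 x * w2 x \<partial>?M) = - (\<integral>x. frechet_derivative d1 (at x) (0, 1) * w x \<partial>?M)"
      using weak_deriv_test[OF domains(9) assms(2) td(1)] by simp
    also have "(\<integral>x. frechet_derivative d1 (at x) (0, 1) * w x \<partial>?M) = (\<integral>x. frechet_derivative d2 (at x) (1, 0) * w x \<partial>?M)"
      using test_function_mixed_partials[OF t] m unfolding d1_def[symmetric] d2_def[symmetric]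
      by (intro integral_cong_AE) auto
    also have "\<dots> = - (\<integral>x. d2 x * w1 x \<partial>?M)" by (rule weak_deriv_test[OF domains(9) assms(1) td(2)])
    also have "(\<integral>x. d2 x * w1 x \<partial>?M) = - (\<integral>x. \<phi> x * w12 x \<partial>?M)"
      unfolding d2_def by (rule weak_deriv_test[OF domains(9) assms(3) t])
    finally show ?thesis by (simp add: d1_def)
  qed
  then have "has_weak_deriv (S_dom l) (1, 0) w2 w12"
    unfolding has_weak_deriv_iff[OF domains(9)]
    using assms(3,4)[unfolded has_weak_deriv_iff[OF domains(9)]] by simp
  from has_weak_deriv_unique[OF domains(9) _ this assms(4)] show ?thesis by simp
qed

subsection \<open>Weak convergence\<close>

lemma weakly_convergesD:
  "weakly_converges V N u v F \<Longrightarrow> bounded_functional V N T \<Longrightarrow> ((\<lambda>i. T (u i)) \<longlongrightarrow> T v) F"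
  by (simp add: weakly_converges_def)

text \<open>All functionals used are pairings of a fixed \<open>L2\<close> function with some
  derivative \<open>D f\<close>. As a choice of representative, \<open>D\<close> is additive and
  homogeneous only almost everywhere; integration restores the exact linearity demanded of a
  functional.\<close>

lemma bounded_functional_inner:
  fixes D :: "('a::euclidean_space \<Rightarrow> 'b::real_vector) \<Rightarrow> 'c::euclidean_space \<Rightarrow> real"
  assumes \<Omega>: "open \<Omega>" and \<phi>: "\<phi> \<in> L2 \<Omega>" and D: "\<And>f. f \<in> V \<Longrightarrow> D f \<in> L2 \<Omega>"
    and add: "\<And>f g. f \<in> V \<Longrightarrow> g \<in> V \<Longrightarrow> (\<lambda>x. f x + g x) \<in> V \<and> (AE x in lebesgue_on \<Omega>. D (\<lambda>x. f x + g x) x = D f x + D g x)"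
    and scale: "\<And>f c. f \<in> V \<Longrightarrow> (\<lambda>x. c *\<^sub>R f x) \<in> V \<and> (AE x in lebesgue_on \<Omega>. D (\<lambda>x. c *\<^sub>R f x) x = c * D f x)"
    and bd: "\<And>f. f \<in> V \<Longrightarrow> integral\<^sup>L (lebesgue_on \<Omega>) (\<lambda>x. (D f x)\<^sup>2) \<le> (N f)\<^sup>2" "\<And>f. f \<in> V \<Longrightarrow> 0 \<le> N f"
  shows "bounded_functional V N (\<lambda>f. integral\<^sup>L (lebesgue_on \<Omega>) (\<lambda>x. \<phi> x * D f x))"
  unfolding bounded_functional_def
proof (intro conjI ballI allI)
  let ?M = "lebesgue_on \<Omega>"
  have m: "\<phi> \<in> borel_measurable ?M" "\<And>f. f \<in> V \<Longrightarrow> D f \<in> borel_measurable ?M" using \<phi> D \<Omega> by (auto simp: L2_iff)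
  note ii = L2_inner_integrable[OF \<Omega> \<phi> D]
  fix f assume f: "f \<in> V"
  { fix g assume g: "g \<in> V"
    have "integral\<^sup>L ?M (\<lambda>x. \<phi> x * D (\<lambda>x. f x + g x) x) = integral\<^sup>L ?M (\<lambda>x. \<phi> x * D f x + \<phi> x * D g x)"
    proof (rule integral_cong_AE)
      show "AE x in ?M. \<phi> x * D (\<lambda>x. f x + g x) x = \<phi> x * D f x + \<phi> x * D g x"
        using conjunct2[OF add[OF f g]] by eventually_elim (simp add: algebra_simps)
    qed (use m f g add in \<open>auto intro!: borel_measurable_times borel_measurable_add\<close>)
    then show "integral\<^sup>L ?M (\<lambda>x. \<phi> x * D (\<lambda>x. f x + g x) x) = integral\<^sup>L ?M (\<lambda>x. \<phi> x * D f x) + integral\<^sup>L ?M (\<lambda>x. \<phi> x * D g x)"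
      using ii(1)[OF f] ii(1)[OF g] by simp }
  fix c
  have "integral\<^sup>L ?M (\<lambda>x. \<phi> x * D (\<lambda>x. c *\<^sub>R f x) x) = integral\<^sup>L ?M (\<lambda>x. c * (\<phi> x * D f x))"
  proof (rule integral_cong_AE)
    show "AE x in ?M. \<phi> x * D (\<lambda>x. c *\<^sub>R f x) x = c * (\<phi> x * D f x)"
      using conjunct2[OF scale[OF f, of c]] by eventually_elim (simp add: algebra_simps)
  qed (use m f scale in \<open>auto intro!: borel_measurable_times\<close>)
  then show "integral\<^sup>L ?M (\<lambda>x. \<phi> x * D (\<lambda>x. c *\<^sub>R f x) x) = c * integral\<^sup>L ?M (\<lambda>x. \<phi> x * D f x)" by simp
next
  let ?M = "lebesgue_on \<Omega>"
  have "\<bar>integral\<^sup>L ?M (\<lambda>x. \<phi> x * D f x)\<bar> \<le> sqrt (integral\<^sup>L ?M (\<lambda>x. (\<phi> x)\<^sup>2)) * N f" if "f \<in> V" for f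
  proof -
    have "sqrt (integral\<^sup>L ?M (\<lambda>x. (D f x)\<^sup>2)) \<le> N f"
      using bd[OF that] by (simp add: real_le_lsqrt)
    then have "sqrt (integral\<^sup>L ?M (\<lambda>x. (\<phi> x)\<^sup>2)) * sqrt (integral\<^sup>L ?M (\<lambda>x. (D f x)\<^sup>2)) \<le> sqrt (integral\<^sup>L ?M (\<lambda>x. (\<phi> x)\<^sup>2)) * N f"
      by (intro mult_left_mono) auto
    then show ?thesis using L2_inner_integrable(2)[OF \<Omega> \<phi> D[OF that]] by linarith
  qed
  then show "\<exists>C. \<forall>f\<in>V. \<bar>integral\<^sup>L ?M (\<lambda>x. \<phi> x * D f x)\<bar> \<le> C * N f" by blast
qed

section \<open>Linear structure and norms of the Sobolev spaces\<close>

lemma W12_add: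
  fixes f g :: "'a::euclidean_space \<Rightarrow> 'b::euclidean_space"
  assumes "open \<Omega>" "f \<in> W12 \<Omega>" "g \<in> W12 \<Omega>"
  shows "(\<lambda>x. f x + g x) \<in> W12 \<Omega>"
    "b \<in> Basis \<Longrightarrow> AE x in lebesgue_on \<Omega>. wderiv \<Omega> b (\<lambda>x. f x + g x) x = wderiv \<Omega> b f x + wderiv \<Omega> b g x"
proof -
  note F = W12D[OF assms(1,2)] and G = W12D[OF assms(1,3)]
  show "(\<lambda>x. f x + g x) \<in> W12 \<Omega>"
    by (rule W12I[where g = "\<lambda>b x. wderiv \<Omega> b f x + wderiv \<Omega> b g x"])
       (rule L2_add[OF assms(1) F(1) G(1)] has_weak_deriv_add[OF assms(1) _ F(2) G(2)] L2_add[OF assms(1) F(3) G(3)]; assumption)+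
  show "b \<in> Basis \<Longrightarrow> AE x in lebesgue_on \<Omega>. wderiv \<Omega> b (\<lambda>x. f x + g x) x = wderiv \<Omega> b f x + wderiv \<Omega> b g x"
    by (rule wderiv_eq(2)[OF assms(1) _ has_weak_deriv_add[OF assms(1) _ F(2) G(2)]])
qed

lemma W12_scale:
  fixes f :: "'a::euclidean_space \<Rightarrow> 'b::euclidean_space"
  assumes "open \<Omega>" "f \<in> W12 \<Omega>"
  shows "(\<lambda>x. c *\<^sub>R f x) \<in> W12 \<Omega>"
    "b \<in> Basis \<Longrightarrow> AE x in lebesgue_on \<Omega>. wderiv \<Omega> b (\<lambda>x. c *\<^sub>R f x) x = c *\<^sub>R wderiv \<Omega> b f x"
proof -
  note F = W12D[OF assms(1,2)]
  show "(\<lambda>x. c *\<^sub>R f x) \<in> W12 \<Omega>"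
    by (rule W12I[where g = "\<lambda>b x. c *\<^sub>R wderiv \<Omega> b f x"])
       (rule L2_cmult[OF assms(1) F(1)] has_weak_deriv_cmult[OF assms(1) _ F(2)] L2_cmult[OF assms(1) F(3)]; assumption)+
  show "b \<in> Basis \<Longrightarrow> AE x in lebesgue_on \<Omega>. wderiv \<Omega> b (\<lambda>x. c *\<^sub>R f x) x = c *\<^sub>R wderiv \<Omega> b f x"
    by (rule wderiv_eq(2)[OF assms(1) _ has_weak_deriv_cmult[OF assms(1) _ F(2)]])
qed

text \<open>Computes iterated derivatives: the inner \<open>wderiv\<close> is an unknown
  representative, equal almost everywhere to a function \<open>g\<close> whose derivative is known,
  and weak derivatives do not see the difference.\<close>

lemma wderiv_wderiv_cong:
  fixes f :: "'a::euclidean_space \<Rightarrow> 'b::euclidean_space"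
  assumes "open \<Omega>" "b \<in> Basis" "AE x in lebesgue_on \<Omega>. f x = g x" "has_weak_deriv \<Omega> b g h"
  shows "AE x in lebesgue_on \<Omega>. wderiv \<Omega> b f x = h x"
proof -
  have "AE x in lebesgue_on \<Omega>. g x = f x" using assms(3) by eventually_elim simp
  from has_weak_deriv_AE[OF assms(1,4) this, of h] show ?thesis
    by (intro wderiv_eq(2)[OF assms(1,2)]) simp
qed

lemma W22D:
  fixes f :: "'a::euclidean_space \<Rightarrow> 'b::euclidean_space"
  assumes "f \<in> W22 \<Omega>"
  shows "f \<in> W12 \<Omega>" "b \<in> Basis \<Longrightarrow> wderiv \<Omega> b f \<in> W12 \<Omega>"
  using assms by (auto simp: W22_def)

lemma W22_add:
  fixes f g :: "'a::euclidean_space \<Rightarrow> 'b::euclidean_space"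
  assumes "open \<Omega>" "f \<in> W22 \<Omega>" "g \<in> W22 \<Omega>"
  shows "(\<lambda>x. f x + g x) \<in> W22 \<Omega>"
    "b \<in> Basis \<Longrightarrow> c \<in> Basis \<Longrightarrow> AE x in lebesgue_on \<Omega>.
      wderiv \<Omega> b (wderiv \<Omega> c (\<lambda>x. f x + g x)) x = wderiv \<Omega> b (wderiv \<Omega> c f) x + wderiv \<Omega> b (wderiv \<Omega> c g) x"
proof -
  note F = W22D[OF assms(2)] and G = W22D[OF assms(3)]
  have ae: "AE x in lebesgue_on \<Omega>. wderiv \<Omega> b f x + wderiv \<Omega> b g x = wderiv \<Omega> b (\<lambda>x. f x + g x) x" if "b \<in> Basis" for b
    using W12_add(2)[OF assms(1) F(1) G(1) that] by eventually_elim simp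
  show "(\<lambda>x. f x + g x) \<in> W22 \<Omega>"
    unfolding W22_def using W12_add(1)[OF assms(1) F(1) G(1)] W12_AE[OF assms(1) W12_add(1)[OF assms(1) F(2) G(2)] ae] by blast
  assume b: "b \<in> Basis" "c \<in> Basis"
  show "AE x in lebesgue_on \<Omega>. wderiv \<Omega> b (wderiv \<Omega> c (\<lambda>x. f x + g x)) x = wderiv \<Omega> b (wderiv \<Omega> c f) x + wderiv \<Omega> b (wderiv \<Omega> c g) x"
    by (rule wderiv_wderiv_cong[OF assms(1) b(1) W12_add(2)[OF assms(1) F(1) G(1) b(2)]
       has_weak_deriv_add[OF assms(1) b(1) W12D(2)[OF assms(1) F(2)[OF b(2)] b(1)] W12D(2)[OF assms(1) G(2)[OF b(2)] b(1)]]])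
qed

lemma W22_scale:
  fixes f :: "'a::euclidean_space \<Rightarrow> 'b::euclidean_space"
  assumes "open \<Omega>" "f \<in> W22 \<Omega>"
  shows "(\<lambda>x. k *\<^sub>R f x) \<in> W22 \<Omega>"
    "b \<in> Basis \<Longrightarrow> c \<in> Basis \<Longrightarrow> AE x in lebesgue_on \<Omega>.
      wderiv \<Omega> b (wderiv \<Omega> c (\<lambda>x. k *\<^sub>R f x)) x = k *\<^sub>R wderiv \<Omega> b (wderiv \<Omega> c f) x"
proof -
  note F = W22D[OF assms(2)]
  have ae: "AE x in lebesgue_on \<Omega>. k *\<^sub>R wderiv \<Omega> b f x = wderiv \<Omega> b (\<lambda>x. k *\<^sub>R f x) x" if "b \<in> Basis" for b
    using W12_scale(2)[OF assms(1) F(1) that, of k] by eventually_elim simp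
  show "(\<lambda>x. k *\<^sub>R f x) \<in> W22 \<Omega>"
    unfolding W22_def using W12_scale(1)[OF assms(1) F(1)] W12_AE[OF assms(1) W12_scale(1)[OF assms(1) F(2)] ae] by blast
  assume b: "b \<in> Basis" "c \<in> Basis"
  show "AE x in lebesgue_on \<Omega>. wderiv \<Omega> b (wderiv \<Omega> c (\<lambda>x. k *\<^sub>R f x)) x = k *\<^sub>R wderiv \<Omega> b (wderiv \<Omega> c f) x"
    by (rule wderiv_wderiv_cong[OF assms(1) b(1) W12_scale(2)[OF assms(1) F(1) b(2)]
       has_weak_deriv_cmult[OF assms(1) b(1) W12D(2)[OF assms(1) F(2)[OF b(2)] b(1)]]])
qed

lemma norm_W12_sq:
  fixes f :: "'a::euclidean_space \<Rightarrow> 'b::euclidean_space"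
  assumes "open \<Omega>"
  shows "(norm_W12 \<Omega> f)\<^sup>2 = (\<integral>x. (norm (f x))\<^sup>2 \<partial>lebesgue_on \<Omega>) +
     (\<Sum>b\<in>Basis. \<integral>x. (norm (wderiv \<Omega> b f x))\<^sup>2 \<partial>lebesgue_on \<Omega>)" "0 \<le> norm_W12 \<Omega> f"
    "b \<in> Basis \<Longrightarrow> (\<integral>x. (norm (wderiv \<Omega> b f x))\<^sup>2 \<partial>lebesgue_on \<Omega>) \<le> (norm_W12 \<Omega> f)\<^sup>2"
    "(\<integral>x. (norm (f x))\<^sup>2 \<partial>lebesgue_on \<Omega>) \<le> (norm_W12 \<Omega> f)\<^sup>2"
proof -
  show 1: "(norm_W12 \<Omega> f)\<^sup>2 = (\<integral>x. (norm (f x))\<^sup>2 \<partial>lebesgue_on \<Omega>) +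
     (\<Sum>b\<in>Basis. \<integral>x. (norm (wderiv \<Omega> b f x))\<^sup>2 \<partial>lebesgue_on \<Omega>)"
    unfolding norm_W12_def set_integral_lebesgue_on(1)[OF assms] by (simp add: sum_nonneg)
  show "0 \<le> norm_W12 \<Omega> f"
    unfolding norm_W12_def set_integral_lebesgue_on(1)[OF assms] by (simp add: sum_nonneg)
  show "(\<integral>x. (norm (f x))\<^sup>2 \<partial>lebesgue_on \<Omega>) \<le> (norm_W12 \<Omega> f)\<^sup>2"
    unfolding 1 by (simp add: sum_nonneg)
  assume b: "b \<in> Basis"
  have "(\<integral>x. (norm (wderiv \<Omega> b f x))\<^sup>2 \<partial>lebesgue_on \<Omega>) \<le> (\<Sum>b\<in>Basis. \<integral>x. (norm (wderiv \<Omega> b f x))\<^sup>2 \<partial>lebesgue_on \<Omega>)"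
    by (rule member_le_sum[OF b]) auto
  then show "(\<integral>x. (norm (wderiv \<Omega> b f x))\<^sup>2 \<partial>lebesgue_on \<Omega>) \<le> (norm_W12 \<Omega> f)\<^sup>2"
    unfolding 1 by (simp add: add_increasing)
qed

lemma norm_W22_sq:
  fixes f :: "'a::euclidean_space \<Rightarrow> 'b::euclidean_space"
  assumes "open \<Omega>"
  shows "(norm_W22 \<Omega> f)\<^sup>2 = (norm_W12 \<Omega> f)\<^sup>2 +
     (\<Sum>b\<in>Basis. \<Sum>c\<in>Basis. \<integral>x. (norm (wderiv \<Omega> b (wderiv \<Omega> c f) x))\<^sup>2 \<partial>lebesgue_on \<Omega>)" "0 \<le> norm_W22 \<Omega> f"
    "b \<in> Basis \<Longrightarrow> c \<in> Basis \<Longrightarrow> (\<integral>x. (norm (wderiv \<Omega> b (wderiv \<Omega> c f) x))\<^sup>2 \<partial>lebesgue_on \<Omega>) \<le> (norm_W22 \<Omega> f)\<^sup>2"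
    "(norm_W12 \<Omega> f)\<^sup>2 \<le> (norm_W22 \<Omega> f)\<^sup>2"
proof -
  show 1: "(norm_W22 \<Omega> f)\<^sup>2 = (norm_W12 \<Omega> f)\<^sup>2 +
     (\<Sum>b\<in>Basis. \<Sum>c\<in>Basis. \<integral>x. (norm (wderiv \<Omega> b (wderiv \<Omega> c f) x))\<^sup>2 \<partial>lebesgue_on \<Omega>)"
    unfolding norm_W22_def norm_W12_sq(1)[OF assms] set_integral_lebesgue_on(1)[OF assms] by (simp add: sum_nonneg)
  show "0 \<le> norm_W22 \<Omega> f"
    unfolding norm_W22_def set_integral_lebesgue_on(1)[OF assms] by (simp add: sum_nonneg)
  show "(norm_W12 \<Omega> f)\<^sup>2 \<le> (norm_W22 \<Omega> f)\<^sup>2" unfolding 1 by (simp add: sum_nonneg)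
  assume b: "b \<in> Basis" "c \<in> Basis"
  have "(\<integral>x. (norm (wderiv \<Omega> b (wderiv \<Omega> c f) x))\<^sup>2 \<partial>lebesgue_on \<Omega>) \<le>
      (\<Sum>c\<in>Basis. \<integral>x. (norm (wderiv \<Omega> b (wderiv \<Omega> c f) x))\<^sup>2 \<partial>lebesgue_on \<Omega>)"
    by (rule member_le_sum[OF b(2)]) auto
  also have "\<dots> \<le> (\<Sum>b\<in>Basis. \<Sum>c\<in>Basis. \<integral>x. (norm (wderiv \<Omega> b (wderiv \<Omega> c f) x))\<^sup>2 \<partial>lebesgue_on \<Omega>)"
    by (rule member_le_sum[OF b(1)]) (auto intro: sum_nonneg)
  also have "\<dots> \<le> (norm_W22 \<Omega> f)\<^sup>2" unfolding 1 by simp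
  finally show "(\<integral>x. (norm (wderiv \<Omega> b (wderiv \<Omega> c f) x))\<^sup>2 \<partial>lebesgue_on \<Omega>) \<le> (norm_W22 \<Omega> f)\<^sup>2" .
qed

text \<open>The contraction \<open>L\<close> selects a component of a vector field, so that the
  pairing is again with a real function; its bound by the norm keeps the functional below the
  Sobolev norm.\<close>

lemma weak_limit_W12_deriv:
  fixes u :: "'i \<Rightarrow> 'a::euclidean_space \<Rightarrow> 'b::euclidean_space" and L :: "'b \<Rightarrow> real"
  assumes \<Omega>: "open \<Omega>" and w: "weakly_converges (W12 \<Omega>) (norm_W12 \<Omega>) u v F"
    and \<phi>: "\<phi> \<in> L2 \<Omega>" and b: "b \<in> Basis" and L: "bounded_linear L" "\<And>y. \<bar>L y\<bar> \<le> norm y"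
  shows "((\<lambda>i. \<integral>x. \<phi> x * L (wderiv \<Omega> b (u i) x) \<partial>lebesgue_on \<Omega>) \<longlongrightarrow> (\<integral>x. \<phi> x * L (wderiv \<Omega> b v x) \<partial>lebesgue_on \<Omega>)) F"
proof (rule weakly_convergesD[OF w bounded_functional_inner[OF \<Omega> \<phi>, where D = "\<lambda>f x. L (wderiv \<Omega> b f x)"]])
  fix f g :: "'a \<Rightarrow> 'b" and c :: real
  assume f: "f \<in> W12 \<Omega>"
  show DL: "(\<lambda>x. L (wderiv \<Omega> b f x)) \<in> L2 \<Omega>" by (rule L2_bounded_linear[OF \<Omega> W12D(3)[OF \<Omega> f b] L(1)])
  show "0 \<le> norm_W12 \<Omega> f" by (rule norm_W12_sq[OF \<Omega>])
  have "(\<integral>x. (L (wderiv \<Omega> b f x))\<^sup>2 \<partial>lebesgue_on \<Omega>) \<le> (\<integral>x. (norm (wderiv \<Omega> b f x))\<^sup>2 \<partial>lebesgue_on \<Omega>)"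
    using DL W12D(3)[OF \<Omega> f b] power_mono[OF L(2) abs_ge_zero, of _ 2] \<Omega> by (intro integral_mono) (auto simp: L2_iff)
  then show "(\<integral>x. (L (wderiv \<Omega> b f x))\<^sup>2 \<partial>lebesgue_on \<Omega>) \<le> (norm_W12 \<Omega> f)\<^sup>2"
    using norm_W12_sq(3)[OF \<Omega> b, of f] by linarith
  show "(\<lambda>x. c *\<^sub>R f x) \<in> W12 \<Omega> \<and> (AE x in lebesgue_on \<Omega>. L (wderiv \<Omega> b (\<lambda>x. c *\<^sub>R f x) x) = c * L (wderiv \<Omega> b f x))"
  proof
    show "AE x in lebesgue_on \<Omega>. L (wderiv \<Omega> b (\<lambda>x. c *\<^sub>R f x) x) = c * L (wderiv \<Omega> b f x)"
      using W12_scale(2)[OF \<Omega> f b, of c] by eventually_elim (simp add: linear_cmul[OF bounded_linear.linear[OF L(1)]])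
  qed (rule W12_scale[OF \<Omega> f])
  assume g: "g \<in> W12 \<Omega>"
  show "(\<lambda>x. f x + g x) \<in> W12 \<Omega> \<and> (AE x in lebesgue_on \<Omega>. L (wderiv \<Omega> b (\<lambda>x. f x + g x) x) = L (wderiv \<Omega> b f x) + L (wderiv \<Omega> b g x))"
  proof
    show "AE x in lebesgue_on \<Omega>. L (wderiv \<Omega> b (\<lambda>x. f x + g x) x) = L (wderiv \<Omega> b f x) + L (wderiv \<Omega> b g x)"
      using W12_add(2)[OF \<Omega> f g b] by eventually_elim (simp add: linear_add[OF bounded_linear.linear[OF L(1)]])
  qed (rule W12_add[OF \<Omega> f g])
qed

lemma weak_limit_W22_deriv:
  fixes u :: "'i \<Rightarrow> 'a::euclidean_space \<Rightarrow> real"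
  assumes \<Omega>: "open \<Omega>" and w: "weakly_converges (W22 \<Omega>) (norm_W22 \<Omega>) u v F"
    and \<phi>: "\<phi> \<in> L2 \<Omega>" and b: "b \<in> Basis" "c \<in> Basis"
  shows "((\<lambda>i. \<integral>x. \<phi> x * wderiv \<Omega> b (u i) x \<partial>lebesgue_on \<Omega>) \<longlongrightarrow> (\<integral>x. \<phi> x * wderiv \<Omega> b v x \<partial>lebesgue_on \<Omega>)) F"
    "((\<lambda>i. \<integral>x. \<phi> x * wderiv \<Omega> b (wderiv \<Omega> c (u i)) x \<partial>lebesgue_on \<Omega>) \<longlongrightarrow> (\<integral>x. \<phi> x * wderiv \<Omega> b (wderiv \<Omega> c v) x \<partial>lebesgue_on \<Omega>)) F"
proof -
  note A = W22_add[OF \<Omega>] and S = W22_scale[OF \<Omega>]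
  show "((\<lambda>i. \<integral>x. \<phi> x * wderiv \<Omega> b (u i) x \<partial>lebesgue_on \<Omega>) \<longlongrightarrow> (\<integral>x. \<phi> x * wderiv \<Omega> b v x \<partial>lebesgue_on \<Omega>)) F"
  proof (rule weakly_convergesD[OF w bounded_functional_inner[OF \<Omega> \<phi>]])
    fix f g :: "'a \<Rightarrow> real" and k :: real
    assume f: "f \<in> W22 \<Omega>"
    note f12 = W22D(1)[OF f]
    show "wderiv \<Omega> b f \<in> L2 \<Omega>" by (rule W12D(3)[OF \<Omega> f12 b(1)])
    show "0 \<le> norm_W22 \<Omega> f" by (rule norm_W22_sq[OF \<Omega>])
    show "(\<integral>x. (wderiv \<Omega> b f x)\<^sup>2 \<partial>lebesgue_on \<Omega>) \<le> (norm_W22 \<Omega> f)\<^sup>2"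
      using norm_W12_sq(3)[OF \<Omega> b(1), of f] norm_W22_sq(4)[OF \<Omega>, of f] by simp
    show "(\<lambda>x. k *\<^sub>R f x) \<in> W22 \<Omega> \<and> (AE x in lebesgue_on \<Omega>. wderiv \<Omega> b (\<lambda>x. k *\<^sub>R f x) x = k * wderiv \<Omega> b f x)"
      using S(1)[OF f, of k] W12_scale(2)[OF \<Omega> f12 b(1), of k] by simp
    assume g: "g \<in> W22 \<Omega>"
    show "(\<lambda>x. f x + g x) \<in> W22 \<Omega> \<and> (AE x in lebesgue_on \<Omega>. wderiv \<Omega> b (\<lambda>x. f x + g x) x = wderiv \<Omega> b f x + wderiv \<Omega> b g x)"
      using A(1)[OF f g] W12_add(2)[OF \<Omega> f12 W22D(1)[OF g] b(1)] by simp
  qed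
  show "((\<lambda>i. \<integral>x. \<phi> x * wderiv \<Omega> b (wderiv \<Omega> c (u i)) x \<partial>lebesgue_on \<Omega>) \<longlongrightarrow> (\<integral>x. \<phi> x * wderiv \<Omega> b (wderiv \<Omega> c v) x \<partial>lebesgue_on \<Omega>)) F"
  proof (rule weakly_convergesD[OF w bounded_functional_inner[OF \<Omega> \<phi>, where D = "\<lambda>f. wderiv \<Omega> b (wderiv \<Omega> c f)"]])
    fix f g :: "'a \<Rightarrow> real" and k :: real
    assume f: "f \<in> W22 \<Omega>"
    show "wderiv \<Omega> b (wderiv \<Omega> c f) \<in> L2 \<Omega>" by (rule W12D(3)[OF \<Omega> W22D(2)[OF f b(2)] b(1)])
    show "0 \<le> norm_W22 \<Omega> f" by (rule norm_W22_sq[OF \<Omega>])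
    show "(\<integral>x. (wderiv \<Omega> b (wderiv \<Omega> c f) x)\<^sup>2 \<partial>lebesgue_on \<Omega>) \<le> (norm_W22 \<Omega> f)\<^sup>2"
      using norm_W22_sq(3)[OF \<Omega> b, of f] by simp
    show "(\<lambda>x. k *\<^sub>R f x) \<in> W22 \<Omega> \<and> (AE x in lebesgue_on \<Omega>. wderiv \<Omega> b (wderiv \<Omega> c (\<lambda>x. k *\<^sub>R f x)) x = k * wderiv \<Omega> b (wderiv \<Omega> c f) x)"
      using S(1)[OF f, of k] S(2)[OF f b, of k] by simp
    assume g: "g \<in> W22 \<Omega>"
    show "(\<lambda>x. f x + g x) \<in> W22 \<Omega> \<and> (AE x in lebesgue_on \<Omega>. wderiv \<Omega> b (wderiv \<Omega> c (\<lambda>x. f x + g x)) x =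
        wderiv \<Omega> b (wderiv \<Omega> c f) x + wderiv \<Omega> b (wderiv \<Omega> c g) x)"
      using A(1)[OF f g] A(2)[OF f g b] by simp
  qed
qed

text \<open>A functional bounded by a multiple of \<open>N\<close> sees a difference only through
  \<open>N\<close>. The recovery sequence converges in norm, and this is how weak convergence is
  deduced.\<close>

lemma norm_tendsto_weakly_converges:
  fixes u :: "'i \<Rightarrow> 'a \<Rightarrow> 'b::real_vector"
  assumes V: "\<And>f g. f \<in> V \<Longrightarrow> g \<in> V \<Longrightarrow> (\<lambda>x. f x + g x) \<in> V" "\<And>f c. f \<in> V \<Longrightarrow> (\<lambda>x. c *\<^sub>R f x) \<in> V"
    and u: "eventually (\<lambda>i. u i \<in> V) F" and v: "v \<in> V" and N: "((\<lambda>i. N (\<lambda>x. u i x - v x)) \<longlongrightarrow> 0) F"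
  shows "weakly_converges V N u v F"
  unfolding weakly_converges_def
proof (intro conjI u v allI impI)
  fix T assume T: "bounded_functional V N T"
  then obtain C where C: "\<And>f. f \<in> V \<Longrightarrow> \<bar>T f\<bar> \<le> C * N f" unfolding bounded_functional_def by blast
  have T1: "\<And>f g. f \<in> V \<Longrightarrow> g \<in> V \<Longrightarrow> T (\<lambda>x. f x + g x) = T f + T g"
    and T2: "\<And>f c. f \<in> V \<Longrightarrow> T (\<lambda>x. c *\<^sub>R f x) = c * T f"
    using T unfolding bounded_functional_def by blast+
  have "eventually (\<lambda>i. norm (T (u i) - T v) \<le> C * N (\<lambda>x. u i x - v x)) F"
    using u
  proof eventually_elim
    case (elim i)
    have v': "(\<lambda>x. (-1) *\<^sub>R v x) \<in> V" by (rule V(2)[OF v])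
    have "T (\<lambda>x. u i x + (-1) *\<^sub>R v x) = T (u i) + T (\<lambda>x. (-1) *\<^sub>R v x)"
      by (rule T1[OF elim v'])
    also have "T (\<lambda>x. (-1) *\<^sub>R v x) = (-1) * T v" by (rule T2[OF v])
    finally have "T (\<lambda>x. u i x - v x) = T (u i) - T v" by simp
    moreover have "(\<lambda>x. u i x - v x) \<in> V" using V(1)[OF elim v'] by simp
    ultimately show ?case using C[of "\<lambda>x. u i x - v x"] by simp
  qed
  moreover have "((\<lambda>i. C * N (\<lambda>x. u i x - v x)) \<longlongrightarrow> 0) F" using tendsto_mult_right_zero[OF N] .
  ultimately have "((\<lambda>i. T (u i) - T v) \<longlongrightarrow> 0) F" by (rule Lim_null_comparison)
  then show "((\<lambda>i. T (u i)) \<longlongrightarrow> T v) F" by (simp add: LIM_zero_iff)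
qed


subsection \<open>The liminf inequality\<close>

lemma nn_integral_on:
  fixes g :: "'a::euclidean_space \<Rightarrow> real"
  assumes "open \<Omega>"
  shows "(\<integral>\<^sup>+x\<in>\<Omega>. ennreal (g x) \<partial>lebesgue) = (\<integral>\<^sup>+x. ennreal (g x) \<partial>lebesgue_on \<Omega>)"
  by (rule nn_integral_restrict_space[OF open_sets_lebesgue[OF assms], symmetric])

lemma ennreal_coeffs: "(1/2 :: ennreal) = ennreal (1/2)" "(1/24 :: ennreal) = ennreal (1/24)"
  using divide_ennreal[of 1 2] divide_ennreal[of 1 24] by simp_all

lemma ennreal_combine:
  assumes "0 \<le> a" "0 \<le> b"
  shows "ennreal (1/2) * ennreal a + ennreal (1/24) * ennreal b = ennreal (a / 2 + b / 24)"
proof -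
  have "ennreal (1/2) * ennreal a = ennreal (1/2 * a)" "ennreal (1/24) * ennreal b = ennreal (1/24 * b)"
    using assms by (intro ennreal_mult[symmetric]; simp)+
  then have "ennreal (1/2) * ennreal a + ennreal (1/24) * ennreal b = ennreal (1/2 * a) + ennreal (1/24 * b)"
    by (simp only:)
  also have "\<dots> = ennreal (1/2 * a + 1/24 * b)" using assms by (intro ennreal_plus[symmetric]) auto
  finally show ?thesis by simp
qed

lemma E_eps_mat22:
  "E_eps l \<epsilon> y x + (1/2) *\<^sub>R tensor (grad_eps l \<epsilon> w x) (grad_eps l \<epsilon> w x) =
    mat22 (fst (D1 l y x) + (D1 l w x)\<^sup>2 / 2)
      (1 / (2 * \<epsilon>) * (fst (D2 l y x) + snd (D1 l y x)) + D1 l w x * (1 / \<epsilon> * D2 l w x) / 2)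
      (1 / (2 * \<epsilon>) * (fst (D2 l y x) + snd (D1 l y x)) + D1 l w x * (1 / \<epsilon> * D2 l w x) / 2)
      (1 / \<epsilon>\<^sup>2 * snd (D2 l y x) + (1 / \<epsilon> * D2 l w x)\<^sup>2 / 2)"
  by (rule mat22_eqI) (simp_all add: E_eps_def tensor_def grad_eps_def power2_eq_square algebra_simps)

text \<open>The quadratic form is controlled on symmetric matrices only. This symmetry makes the
  scaled Hessian symmetric almost everywhere, and it also turns a bound on \<open>D1 (D2 w)\<close>
  into one on the vertical derivative of \<open>D1 w\<close>.\<close>

lemma hess_symmetric:
  fixes w :: "real \<times> real \<Rightarrow> real"
  assumes "w \<in> W22 (S_dom l)"
  shows "AE x in lebesgue_on (S_dom l). D2 l (D1 l w) x = D1 l (D2 l w) x"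
proof -
  note w = W22D[OF assms]
  show ?thesis
    by (rule weak_mixed_partials[of l w])
       (rule W12D(2)[OF domains(9) w(1)] W12D(2)[OF domains(9) w(2)] W12D(1)[OF domains(9) w(1)]; simp)+
qed

text \<open>The square involving the lower right entry is dropped in both energies, and the shear
  square in the membrane part. Initially the strain \<open>f\<close> contains the square of an
  \<open>L2\<close> function and is merely integrable; finiteness of the energy is what puts it into
  \<open>L2\<close>.\<close>

lemma energy_lower_bound:
  fixes y :: "real \<times> real \<Rightarrow> real \<times> real" and w :: "real \<times> real \<Rightarrow> real"
  assumes pos: "D > 0" "B > 0" "q > 0"
    and Q: "\<And>a b d. Q (mat22 a b b d) = D * (d - g1 * a - g2 * b)\<^sup>2 + B * (b - k * a)\<^sup>2 + q * (a::real)\<^sup>2"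
    and y: "y \<in> W12 (S_dom l)" and w: "w \<in> W22 (S_dom l)"
    and E: "J_vK_eps Q l \<epsilon> y w \<le> ennreal c" and c: "0 \<le> c"
  defines "f \<equiv> \<lambda>x. fst (D1 l y x) + (D1 l w x)\<^sup>2 / 2"
    and "h11 \<equiv> D1 l (D1 l w)" and "h12 \<equiv> \<lambda>x. 1 / \<epsilon> * D1 l (D2 l w) x"
  shows "integrable (lebesgue_on (S_dom l)) (\<lambda>x. (f x)\<^sup>2)"
    "q / 2 * integral\<^sup>L (lebesgue_on (S_dom l)) (\<lambda>x. (f x)\<^sup>2) +
     B / 24 * integral\<^sup>L (lebesgue_on (S_dom l)) (\<lambda>x. (h12 x - k * h11 x)\<^sup>2) +
     q / 24 * integral\<^sup>L (lebesgue_on (S_dom l)) (\<lambda>x. (h11 x)\<^sup>2) \<le> c"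
proof -
  let ?M = "lebesgue_on (S_dom l)"
  note W = W22D[OF w]
  have L: "D1 l y \<in> L2 (S_dom l)" "D1 l w \<in> L2 (S_dom l)" "h11 \<in> L2 (S_dom l)" "D1 l (D2 l w) \<in> L2 (S_dom l)"
    unfolding h11_def using W12D(3)[OF domains(9) y] W12D(3)[OF domains(9) W(1)] W12D(3)[OF domains(9) W(2)] by auto
  have h12L: "h12 \<in> L2 (S_dom l)" using L2_cmult[OF domains(9) L(4), of "1 / \<epsilon>"] by (simp add: h12_def)
  have rL: "(\<lambda>x. h12 x - k * h11 x) \<in> L2 (S_dom l)"
    using L2_diff[OF domains(9) h12L L2_cmult[OF domains(9) L(3), of k]] by simp
  have ir: "integrable ?M (\<lambda>x. (h12 x - k * h11 x)\<^sup>2)" "integrable ?M (\<lambda>x. (h11 x)\<^sup>2)"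
    using rL L(3) by (auto simp: L2_iff)
  have fm: "f \<in> borel_measurable ?M"
  proof -
    have "(\<lambda>x. fst (D1 l y x)) \<in> L2 (S_dom l)" by (rule L2_bounded_linear[OF domains(9) L(1) bounded_linear_fst])
    then show ?thesis using L(2) unfolding f_def by (auto simp: L2_iff)
  qed
  have ext: "(\<integral>\<^sup>+x. ennreal (q * (f x)\<^sup>2) \<partial>?M) \<le> (\<integral>\<^sup>+x\<in>S_dom l. ennreal
      (Q (E_eps l \<epsilon> y x + (1/2) *\<^sub>R tensor (grad_eps l \<epsilon> w x) (grad_eps l \<epsilon> w x))) \<partial>lebesgue)"
    unfolding nn_integral_on[OF domains(9)] E_eps_mat22 Q f_def using pos
    by (intro nn_integral_mono ennreal_leI) auto
  have ben: "ennreal (B * integral\<^sup>L ?M (\<lambda>x. (h12 x - k * h11 x)\<^sup>2) + q * integral\<^sup>L ?M (\<lambda>x. (h11 x)\<^sup>2))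
      \<le> (\<integral>\<^sup>+x\<in>S_dom l. ennreal (Q (hess_eps l \<epsilon> w x)) \<partial>lebesgue)"
  proof -
    have "ennreal (B * integral\<^sup>L ?M (\<lambda>x. (h12 x - k * h11 x)\<^sup>2) + q * integral\<^sup>L ?M (\<lambda>x. (h11 x)\<^sup>2)) =
        ennreal (integral\<^sup>L ?M (\<lambda>x. B * (h12 x - k * h11 x)\<^sup>2 + q * (h11 x)\<^sup>2))"
      using ir by simp
    also have "\<dots> = (\<integral>\<^sup>+x. ennreal (B * (h12 x - k * h11 x)\<^sup>2 + q * (h11 x)\<^sup>2) \<partial>?M)"
      using ir pos by (intro nn_integral_eq_integral[symmetric]) auto
    also have "\<dots> \<le> (\<integral>\<^sup>+x. ennreal (Q (hess_eps l \<epsilon> w x)) \<partial>?M)"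
    proof (rule nn_integral_mono_AE)
      show "AE x in ?M. ennreal (B * (h12 x - k * h11 x)\<^sup>2 + q * (h11 x)\<^sup>2) \<le> ennreal (Q (hess_eps l \<epsilon> w x))"
        using hess_symmetric[OF w]
      proof eventually_elim
        case (elim x)
        have "hess_eps l \<epsilon> w x = mat22 (h11 x) (h12 x) (h12 x) (1 / \<epsilon>\<^sup>2 * D2 l (D2 l w) x)"
          by (simp add: hess_eps_def h11_def h12_def elim)
        then show ?case using pos by (simp add: Q ennreal_leI)
      qed
    qed
    finally show ?thesis unfolding nn_integral_on[OF domains(9)] .
  qed
  let ?A = "\<integral>\<^sup>+x. ennreal (q * (f x)\<^sup>2) \<partial>?M"
  define b where "b = (B * integral\<^sup>L ?M (\<lambda>x. (h12 x - k * h11 x)\<^sup>2) + q * integral\<^sup>L ?M (\<lambda>x. (h11 x)\<^sup>2))"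
  have b0: "b \<ge> 0" using pos by (simp add: b_def)
  have le: "ennreal (1/2) * ?A + ennreal (1/24) * ennreal b \<le> ennreal c"
    using order_trans[OF add_mono[OF mult_left_mono[OF ext, of "1/2"] mult_left_mono[OF ben, of "1/24"]]] E
    unfolding J_vK_eps_def J_ext_def J_ben_def b_def ennreal_coeffs by auto
  \<comment> \<open>Finiteness of the membrane integral is extracted first, from half of it being
    below \<open>c\<close>; only then can the estimate be read in the real numbers.\<close>
  have "?A = ennreal 2 * (ennreal (1/2) * ?A)"
    unfolding mult.assoc[symmetric] by (subst ennreal_mult[symmetric]) auto
  also have "\<dots> \<le> ennreal 2 * ennreal c"
    using order_trans[OF add_increasing2[OF zero_le order_refl] le] by (rule mult_left_mono) simp
  also have "\<dots> < \<infinity>" by (simp add: ennreal_mult_less_top)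
  finally have "?A \<noteq> \<infinity>" by simp
  then have qf: "integrable ?M (\<lambda>x. q * (f x)\<^sup>2)"
    using fm pos by (intro integrableI_nonneg) (auto simp: less_top)
  then show "integrable ?M (\<lambda>x. (f x)\<^sup>2)" using pos by simp
  have "?A = ennreal (q * integral\<^sup>L ?M (\<lambda>x. (f x)\<^sup>2))"
    using qf pos by (subst nn_integral_eq_integral) auto
  then have "ennreal ((q * integral\<^sup>L ?M (\<lambda>x. (f x)\<^sup>2)) / 2 + b / 24) \<le> ennreal c"
    using le b0 pos by (subst ennreal_combine[symmetric]) auto
  then have "(q * integral\<^sup>L ?M (\<lambda>x. (f x)\<^sup>2)) / 2 + b / 24 \<le> c"
    using c by (simp add: ennreal_le_iff)
  then show "q / 2 * integral\<^sup>L ?M (\<lambda>x. (f x)\<^sup>2) +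
     B / 24 * integral\<^sup>L ?M (\<lambda>x. (h12 x - k * h11 x)\<^sup>2) +
     q / 24 * integral\<^sup>L ?M (\<lambda>x. (h11 x)\<^sup>2) \<le> c"
    by (simp add: b_def add_divide_distrib)
qed

section \<open>Finiteness and explicit form of the limit functional\<close>

lemma W12_0_interval:
  fixes v :: "real \<Rightarrow> real"
  assumes "0 < l" "v \<in> W12 (I_dom l)" "(LINT x:I_dom l|lebesgue. v x) = 0"
  obtains M where "0 \<le> M" "AE t in lebesgue_on (I_dom l). \<bar>v t\<bar> \<le> M"
proof -
  have "integral\<^sup>L (lebesgue_on (I_dom l)) v = 0" using assms(3) set_integral_lebesgue_on(1)[OF domains(1)] by metis
  note v = W12D[OF domains(1) assms(2)]
  have b: "1 \<in> (Basis :: real set)" by simp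
  have "AE t in lebesgue_on (I_dom l). \<bar>v t\<bar> \<le> sqrt l * sqrt (integral\<^sup>L (lebesgue_on (I_dom l)) (\<lambda>x. (DI l v x)\<^sup>2))"
    by (rule sup_bound[OF assms(1) v(1) v(3)[OF b] v(2)[OF b]]) fact
  moreover have "0 \<le> sqrt l * sqrt (integral\<^sup>L (lebesgue_on (I_dom l)) (\<lambda>x. (DI l v x)\<^sup>2))"
    using assms(1) by simp
  ultimately show ?thesis using that by blast
qed

lemma L2_mult_bounded:
  fixes f g :: "'a::euclidean_space \<Rightarrow> real"
  assumes "open \<Omega>" "f \<in> L2 \<Omega>" "g \<in> borel_measurable (lebesgue_on \<Omega>)" "AE x in lebesgue_on \<Omega>. \<bar>g x\<bar> \<le> M"
  shows "(\<lambda>x. g x * f x) \<in> L2 \<Omega>"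
    "integral\<^sup>L (lebesgue_on \<Omega>) (\<lambda>x. (g x * f x)\<^sup>2) \<le> M\<^sup>2 * integral\<^sup>L (lebesgue_on \<Omega>) (\<lambda>x. (f x)\<^sup>2)"
proof -
  have f: "f \<in> borel_measurable (lebesgue_on \<Omega>)" "integrable (lebesgue_on \<Omega>) (\<lambda>x. (f x)\<^sup>2)" using assms by (auto simp: L2_iff)
  have ae: "AE x in lebesgue_on \<Omega>. (g x * f x)\<^sup>2 \<le> M\<^sup>2 * (f x)\<^sup>2"
    using assms(4)
  proof eventually_elim
    case (elim x)
    from power_mono[OF elim abs_ge_zero, of 2] show ?case by (simp add: power_mult_distrib mult_right_mono)
  qed
  have i: "integrable (lebesgue_on \<Omega>) (\<lambda>x. (g x * f x)\<^sup>2)"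
    by (rule Bochner_Integration.integrable_bound[OF integrable_mult_right[OF f(2), of "M\<^sup>2"]])
       (use f assms(3) ae in \<open>auto elim: eventually_mono\<close>)
  then show "(\<lambda>x. g x * f x) \<in> L2 \<Omega>" using f assms by (simp add: L2_iff)
  have "integral\<^sup>L (lebesgue_on \<Omega>) (\<lambda>x. (g x * f x)\<^sup>2) \<le> integral\<^sup>L (lebesgue_on \<Omega>) (\<lambda>x. M\<^sup>2 * (f x)\<^sup>2)"
    by (rule integral_mono_AE) (use i f ae in auto)
  then show "integral\<^sup>L (lebesgue_on \<Omega>) (\<lambda>x. (g x * f x)\<^sup>2) \<le> M\<^sup>2 * integral\<^sup>L (lebesgue_on \<Omega>) (\<lambda>x. (f x)\<^sup>2)" by simp
qed

lemma bounded_L2: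
  fixes g :: "'a::euclidean_space \<Rightarrow> real"
  assumes "open \<Omega>" "bounded \<Omega>" "g \<in> borel_measurable (lebesgue_on \<Omega>)" "AE x in lebesgue_on \<Omega>. \<bar>g x\<bar> \<le> M"
  shows "g \<in> L2 \<Omega>"
  using L2_mult_bounded(1)[OF assms(1) const_L2[OF assms(1,2), of 1] assms(3,4)] by simp

text \<open>The derivative of \<open>w\<close> has mean zero and a derivative in \<open>L2\<close>,
  so it is bounded, and its square is again in \<open>L2\<close>.\<close>

lemma limit_strain_L2:
  assumes l: "0 < l" and y: "y \<in> W12 (S_dom l)" and w: "w \<in> W22_0 (I_dom l)"
  shows "(\<lambda>x. fst (D1 l y x) + (DI l w (fst x))\<^sup>2 / 2) \<in> L2 (S_dom l)"
proof -
  have w': "DI l w \<in> W12 (I_dom l)" "(LINT x:I_dom l|lebesgue. DI l w x) = 0"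
    using w by (auto simp: W22_0_def W22_def)
  obtain M where "0 \<le> M" and M: "AE t in lebesgue_on (I_dom l). \<bar>DI l w t\<bar> \<le> M" by (rule W12_0_interval[OF l w'])
  have wL: "DI l w \<in> L2 (I_dom l)" using W12D(1)[OF domains(1) w'(1)] .
  have "(\<lambda>t. DI l w t * DI l w t) \<in> L2 (I_dom l)"
    by (rule L2_mult_bounded(1)[OF domains(1) wL _ M]) (use wL in \<open>simp add: L2_iff\<close>)
  from L2_cmult[OF domains(9) lift_fst(1)[OF this], of "1/2"]
  have h: "(\<lambda>x. (DI l w (fst x))\<^sup>2 / 2) \<in> L2 (S_dom l)" by (simp add: power2_eq_square)
  have a: "(\<lambda>x. fst (D1 l y x)) \<in> L2 (S_dom l)"
    by (rule L2_bounded_linear[OF domains(9) W12D(3)[OF domains(9) y] bounded_linear_fst]) simp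
  show ?thesis by (rule L2_add[OF domains(9) a h])
qed

lemma J_vK_eq:
  assumes l: "0 < l" and pos: "D > 0" "B > 0" "q > 0"
    and Q: "\<And>a b d. Q (mat22 a b b d) = D * (d - g1 * a - g2 * b)\<^sup>2 + B * (b - k * a)\<^sup>2 + q * (a::real)\<^sup>2"
    and y: "y \<in> W12 (S_dom l)" and w: "w \<in> W22_0 (I_dom l)" and \<theta>: "\<theta> \<in> W12 (I_dom l)"
  shows "J_vK Q l y w \<theta> = ennreal (
     q / 2 * integral\<^sup>L (lebesgue_on (S_dom l)) (\<lambda>x. (fst (D1 l y x) + (DI l w (fst x))\<^sup>2 / 2)\<^sup>2) +
     B / 24 * integral\<^sup>L (lebesgue_on (I_dom l)) (\<lambda>t. (DI l \<theta> t - k * DI l (DI l w) t)\<^sup>2) +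
     q / 24 * integral\<^sup>L (lebesgue_on (I_dom l)) (\<lambda>t. (DI l (DI l w) t)\<^sup>2))"
proof -
  have w': "DI l w \<in> W12 (I_dom l)" using w by (auto simp: W22_0_def W22_def)
  have L: "DI l (DI l w) \<in> L2 (I_dom l)" "DI l \<theta> \<in> L2 (I_dom l)"
    using W12D(3)[OF domains(1) w'] W12D(3)[OF domains(1) \<theta>] by auto
  have rL: "(\<lambda>t. DI l \<theta> t - k * DI l (DI l w) t) \<in> L2 (I_dom l)"
    using L2_diff[OF domains(1) L(2) L2_cmult[OF domains(1) L(1), of k]] by simp
  have i: "integrable (lebesgue_on (I_dom l)) (\<lambda>t. (DI l \<theta> t - k * DI l (DI l w) t)\<^sup>2)"
    "integrable (lebesgue_on (I_dom l)) (\<lambda>t. (DI l (DI l w) t)\<^sup>2)"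
    "integrable (lebesgue_on (S_dom l)) (\<lambda>x. (fst (D1 l y x) + (DI l w (fst x))\<^sup>2 / 2)\<^sup>2)"
    using L rL limit_strain_L2[OF l y w] by (auto simp: L2_iff)
  have 1: "(\<integral>\<^sup>+x. ennreal (q * (fst (D1 l y x) + (DI l w (fst x))\<^sup>2 / 2)\<^sup>2) \<partial>lebesgue_on (S_dom l)) =
      ennreal (q * integral\<^sup>L (lebesgue_on (S_dom l)) (\<lambda>x. (fst (D1 l y x) + (DI l w (fst x))\<^sup>2 / 2)\<^sup>2))"
    using i pos by (subst nn_integral_eq_integral) auto
  have 2: "(\<integral>\<^sup>+t. ennreal (B * (DI l \<theta> t - k * DI l (DI l w) t)\<^sup>2 + q * (DI l (DI l w) t)\<^sup>2) \<partial>lebesgue_on (I_dom l)) =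
      ennreal (B * integral\<^sup>L (lebesgue_on (I_dom l)) (\<lambda>t. (DI l \<theta> t - k * DI l (DI l w) t)\<^sup>2) +
        q * integral\<^sup>L (lebesgue_on (I_dom l)) (\<lambda>t. (DI l (DI l w) t)\<^sup>2))"
    using i pos by (subst nn_integral_eq_integral) auto
  show ?thesis
    unfolding J_vK_def nn_integral_on[OF domains(1)] nn_integral_on[OF domains(9)]
      Q1_Q0_eq[OF pos(1,2) Q] power2_abs 1 2 ennreal_coeffs
    using pos by (subst ennreal_combine) (auto simp: add_divide_distrib intro!: arg_cong[where f = ennreal])
qed

lemma lift_derivs:
  assumes w: "w \<in> W22 (I_dom l)"
  shows "AE x in lebesgue_on (S_dom l). D1 l (\<lambda>x. w (fst x)) x = DI l w (fst x)"
    "AE x in lebesgue_on (S_dom l). D1 l (D1 l (\<lambda>x. w (fst x))) x = DI l (DI l w) (fst x)"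
proof -
  note W = W22D[OF w]
  have b: "1 \<in> (Basis :: real set)" by simp
  note w1 = has_weak_deriv_lift_fst[OF W12D(1)[OF domains(1) W(1)] W12D(3)[OF domains(1) W(1) b] W12D(2)[OF domains(1) W(1) b]]
  note w2 = has_weak_deriv_lift_fst[OF W12D(1)[OF domains(1) W(2)[OF b]] W12D(3)[OF domains(1) W(2)[OF b] b] W12D(2)[OF domains(1) W(2)[OF b] b]]
  show 1: "AE x in lebesgue_on (S_dom l). D1 l (\<lambda>x. w (fst x)) x = DI l w (fst x)"
    by (rule wderiv_eq(2)[OF domains(9) _ w1(1)]) simp
  show "AE x in lebesgue_on (S_dom l). D1 l (D1 l (\<lambda>x. w (fst x))) x = DI l (DI l w) (fst x)"
    by (rule wderiv_wderiv_cong[OF domains(9) _ 1 w2(1)]) simp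
qed

lemma grad_eps_weak_deriv:
  assumes w: "w \<in> W22 (S_dom l)" and b: "b \<in> Basis"
  shows "has_weak_deriv (S_dom l) b (grad_eps l \<epsilon> w)
    (\<lambda>x. (wderiv (S_dom l) b (D1 l w) x, 1 / \<epsilon> * wderiv (S_dom l) b (D2 l w) x))"
proof -
  note W = W22D[OF w]
  have "has_weak_deriv (S_dom l) b (\<lambda>x. (1 / \<epsilon>) *\<^sub>R D2 l w x) (\<lambda>x. (1 / \<epsilon>) *\<^sub>R wderiv (S_dom l) b (D2 l w) x)"
    by (intro has_weak_deriv_cmult[OF domains(9) b] W12D(2)[OF domains(9) W(2)] b) simp
  from has_weak_deriv_Pair[OF domains(9) b W12D(2)[OF domains(9) W(2) b] this]
  show ?thesis by (simp add: grad_eps_def[abs_def])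
qed

text \<open>Failure of the inequality yields a level \<open>C\<close> below the limit energy that is
  not exceeded along some sequence of parameters tending to 0. Passing to it provides uniform energy
  bounds and the countable setting that \<open>strong_convergence\<close> requires.\<close>

theorem liminf_inequality:
  assumes l: "0 < l" and pos: "D > 0" "B > 0" "q > 0"
    and Q: "\<And>a b d. Q (mat22 a b b d) = D * (d - g1 * a - g2 * b)\<^sup>2 + B * (b - k * a)\<^sup>2 + q * (a::real)\<^sup>2"
    and ys: "\<And>\<epsilon>. \<epsilon> > 0 \<Longrightarrow> ys \<epsilon> \<in> W12_0 (S_dom l)" and ws: "\<And>\<epsilon>. \<epsilon> > 0 \<Longrightarrow> ws \<epsilon> \<in> W22_0 (S_dom l)"
    and y: "y \<in> BN_0 l" and w: "w \<in> W22_0 (I_dom l)" and \<theta>: "\<theta> \<in> W12_0 (I_dom l)"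
    and conv: "vK_converges l ys ws y w \<theta>"
  shows "J_vK Q l y w \<theta> \<le> Liminf (at_right 0) (\<lambda>\<epsilon>. J_vK_eps Q l \<epsilon> (ys \<epsilon>) (ws \<epsilon>))"
proof (rule ccontr)
  let ?M = "lebesgue_on (S_dom l)" and ?S = "S_dom l"
  assume "\<not> ?thesis"
  then obtain C where C: "C < J_vK Q l y w \<theta>" "\<not> eventually (\<lambda>\<epsilon>. C < J_vK_eps Q l \<epsilon> (ys \<epsilon>) (ws \<epsilon>)) (at_right 0)"
    unfolding le_Liminf_iff by blast
  have y12: "y \<in> W12 ?S" using y by (simp add: BN_0_def W12_0_def)
  have \<theta>12: "\<theta> \<in> W12 (I_dom l)" using \<theta> by (simp add: W12_0_def)
  have w22: "w \<in> W22 (I_dom l)" using w by (simp add: W22_0_def)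
  have b1: "1 \<in> (Basis :: real set)" by simp
  define f where "f x = fst (D1 l y x) + (DI l w (fst x))\<^sup>2 / 2" for x
  define \<omega> \<rho> where "\<omega> x = DI l (DI l w) (fst x)" and "\<rho> x = DI l \<theta> (fst x) - k * DI l (DI l w) (fst x)" for x :: "real \<times> real"
  have w1: "DI l w \<in> W12 (I_dom l)" "(LINT x:I_dom l|lebesgue. DI l w x) = 0"
    using w by (auto simp: W22_0_def W22_def)
  have L: "DI l w \<in> L2 (I_dom l)" "DI l (DI l w) \<in> L2 (I_dom l)" "DI l \<theta> \<in> L2 (I_dom l)"
    using W12D(1)[OF domains(1) w1(1)] W12D(3)[OF domains(1) w1(1) b1] W12D(3)[OF domains(1) \<theta>12 b1] .
  have rL: "(\<lambda>t. DI l \<theta> t - k * DI l (DI l w) t) \<in> L2 (I_dom l)"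
    using L2_diff[OF domains(1) L(3) L2_cmult[OF domains(1) L(2), of k]] by simp
  have \<theta>L: "(\<lambda>x. DI l \<theta> (fst x)) \<in> L2 ?S" by (rule lift_fst(1)[OF L(3)])
  have SL: "f \<in> L2 ?S" "\<omega> \<in> L2 ?S" "\<rho> \<in> L2 ?S" "(\<lambda>x. DI l w (fst x)) \<in> L2 ?S"
    unfolding f_def \<omega>_def \<rho>_def using limit_strain_L2[OF l y12 w] lift_fst(1)[OF L(2)] lift_fst(1)[OF rL] lift_fst(1)[OF L(1)] .
  define j where "j = q / 2 * integral\<^sup>L ?M (\<lambda>x. (f x)\<^sup>2) + B / 24 * integral\<^sup>L ?M (\<lambda>x. (\<rho> x)\<^sup>2) + q / 24 * integral\<^sup>L ?M (\<lambda>x. (\<omega> x)\<^sup>2)"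
  have j: "J_vK Q l y w \<theta> = ennreal j"
    unfolding J_vK_eq[OF l pos Q y12 w \<theta>12] j_def f_def \<rho>_def \<omega>_def lift_fst(3)[OF L(2)] lift_fst(3)[OF rL] ..
  obtain c where c: "0 \<le> c" "C = ennreal c" "c < j"
    using C(1) unfolding j by (cases C) (auto simp: ennreal_less_iff)
  \<comment> \<open>The negated lower limit produces arbitrarily small parameters with energy at
    most \<open>C\<close>; one is picked below each \<open>1/(n+1)\<close>.\<close>
  have "\<exists>\<epsilon>>0. \<epsilon> < inverse (real (Suc n)) \<and> J_vK_eps Q l \<epsilon> (ys \<epsilon>) (ws \<epsilon>) \<le> C" for n
  proof (rule ccontr)
    assume "\<not> ?thesis"
    then have "\<forall>\<epsilon>>0. \<epsilon> < inverse (real (Suc n)) \<longrightarrow> C < J_vK_eps Q l \<epsilon> (ys \<epsilon>) (ws \<epsilon>)" by (meson not_le)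
    then have "eventually (\<lambda>\<epsilon>. C < J_vK_eps Q l \<epsilon> (ys \<epsilon>) (ws \<epsilon>)) (at_right 0)"
      unfolding eventually_at_right_field by (intro exI[of _ "inverse (real (Suc n))"]) auto
    then show False using C(2) by simp
  qed
  then have "\<forall>n. \<exists>\<epsilon>. 0 < \<epsilon> \<and> \<epsilon> < inverse (real (Suc n)) \<and> J_vK_eps Q l \<epsilon> (ys \<epsilon>) (ws \<epsilon>) \<le> C" by blast
  from choice[OF this] obtain e where e: "\<And>n. 0 < e n" "\<And>n. e n < inverse (real (Suc n))"
    "\<And>n. J_vK_eps Q l (e n) (ys (e n)) (ws (e n)) \<le> C" by blast
  have e0: "e \<longlonglongrightarrow> 0"
    by (rule tendsto_sandwich[OF _ _ tendsto_const LIMSEQ_inverse_real_of_nat])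
       (use e in \<open>auto intro!: always_eventually less_imp_le\<close>)
  have er: "filterlim e (at_right 0) sequentially"
    unfolding filterlim_at using e0 e(1) by (auto intro!: always_eventually simp: less_imp_neq[symmetric])
  define Y W where "Y n = ys (e n)" and "W n = ws (e n)" for n
  have Y: "Y n \<in> W12 ?S" and W: "W n \<in> W22 ?S" for n
    using ys[OF e(1)] ws[OF e(1)] by (auto simp: Y_def W_def W12_0_def W22_0_def)
  define fn where "fn n x = fst (D1 l (Y n) x) + (D1 l (W n) x)\<^sup>2 / 2" for n x
  define h11 where "h11 n = D1 l (D1 l (W n))" for n
  define h12 where "h12 n x = 1 / e n * D1 l (D2 l (W n)) x" for n x
  have E: "J_vK_eps Q l (e n) (Y n) (W n) \<le> ennreal c" for n using e(3)[of n] by (simp add: Y_def W_def c(2))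
  have fn2: "integrable ?M (\<lambda>x. (fn n x)\<^sup>2)" 
    and bound: "q / 2 * integral\<^sup>L ?M (\<lambda>x. (fn n x)\<^sup>2) +
     B / 24 * integral\<^sup>L ?M (\<lambda>x. (h12 n x - k * h11 n x)\<^sup>2) + q / 24 * integral\<^sup>L ?M (\<lambda>x. (h11 n x)\<^sup>2) \<le> c" for n
    using energy_lower_bound[OF pos Q Y W E c(1)] unfolding fn_def h11_def h12_def by auto
  note W12' = W22D[OF W]
  have bs: "(1, 0) \<in> (Basis :: (real \<times> real) set)" "(0, 1) \<in> (Basis :: (real \<times> real) set)" by auto
  have hL: "h11 n \<in> L2 ?S" "D1 l (D2 l (W n)) \<in> L2 ?S" "D2 l (D1 l (W n)) \<in> L2 ?S" "D1 l (W n) \<in> L2 ?S" for n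
    unfolding h11_def using W12D(3)[OF domains(9) W12'(2)] W12D(3)[OF domains(9) W12'(1)] bs by auto
  have h12L: "h12 n \<in> L2 ?S" for n using L2_cmult[OF domains(9) hL(2), of "1 / e n" n] by (simp add: h12_def[abs_def])
  have rnL: "(\<lambda>x. h12 n x - k * h11 n x) \<in> L2 ?S" for n
    using L2_diff[OF domains(9) h12L L2_cmult[OF domains(9) hL(1), of k]] by simp
  have aL: "(\<lambda>x. fst (D1 l (Y n) x)) \<in> L2 ?S" "(\<lambda>x. fst (D1 l y x)) \<in> L2 ?S" for n
    using L2_bounded_linear[OF domains(9) W12D(3)[OF domains(9) Y bs(1)] bounded_linear_fst]
      L2_bounded_linear[OF domains(9) W12D(3)[OF domains(9) y12 bs(1)] bounded_linear_fst] .
  have nn: "0 \<le> integral\<^sup>L ?M (\<lambda>x. (g x)\<^sup>2)" for g :: "real \<times> real \<Rightarrow> real" by simp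
  have H11: "integral\<^sup>L ?M (\<lambda>x. (h11 n x)\<^sup>2) \<le> 24 * c / q" for n
  proof -
    have "q / 24 * integral\<^sup>L ?M (\<lambda>x. (h11 n x)\<^sup>2) \<le> c"
      using bound[of n] mult_nonneg_nonneg[OF _ nn[of "fn n"], of "q / 2"]
        mult_nonneg_nonneg[OF _ nn[of "\<lambda>x. h12 n x - k * h11 n x"], of "B / 24"] pos by linarith
    then show ?thesis using pos by (simp add: field_simps)
  qed
  have Hr: "integral\<^sup>L ?M (\<lambda>x. (h12 n x - k * h11 n x)\<^sup>2) \<le> 24 * c / B" for n
  proof -
    have "B / 24 * integral\<^sup>L ?M (\<lambda>x. (h12 n x - k * h11 n x)\<^sup>2) \<le> c"
      using bound[of n] mult_nonneg_nonneg[OF _ nn[of "fn n"], of "q / 2"]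
        mult_nonneg_nonneg[OF _ nn[of "h11 n"], of "q / 24"] pos by linarith
    then show ?thesis using pos by (simp add: field_simps)
  qed
  \<comment> \<open>The form controls the combination \<open>h12 - k h11\<close> and
    \<open>h11\<close> separately. Adding \<open>k h11\<close> back, at the cost of the factors 2,
    bounds the scaled twist \<open>h12\<close>.\<close>
  define H where "H = 2 * (24 * c / B) + 2 * (k\<^sup>2 * (24 * c / q))"
  have H12: "integral\<^sup>L ?M (\<lambda>x. (h12 n x)\<^sup>2) \<le> H" for n
  proof -
    have "(\<lambda>x. k * h11 n x) \<in> L2 ?S" using L2_cmult[OF domains(9) hL(1), of k] by simp
    from L2_sq_add_le[OF domains(9) rnL this, of n]
    have "integral\<^sup>L ?M (\<lambda>x. (h12 n x)\<^sup>2) \<le> 2 * integral\<^sup>L ?M (\<lambda>x. (h12 n x - k * h11 n x)\<^sup>2) + 2 * (k\<^sup>2 * integral\<^sup>L ?M (\<lambda>x. (h11 n x)\<^sup>2))"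
      by (simp add: power_mult_distrib)
    also have "\<dots> \<le> H" unfolding H_def using Hr[of n] mult_left_mono[OF H11[of n], of "k\<^sup>2"] by simp
    finally show ?thesis .
  qed
  note cv = conv[unfolded vK_converges_def]
  note c1 = conjunct1[OF cv] and c2 = conjunct1[OF conjunct2[OF cv]] and c3 = conjunct2[OF conjunct2[OF cv]]
  note seq = filterlim_compose[OF _ er]
  define d where "d n x = D1 l (W n) x - DI l w (fst x)" for n x
  have dL: "d n \<in> L2 ?S" for n unfolding d_def by (rule L2_diff[OF domains(9) hL(4) SL(4)])
  have strong: "(\<lambda>n. integral\<^sup>L ?M (\<lambda>x. (d n x)\<^sup>2)) \<longlonglongrightarrow> 0"
  proof (rule strong_convergence[OF l dL])
    show "(\<lambda>x. h11 n x - \<omega> x) \<in> L2 ?S" for n by (rule L2_diff[OF domains(9) hL(1) SL(2)])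
    show "D2 l (D1 l (W n)) \<in> L2 ?S" for n by (rule hL(3))
    note lw = has_weak_deriv_lift_fst[OF L(1,2) W12D(2)[OF domains(1) w1(1) b1]]
    show "has_weak_deriv ?S (1, 0) (d n) (\<lambda>x. h11 n x - \<omega> x)" for n
      unfolding d_def h11_def \<omega>_def
      by (rule has_weak_deriv_diff[OF domains(9) bs(1) W12D(2)[OF domains(9) W12'(2)[OF bs(1)] bs(1)] lw(1)])
    show "has_weak_deriv ?S (0, 1) (d n) (D2 l (D1 l (W n)))" for n
      unfolding d_def 
      using has_weak_deriv_diff[OF domains(9) bs(2) W12D(2)[OF domains(9) W12'(2)[OF bs(1)] bs(2)] lw(2)] by simp
    show "integral\<^sup>L ?M (\<lambda>x. (h11 n x - \<omega> x)\<^sup>2) \<le> 2 * (24 * c / q) + 2 * integral\<^sup>L ?M (\<lambda>x. (\<omega> x)\<^sup>2)" for n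
    proof -
      have "(\<lambda>x. - \<omega> x) \<in> L2 ?S" using L2_cmult[OF domains(9) SL(2), of "-1"] by simp
      from L2_sq_add_le[OF domains(9) hL(1) this, of n] H11[of n] show ?thesis by simp
    qed
    \<comment> \<open>By symmetry the vertical derivative of \<open>D1 w\<close> is
      \<open>e n\<close> times the bounded \<open>h12\<close>. This is the smallness that reduces
      compactness to one dimension.\<close>
    show "(\<lambda>n. integral\<^sup>L ?M (\<lambda>x. (D2 l (D1 l (W n)) x)\<^sup>2)) \<longlonglongrightarrow> 0"
    proof -
      have "integral\<^sup>L ?M (\<lambda>x. (D2 l (D1 l (W n)) x)\<^sup>2) \<le> (e n)\<^sup>2 * H" for n
      proof -
        have ae: "AE x in ?M. D2 l (D1 l (W n)) x = e n * h12 n x"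
          using hess_symmetric[OF W[of n]] by eventually_elim (use e(1)[of n] in \<open>simp add: h12_def\<close>)
        have "integral\<^sup>L ?M (\<lambda>x. (D2 l (D1 l (W n)) x)\<^sup>2) = integral\<^sup>L ?M (\<lambda>x. (e n * h12 n x)\<^sup>2)"
          by (rule L2_AE_integral[OF domains(9) hL(3) ae])
        then show ?thesis using H12[of n] by (simp add: power_mult_distrib mult_left_mono)
      qed
      note le = this
      have "(\<lambda>n. (e n)\<^sup>2 * H) \<longlonglongrightarrow> 0\<^sup>2 * H" by (intro tendsto_intros e0)
      then have lim: "(\<lambda>n. (e n)\<^sup>2 * H) \<longlonglongrightarrow> 0" by simp
      show ?thesis
        by (rule tendsto_sandwich[OF _ _ tendsto_const lim]) (auto simp: le)
    qed
    show "(\<lambda>n. integral\<^sup>L ?M (d n)) \<longlonglongrightarrow> 0"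
    proof -
      have "(\<lambda>n. integral\<^sup>L ?M (\<lambda>x. 1 * D1 l (W n) x)) \<longlonglongrightarrow> integral\<^sup>L ?M (\<lambda>x. 1 * D1 l (\<lambda>x. w (fst x)) x)"
        unfolding W_def by (rule seq[OF weak_limit_W22_deriv(1)[OF domains(9) c2 const_L2[OF domains(9,10)] bs(1) bs(1)]])
      moreover have "integral\<^sup>L ?M (\<lambda>x. 1 * D1 l (\<lambda>x. w (fst x)) x) = integral\<^sup>L ?M (\<lambda>x. DI l w (fst x))"
      proof (rule integral_cong_AE)
        show "AE x in ?M. 1 * D1 l (\<lambda>x. w (fst x)) x = DI l w (fst x)" using lift_derivs(1)[OF w22] by simp
        then have "AE x in ?M. DI l w (fst x) = D1 l (\<lambda>x. w (fst x)) x" by eventually_elim simp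
        from L2_AE[OF domains(9) SL(4) this] show "(\<lambda>x. 1 * D1 l (\<lambda>x. w (fst x)) x) \<in> borel_measurable ?M"
          by (simp add: L2_iff)
      qed (use SL(4) in \<open>simp add: L2_iff\<close>)
      moreover have "integral\<^sup>L ?M (d n) = integral\<^sup>L ?M (\<lambda>x. 1 * D1 l (W n) x) - integral\<^sup>L ?M (\<lambda>x. DI l w (fst x))" for n
        unfolding d_def using L2_integrable(1)[OF domains(9,10) hL(4)] L2_integrable(1)[OF domains(9,10) SL(4)] by simp
      ultimately show ?thesis by (simp add: LIM_zero_iff)
    qed
    fix s r
    have kL: "(\<lambda>x. kern s r (fst x)) \<in> L2 ?S"
      by (rule bounded_L2[OF domains(9,10), where M = 1])
         (auto intro!: measurable_restrict_space1 borel_measurable_lebesgueI measurable_compose[OF fst_snd_borel(1)] simp: kern_bound)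
    have "(\<lambda>n. integral\<^sup>L ?M (\<lambda>x. kern s r (fst x) * h11 n x)) \<longlonglongrightarrow> integral\<^sup>L ?M (\<lambda>x. kern s r (fst x) * D1 l (D1 l (\<lambda>x. w (fst x))) x)"
      unfolding W_def h11_def by (rule seq[OF weak_limit_W22_deriv(2)[OF domains(9) c2 kL bs(1) bs(1)]])
    moreover have ae: "AE x in ?M. \<omega> x = D1 l (D1 l (\<lambda>x. w (fst x))) x"
      using lift_derivs(2)[OF w22] by eventually_elim (simp add: \<omega>_def)
    moreover have "integral\<^sup>L ?M (\<lambda>x. kern s r (fst x) * D1 l (D1 l (\<lambda>x. w (fst x))) x) = integral\<^sup>L ?M (\<lambda>x. kern s r (fst x) * \<omega> x)"
    proof (rule integral_cong_AE)
      show "AE x in ?M. kern s r (fst x) * D1 l (D1 l (\<lambda>x. w (fst x))) x = kern s r (fst x) * \<omega> x"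
        using ae by eventually_elim simp
    qed (use kL SL(2) L2_AE[OF domains(9) SL(2) ae] in \<open>auto simp: L2_iff\<close>)
    moreover have "integral\<^sup>L ?M (\<lambda>x. kern s r (fst x) * (h11 n x - \<omega> x)) =
        integral\<^sup>L ?M (\<lambda>x. kern s r (fst x) * h11 n x) - integral\<^sup>L ?M (\<lambda>x. kern s r (fst x) * \<omega> x)" for n
      using L2_inner_integrable(1)[OF domains(9) kL hL(1)] L2_inner_integrable(1)[OF domains(9) kL SL(2)]
      by (simp add: right_diff_distrib)
    ultimately show "(\<lambda>n. integral\<^sup>L ?M (\<lambda>x. kern s r (fst x) * (h11 n x - \<omega> x))) \<longlonglongrightarrow> 0"
      by (simp add: LIM_zero_iff)
  qed
  have \<omega>lim: "(\<lambda>n. integral\<^sup>L ?M (\<lambda>x. \<phi> x * h11 n x)) \<longlonglongrightarrow> integral\<^sup>L ?M (\<lambda>x. \<phi> x * \<omega> x)" if \<phi>: "\<phi> \<in> L2 ?S" for \<phi>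
  proof -
    have "(\<lambda>n. integral\<^sup>L ?M (\<lambda>x. \<phi> x * h11 n x)) \<longlonglongrightarrow> integral\<^sup>L ?M (\<lambda>x. \<phi> x * D1 l (D1 l (\<lambda>x. w (fst x))) x)"
      unfolding W_def h11_def by (rule seq[OF weak_limit_W22_deriv(2)[OF domains(9) c2 \<phi> bs(1) bs(1)]])
    moreover have ae: "AE x in ?M. \<omega> x = D1 l (D1 l (\<lambda>x. w (fst x))) x"
      using lift_derivs(2)[OF w22] by eventually_elim (simp add: \<omega>_def)
    moreover have "integral\<^sup>L ?M (\<lambda>x. \<phi> x * D1 l (D1 l (\<lambda>x. w (fst x))) x) = integral\<^sup>L ?M (\<lambda>x. \<phi> x * \<omega> x)"
    proof (rule integral_cong_AE)
      show "AE x in ?M. \<phi> x * D1 l (D1 l (\<lambda>x. w (fst x))) x = \<phi> x * \<omega> x"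
        using ae by eventually_elim simp
    qed (use \<phi> SL(2) L2_AE[OF domains(9) SL(2) ae] in \<open>auto simp: L2_iff\<close>)
    ultimately show ?thesis by simp
  qed
  \<comment> \<open>The only place where the third convergence enters: the horizontal derivative of
    the second component of the scaled gradient is \<open>h12\<close>, so its weak limit is the
    derivative of \<theta>.\<close>
  have \<theta>lim: "(\<lambda>n. integral\<^sup>L ?M (\<lambda>x. \<phi> x * h12 n x)) \<longlonglongrightarrow> integral\<^sup>L ?M (\<lambda>x. \<phi> x * DI l \<theta> (fst x))" if \<phi>: "\<phi> \<in> L2 ?S" for \<phi>
  proof -
    have nsnd: "\<bar>snd z\<bar> \<le> norm z" for z :: "real \<times> real" using norm_snd_le[of "snd z" "fst z"] by simp
    have "(\<lambda>n. integral\<^sup>L ?M (\<lambda>x. \<phi> x * snd (D1 l (grad_eps l (e n) (W n)) x))) \<longlonglongrightarrow>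
        integral\<^sup>L ?M (\<lambda>x. \<phi> x * snd (D1 l (\<lambda>x. (DI l w (fst x), \<theta> (fst x))) x))"
      unfolding W_def by (rule seq[OF weak_limit_W12_deriv[OF domains(9) c3 \<phi> bs(1) bounded_linear_snd nsnd]])
    moreover have "integral\<^sup>L ?M (\<lambda>x. \<phi> x * snd (D1 l (grad_eps l (e n) (W n)) x)) = integral\<^sup>L ?M (\<lambda>x. \<phi> x * h12 n x)" for n
    proof -
      have ae: "AE x in ?M. h12 n x = snd (D1 l (grad_eps l (e n) (W n)) x)"
        using wderiv_eq(2)[OF domains(9) bs(1) grad_eps_weak_deriv[OF W bs(1), of "e n" n]]
        by eventually_elim (simp add: h12_def)
      show ?thesis
      proof (rule integral_cong_AE)
        show "AE x in ?M. \<phi> x * snd (D1 l (grad_eps l (e n) (W n)) x) = \<phi> x * h12 n x" using ae by eventually_elim simp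
      qed (use \<phi> h12L[of n] L2_AE[OF domains(9) h12L ae] in \<open>auto simp: L2_iff\<close>)
    qed
    moreover have "integral\<^sup>L ?M (\<lambda>x. \<phi> x * snd (D1 l (\<lambda>x. (DI l w (fst x), \<theta> (fst x))) x)) = integral\<^sup>L ?M (\<lambda>x. \<phi> x * DI l \<theta> (fst x))"
    proof -
      note lw = has_weak_deriv_lift_fst[OF L(1,2) W12D(2)[OF domains(1) w1(1) b1]]
      note l\<theta> = has_weak_deriv_lift_fst[OF W12D(1)[OF domains(1) \<theta>12] L(3) W12D(2)[OF domains(1) \<theta>12 b1]]
      have ae: "AE x in ?M. DI l \<theta> (fst x) = snd (D1 l (\<lambda>x. (DI l w (fst x), \<theta> (fst x))) x)"
        using wderiv_eq(2)[OF domains(9) bs(1) has_weak_deriv_Pair[OF domains(9) bs(1) lw(1) l\<theta>(1)]]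
        by eventually_elim simp
      show ?thesis
      proof (rule integral_cong_AE)
        show "AE x in ?M. \<phi> x * snd (D1 l (\<lambda>x. (DI l w (fst x), \<theta> (fst x))) x) = \<phi> x * DI l \<theta> (fst x)" using ae by eventually_elim simp
      qed (use \<phi> \<theta>L L2_AE[OF domains(9) \<theta>L ae] in \<open>auto simp: L2_iff\<close>)
    qed
    ultimately show ?thesis by simp
  qed
  have \<rho>lim: "(\<lambda>n. integral\<^sup>L ?M (\<lambda>x. \<rho> x * (h12 n x - k * h11 n x))) \<longlonglongrightarrow> integral\<^sup>L ?M (\<lambda>x. (\<rho> x)\<^sup>2)"
  proof -
    have "(\<lambda>n. integral\<^sup>L ?M (\<lambda>x. \<rho> x * h12 n x) - k * integral\<^sup>L ?M (\<lambda>x. \<rho> x * h11 n x)) \<longlonglongrightarrow>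
        integral\<^sup>L ?M (\<lambda>x. \<rho> x * DI l \<theta> (fst x)) - k * integral\<^sup>L ?M (\<lambda>x. \<rho> x * \<omega> x)"
      by (intro tendsto_intros \<theta>lim \<omega>lim SL(3))
    moreover have "integral\<^sup>L ?M (\<lambda>x. \<rho> x * (h12 n x - k * h11 n x)) =
        integral\<^sup>L ?M (\<lambda>x. \<rho> x * h12 n x) - k * integral\<^sup>L ?M (\<lambda>x. \<rho> x * h11 n x)" for n
      using L2_inner_integrable(1)[OF domains(9) SL(3) h12L] L2_inner_integrable(1)[OF domains(9) SL(3) hL(1)]
      by (simp add: right_diff_distrib mult.left_commute[of _ k])
    moreover have "integral\<^sup>L ?M (\<lambda>x. \<rho> x * DI l \<theta> (fst x)) - k * integral\<^sup>L ?M (\<lambda>x. \<rho> x * \<omega> x) = integral\<^sup>L ?M (\<lambda>x. (\<rho> x)\<^sup>2)"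
    proof -
      have "(\<rho> x)\<^sup>2 = \<rho> x * DI l \<theta> (fst x) - k * (\<rho> x * \<omega> x)" for x
        by (simp add: \<rho>_def \<omega>_def power2_eq_square algebra_simps)
      then show ?thesis
        using L2_inner_integrable(1)[OF domains(9) SL(3) \<theta>L] L2_inner_integrable(1)[OF domains(9) SL(3) SL(2)] by simp
    qed
    ultimately show ?thesis by simp
  qed
  (* Only the strain f is paired with truncations: the membrane term contains (D1 w)^2, whose weak limit
     is known against bounded functions only. *)
  have main: "q / 2 * integral\<^sup>L ?M (\<lambda>x. (\<phi> x)\<^sup>2) + B / 24 * integral\<^sup>L ?M (\<lambda>x. (\<rho> x)\<^sup>2) + q / 24 * integral\<^sup>L ?M (\<lambda>x. (\<omega> x)\<^sup>2) \<le> c"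
    if R: "0 \<le> R" and \<phi>_def: "\<phi> = (\<lambda>x. max (- R) (min R (f x)))" for R \<phi>
  proof -
    have \<phi>m: "\<phi> \<in> borel_measurable ?M" using SL(1) unfolding \<phi>_def by (auto simp: L2_iff)
    have \<phi>R: "\<bar>\<phi> x\<bar> \<le> R" for x using R by (auto simp: \<phi>_def)
    have \<phi>L: "\<phi> \<in> L2 ?S" by (rule bounded_L2[OF domains(9,10) \<phi>m, where M = R]) (simp add: \<phi>R)
    have vL: "(\<lambda>x. \<phi> x * DI l w (fst x)) \<in> L2 ?S" by (rule L2_mult_bounded(1)[OF domains(9) SL(4) \<phi>m, where M = R]) (simp add: \<phi>R)
    have ib: "integrable ?M (\<lambda>x. \<phi> x * (g x)\<^sup>2)" if "g \<in> L2 ?S" for g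
      by (rule integrable_bounded_mult[OF _ \<phi>m \<phi>R]) (use that in \<open>simp add: L2_iff\<close>)
    \<comment> \<open>The difference of squares is \<open>d^2\<close> plus twice the limit times
      \<open>d\<close>. The first part is small because \<phi> is bounded, the second by
      Cauchy-Schwarz; both use the strong convergence of \<open>d n\<close> to zero.\<close>
    have blim: "(\<lambda>n. integral\<^sup>L ?M (\<lambda>x. \<phi> x * (D1 l (W n) x)\<^sup>2)) \<longlonglongrightarrow> integral\<^sup>L ?M (\<lambda>x. \<phi> x * (DI l w (fst x))\<^sup>2)"
    proof -
      have eq: "integral\<^sup>L ?M (\<lambda>x. \<phi> x * (D1 l (W n) x)\<^sup>2) - integral\<^sup>L ?M (\<lambda>x. \<phi> x * (DI l w (fst x))\<^sup>2) =
          integral\<^sup>L ?M (\<lambda>x. \<phi> x * (d n x)\<^sup>2) + 2 * integral\<^sup>L ?M (\<lambda>x. (\<phi> x * DI l w (fst x)) * d n x)" for n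
      proof -
        have "\<phi> x * (D1 l (W n) x)\<^sup>2 - \<phi> x * (DI l w (fst x))\<^sup>2 = \<phi> x * (d n x)\<^sup>2 + 2 * ((\<phi> x * DI l w (fst x)) * d n x)" for x
          by (simp add: d_def power2_eq_square algebra_simps)
        then have "integral\<^sup>L ?M (\<lambda>x. \<phi> x * (D1 l (W n) x)\<^sup>2 - \<phi> x * (DI l w (fst x))\<^sup>2) =
            integral\<^sup>L ?M (\<lambda>x. \<phi> x * (d n x)\<^sup>2 + 2 * ((\<phi> x * DI l w (fst x)) * d n x))" by simp
        then show ?thesis
          using ib[OF hL(4)] ib[OF SL(4)] ib[OF dL] L2_inner_integrable(1)[OF domains(9) vL dL] by simp
      qed
      have b1: "\<bar>integral\<^sup>L ?M (\<lambda>x. \<phi> x * (d n x)\<^sup>2)\<bar> \<le> R * integral\<^sup>L ?M (\<lambda>x. (d n x)\<^sup>2)" for n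
      proof -
        have "\<bar>integral\<^sup>L ?M (\<lambda>x. \<phi> x * (d n x)\<^sup>2)\<bar> \<le> integral\<^sup>L ?M (\<lambda>x. \<bar>\<phi> x * (d n x)\<^sup>2\<bar>)" by (rule integral_abs_bound)
        also have "\<dots> \<le> integral\<^sup>L ?M (\<lambda>x. R * (d n x)\<^sup>2)"
        proof (rule integral_mono[OF integrable_abs[OF ib[OF dL]]])
          show "integrable ?M (\<lambda>x. R * (d n x)\<^sup>2)" using dL[of n] by (simp add: L2_iff)
          show "\<bar>\<phi> x * (d n x)\<^sup>2\<bar> \<le> R * (d n x)\<^sup>2" for x
            unfolding abs_mult using mult_right_mono[OF \<phi>R[of x], of "(d n x)\<^sup>2"] by simp
        qed
        finally show ?thesis by simp
      qed
      have "(\<lambda>n. R * integral\<^sup>L ?M (\<lambda>x. (d n x)\<^sup>2) + 2 * (sqrt (integral\<^sup>L ?M (\<lambda>x. (\<phi> x * DI l w (fst x))\<^sup>2)) * sqrt (integral\<^sup>L ?M (\<lambda>x. (d n x)\<^sup>2)))) \<longlonglongrightarrow>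
          R * 0 + 2 * (sqrt (integral\<^sup>L ?M (\<lambda>x. (\<phi> x * DI l w (fst x))\<^sup>2)) * sqrt 0)"
        by (intro tendsto_intros strong)
      then have lim: "(\<lambda>n. R * integral\<^sup>L ?M (\<lambda>x. (d n x)\<^sup>2) + 2 * (sqrt (integral\<^sup>L ?M (\<lambda>x. (\<phi> x * DI l w (fst x))\<^sup>2)) * sqrt (integral\<^sup>L ?M (\<lambda>x. (d n x)\<^sup>2)))) \<longlonglongrightarrow> 0"
        by simp
      have "\<bar>integral\<^sup>L ?M (\<lambda>x. \<phi> x * (D1 l (W n) x)\<^sup>2) - integral\<^sup>L ?M (\<lambda>x. \<phi> x * (DI l w (fst x))\<^sup>2)\<bar> \<le>
          R * integral\<^sup>L ?M (\<lambda>x. (d n x)\<^sup>2) + 2 * (sqrt (integral\<^sup>L ?M (\<lambda>x. (\<phi> x * DI l w (fst x))\<^sup>2)) * sqrt (integral\<^sup>L ?M (\<lambda>x. (d n x)\<^sup>2)))" for n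
        unfolding eq using b1[of n] L2_inner_integrable(2)[OF domains(9) vL dL, of n] by linarith
      then have "(\<lambda>n. integral\<^sup>L ?M (\<lambda>x. \<phi> x * (D1 l (W n) x)\<^sup>2) - integral\<^sup>L ?M (\<lambda>x. \<phi> x * (DI l w (fst x))\<^sup>2)) \<longlonglongrightarrow> 0"
        by (intro Lim_null_comparison[OF _ lim]) (auto intro!: always_eventually)
      then show ?thesis by (simp add: LIM_zero_iff)
    qed
    have nfst: "\<bar>fst z\<bar> \<le> norm z" for z :: "real \<times> real" using norm_fst_le[of "fst z" "snd z"] by simp
    have alim: "(\<lambda>n. integral\<^sup>L ?M (\<lambda>x. \<phi> x * fst (D1 l (Y n) x))) \<longlonglongrightarrow> integral\<^sup>L ?M (\<lambda>x. \<phi> x * fst (D1 l y x))"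
      unfolding Y_def by (rule seq[OF weak_limit_W12_deriv[OF domains(9) c1 \<phi>L bs(1) bounded_linear_fst nfst]])
    have flim: "(\<lambda>n. integral\<^sup>L ?M (\<lambda>x. \<phi> x * fn n x)) \<longlonglongrightarrow> integral\<^sup>L ?M (\<lambda>x. \<phi> x * f x)"
    proof -
      have "(\<lambda>n. integral\<^sup>L ?M (\<lambda>x. \<phi> x * fst (D1 l (Y n) x)) + 1/2 * integral\<^sup>L ?M (\<lambda>x. \<phi> x * (D1 l (W n) x)\<^sup>2)) \<longlonglongrightarrow>
          integral\<^sup>L ?M (\<lambda>x. \<phi> x * fst (D1 l y x)) + 1/2 * integral\<^sup>L ?M (\<lambda>x. \<phi> x * (DI l w (fst x))\<^sup>2)"
        by (intro tendsto_intros alim blim)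
      moreover have "integral\<^sup>L ?M (\<lambda>x. \<phi> x * fn n x) = integral\<^sup>L ?M (\<lambda>x. \<phi> x * fst (D1 l (Y n) x)) + 1/2 * integral\<^sup>L ?M (\<lambda>x. \<phi> x * (D1 l (W n) x)\<^sup>2)" for n
        using L2_inner_integrable(1)[OF domains(9) \<phi>L aL(1)] ib[OF hL(4)] by (simp add: fn_def distrib_left)
      moreover have "integral\<^sup>L ?M (\<lambda>x. \<phi> x * f x) = integral\<^sup>L ?M (\<lambda>x. \<phi> x * fst (D1 l y x)) + 1/2 * integral\<^sup>L ?M (\<lambda>x. \<phi> x * (DI l w (fst x))\<^sup>2)"
        using L2_inner_integrable(1)[OF domains(9) \<phi>L aL(2)] ib[OF SL(4)] by (simp add: f_def distrib_left)
      ultimately show ?thesis by simp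
    qed
    have fnL: "fn n \<in> L2 ?S" for n
      using fn2[of n] aL(1)[of n] hL(4)[of n] unfolding fn_def by (auto simp: L2_iff)
    \<comment> \<open>The tangent inequality of the square: the left side is affine in
      \<open>v\<close>, so it passes to weak limits, and at \<open>v = u\<close> it is an equality.
      Used for all three squares, with \<open>u\<close> the limit or its truncation.\<close>
    have young: "2 * integral\<^sup>L ?M (\<lambda>x. u x * v x) - integral\<^sup>L ?M (\<lambda>x. (u x)\<^sup>2) \<le> integral\<^sup>L ?M (\<lambda>x. (v x)\<^sup>2)"
      if uv: "u \<in> L2 ?S" "v \<in> L2 ?S" for u v :: "real \<times> real \<Rightarrow> real"
    proof -
      have "0 \<le> integral\<^sup>L ?M (\<lambda>x. (v x - u x)\<^sup>2)" by simp
      also have "(\<lambda>x. (v x - u x)\<^sup>2) = (\<lambda>x. (v x)\<^sup>2 + (u x)\<^sup>2 - 2 * (u x * v x))"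
        by (simp add: power2_eq_square algebra_simps)
      finally show ?thesis using uv L2_inner_integrable(1)[OF domains(9) uv] by (simp add: L2_iff)
    qed
    have "(\<lambda>n. q / 2 * (2 * integral\<^sup>L ?M (\<lambda>x. \<phi> x * fn n x) - integral\<^sup>L ?M (\<lambda>x. (\<phi> x)\<^sup>2)) +
        B / 24 * (2 * integral\<^sup>L ?M (\<lambda>x. \<rho> x * (h12 n x - k * h11 n x)) - integral\<^sup>L ?M (\<lambda>x. (\<rho> x)\<^sup>2)) +
        q / 24 * (2 * integral\<^sup>L ?M (\<lambda>x. \<omega> x * h11 n x) - integral\<^sup>L ?M (\<lambda>x. (\<omega> x)\<^sup>2))) \<longlonglongrightarrow>
       q / 2 * (2 * integral\<^sup>L ?M (\<lambda>x. \<phi> x * f x) - integral\<^sup>L ?M (\<lambda>x. (\<phi> x)\<^sup>2)) +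
        B / 24 * (2 * integral\<^sup>L ?M (\<lambda>x. (\<rho> x)\<^sup>2) - integral\<^sup>L ?M (\<lambda>x. (\<rho> x)\<^sup>2)) +
        q / 24 * (2 * integral\<^sup>L ?M (\<lambda>x. \<omega> x * \<omega> x) - integral\<^sup>L ?M (\<lambda>x. (\<omega> x)\<^sup>2))"
      by (intro tendsto_intros flim \<rho>lim \<omega>lim SL(2))
    moreover have "q / 2 * (2 * integral\<^sup>L ?M (\<lambda>x. \<phi> x * fn n x) - integral\<^sup>L ?M (\<lambda>x. (\<phi> x)\<^sup>2)) +
        B / 24 * (2 * integral\<^sup>L ?M (\<lambda>x. \<rho> x * (h12 n x - k * h11 n x)) - integral\<^sup>L ?M (\<lambda>x. (\<rho> x)\<^sup>2)) +
        q / 24 * (2 * integral\<^sup>L ?M (\<lambda>x. \<omega> x * h11 n x) - integral\<^sup>L ?M (\<lambda>x. (\<omega> x)\<^sup>2)) \<le> c" for n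
      using bound[of n] pos mult_left_mono[OF young[OF \<phi>L fnL[of n]], of "q / 2"]
        mult_left_mono[OF young[OF SL(3) rnL[of n]], of "B / 24"] mult_left_mono[OF young[OF SL(2) hL(1)[of n]], of "q / 24"]
      by linarith
    ultimately have "q / 2 * (2 * integral\<^sup>L ?M (\<lambda>x. \<phi> x * f x) - integral\<^sup>L ?M (\<lambda>x. (\<phi> x)\<^sup>2)) +
        B / 24 * (2 * integral\<^sup>L ?M (\<lambda>x. (\<rho> x)\<^sup>2) - integral\<^sup>L ?M (\<lambda>x. (\<rho> x)\<^sup>2)) +
        q / 24 * (2 * integral\<^sup>L ?M (\<lambda>x. \<omega> x * \<omega> x) - integral\<^sup>L ?M (\<lambda>x. (\<omega> x)\<^sup>2)) \<le> c"
      by (intro LIMSEQ_le_const2) auto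
    \<comment> \<open>The truncation has the sign of \<open>f\<close> and is no larger in absolute
      value, so its pairing with \<open>f\<close> is at least its own squared norm. The tangent
      bound therefore still yields the square of the truncation.\<close>
    moreover have "integral\<^sup>L ?M (\<lambda>x. (\<phi> x)\<^sup>2) \<le> integral\<^sup>L ?M (\<lambda>x. \<phi> x * f x)"
    proof (rule integral_mono)
      show "(\<phi> x)\<^sup>2 \<le> \<phi> x * f x" for x
      proof -
        have "0 \<le> \<phi> x * (f x - \<phi> x)" using R by (auto simp: \<phi>_def max_def min_def zero_le_mult_iff)
        then show ?thesis by (simp add: power2_eq_square algebra_simps)
      qed
    qed (use \<phi>L L2_inner_integrable(1)[OF domains(9) \<phi>L SL(1)] in \<open>auto simp: L2_iff\<close>)
    then have "q / 2 * integral\<^sup>L ?M (\<lambda>x. (\<phi> x)\<^sup>2) \<le> q / 2 * (2 * integral\<^sup>L ?M (\<lambda>x. \<phi> x * f x) - integral\<^sup>L ?M (\<lambda>x. (\<phi> x)\<^sup>2))"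
      using pos by (intro mult_left_mono) auto
    ultimately show ?thesis by (simp add: power2_eq_square)
  qed
  \<comment> \<open>The truncation level is released: the truncated strains stabilise pointwise and
    are dominated by \<open>f\<close>, so the bound by \<open>c\<close> holds for the full limit
    energy, against the choice of \<open>c\<close>.\<close>
  have "(\<lambda>n. integral\<^sup>L ?M (\<lambda>x. (max (- real n) (min (real n) (f x)))\<^sup>2)) \<longlonglongrightarrow> integral\<^sup>L ?M (\<lambda>x. (f x)\<^sup>2)"
  proof (rule integral_dominated_convergence[where w = "\<lambda>x. (f x)\<^sup>2"])
    show "AE x in ?M. (\<lambda>n. (max (- real n) (min (real n) (f x)))\<^sup>2) \<longlonglongrightarrow> (f x)\<^sup>2"
    proof (rule AE_I2, rule tendsto_eventually)
      fix x
      obtain N :: nat where N: "\<bar>f x\<bar> \<le> real N" using real_arch_simple by blast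
      show "eventually (\<lambda>n. (max (- real n) (min (real n) (f x)))\<^sup>2 = (f x)\<^sup>2) sequentially"
        unfolding eventually_sequentially by (rule exI[of _ N]) (use N in \<open>auto simp: max_def min_def\<close>)
    qed
    show "AE x in ?M. norm ((max (- real n) (min (real n) (f x)))\<^sup>2) \<le> (f x)\<^sup>2" for n
    proof (rule AE_I2)
      fix x
      have "\<bar>max (- real n) (min (real n) (f x))\<bar> \<le> \<bar>f x\<bar>" by auto
      from power_mono[OF this abs_ge_zero, of 2] show "norm ((max (- real n) (min (real n) (f x)))\<^sup>2) \<le> (f x)\<^sup>2" by simp
    qed
  qed (use SL(1) in \<open>auto simp: L2_iff\<close>)
  then have "(\<lambda>n. q / 2 * integral\<^sup>L ?M (\<lambda>x. (max (- real n) (min (real n) (f x)))\<^sup>2) + B / 24 * integral\<^sup>L ?M (\<lambda>x. (\<rho> x)\<^sup>2) + q / 24 * integral\<^sup>L ?M (\<lambda>x. (\<omega> x)\<^sup>2)) \<longlonglongrightarrow> j"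
    unfolding j_def by (intro tendsto_intros)
  then have "j \<le> c" using main[OF of_nat_0_le_iff refl] by (intro LIMSEQ_le_const2) auto
  then show False using c(3) by simp
qed


subsection \<open>The recovery sequence\<close>

lemma continuous_bounded:
  fixes f :: "'a::euclidean_space \<Rightarrow> real"
  assumes "continuous_on UNIV f" "bounded \<Omega>"
  obtains b where "0 \<le> b" "\<And>x. x \<in> \<Omega> \<Longrightarrow> \<bar>f x\<bar> \<le> b"
proof -
  have "compact (f ` closure \<Omega>)"
    using assms by (intro compact_continuous_image) (auto simp: compact_closure intro: continuous_on_subset)
  then obtain B where B: "\<And>x. x \<in> \<Omega> \<Longrightarrow> \<bar>f x\<bar> \<le> B"
    using compact_imp_bounded[of "f ` closure \<Omega>"] closure_subset[of \<Omega>] by (auto simp: bounded_iff)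
  have "\<bar>f x\<bar> \<le> max B 0" if "x \<in> \<Omega>" for x using B[OF that] by simp
  then show ?thesis using that[of "max B 0"] by simp
qed

lemma polynomial_derivative:
  fixes p :: "real \<Rightarrow> real"
  assumes "real_polynomial_function p"
  obtains p' where "real_polynomial_function p'" "\<And>t. (p has_real_derivative p' t) (at t)"
proof -
  obtain p' where p': "polynomial_function p'" "\<And>t. (p has_vector_derivative p' t) (at t)"
    using has_vector_derivative_polynomial_function[of p] assms by (auto simp: real_polynomial_function_eq)
  show ?thesis
    by (rule that[of p']) (use p' in \<open>auto simp: real_polynomial_function_eq has_real_derivative_iff_has_vector_derivative\<close>)
qed

lemma polynomial_antiderivative:
  fixes p :: "real \<Rightarrow> real"
  assumes "real_polynomial_function p"
  obtains P where "\<And>t. (P has_real_derivative p t) (at t)"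
proof -
  obtain a n where p: "p = (\<lambda>x. \<Sum>i\<le>n. a i * x ^ i)"
    using assms unfolding real_polynomial_function_iff_sum by blast
  show ?thesis
  proof (rule that[of "\<lambda>x. \<Sum>i\<le>n. a i / real (Suc i) * x ^ Suc i"])
    fix t
    have "((\<lambda>x. a i / real (Suc i) * x ^ Suc i) has_real_derivative a i * t ^ i) (at t)" for i
      using DERIV_cmult[OF DERIV_pow[of "Suc i" t UNIV], of "a i / real (Suc i)"] by (simp del: of_nat_Suc)
    then show "((\<lambda>x. \<Sum>i\<le>n. a i / real (Suc i) * x ^ Suc i) has_real_derivative p t) (at t)"
      unfolding p by (intro DERIV_sum)
  qed
qed

text \<open>The cost fed into the slow traversal: a common bound for the polynomial and its first
  two derivatives. The primitive \<open>P\<close> is only recorded, not bounded; it is used to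
  approximate \<theta> through its derivative, and its size is then controlled by closeness to
  \<theta>.\<close>

definition interval_bound :: "real \<Rightarrow> (real \<Rightarrow> real) \<Rightarrow> real \<Rightarrow> bool" where
  "interval_bound l p b \<longleftrightarrow> 0 \<le> b \<and> (\<exists>P p1 p2. (\<forall>t. (P has_real_derivative p t) (at t)) \<and>
     (\<forall>t. (p has_real_derivative p1 t) (at t)) \<and> (\<forall>t. (p1 has_real_derivative p2 t) (at t)) \<and>
     continuous_on UNIV p2 \<and> (\<forall>t\<in>I_dom l. \<bar>p t\<bar> \<le> b \<and> \<bar>p1 t\<bar> \<le> b \<and> \<bar>p2 t\<bar> \<le> b))"

lemma polynomial_continuous:
  fixes p :: "'a::euclidean_space \<Rightarrow> real"
  shows "real_polynomial_function p \<Longrightarrow> continuous_on A p"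
  by (simp add: real_polynomial_function_eq continuous_on_polymonial_function)

lemma interval_bound_ex:
  assumes "real_polynomial_function p"
  shows "\<exists>b. interval_bound l p b"
proof -
  obtain P where P: "\<And>t. (P has_real_derivative p t) (at t)" by (rule polynomial_antiderivative[OF assms]) (rule that)
  obtain p1 where p1: "real_polynomial_function p1" "\<And>t. (p has_real_derivative p1 t) (at t)" by (rule polynomial_derivative[OF assms]) (rule that)
  obtain p2 where p2: "real_polynomial_function p2" "\<And>t. (p1 has_real_derivative p2 t) (at t)" by (rule polynomial_derivative[OF p1(1)]) (rule that)
  obtain b0 where b0: "0 \<le> b0" "\<And>x. x \<in> I_dom l \<Longrightarrow> \<bar>p x\<bar> \<le> b0" by (rule continuous_bounded[OF polynomial_continuous[OF assms] domains(2)]) (rule that)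
  obtain b1 where b1: "0 \<le> b1" "\<And>x. x \<in> I_dom l \<Longrightarrow> \<bar>p1 x\<bar> \<le> b1" by (rule continuous_bounded[OF polynomial_continuous[OF p1(1)] domains(2)]) (rule that)
  obtain b2 where b2: "0 \<le> b2" "\<And>x. x \<in> I_dom l \<Longrightarrow> \<bar>p2 x\<bar> \<le> b2" by (rule continuous_bounded[OF polynomial_continuous[OF p2(1)] domains(2)]) (rule that)
  have "interval_bound l p (b0 + b1 + b2)"
    unfolding interval_bound_def
  proof (intro conjI exI ballI allI)
    show "(P has_real_derivative p t) (at t)" "(p has_real_derivative p1 t) (at t)" "(p1 has_real_derivative p2 t) (at t)" for t
      by (rule P p1(2) p2(2))+
    show "continuous_on UNIV p2" by (rule polynomial_continuous[OF p2(1)])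
    show "0 \<le> b0 + b1 + b2" using b0 b1 b2 by simp
    fix t assume "t \<in> I_dom l"
    then show "\<bar>p t\<bar> \<le> b0 + b1 + b2" "\<bar>p1 t\<bar> \<le> b0 + b1 + b2" "\<bar>p2 t\<bar> \<le> b0 + b1 + b2"
      using b0(1) b1(1) b2(1) b0(2)[of t] b1(2)[of t] b2(2)[of t] by linarith+
  qed
  then show ?thesis by blast
qed

lemma interval_family:
  assumes f: "f \<in> L2 (I_dom l)"
  obtains P p p1 p2 :: "real \<Rightarrow> real \<Rightarrow> real" and b :: "real \<Rightarrow> real" where
    "\<And>\<epsilon> t. (P \<epsilon> has_real_derivative p \<epsilon> t) (at t)" "\<And>\<epsilon> t. (p \<epsilon> has_real_derivative p1 \<epsilon> t) (at t)"
    "\<And>\<epsilon> t. (p1 \<epsilon> has_real_derivative p2 \<epsilon> t) (at t)" "\<And>\<epsilon>. continuous_on UNIV (p2 \<epsilon>)" "\<And>\<epsilon>. 0 \<le> b \<epsilon>"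
    "\<And>\<epsilon> t. t \<in> I_dom l \<Longrightarrow> \<bar>p \<epsilon> t\<bar> \<le> b \<epsilon> \<and> \<bar>p1 \<epsilon> t\<bar> \<le> b \<epsilon> \<and> \<bar>p2 \<epsilon> t\<bar> \<le> b \<epsilon>"
    "((\<lambda>\<epsilon>. integral\<^sup>L (lebesgue_on (I_dom l)) (\<lambda>t. (p \<epsilon> t - f t)\<^sup>2)) \<longlongrightarrow> 0) (at_right 0)"
    "((\<lambda>\<epsilon>. \<epsilon> * b \<epsilon>) \<longlongrightarrow> 0) (at_right 0)"
proof -
  define m where "m p = (SOME b. interval_bound l p b)" for p
  obtain p where p: "\<And>\<epsilon>. real_polynomial_function (p \<epsilon>)"
    "((\<lambda>\<epsilon>. integral\<^sup>L (lebesgue_on (I_dom l)) (\<lambda>x. (p \<epsilon> x - f x)\<^sup>2)) \<longlongrightarrow> 0) (at_right 0)"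
    "((\<lambda>\<epsilon>::real. \<epsilon> * m (p \<epsilon>)) \<longlongrightarrow> 0) (at_right 0)"
    by (rule L2_polynomial_family[OF domains(1,2) f, where m = m]) (rule that)
  have ib: "interval_bound l (p \<epsilon>) (m (p \<epsilon>))" for \<epsilon>
    unfolding m_def by (rule someI_ex[OF interval_bound_ex[OF p(1)]])
  have "\<forall>\<epsilon>. \<exists>r. (\<forall>t. (fst r has_real_derivative p \<epsilon> t) (at t)) \<and>
     (\<forall>t. (p \<epsilon> has_real_derivative fst (snd r) t) (at t)) \<and> (\<forall>t. (fst (snd r) has_real_derivative snd (snd r) t) (at t)) \<and>
     continuous_on UNIV (snd (snd r)) \<and> (\<forall>t\<in>I_dom l. \<bar>p \<epsilon> t\<bar> \<le> m (p \<epsilon>) \<and> \<bar>fst (snd r) t\<bar> \<le> m (p \<epsilon>) \<and> \<bar>snd (snd r) t\<bar> \<le> m (p \<epsilon>))"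
    using ib unfolding interval_bound_def by simp
  from choice[OF this] obtain r where r: "\<forall>\<epsilon>. (\<forall>t. (fst (r \<epsilon>) has_real_derivative p \<epsilon> t) (at t)) \<and>
     (\<forall>t. (p \<epsilon> has_real_derivative fst (snd (r \<epsilon>)) t) (at t)) \<and> (\<forall>t. (fst (snd (r \<epsilon>)) has_real_derivative snd (snd (r \<epsilon>)) t) (at t)) \<and>
     continuous_on UNIV (snd (snd (r \<epsilon>))) \<and> (\<forall>t\<in>I_dom l. \<bar>p \<epsilon> t\<bar> \<le> m (p \<epsilon>) \<and> \<bar>fst (snd (r \<epsilon>)) t\<bar> \<le> m (p \<epsilon>) \<and> \<bar>snd (snd (r \<epsilon>)) t\<bar> \<le> m (p \<epsilon>))" ..
  show ?thesis
    by (rule that[of "\<lambda>\<epsilon>. fst (r \<epsilon>)" p "\<lambda>\<epsilon>. fst (snd (r \<epsilon>))" "\<lambda>\<epsilon>. snd (snd (r \<epsilon>))" "\<lambda>\<epsilon>. m (p \<epsilon>)"])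
       (use r ib p in \<open>simp_all add: interval_bound_def\<close>)
qed

text \<open>The corresponding cost on the strip: \<open>A\<close> is a vertical primitive of
  \<open>q\<close>, and \<open>A1\<close>, the horizontal derivative of this primitive, is the term
  without a uniform bound that has to be beaten by \<epsilon>.\<close>

definition strip_bound :: "real \<Rightarrow> (real \<times> real \<Rightarrow> real) \<Rightarrow> real \<Rightarrow> bool" where
  "strip_bound l q b \<longleftrightarrow> 0 \<le> b \<and> (\<exists>A A1. (\<forall>x. (A has_derivative (\<lambda>h. fst h * A1 x + snd h * q x)) (at x)) \<and>
     continuous_on UNIV A \<and> continuous_on UNIV A1 \<and> (\<forall>x\<in>S_dom l. \<bar>q x\<bar> \<le> b \<and> \<bar>A x\<bar> \<le> b \<and> \<bar>A1 x\<bar> \<le> b))"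

lemma strip_bound_ex:
  assumes "real_polynomial_function q"
  shows "\<exists>b. strip_bound l q b"
proof -
  obtain A A1 where A: "bipoly A" "bipoly A1" "\<And>x. (A has_derivative (\<lambda>h. fst h * A1 x + snd h * q x)) (at x)"
    by (rule bipoly_vertical_antiderivative[OF polynomial_bipoly[OF assms]]) (rule that)
  obtain b0 where b0: "0 \<le> b0" "\<And>x. x \<in> S_dom l \<Longrightarrow> \<bar>q x\<bar> \<le> b0" by (rule continuous_bounded[OF polynomial_continuous[OF assms] domains(10)]) (rule that)
  obtain b1 where b1: "0 \<le> b1" "\<And>x. x \<in> S_dom l \<Longrightarrow> \<bar>A x\<bar> \<le> b1" by (rule continuous_bounded[OF bipoly_continuous[OF A(1)] domains(10)]) (rule that)
  obtain b2 where b2: "0 \<le> b2" "\<And>x. x \<in> S_dom l \<Longrightarrow> \<bar>A1 x\<bar> \<le> b2" by (rule continuous_bounded[OF bipoly_continuous[OF A(2)] domains(10)]) (rule that)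
  have "strip_bound l q (b0 + b1 + b2)"
    unfolding strip_bound_def
  proof (intro conjI exI ballI allI)
    show "(A has_derivative (\<lambda>h. fst h * A1 x + snd h * q x)) (at x)" for x by (rule A(3))
    show "continuous_on UNIV A" "continuous_on UNIV A1" by (rule bipoly_continuous[OF A(1)] bipoly_continuous[OF A(2)])+
    show "0 \<le> b0 + b1 + b2" using b0 b1 b2 by simp
    fix t assume "t \<in> S_dom l"
    then show "\<bar>q t\<bar> \<le> b0 + b1 + b2" "\<bar>A t\<bar> \<le> b0 + b1 + b2" "\<bar>A1 t\<bar> \<le> b0 + b1 + b2"
      using b0(1) b1(1) b2(1) b0(2)[of t] b1(2)[of t] b2(2)[of t] by linarith+
  qed
  then show ?thesis by blast
qed

lemma strip_family:
  assumes f: "f \<in> L2 (S_dom l)"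
  obtains A A1 q :: "real \<Rightarrow> real \<times> real \<Rightarrow> real" and b :: "real \<Rightarrow> real" where
    "\<And>\<epsilon> x. (A \<epsilon> has_derivative (\<lambda>h. fst h * A1 \<epsilon> x + snd h * q \<epsilon> x)) (at x)"
    "\<And>\<epsilon>. continuous_on UNIV (A \<epsilon>)" "\<And>\<epsilon>. continuous_on UNIV (A1 \<epsilon>)" "\<And>\<epsilon>. continuous_on UNIV (q \<epsilon>)" "\<And>\<epsilon>. 0 \<le> b \<epsilon>"
    "\<And>\<epsilon> x. x \<in> S_dom l \<Longrightarrow> \<bar>q \<epsilon> x\<bar> \<le> b \<epsilon> \<and> \<bar>A \<epsilon> x\<bar> \<le> b \<epsilon> \<and> \<bar>A1 \<epsilon> x\<bar> \<le> b \<epsilon>"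
    "((\<lambda>\<epsilon>. integral\<^sup>L (lebesgue_on (S_dom l)) (\<lambda>x. (q \<epsilon> x - f x)\<^sup>2)) \<longlongrightarrow> 0) (at_right 0)"
    "((\<lambda>\<epsilon>. \<epsilon> * b \<epsilon>) \<longlongrightarrow> 0) (at_right 0)"
proof -
  define m where "m p = (SOME b. strip_bound l p b)" for p
  obtain p where p: "\<And>\<epsilon>. real_polynomial_function (p \<epsilon>)"
    "((\<lambda>\<epsilon>. integral\<^sup>L (lebesgue_on (S_dom l)) (\<lambda>x. (p \<epsilon> x - f x)\<^sup>2)) \<longlongrightarrow> 0) (at_right 0)"
    "((\<lambda>\<epsilon>::real. \<epsilon> * m (p \<epsilon>)) \<longlongrightarrow> 0) (at_right 0)"
    by (rule L2_polynomial_family[OF domains(9,10) f, where m = m]) (rule that)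
  have ib: "strip_bound l (p \<epsilon>) (m (p \<epsilon>))" for \<epsilon>
    unfolding m_def by (rule someI_ex[OF strip_bound_ex[OF p(1)]])
  have "\<forall>\<epsilon>. \<exists>r. (\<forall>x. (fst r has_derivative (\<lambda>h. fst h * snd r x + snd h * p \<epsilon> x)) (at x)) \<and>
     continuous_on UNIV (fst r) \<and> continuous_on UNIV (snd r) \<and> (\<forall>x\<in>S_dom l. \<bar>p \<epsilon> x\<bar> \<le> m (p \<epsilon>) \<and> \<bar>fst r x\<bar> \<le> m (p \<epsilon>) \<and> \<bar>snd r x\<bar> \<le> m (p \<epsilon>))"
    using ib unfolding strip_bound_def split_paired_Ex fst_conv snd_conv by blast
  from choice[OF this] obtain r where r: "\<forall>\<epsilon>. (\<forall>x. (fst (r \<epsilon>) has_derivative (\<lambda>h. fst h * snd (r \<epsilon>) x + snd h * p \<epsilon> x)) (at x)) \<and>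
     continuous_on UNIV (fst (r \<epsilon>)) \<and> continuous_on UNIV (snd (r \<epsilon>)) \<and> (\<forall>x\<in>S_dom l. \<bar>p \<epsilon> x\<bar> \<le> m (p \<epsilon>) \<and> \<bar>fst (r \<epsilon>) x\<bar> \<le> m (p \<epsilon>) \<and> \<bar>snd (r \<epsilon>) x\<bar> \<le> m (p \<epsilon>))" ..
  show ?thesis
  proof (rule that[of "\<lambda>\<epsilon>. fst (r \<epsilon>)" "\<lambda>\<epsilon>. snd (r \<epsilon>)" p "\<lambda>\<epsilon>. m (p \<epsilon>)"])
    show "(fst (r \<epsilon>) has_derivative (\<lambda>h. fst h * snd (r \<epsilon>) x + snd h * p \<epsilon> x)) (at x)" for \<epsilon> x using r by blast
    show "continuous_on UNIV (fst (r \<epsilon>))" "continuous_on UNIV (snd (r \<epsilon>))" for \<epsilon> using r by blast+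
    show "\<bar>p \<epsilon> x\<bar> \<le> m (p \<epsilon>) \<and> \<bar>fst (r \<epsilon>) x\<bar> \<le> m (p \<epsilon>) \<and> \<bar>snd (r \<epsilon>) x\<bar> \<le> m (p \<epsilon>)" if "x \<in> S_dom l" for \<epsilon> x using r that by blast
    show "continuous_on UNIV (p \<epsilon>)" for \<epsilon> by (rule polynomial_continuous[OF p(1)])
    show "0 \<le> m (p \<epsilon>)" for \<epsilon> using ib[of \<epsilon>] by (simp add: strip_bound_def)
  qed (rule p)+
qed

lemma interval_C1_has_weak_deriv:
  fixes p :: "real \<Rightarrow> real"
  assumes "\<And>t. (p has_real_derivative p1 t) (at t)" "continuous_on UNIV p1"
  shows "has_weak_deriv (I_dom l) 1 p p1"
  using C1_has_weak_deriv[of "I_dom l" 1 p "\<lambda>x h. p1 x * h"] assms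
  by (simp add: has_field_derivative_def)

lemma has_real_derivative_continuous:
  assumes "\<And>t. (p has_real_derivative p1 t) (at t)"
  shows "continuous_on UNIV p"
  using assms DERIV_isCont by (intro continuous_at_imp_continuous_on) blast

text \<open>The derivative of \<theta> is approximated and then integrated, rather than \<theta>
  itself. One approximation thus gives convergence of derivatives in \<open>L2\<close> and, through
  \<open>sup_bound\<close>, uniform convergence of the functions, which the products in the strain
  require.\<close>

lemma mean_zero_family:
  assumes l: "0 < l" and \<theta>: "\<theta> \<in> W12_0 (I_dom l)"
  obtains T T1 T2 :: "real \<Rightarrow> real \<Rightarrow> real" and b \<tau> :: "real \<Rightarrow> real" where
    "\<And>\<epsilon> t. (T \<epsilon> has_real_derivative T1 \<epsilon> t) (at t)" "\<And>\<epsilon> t. (T1 \<epsilon> has_real_derivative T2 \<epsilon> t) (at t)"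
    "\<And>\<epsilon>. continuous_on UNIV (T2 \<epsilon>)" "\<And>\<epsilon>. 0 \<le> b \<epsilon>"
    "\<And>\<epsilon> t. t \<in> I_dom l \<Longrightarrow> \<bar>T1 \<epsilon> t\<bar> \<le> b \<epsilon> \<and> \<bar>T2 \<epsilon> t\<bar> \<le> b \<epsilon>"
    "((\<lambda>\<epsilon>. integral\<^sup>L (lebesgue_on (I_dom l)) (\<lambda>t. (T1 \<epsilon> t - DI l \<theta> t)\<^sup>2)) \<longlongrightarrow> 0) (at_right 0)"
    "((\<lambda>\<epsilon>. \<epsilon> * b \<epsilon>) \<longlongrightarrow> 0) (at_right 0)"
    "\<And>\<epsilon>. integral\<^sup>L (lebesgue_on (I_dom l)) (T \<epsilon>) = 0"
    "\<And>\<epsilon>. 0 \<le> \<tau> \<epsilon>" "(\<tau> \<longlongrightarrow> 0) (at_right 0)" "\<And>\<epsilon>. AE t in lebesgue_on (I_dom l). \<bar>T \<epsilon> t - \<theta> t\<bar> \<le> \<tau> \<epsilon>"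
proof -
  let ?M = "lebesgue_on (I_dom l)"
  have b1: "1 \<in> (Basis :: real set)" by simp
  have \<theta>12: "\<theta> \<in> W12 (I_dom l)" and mean\<theta>: "integral\<^sup>L ?M \<theta> = 0"
    using \<theta> set_integral_lebesgue_on(1)[OF domains(1), of l \<theta>] by (auto simp: W12_0_def)
  note W = W12D[OF domains(1) \<theta>12]
  obtain P p p1 p2 :: "real \<Rightarrow> real \<Rightarrow> real" and b :: "real \<Rightarrow> real" where
    d: "\<And>\<epsilon> t. (P \<epsilon> has_real_derivative p \<epsilon> t) (at t)" "\<And>\<epsilon> t. (p \<epsilon> has_real_derivative p1 \<epsilon> t) (at t)"
    "\<And>\<epsilon> t. (p1 \<epsilon> has_real_derivative p2 \<epsilon> t) (at t)" "\<And>\<epsilon>. continuous_on UNIV (p2 \<epsilon>)" "\<And>\<epsilon>. 0 \<le> b \<epsilon>"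
    and bd: "\<And>\<epsilon> t. t \<in> I_dom l \<Longrightarrow> \<bar>p \<epsilon> t\<bar> \<le> b \<epsilon> \<and> \<bar>p1 \<epsilon> t\<bar> \<le> b \<epsilon> \<and> \<bar>p2 \<epsilon> t\<bar> \<le> b \<epsilon>"
    and lim: "((\<lambda>\<epsilon>. integral\<^sup>L ?M (\<lambda>t. (p \<epsilon> t - DI l \<theta> t)\<^sup>2)) \<longlongrightarrow> 0) (at_right 0)"
    "((\<lambda>\<epsilon>. \<epsilon> * b \<epsilon>) \<longlongrightarrow> 0) (at_right 0)"
    by (rule interval_family[OF W(3)[OF b1]]) (rule that)
  interpret finite_measure ?M by (rule finite_measure_lebesgue_on) auto
  have meas: "measure ?M (I_dom l) = l"
    using l by (simp add: measure_restrict_space I_dom_def)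
  \<comment> \<open>The free constant of the primitive is fixed by mean zero. This keeps the
    recovery sequence in its normalised space and makes \<open>sup_bound\<close> applicable to the
    difference from \<theta>.\<close>
  define T where "T \<epsilon> t = P \<epsilon> t - integral\<^sup>L ?M (P \<epsilon>) / l" for \<epsilon> t
  have dT: "(T \<epsilon> has_real_derivative p \<epsilon> t) (at t)" for \<epsilon> t
    unfolding T_def using DERIV_diff[OF d(1) DERIV_const] by simp
  have cont: "continuous_on UNIV (P \<epsilon>)" "continuous_on UNIV (p \<epsilon>)" "continuous_on UNIV (p1 \<epsilon>)" "continuous_on UNIV (T \<epsilon>)" for \<epsilon>
    using has_real_derivative_continuous[OF d(1)] has_real_derivative_continuous[OF d(2)] has_real_derivative_continuous[OF d(3)]
      has_real_derivative_continuous[OF dT] .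
  have L: "T \<epsilon> \<in> L2 (I_dom l)" "p \<epsilon> \<in> L2 (I_dom l)" for \<epsilon>
    by (rule continuous_L2[OF domains(1,2) cont(4)], rule continuous_L2[OF domains(1,2) cont(2)])
  have iP: "integrable ?M (P \<epsilon>)" for \<epsilon> by (rule L2_integrable(1)[OF domains(1,2) continuous_L2[OF domains(1,2) cont(1)]])
  have mean: "integral\<^sup>L ?M (T \<epsilon>) = 0" for \<epsilon>
    unfolding T_def using iP l meas by simp
  define \<tau> where "\<tau> \<epsilon> = sqrt l * sqrt (integral\<^sup>L ?M (\<lambda>t. (p \<epsilon> t - DI l \<theta> t)\<^sup>2))" for \<epsilon>
  have "(\<tau> \<longlongrightarrow> sqrt l * sqrt 0) (at_right 0)" unfolding \<tau>_def by (intro tendsto_intros lim)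
  then have \<tau>lim: "(\<tau> \<longlongrightarrow> 0) (at_right 0)" by simp
  have sup: "AE t in ?M. \<bar>T \<epsilon> t - \<theta> t\<bar> \<le> \<tau> \<epsilon>" for \<epsilon>
    unfolding \<tau>_def
  proof (rule sup_bound[OF l])
    show "(\<lambda>t. T \<epsilon> t - \<theta> t) \<in> L2 (I_dom l)" by (rule L2_diff[OF domains(1) L(1) W(1)])
    show "(\<lambda>t. p \<epsilon> t - DI l \<theta> t) \<in> L2 (I_dom l)" by (rule L2_diff[OF domains(1) L(2) W(3)[OF b1]])
    show "has_weak_deriv (I_dom l) 1 (\<lambda>t. T \<epsilon> t - \<theta> t) (\<lambda>t. p \<epsilon> t - DI l \<theta> t)"
      by (rule has_weak_deriv_diff[OF domains(1) b1 interval_C1_has_weak_deriv[OF dT cont(2)] W(2)[OF b1]])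
    show "integral\<^sup>L ?M (\<lambda>t. T \<epsilon> t - \<theta> t) = 0"
      using mean[of \<epsilon>] mean\<theta> L2_integrable(1)[OF domains(1,2) L(1)] L2_integrable(1)[OF domains(1,2) W(1)] by simp
  qed
  show ?thesis
    by (rule that[of T p p1 b \<tau>, OF dT d(2) cont(3) d(5) _ lim mean _ \<tau>lim sup]) (use bd l in \<open>auto simp: \<tau>_def\<close>)
qed

section \<open>Families of error terms vanishing in the mean square\<close>

definition L2_null :: "real \<Rightarrow> (real \<Rightarrow> real \<times> real \<Rightarrow> real) \<Rightarrow> bool" where
  "L2_null l g \<longleftrightarrow> (\<forall>\<epsilon>>0. g \<epsilon> \<in> L2 (S_dom l)) \<and>
    ((\<lambda>\<epsilon>. integral\<^sup>L (lebesgue_on (S_dom l)) (\<lambda>x. (g \<epsilon> x)\<^sup>2)) \<longlongrightarrow> 0) (at_right 0)"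

lemma eventually_pos: "eventually (\<lambda>\<epsilon>::real. 0 < \<epsilon>) (at_right 0)"
  by (rule eventually_at_right_less)

lemma L2_null_add:
  assumes "L2_null l g" "L2_null l h"
  shows "L2_null l (\<lambda>\<epsilon> x. g \<epsilon> x + h \<epsilon> x)"
  unfolding L2_null_def
proof (intro conjI allI impI)
  let ?N = "\<lambda>g \<epsilon>. integral\<^sup>L (lebesgue_on (S_dom l)) (\<lambda>x. (g \<epsilon> x)\<^sup>2) :: real"
  have L: "g \<epsilon> \<in> L2 (S_dom l)" "h \<epsilon> \<in> L2 (S_dom l)" if "0 < \<epsilon>" for \<epsilon> using assms that by (auto simp: L2_null_def)
  then show "(\<lambda>x. g \<epsilon> x + h \<epsilon> x) \<in> L2 (S_dom l)" if "0 < \<epsilon>" for \<epsilon> using that by (intro L2_add[OF domains(9)])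
  have "((\<lambda>\<epsilon>. 2 * ?N g \<epsilon> + 2 * ?N h \<epsilon>) \<longlongrightarrow> 2 * 0 + 2 * 0) (at_right 0)"
    using assms unfolding L2_null_def by (intro tendsto_intros) auto
  then have lim: "((\<lambda>\<epsilon>. 2 * ?N g \<epsilon> + 2 * ?N h \<epsilon>) \<longlongrightarrow> 0) (at_right 0)" by simp
  show "((\<lambda>\<epsilon>. ?N (\<lambda>\<epsilon> x. g \<epsilon> x + h \<epsilon> x) \<epsilon>) \<longlongrightarrow> 0) (at_right 0)"
    by (rule tendsto_sandwich[OF _ _ tendsto_const lim])
       (auto intro!: eventually_mono[OF eventually_pos] L2_sq_add_le[OF domains(9)] L)
qed

lemma L2_null_cmult:
  assumes "L2_null l g"
  shows "L2_null l (\<lambda>\<epsilon> x. c * g \<epsilon> x)"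
  using assms L2_cmult[OF domains(9), of "g _" l c] unfolding L2_null_def power_mult_distrib
  by (auto intro!: tendsto_mult_right_zero)

lemma L2_null_diff:
  assumes "L2_null l g" "L2_null l h"
  shows "L2_null l (\<lambda>\<epsilon> x. g \<epsilon> x - h \<epsilon> x)"
  using L2_null_add[OF assms(1) L2_null_cmult[OF assms(2), of "-1"]] by simp

lemma L2_null_AE:
  assumes "L2_null l g" "\<And>\<epsilon>. 0 < \<epsilon> \<Longrightarrow> AE x in lebesgue_on (S_dom l). g \<epsilon> x = h \<epsilon> x"
  shows "L2_null l h"
  unfolding L2_null_def
proof (intro conjI allI impI)
  have L: "g \<epsilon> \<in> L2 (S_dom l)" if "0 < \<epsilon>" for \<epsilon> using assms that by (auto simp: L2_null_def)
  show "h \<epsilon> \<in> L2 (S_dom l)" if "0 < \<epsilon>" for \<epsilon> using L2_AE[OF domains(9) L[OF that] assms(2)[OF that]] .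
  show "((\<lambda>\<epsilon>. integral\<^sup>L (lebesgue_on (S_dom l)) (\<lambda>x. (h \<epsilon> x)\<^sup>2)) \<longlongrightarrow> 0) (at_right 0)"
    using conjunct2[OF assms(1)[unfolded L2_null_def]]
    by (rule Lim_transform_eventually)
       (auto intro!: eventually_mono[OF eventually_pos] L2_AE_integral[OF domains(9)] L assms(2))
qed

lemma L2_null_sup:
  assumes m: "\<And>\<epsilon>. 0 < \<epsilon> \<Longrightarrow> g \<epsilon> \<in> borel_measurable (lebesgue_on (S_dom l))"
    and b: "\<And>\<epsilon>. 0 < \<epsilon> \<Longrightarrow> AE x in lebesgue_on (S_dom l). \<bar>g \<epsilon> x\<bar> \<le> \<eta> \<epsilon>" and \<eta>: "(\<eta> \<longlongrightarrow> 0) (at_right 0)"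
  shows "L2_null l g"
  unfolding L2_null_def
proof (intro conjI allI impI)
  let ?M = "lebesgue_on (S_dom l)"
  have c1: "(\<lambda>x. 1 :: real) \<in> L2 (S_dom l)" by (rule const_L2) simp_all
  have L: "g \<epsilon> \<in> L2 (S_dom l)" "integral\<^sup>L ?M (\<lambda>x. (g \<epsilon> x)\<^sup>2) \<le> (\<eta> \<epsilon>)\<^sup>2 * integral\<^sup>L ?M (\<lambda>x. 1\<^sup>2)" if "0 < \<epsilon>" for \<epsilon>
    using L2_mult_bounded[OF domains(9) c1 m[OF that] b[OF that]] by simp_all
  then show "g \<epsilon> \<in> L2 (S_dom l)" if "0 < \<epsilon>" for \<epsilon> using that by blast
  have "((\<lambda>\<epsilon>. (\<eta> \<epsilon>)\<^sup>2 * integral\<^sup>L ?M (\<lambda>x. 1\<^sup>2)) \<longlongrightarrow> 0\<^sup>2 * integral\<^sup>L ?M (\<lambda>x. 1\<^sup>2)) (at_right 0)"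
    by (intro tendsto_intros \<eta>)
  then have lim: "((\<lambda>\<epsilon>. (\<eta> \<epsilon>)\<^sup>2 * integral\<^sup>L ?M (\<lambda>x. 1\<^sup>2)) \<longlongrightarrow> 0) (at_right 0)" by simp
  show "((\<lambda>\<epsilon>. integral\<^sup>L ?M (\<lambda>x. (g \<epsilon> x)\<^sup>2)) \<longlongrightarrow> 0) (at_right 0)"
    by (rule tendsto_sandwich[OF _ _ tendsto_const lim])
       (auto intro!: eventually_mono[OF eventually_pos] simp del: one_power2, use L(2) in auto)
qed

text \<open>Expanding the square of \<open>g + (h - g)\<close> leaves the squared error and a cross
  term, and Cauchy-Schwarz bounds the latter by the square root of the former.\<close>

lemma L2_null_limit:
  assumes g: "g \<in> L2 (S_dom l)" and n: "L2_null l (\<lambda>\<epsilon> x. h \<epsilon> x - g x)"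
  shows "((\<lambda>\<epsilon>. integral\<^sup>L (lebesgue_on (S_dom l)) (\<lambda>x. (h \<epsilon> x)\<^sup>2)) \<longlongrightarrow> integral\<^sup>L (lebesgue_on (S_dom l)) (\<lambda>x. (g x)\<^sup>2)) (at_right 0)"
    "0 < \<epsilon> \<Longrightarrow> h \<epsilon> \<in> L2 (S_dom l)"
proof -
  let ?M = "lebesgue_on (S_dom l)"
  have dL: "(\<lambda>x. h \<epsilon> x - g x) \<in> L2 (S_dom l)" if "0 < \<epsilon>" for \<epsilon> using n that by (simp add: L2_null_def)
  show hL: "h \<epsilon> \<in> L2 (S_dom l)" if "0 < \<epsilon>" for \<epsilon> using L2_add[OF domains(9) dL[OF that] g] by simp
  define e where "e \<epsilon> = integral\<^sup>L ?M (\<lambda>x. (h \<epsilon> x - g x)\<^sup>2)" for \<epsilon>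
  have e: "(e \<longlongrightarrow> 0) (at_right 0)" using n unfolding L2_null_def e_def by simp
  have "((\<lambda>\<epsilon>. e \<epsilon> + 2 * (sqrt (integral\<^sup>L ?M (\<lambda>x. (g x)\<^sup>2)) * sqrt (e \<epsilon>))) \<longlongrightarrow> 0 + 2 * (sqrt (integral\<^sup>L ?M (\<lambda>x. (g x)\<^sup>2)) * sqrt 0)) (at_right 0)"
    by (intro tendsto_intros e)
  then have lim: "((\<lambda>\<epsilon>. e \<epsilon> + 2 * (sqrt (integral\<^sup>L ?M (\<lambda>x. (g x)\<^sup>2)) * sqrt (e \<epsilon>))) \<longlongrightarrow> 0) (at_right 0)" by simp
  have "eventually (\<lambda>\<epsilon>. norm (integral\<^sup>L ?M (\<lambda>x. (h \<epsilon> x)\<^sup>2) - integral\<^sup>L ?M (\<lambda>x. (g x)\<^sup>2)) \<le>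
      e \<epsilon> + 2 * (sqrt (integral\<^sup>L ?M (\<lambda>x. (g x)\<^sup>2)) * sqrt (e \<epsilon>))) (at_right 0)"
    using eventually_pos
  proof eventually_elim
    case (elim \<epsilon>)
    note i = L2_inner_integrable[OF domains(9) g dL[OF elim]]
    have "(\<lambda>x. (h \<epsilon> x)\<^sup>2) = (\<lambda>x. (g x)\<^sup>2 + (h \<epsilon> x - g x)\<^sup>2 + 2 * (g x * (h \<epsilon> x - g x)))"
      by (simp add: power2_eq_square algebra_simps)
    then have "integral\<^sup>L ?M (\<lambda>x. (h \<epsilon> x)\<^sup>2) = integral\<^sup>L ?M (\<lambda>x. (g x)\<^sup>2) + e \<epsilon> + 2 * integral\<^sup>L ?M (\<lambda>x. g x * (h \<epsilon> x - g x))"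
      using i(1) g dL[OF elim] by (simp add: L2_iff e_def)
    moreover have "0 \<le> e \<epsilon>" by (simp add: e_def)
    ultimately show ?case using i(2) by (simp add: e_def[symmetric])
  qed
  from Lim_null_comparison[OF this lim]
  show "((\<lambda>\<epsilon>. integral\<^sup>L ?M (\<lambda>x. (h \<epsilon> x)\<^sup>2)) \<longlongrightarrow> integral\<^sup>L ?M (\<lambda>x. (g x)\<^sup>2)) (at_right 0)"
    by (simp add: LIM_zero_iff)
qed

lemma L2_null_lift:
  assumes "\<And>\<epsilon>. g \<epsilon> \<in> L2 (I_dom l)" "((\<lambda>\<epsilon>. integral\<^sup>L (lebesgue_on (I_dom l)) (\<lambda>t. (g \<epsilon> t)\<^sup>2)) \<longlongrightarrow> 0) (at_right 0)"
  shows "L2_null l (\<lambda>\<epsilon> x. g \<epsilon> (fst x))"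
  using assms by (auto simp: L2_null_def lift_fst)

text \<open>For entries in \<open>L2\<close> the energy is finite and becomes a combination of
  squared norms, so that its limit can be computed entry by entry.\<close>

lemma energy_eq:
  assumes pos: "D > 0" "B > 0" "q > 0"
    and Q: "\<And>a b d. Q (mat22 a b b d) = D * (d - g1 * a - g2 * b)\<^sup>2 + B * (b - k * a)\<^sup>2 + q * (a::real)\<^sup>2"
    and ext: "AE x in lebesgue_on (S_dom l). E_eps l \<epsilon> y x + (1/2) *\<^sub>R tensor (grad_eps l \<epsilon> w x) (grad_eps l \<epsilon> w x) = mat22 (a x) (b x) (b x) (d x)"
    and ben: "AE x in lebesgue_on (S_dom l). hess_eps l \<epsilon> w x = mat22 (a' x) (b' x) (b' x) (d' x)"
    and L: "a \<in> L2 (S_dom l)" "b \<in> L2 (S_dom l)" "d \<in> L2 (S_dom l)" "a' \<in> L2 (S_dom l)" "b' \<in> L2 (S_dom l)" "d' \<in> L2 (S_dom l)"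
  defines "N \<equiv> \<lambda>f. integral\<^sup>L (lebesgue_on (S_dom l)) (\<lambda>x. (f x)\<^sup>2)"
  shows "J_vK_eps Q l \<epsilon> y w = ennreal (
    (D * N (\<lambda>x. d x - g1 * a x - g2 * b x) + B * N (\<lambda>x. b x - k * a x) + q * N a) / 2 +
    (D * N (\<lambda>x. d' x - g1 * a' x - g2 * b' x) + B * N (\<lambda>x. b' x - k * a' x) + q * N a') / 24)"
proof -
  let ?M = "lebesgue_on (S_dom l)"
  have key: "(\<integral>\<^sup>+x\<in>S_dom l. ennreal (Q (H x)) \<partial>lebesgue) =
      ennreal (D * N (\<lambda>x. d x - g1 * a x - g2 * b x) + B * N (\<lambda>x. b x - k * a x) + q * N a)"
    if H: "AE x in ?M. H x = mat22 (a x) (b x) (b x) (d x)" and L: "a \<in> L2 (S_dom l)" "b \<in> L2 (S_dom l)" "d \<in> L2 (S_dom l)" for H and a b d :: "real \<times> real \<Rightarrow> real"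
  proof -
    have cm: "(\<lambda>x. c * f x) \<in> L2 (S_dom l)" if "f \<in> L2 (S_dom l)" for c and f :: "real \<times> real \<Rightarrow> real" using L2_cmult[OF domains(9) that, of c] by simp
    have "(\<lambda>x. d x - g1 * a x - g2 * b x) \<in> L2 (S_dom l)" "(\<lambda>x. b x - k * a x) \<in> L2 (S_dom l)"
      by (intro L2_diff[OF domains(9)] cm L)+
    then have i: "integrable ?M (\<lambda>x. (d x - g1 * a x - g2 * b x)\<^sup>2)" "integrable ?M (\<lambda>x. (b x - k * a x)\<^sup>2)" "integrable ?M (\<lambda>x. (a x)\<^sup>2)"
      using L(1) by (auto simp: L2_iff)
    have "(\<integral>\<^sup>+x. ennreal (Q (H x)) \<partial>?M) = (\<integral>\<^sup>+x. ennreal (D * (d x - g1 * a x - g2 * b x)\<^sup>2 + B * (b x - k * a x)\<^sup>2 + q * (a x)\<^sup>2) \<partial>?M)"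
      by (rule nn_integral_cong_AE) (use H in \<open>eventually_elim, simp add: Q\<close>)
    also have "\<dots> = ennreal (integral\<^sup>L ?M (\<lambda>x. D * (d x - g1 * a x - g2 * b x)\<^sup>2 + B * (b x - k * a x)\<^sup>2 + q * (a x)\<^sup>2))"
      using i pos by (intro nn_integral_eq_integral) auto
    finally show ?thesis using i by (simp add: nn_integral_on N_def)
  qed
  have nn: "0 \<le> D * N f + B * N g + q * N h" for f g h :: "real \<times> real \<Rightarrow> real" using pos by (simp add: N_def)
  show ?thesis
    unfolding J_vK_eps_def J_ext_def J_ben_def key[OF ext L(1-3)] key[OF ben L(4-6)] ennreal_coeffs
    by (rule ennreal_combine[OF nn nn])
qed


section \<open>Products of functions of one variable on the strip\<close>

lemma continuous_measurable_strip:
  "continuous_on UNIV f \<Longrightarrow> (f :: real \<times> real \<Rightarrow> real) \<in> borel_measurable (lebesgue_on (S_dom l))"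
  by (intro measurable_restrict_space1 borel_measurable_lebesgueI borel_measurable_continuous_onI)

lemma separated_continuous:
  fixes T X :: "real \<Rightarrow> real"
  assumes "continuous_on UNIV T" "continuous_on UNIV X"
  shows "continuous_on UNIV (\<lambda>x. X (snd x) * T (fst x))"
  by (intro continuous_on_mult continuous_on_compose2[OF assms(1)] continuous_on_compose2[OF assms(2)]
      continuous_on_fst continuous_on_snd continuous_on_id) auto

lemma separated_derivative:
  fixes T X :: "real \<Rightarrow> real"
  assumes "\<And>t. (T has_real_derivative T1 t) (at t)" "\<And>s. (X has_real_derivative X1 s) (at s)"
  shows "((\<lambda>x. X (snd x) * T (fst x)) has_derivative
    (\<lambda>h. fst h * (X (snd x) * T1 (fst x)) + snd h * (X1 (snd x) * T (fst x)))) (at x)"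
proof -
  have "((\<lambda>x. T (fst x)) has_derivative (\<lambda>h. T1 (fst x) * fst h)) (at x)"
    using diff_chain_at[OF has_derivative_fst[OF has_derivative_ident] assms(1)[of "fst x", unfolded has_field_derivative_def]]
    by (simp add: o_def)
  moreover have "((\<lambda>x. X (snd x)) has_derivative (\<lambda>h. X1 (snd x) * snd h)) (at x)"
    using diff_chain_at[OF has_derivative_snd[OF has_derivative_ident] assms(2)[of "snd x", unfolded has_field_derivative_def]]
    by (simp add: o_def)
  ultimately have "((\<lambda>x. X (snd x) * T (fst x)) has_derivative
      (\<lambda>h. X (snd x) * (T1 (fst x) * fst h) + X1 (snd x) * snd h * T (fst x))) (at x)"
    by (rule has_derivative_mult[rotated])
  then show ?thesis by (simp add: algebra_simps)
qed

lemma two_term_derivative: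
  fixes T X G Z :: "real \<Rightarrow> real"
  assumes "\<And>t. (T has_real_derivative T1 t) (at t)" "\<And>s. (X has_real_derivative X1 s) (at s)"
    "\<And>t. (G has_real_derivative G1 t) (at t)" "\<And>s. (Z has_real_derivative Z1 s) (at s)"
  shows "((\<lambda>x. c * (X (snd x) * T (fst x)) + d * (Z (snd x) * G (fst x))) has_derivative
    (\<lambda>h. fst h * (c * (X (snd x) * T1 (fst x)) + d * (Z (snd x) * G1 (fst x))) +
      snd h * (c * (X1 (snd x) * T (fst x)) + d * (Z1 (snd x) * G (fst x))))) (at x)"
  using has_derivative_add[OF has_derivative_mult_right[OF separated_derivative[OF assms(1,2)], of c]
      has_derivative_mult_right[OF separated_derivative[OF assms(3,4)], of d]]
  by (simp add: algebra_simps)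

lemma two_term_continuous:
  fixes T X G Z :: "real \<Rightarrow> real"
  assumes "continuous_on UNIV T" "continuous_on UNIV X" "continuous_on UNIV G" "continuous_on UNIV Z"
  shows "continuous_on UNIV (\<lambda>x. c * (X (snd x) * T (fst x)) + d * (Z (snd x) * G (fst x)))"
  by (intro continuous_on_add continuous_on_mult continuous_on_const separated_continuous[OF assms(1,2), simplified]
    continuous_on_compose2[OF assms(1)] continuous_on_compose2[OF assms(2)] continuous_on_compose2[OF assms(3)] continuous_on_compose2[OF assms(4)]
      continuous_on_fst continuous_on_snd continuous_on_id) auto

text \<open>The integral of a product over the strip factorises, so zero mean of the vertical factor
  suffices; it is expressed by a primitive with equal values at both ends of the cross
  section.\<close>

lemma vertical_mean_zero:
  fixes T X :: "real \<Rightarrow> real"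
  assumes T: "continuous_on UNIV T" and X: "continuous_on UNIV X"
    and Y: "\<And>s. (Y has_real_derivative X s) (at s)" "Y (1/2) = Y (-1/2)"
  shows "integral\<^sup>L (lebesgue_on (S_dom l)) (\<lambda>x. X (snd x) * T (fst x)) = 0"
proof -
  let ?M = "lebesgue_on (S_dom l)"
  let ?h = "\<lambda>x. indicator (S_dom l) x * (X (snd x) * T (fst x))"
  note c = separated_continuous[OF T X]
  have hm: "?h \<in> borel_measurable borel"
    by (intro borel_measurable_times borel_measurable_indicator borel_measurable_continuous_onI[OF c]) simp
  have eq: "integral\<^sup>L ?M (\<lambda>x. X (snd x) * T (fst x)) = integral\<^sup>L ?M ?h"
    by (rule Bochner_Integration.integral_cong) auto
  have "integrable ?M ?h"
    using L2_integrable(1)[OF domains(9,10) continuous_L2[OF domains(9,10) c], of l]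
    by (subst Bochner_Integration.integrable_cong[of ?M ?M _ "\<lambda>x. X (snd x) * T (fst x)"]) auto
  then have i: "integrable lborel ?h"
    by (subst (asm) integral_lebesgue_on_borel(2)[OF domains(9) hm]) auto
  have "(\<integral>s. X s * indicator {-1/2..1/2} s \<partial>lborel) = Y (1/2) - Y (-1/2)"
    by (rule integral_FTC_Icc_real) (use Y X in \<open>auto simp: continuous_on_eq_continuous_at\<close>)
  then have z: "(\<integral>s. X s * indicator {-1/2..1/2} s \<partial>lborel) = 0" using Y(2) by simp
  have XJ: "(\<integral>s. indicator J_dom s * X s \<partial>lborel) = 0"
  proof -
    have Xm: "X \<in> borel_measurable borel" by (rule borel_measurable_continuous_onI[OF X])
    \<comment> \<open>The fundamental theorem is stated on the closed interval and the cross section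
      is open; the two differ by these two points.\<close>
    have "AE s in lborel. s \<noteq> -1/2" "AE s in lborel. s \<noteq> (1/2 :: real)" by (rule AE_lborel_singleton)+
    then have "AE s in lborel. indicator J_dom s * X s = X s * indicator {-1/2..1/2} s"
      by eventually_elim (auto simp: J_dom_def indicator_def)
    then have "(\<integral>s. indicator J_dom s * X s \<partial>lborel) = (\<integral>s. X s * indicator {-1/2..1/2} s \<partial>lborel)"
      using Xm by (intro integral_cong_AE) auto
    then show ?thesis using z by simp
  qed
  have hts: "?h (t, s) = (indicator (I_dom l) t * T t) * (indicator J_dom s * X s)" for t s
    by (simp add: S_dom_eq indicator_def)
  have "integral\<^sup>L lborel ?h = (\<integral>t. (\<integral>s. (indicator (I_dom l) t * T t) * (indicator J_dom s * X s) \<partial>lborel) \<partial>lborel)"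
    using integral_lborel_pair(1)[OF i] unfolding hts .
  also have "\<dots> = 0" using XJ by simp
  finally have "integral\<^sup>L lborel ?h = 0" .
  moreover have "integral\<^sup>L ?M ?h = integral\<^sup>L lborel ?h"
    by (rule integral_lebesgue_on_borel(1)[OF domains(9) hm]) auto
  ultimately show ?thesis using eq by simp
qed

lemma two_term_mean_zero:
  fixes T X G Z :: "real \<Rightarrow> real"
  assumes "continuous_on UNIV T" "continuous_on UNIV X" "continuous_on UNIV G" "continuous_on UNIV Z"
    "integral\<^sup>L (lebesgue_on (S_dom l)) (\<lambda>x. X (snd x) * T (fst x)) = 0"
    "integral\<^sup>L (lebesgue_on (S_dom l)) (\<lambda>x. Z (snd x) * G (fst x)) = 0"
  shows "integral\<^sup>L (lebesgue_on (S_dom l)) (\<lambda>x. c * (X (snd x) * T (fst x)) + d * (Z (snd x) * G (fst x))) = 0"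
  using L2_integrable(1)[OF domains(9,10) continuous_L2[OF domains(9,10) separated_continuous[OF assms(1,2)]], of l]
    L2_integrable(1)[OF domains(9,10) continuous_L2[OF domains(9,10) separated_continuous[OF assms(3,4)]], of l] assms(5,6)
  by simp

lemma Basis_plane: "(Basis :: (real \<times> real) set) = {(1, 0), (0, 1)}"
  by (auto simp: Basis_prod_def)

lemma tendsto_of_square:
  fixes N :: "'a \<Rightarrow> real"
  assumes "((\<lambda>i. (N i)\<^sup>2) \<longlongrightarrow> 0) F" "\<And>i. 0 \<le> N i"
  shows "(N \<longlongrightarrow> 0) F"
  using tendsto_real_sqrt[OF assms(1)] assms(2) by simp

section \<open>Convergence in Sobolev norms, reduced to components\<close>

lemma norm_W12_pair_tendsto:
  fixes f :: "real \<Rightarrow> real \<times> real \<Rightarrow> real \<times> real"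
  assumes n: "L2_null l c1" "L2_null l c2" "L2_null l c11" "L2_null l c12" "L2_null l c21" "L2_null l c22"
    and wd: "\<And>\<epsilon>. 0 < \<epsilon> \<Longrightarrow> has_weak_deriv (S_dom l) (1, 0) (c1 \<epsilon>) (c11 \<epsilon>)" "\<And>\<epsilon>. 0 < \<epsilon> \<Longrightarrow> has_weak_deriv (S_dom l) (0, 1) (c1 \<epsilon>) (c12 \<epsilon>)"
      "\<And>\<epsilon>. 0 < \<epsilon> \<Longrightarrow> has_weak_deriv (S_dom l) (1, 0) (c2 \<epsilon>) (c21 \<epsilon>)" "\<And>\<epsilon>. 0 < \<epsilon> \<Longrightarrow> has_weak_deriv (S_dom l) (0, 1) (c2 \<epsilon>) (c22 \<epsilon>)"
    and f: "\<And>\<epsilon>. 0 < \<epsilon> \<Longrightarrow> AE x in lebesgue_on (S_dom l). f \<epsilon> x = (c1 \<epsilon> x, c2 \<epsilon> x)"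
  shows "((\<lambda>\<epsilon>. norm_W12 (S_dom l) (f \<epsilon>)) \<longlongrightarrow> 0) (at_right 0)"
proof (rule tendsto_of_square)
  let ?M = "lebesgue_on (S_dom l)" and ?N = "\<lambda>c \<epsilon>. integral\<^sup>L (lebesgue_on (S_dom l)) (\<lambda>x. (c \<epsilon> x)\<^sup>2) :: real"
  note L = n[unfolded L2_null_def, THEN conjunct1, rule_format] and lim = n[unfolded L2_null_def, THEN conjunct2]
  have pair: "integral\<^sup>L ?M (\<lambda>x. (norm (g x))\<^sup>2) = integral\<^sup>L ?M (\<lambda>x. (a x)\<^sup>2) + integral\<^sup>L ?M (\<lambda>x. (b x)\<^sup>2)"
    if "AE x in ?M. g x = (a x, b x)" "a \<in> L2 (S_dom l)" "b \<in> L2 (S_dom l)" for g and a b :: "real \<times> real \<Rightarrow> real"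
  proof -
    have ab: "(\<lambda>x. (a x, b x)) \<in> L2 (S_dom l)" by (rule L2_Pair[OF domains(9) that(2,3)])
    have ae: "AE x in ?M. (a x, b x) = g x" using that(1) by eventually_elim simp
    have "integral\<^sup>L ?M (\<lambda>x. (norm (g x))\<^sup>2) = integral\<^sup>L ?M (\<lambda>x. (a x)\<^sup>2 + (b x)\<^sup>2)"
    proof (rule integral_cong_AE)
      show "AE x in ?M. (norm (g x))\<^sup>2 = (a x)\<^sup>2 + (b x)\<^sup>2" using that(1) by eventually_elim (simp add: norm_Pair)
      show "(\<lambda>x. (norm (g x))\<^sup>2) \<in> borel_measurable ?M"
      proof -
        have "integrable ?M (\<lambda>x. (norm (g x))\<^sup>2)" using L2_AE[OF domains(9) ab ae] by (simp add: L2_iff)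
        from borel_measurable_integrable[OF this] show ?thesis .
      qed
      show "(\<lambda>x. (a x)\<^sup>2 + (b x)\<^sup>2) \<in> borel_measurable ?M"
        using that(2,3) by (intro borel_measurable_add borel_measurable_power) (simp_all add: L2_iff)
    qed
    then show ?thesis using that by (simp add: L2_iff)
  qed
  have eq: "(norm_W12 (S_dom l) (f \<epsilon>))\<^sup>2 = (?N c1 \<epsilon> + ?N c2 \<epsilon>) + ((?N c11 \<epsilon> + ?N c21 \<epsilon>) + (?N c12 \<epsilon> + ?N c22 \<epsilon>))" if e: "0 < \<epsilon>" for \<epsilon>
  proof -
    have b: "(1, 0) \<in> (Basis :: (real \<times> real) set)" "(0, 1) \<in> (Basis :: (real \<times> real) set)" by auto
    note d1 = wderiv_wderiv_cong[OF domains(9) b(1) f[OF e] has_weak_deriv_Pair[OF domains(9) b(1) wd(1)[OF e] wd(3)[OF e]]]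
    note d2 = wderiv_wderiv_cong[OF domains(9) b(2) f[OF e] has_weak_deriv_Pair[OF domains(9) b(2) wd(2)[OF e] wd(4)[OF e]]]
    show ?thesis
      unfolding norm_W12_sq(1)[OF domains(9)] Basis_plane
      using pair[OF f[OF e] L(1)[OF e] L(2)[OF e]] pair[OF d1 L(3)[OF e] L(5)[OF e]] pair[OF d2 L(4)[OF e] L(6)[OF e]]
      by simp
  qed
  have "((\<lambda>\<epsilon>. (?N c1 \<epsilon> + ?N c2 \<epsilon>) + ((?N c11 \<epsilon> + ?N c21 \<epsilon>) + (?N c12 \<epsilon> + ?N c22 \<epsilon>))) \<longlongrightarrow> (0 + 0) + ((0 + 0) + (0 + 0))) (at_right 0)"
    by (intro tendsto_add lim)
  then have "((\<lambda>\<epsilon>. (?N c1 \<epsilon> + ?N c2 \<epsilon>) + ((?N c11 \<epsilon> + ?N c21 \<epsilon>) + (?N c12 \<epsilon> + ?N c22 \<epsilon>))) \<longlongrightarrow> 0) (at_right 0)"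
    by simp
  then show "((\<lambda>\<epsilon>. (norm_W12 (S_dom l) (f \<epsilon>))\<^sup>2) \<longlongrightarrow> 0) (at_right 0)"
    by (rule Lim_transform_eventually) (rule eventually_mono[OF eventually_pos], simp add: eq)
qed (rule norm_W12_sq[OF domains(9)])

lemma norm_W22_tendsto:
  fixes c :: "real \<Rightarrow> real \<times> real \<Rightarrow> real"
  assumes n: "L2_null l c" "L2_null l c1" "L2_null l c2" "L2_null l c11" "L2_null l c12" "L2_null l c22"
    and wd: "\<And>\<epsilon>. 0 < \<epsilon> \<Longrightarrow> has_weak_deriv (S_dom l) (1, 0) (c \<epsilon>) (c1 \<epsilon>)" "\<And>\<epsilon>. 0 < \<epsilon> \<Longrightarrow> has_weak_deriv (S_dom l) (0, 1) (c \<epsilon>) (c2 \<epsilon>)"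
      "\<And>\<epsilon>. 0 < \<epsilon> \<Longrightarrow> has_weak_deriv (S_dom l) (1, 0) (c1 \<epsilon>) (c11 \<epsilon>)" "\<And>\<epsilon>. 0 < \<epsilon> \<Longrightarrow> has_weak_deriv (S_dom l) (0, 1) (c1 \<epsilon>) (c12 \<epsilon>)"
      "\<And>\<epsilon>. 0 < \<epsilon> \<Longrightarrow> has_weak_deriv (S_dom l) (1, 0) (c2 \<epsilon>) (c12 \<epsilon>)" "\<And>\<epsilon>. 0 < \<epsilon> \<Longrightarrow> has_weak_deriv (S_dom l) (0, 1) (c2 \<epsilon>) (c22 \<epsilon>)"
  shows "((\<lambda>\<epsilon>. norm_W22 (S_dom l) (c \<epsilon>)) \<longlongrightarrow> 0) (at_right 0)"
proof (rule tendsto_of_square)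
  let ?M = "lebesgue_on (S_dom l)" and ?N = "\<lambda>c \<epsilon>. integral\<^sup>L (lebesgue_on (S_dom l)) (\<lambda>x. (c \<epsilon> x)\<^sup>2) :: real"
  note L = n[unfolded L2_null_def, THEN conjunct1, rule_format] and lim = n[unfolded L2_null_def, THEN conjunct2]
  have sq: "integral\<^sup>L ?M (\<lambda>x. (norm (g x))\<^sup>2) = integral\<^sup>L ?M (\<lambda>x. (a x)\<^sup>2)"
    if "AE x in ?M. g x = a x" "a \<in> L2 (S_dom l)" for g a :: "real \<times> real \<Rightarrow> real"
  proof -
    have ae: "AE x in ?M. a x = g x" using that(1) by eventually_elim simp
    show ?thesis using L2_AE_integral[OF domains(9) that(2) ae] by simp
  qed
  have eq: "(norm_W22 (S_dom l) (c \<epsilon>))\<^sup>2 = (?N c \<epsilon> + (?N c1 \<epsilon> + ?N c2 \<epsilon>)) + ((?N c11 \<epsilon> + ?N c12 \<epsilon>) + (?N c12 \<epsilon> + ?N c22 \<epsilon>))" if e: "0 < \<epsilon>" for \<epsilon>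
  proof -
    have b: "(1, 0) \<in> (Basis :: (real \<times> real) set)" "(0, 1) \<in> (Basis :: (real \<times> real) set)" by auto
    note d1 = wderiv_eq(2)[OF domains(9) b(1) wd(1)[OF e]] and d2 = wderiv_eq(2)[OF domains(9) b(2) wd(2)[OF e]]
    note d11 = wderiv_wderiv_cong[OF domains(9) b(1) d1 wd(3)[OF e]] and d21 = wderiv_wderiv_cong[OF domains(9) b(2) d1 wd(4)[OF e]]
      and d12 = wderiv_wderiv_cong[OF domains(9) b(1) d2 wd(5)[OF e]] and d22 = wderiv_wderiv_cong[OF domains(9) b(2) d2 wd(6)[OF e]]
    show ?thesis
      unfolding norm_W22_sq(1)[OF domains(9)] norm_W12_sq(1)[OF domains(9)] Basis_plane
      using sq[OF d1 L(2)[OF e]] sq[OF d2 L(3)[OF e]] sq[OF d11 L(4)[OF e]] sq[OF d12 L(5)[OF e]] sq[OF d21 L(5)[OF e]] sq[OF d22 L(6)[OF e]]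
      by simp
  qed
  have "((\<lambda>\<epsilon>. (?N c \<epsilon> + (?N c1 \<epsilon> + ?N c2 \<epsilon>)) + ((?N c11 \<epsilon> + ?N c12 \<epsilon>) + (?N c12 \<epsilon> + ?N c22 \<epsilon>))) \<longlongrightarrow> (0 + (0 + 0)) + ((0 + 0) + (0 + 0))) (at_right 0)"
    by (intro tendsto_add lim)
  then have "((\<lambda>\<epsilon>. (?N c \<epsilon> + (?N c1 \<epsilon> + ?N c2 \<epsilon>)) + ((?N c11 \<epsilon> + ?N c12 \<epsilon>) + (?N c12 \<epsilon> + ?N c22 \<epsilon>))) \<longlongrightarrow> 0) (at_right 0)"
    by simp
  then show "((\<lambda>\<epsilon>. (norm_W22 (S_dom l) (c \<epsilon>))\<^sup>2) \<longlongrightarrow> 0) (at_right 0)"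
    by (rule Lim_transform_eventually) (rule eventually_mono[OF eventually_pos], simp add: eq)
qed (rule norm_W22_sq[OF domains(9)])

lemma grad_eps_W12:
  fixes w :: "real \<times> real \<Rightarrow> real"
  assumes w: "w \<in> W22 (S_dom l)"
  shows "grad_eps l \<epsilon> w \<in> W12 (S_dom l)"
proof (rule W12I)
  note W = W22D[OF w]
  have b: "(1, 0) \<in> (Basis :: (real \<times> real) set)" "(0, 1) \<in> (Basis :: (real \<times> real) set)" by auto
  have "(\<lambda>x. 1 / \<epsilon> * D2 l w x) \<in> L2 (S_dom l)"
    using L2_cmult[OF domains(9) W12D(1)[OF domains(9) W(2)[OF b(2)]], of "1 / \<epsilon>"] by simp
  from L2_Pair[OF domains(9) W12D(1)[OF domains(9) W(2)[OF b(1)]] this]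
  show "grad_eps l \<epsilon> w \<in> L2 (S_dom l)" by (simp add: grad_eps_def[abs_def])
  fix b' :: "real \<times> real" assume b': "b' \<in> Basis"
  show "has_weak_deriv (S_dom l) b' (grad_eps l \<epsilon> w) (\<lambda>x. (wderiv (S_dom l) b' (D1 l w) x, 1 / \<epsilon> * wderiv (S_dom l) b' (D2 l w) x))"
    by (rule grad_eps_weak_deriv[OF w b'])
  have "(\<lambda>x. 1 / \<epsilon> * wderiv (S_dom l) b' (D2 l w) x) \<in> L2 (S_dom l)"
    using L2_cmult[OF domains(9) W12D(3)[OF domains(9) W(2)[OF b(2)] b'], of "1 / \<epsilon>"] by simp
  from L2_Pair[OF domains(9) W12D(3)[OF domains(9) W(2)[OF b(1)] b'] this]
  show "(\<lambda>x. (wderiv (S_dom l) b' (D1 l w) x, 1 / \<epsilon> * wderiv (S_dom l) b' (D2 l w) x)) \<in> L2 (S_dom l)" .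
qed

lemma W12_plane:
  fixes f :: "real \<times> real \<Rightarrow> 'b::euclidean_space"
  assumes "f \<in> L2 (S_dom l)" "has_weak_deriv (S_dom l) (1, 0) f f1" "has_weak_deriv (S_dom l) (0, 1) f f2"
    "f1 \<in> L2 (S_dom l)" "f2 \<in> L2 (S_dom l)"
  shows "f \<in> W12 (S_dom l)"
  by (rule W12I[where g = "\<lambda>b. if b = (1, 0) then f1 else f2"]) (use assms in \<open>auto simp: Basis_plane\<close>)

lemma W22_plane:
  fixes f :: "real \<times> real \<Rightarrow> 'b::euclidean_space"
  assumes f: "f \<in> L2 (S_dom l)" and wd: "has_weak_deriv (S_dom l) (1, 0) f f1" "has_weak_deriv (S_dom l) (0, 1) f f2"
    and W: "f1 \<in> W12 (S_dom l)" "f2 \<in> W12 (S_dom l)"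
  shows "f \<in> W22 (S_dom l)"
proof -
  have b: "(1, 0) \<in> (Basis :: (real \<times> real) set)" "(0, 1) \<in> (Basis :: (real \<times> real) set)" by auto
  have "f \<in> W12 (S_dom l)" by (rule W12_plane[OF f wd W12D(1)[OF domains(9) W(1)] W12D(1)[OF domains(9) W(2)]])
  moreover have "AE x in lebesgue_on (S_dom l). f1 x = D1 l f x" "AE x in lebesgue_on (S_dom l). f2 x = D2 l f x"
    using wderiv_eq(2)[OF domains(9) b(1) wd(1)] wderiv_eq(2)[OF domains(9) b(2) wd(2)]
    by (eventually_elim, simp)+
  ultimately show ?thesis
    using W12_AE[OF domains(9) W(1)] W12_AE[OF domains(9) W(2)] unfolding W22_def Basis_plane by auto
qed


lemma L2_null_shrink:
  assumes "L2_null l g"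
  shows "L2_null l (\<lambda>\<epsilon> x. \<epsilon> * g \<epsilon> x)"
  unfolding L2_null_def
proof (intro conjI allI impI)
  note a = assms[unfolded L2_null_def]
  fix \<epsilon> :: real assume "0 < \<epsilon>"
  then have "g \<epsilon> \<in> L2 (S_dom l)" using a by blast
  from L2_cmult[OF domains(9) this, of \<epsilon>] show "(\<lambda>x. \<epsilon> * g \<epsilon> x) \<in> L2 (S_dom l)" by simp
next
  have "((\<lambda>\<epsilon>. \<epsilon>\<^sup>2 * integral\<^sup>L (lebesgue_on (S_dom l)) (\<lambda>x. (g \<epsilon> x)\<^sup>2)) \<longlongrightarrow> 0\<^sup>2 * 0) (at_right 0)"
    using assms[unfolded L2_null_def] by (intro tendsto_intros) auto
  then show "((\<lambda>\<epsilon>. integral\<^sup>L (lebesgue_on (S_dom l)) (\<lambda>x. (\<epsilon> * g \<epsilon> x)\<^sup>2)) \<longlongrightarrow> 0) (at_right 0)"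
    by (simp add: power_mult_distrib)
qed

lemma L2_null_const:
  assumes "g \<in> L2 (S_dom l)"
  shows "L2_null l (\<lambda>\<epsilon> x. \<epsilon> * g x)"
  unfolding L2_null_def
proof (intro conjI allI impI)
  fix \<epsilon> :: real
  from L2_cmult[OF domains(9) assms, of \<epsilon>] show "(\<lambda>x. \<epsilon> * g x) \<in> L2 (S_dom l)" by simp
next
  have "((\<lambda>\<epsilon>. \<epsilon>\<^sup>2 * integral\<^sup>L (lebesgue_on (S_dom l)) (\<lambda>x. (g x)\<^sup>2)) \<longlongrightarrow> 0\<^sup>2 * integral\<^sup>L (lebesgue_on (S_dom l)) (\<lambda>x. (g x)\<^sup>2)) (at_right 0)"
    by (intro tendsto_intros)
  then show "((\<lambda>\<epsilon>. integral\<^sup>L (lebesgue_on (S_dom l)) (\<lambda>x. (\<epsilon> * g x)\<^sup>2)) \<longlongrightarrow> 0) (at_right 0)"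
    by (simp add: power_mult_distrib)
qed

text \<open>Provides a displacement whose vertical derivative approximates a prescribed strain
  \<open>f\<close>. Multiplied by \<epsilon>, the corrector and all its first derivatives vanish in
  \<open>L2\<close>, although the horizontal derivative alone may be unbounded.\<close>

lemma strip_corrector:
  assumes f: "f \<in> L2 (S_dom l)"
  obtains C C1 q :: "real \<Rightarrow> real \<times> real \<Rightarrow> real" where
    "\<And>\<epsilon>. has_weak_deriv (S_dom l) (1, 0) (C \<epsilon>) (C1 \<epsilon>)" "\<And>\<epsilon>. has_weak_deriv (S_dom l) (0, 1) (C \<epsilon>) (q \<epsilon>)"
    "\<And>\<epsilon>. C \<epsilon> \<in> L2 (S_dom l)" "\<And>\<epsilon>. C1 \<epsilon> \<in> L2 (S_dom l)" "\<And>\<epsilon>. q \<epsilon> \<in> L2 (S_dom l)"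
    "\<And>\<epsilon>. integral\<^sup>L (lebesgue_on (S_dom l)) (C \<epsilon>) = 0"
    "L2_null l (\<lambda>\<epsilon> x. \<epsilon> * C \<epsilon> x)" "L2_null l (\<lambda>\<epsilon> x. \<epsilon> * C1 \<epsilon> x)" "L2_null l (\<lambda>\<epsilon> x. \<epsilon> * q \<epsilon> x)"
    "L2_null l (\<lambda>\<epsilon> x. q \<epsilon> x - f x)"
proof -
  let ?M = "lebesgue_on (S_dom l)"
  obtain A A1 q :: "real \<Rightarrow> real \<times> real \<Rightarrow> real" and b :: "real \<Rightarrow> real" where
    dA: "\<And>\<epsilon> x. (A \<epsilon> has_derivative (\<lambda>h. fst h * A1 \<epsilon> x + snd h * q \<epsilon> x)) (at x)"
    and cA: "\<And>\<epsilon>. continuous_on UNIV (A \<epsilon>)" and cA1: "\<And>\<epsilon>. continuous_on UNIV (A1 \<epsilon>)" and cq: "\<And>\<epsilon>. continuous_on UNIV (q \<epsilon>)"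
    and b: "\<And>\<epsilon>. 0 \<le> b \<epsilon>" "\<And>\<epsilon> x. x \<in> S_dom l \<Longrightarrow> \<bar>q \<epsilon> x\<bar> \<le> b \<epsilon> \<and> \<bar>A \<epsilon> x\<bar> \<le> b \<epsilon> \<and> \<bar>A1 \<epsilon> x\<bar> \<le> b \<epsilon>"
    and lim: "((\<lambda>\<epsilon>. integral\<^sup>L ?M (\<lambda>x. (q \<epsilon> x - f x)\<^sup>2)) \<longlongrightarrow> 0) (at_right 0)" "((\<lambda>\<epsilon>. \<epsilon> * b \<epsilon>) \<longlongrightarrow> 0) (at_right 0)"
    by (rule strip_family[OF f]) (rule that)
  \<comment> \<open>Subtracting the mean keeps the corrected displacement in the zero average space
    and changes no derivative. Since the mean is bounded by \<open>b\<close> as well, the corrector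
    is bounded by \<open>2 b\<close>.\<close>
  define m where "m \<epsilon> = integral\<^sup>L ?M (A \<epsilon>) / measure ?M (space ?M)" for \<epsilon>
  note cL = continuous_L2[OF domains(9,10)]
  have kL: "(\<lambda>x. c :: real) \<in> L2 (S_dom l)" for c by (rule const_L2[OF domains(9,10)])
  note ic = L2_integrable(1)[OF domains(9,10) kL]
  have mb: "\<bar>integral\<^sup>L ?M (A \<epsilon>)\<bar> \<le> b \<epsilon> * measure ?M (space ?M)" for \<epsilon>
  proof -
    have "\<bar>integral\<^sup>L ?M (A \<epsilon>)\<bar> \<le> integral\<^sup>L ?M (\<lambda>x. \<bar>A \<epsilon> x\<bar>)" by (rule integral_abs_bound)
    also have "\<dots> \<le> integral\<^sup>L ?M (\<lambda>x. b \<epsilon>)"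
      by (rule integral_mono[OF integrable_abs[OF L2_integrable(1)[OF domains(9,10) cL[OF cA]]] ic]) (use b(2) in simp)
    also have "\<dots> = b \<epsilon> * measure ?M (space ?M)" by simp
    finally show ?thesis .
  qed
  have m: "\<bar>m \<epsilon>\<bar> \<le> b \<epsilon>" for \<epsilon>
  \<comment> \<open>On a strip of measure zero, division by zero makes \<open>m\<close> equal to
    0.\<close>
  proof (cases "measure ?M (space ?M) = 0")
    case True then show ?thesis using b(1) by (simp add: m_def)
  next
    case False
    then have "0 < measure ?M (space ?M)" using zero_less_measure_iff by blast
    then show ?thesis using mb[of \<epsilon>] by (simp add: m_def divide_le_eq)
  qed
  have k0: "has_weak_deriv (S_dom l) d (\<lambda>x. c :: real) (\<lambda>x. 0)" if "d = (1, 0) \<or> d = (0, 1)" for c d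
    using plane_C1_has_weak_deriv[of "\<lambda>x. c" "\<lambda>x. 0" "\<lambda>x. 0" l] that by auto
  note dw = plane_C1_has_weak_deriv[OF dA cA1 cq]
  show ?thesis
  proof (rule that[of "\<lambda>\<epsilon> x. A \<epsilon> x - m \<epsilon>" A1 q])
    show "has_weak_deriv (S_dom l) (1, 0) (\<lambda>x. A \<epsilon> x - m \<epsilon>) (A1 \<epsilon>)" "has_weak_deriv (S_dom l) (0, 1) (\<lambda>x. A \<epsilon> x - m \<epsilon>) (q \<epsilon>)" for \<epsilon>
      using has_weak_deriv_diff[OF domains(9) Basis_S(1) dw(1) k0[of "(1, 0)" "m \<epsilon>"]]
        has_weak_deriv_diff[OF domains(9) Basis_S(2) dw(2) k0[of "(0, 1)" "m \<epsilon>"]] by simp_all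
    show "(\<lambda>x. A \<epsilon> x - m \<epsilon>) \<in> L2 (S_dom l)" for \<epsilon> by (rule L2_diff[OF domains(9) cL[OF cA] kL])
    show "A1 \<epsilon> \<in> L2 (S_dom l)" and qL: "q \<epsilon> \<in> L2 (S_dom l)" for \<epsilon> by (rule cL[OF cA1] cL[OF cq])+
    have "integral\<^sup>L ?M (\<lambda>x. A \<epsilon> x - m \<epsilon>) = integral\<^sup>L ?M (A \<epsilon>) - m \<epsilon> * measure ?M (space ?M)" for \<epsilon>
      using L2_integrable(1)[OF domains(9,10) cL[OF cA]] ic by simp
    moreover have "integral\<^sup>L ?M (A \<epsilon>) = 0" if "measure ?M (space ?M) = 0" for \<epsilon> using mb[of \<epsilon>] that by simp
    ultimately show "integral\<^sup>L ?M (\<lambda>x. A \<epsilon> x - m \<epsilon>) = 0" for \<epsilon>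
      by (cases "measure ?M (space ?M) = 0") (simp_all add: m_def)
    have lim2: "((\<lambda>\<epsilon>. 2 * (\<epsilon> * b \<epsilon>)) \<longlongrightarrow> 0) (at_right 0)" using tendsto_mult_right_zero[OF lim(2), of 2] by simp
    have e: "\<bar>\<epsilon> * u\<bar> \<le> 2 * (\<epsilon> * b \<epsilon>)" if "0 < \<epsilon>" "\<bar>u\<bar> \<le> 2 * b \<epsilon>" for \<epsilon> u
      using mult_left_mono[OF that(2), of \<epsilon>] that(1) by (simp add: abs_mult algebra_simps)
    have z: "L2_null l (\<lambda>\<epsilon> x. \<epsilon> * g \<epsilon> x)" if gm: "\<And>\<epsilon>. continuous_on UNIV (g \<epsilon>)" and gb: "\<And>\<epsilon> x. x \<in> S_dom l \<Longrightarrow> \<bar>g \<epsilon> x\<bar> \<le> 2 * b \<epsilon>" for g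
    proof (rule L2_null_sup[OF _ _ lim2])
      fix \<epsilon> :: real assume "0 < \<epsilon>"
      then show "AE x in ?M. \<bar>\<epsilon> * g \<epsilon> x\<bar> \<le> 2 * (\<epsilon> * b \<epsilon>)"
        by (intro AE_I2 e gb) simp_all
      show "(\<lambda>x. \<epsilon> * g \<epsilon> x) \<in> borel_measurable ?M"
        by (intro continuous_measurable_strip continuous_on_mult continuous_on_const gm)
    qed
    show "L2_null l (\<lambda>\<epsilon> x. \<epsilon> * (A \<epsilon> x - m \<epsilon>))"
    proof (rule z)
      show "continuous_on UNIV (\<lambda>x. A \<epsilon> x - m \<epsilon>)" for \<epsilon> by (intro continuous_on_diff continuous_on_const cA)
      show "\<bar>A \<epsilon> x - m \<epsilon>\<bar> \<le> 2 * b \<epsilon>" if "x \<in> S_dom l" for \<epsilon> x using b(2)[OF that, of \<epsilon>] m[of \<epsilon>] by linarith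
    qed
    show "L2_null l (\<lambda>\<epsilon> x. \<epsilon> * A1 \<epsilon> x)"
    proof (rule z[OF cA1])
      show "\<bar>A1 \<epsilon> x\<bar> \<le> 2 * b \<epsilon>" if "x \<in> S_dom l" for \<epsilon> x using b(1)[of \<epsilon>] b(2)[OF that, of \<epsilon>] by linarith
    qed
    show "L2_null l (\<lambda>\<epsilon> x. \<epsilon> * q \<epsilon> x)"
    proof (rule z[OF cq])
      show "\<bar>q \<epsilon> x\<bar> \<le> 2 * b \<epsilon>" if "x \<in> S_dom l" for \<epsilon> x using b(1)[of \<epsilon>] b(2)[OF that, of \<epsilon>] by linarith
    qed
    show "L2_null l (\<lambda>\<epsilon> x. q \<epsilon> x - f x)"
      unfolding L2_null_def using lim(1) L2_diff[OF domains(9) qL f] by simp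
  qed
qed

text \<open>The targets are the minimisers in the completed squares. With \<open>k f\<close> and
  \<open>(g1 + g2 k) f\<close> as off-diagonal and lower right strain only \<open>q f^2\<close>
  survives; in the bending part the twist \<beta> is prescribed, so only the lower right entry
  \<open>g1 \<omega> + g2 \<beta>\<close> is optimised.\<close>

lemma energy_limit:
  assumes pos: "D > 0" "B > 0" "q > 0"
    and Q: "\<And>a b d. Q (mat22 a b b d) = D * (d - g1 * a - g2 * b)\<^sup>2 + B * (b - k * a)\<^sup>2 + q * (a::real)\<^sup>2"
    and ext: "\<And>\<epsilon>. 0 < \<epsilon> \<Longrightarrow> AE x in lebesgue_on (S_dom l).
      E_eps l \<epsilon> (ys \<epsilon>) x + (1/2) *\<^sub>R tensor (grad_eps l \<epsilon> (ws \<epsilon>) x) (grad_eps l \<epsilon> (ws \<epsilon>) x) = mat22 (a \<epsilon> x) (b \<epsilon> x) (b \<epsilon> x) (d \<epsilon> x)"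
    and ben: "\<And>\<epsilon>. 0 < \<epsilon> \<Longrightarrow> AE x in lebesgue_on (S_dom l). hess_eps l \<epsilon> (ws \<epsilon>) x = mat22 (a' \<epsilon> x) (b' \<epsilon> x) (b' \<epsilon> x) (d' \<epsilon> x)"
    and L: "f \<in> L2 (S_dom l)" "\<omega> \<in> L2 (S_dom l)" "\<beta> \<in> L2 (S_dom l)"
    and n: "L2_null l (\<lambda>\<epsilon> x. a \<epsilon> x - f x)" "L2_null l (\<lambda>\<epsilon> x. b \<epsilon> x - k * f x)" "L2_null l (\<lambda>\<epsilon> x. d \<epsilon> x - (g1 + g2 * k) * f x)"
      "L2_null l (\<lambda>\<epsilon> x. a' \<epsilon> x - \<omega> x)" "L2_null l (\<lambda>\<epsilon> x. b' \<epsilon> x - \<beta> x)" "L2_null l (\<lambda>\<epsilon> x. d' \<epsilon> x - (g1 * \<omega> x + g2 * \<beta> x))"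
  defines "N \<equiv> \<lambda>f. integral\<^sup>L (lebesgue_on (S_dom l)) (\<lambda>x. (f x)\<^sup>2)"
  shows "((\<lambda>\<epsilon>. J_vK_eps Q l \<epsilon> (ys \<epsilon>) (ws \<epsilon>)) \<longlongrightarrow> ennreal (q / 2 * N f + B / 24 * N (\<lambda>x. \<beta> x - k * \<omega> x) + q / 24 * N \<omega>)) (at_right 0)"
proof -
  have cL: "(\<lambda>x. c * u x) \<in> L2 (S_dom l)" if "u \<in> L2 (S_dom l)" for c :: real and u
    using L2_cmult[OF domains(9) that, of c] by simp
  have gL: "(\<lambda>x. g1 * \<omega> x + g2 * \<beta> x) \<in> L2 (S_dom l)" by (rule L2_add[OF domains(9) cL[OF L(2)] cL[OF L(3)]])
  have rL: "(\<lambda>x. \<beta> x - k * \<omega> x) \<in> L2 (S_dom l)" by (rule L2_diff[OF domains(9) L(3) cL[OF L(2)]])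
  note mem = L2_null_limit(2)[OF L(1) n(1)] L2_null_limit(2)[OF cL[OF L(1)] n(2)] L2_null_limit(2)[OF cL[OF L(1)] n(3)]
    L2_null_limit(2)[OF L(2) n(4)] L2_null_limit(2)[OF L(3) n(5)] L2_null_limit(2)[OF gL n(6)]
  have "L2_null l (\<lambda>\<epsilon> x. d \<epsilon> x - g1 * a \<epsilon> x - g2 * b \<epsilon> x)"
    using L2_null_diff[OF L2_null_diff[OF n(3) L2_null_cmult[OF n(1), of g1]] L2_null_cmult[OF n(2), of g2]]
    by (rule L2_null_AE) (simp add: algebra_simps)
  then have l1: "((\<lambda>\<epsilon>. N (\<lambda>x. d \<epsilon> x - g1 * a \<epsilon> x - g2 * b \<epsilon> x)) \<longlongrightarrow> 0) (at_right 0)" by (simp add: L2_null_def N_def)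
  have "L2_null l (\<lambda>\<epsilon> x. b \<epsilon> x - k * a \<epsilon> x)"
    using L2_null_diff[OF n(2) L2_null_cmult[OF n(1), of k]] by (rule L2_null_AE) (simp add: algebra_simps)
  then have l2: "((\<lambda>\<epsilon>. N (\<lambda>x. b \<epsilon> x - k * a \<epsilon> x)) \<longlongrightarrow> 0) (at_right 0)" by (simp add: L2_null_def N_def)
  have l3: "((\<lambda>\<epsilon>. N (a \<epsilon>)) \<longlongrightarrow> N f) (at_right 0)" unfolding N_def by (rule L2_null_limit(1)[OF L(1) n(1)])
  have "L2_null l (\<lambda>\<epsilon> x. d' \<epsilon> x - g1 * a' \<epsilon> x - g2 * b' \<epsilon> x)"
    using L2_null_diff[OF L2_null_diff[OF n(6) L2_null_cmult[OF n(4), of g1]] L2_null_cmult[OF n(5), of g2]]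
    by (rule L2_null_AE) (simp add: algebra_simps)
  then have l4: "((\<lambda>\<epsilon>. N (\<lambda>x. d' \<epsilon> x - g1 * a' \<epsilon> x - g2 * b' \<epsilon> x)) \<longlongrightarrow> 0) (at_right 0)" by (simp add: L2_null_def N_def)
  have "L2_null l (\<lambda>\<epsilon> x. (b' \<epsilon> x - k * a' \<epsilon> x) - (\<beta> x - k * \<omega> x))"
    using L2_null_diff[OF n(5) L2_null_cmult[OF n(4), of k]] by (rule L2_null_AE) (simp add: algebra_simps)
  then have l5: "((\<lambda>\<epsilon>. N (\<lambda>x. b' \<epsilon> x - k * a' \<epsilon> x)) \<longlongrightarrow> N (\<lambda>x. \<beta> x - k * \<omega> x)) (at_right 0)"
    unfolding N_def by (rule L2_null_limit(1)[OF rL])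
  have l6: "((\<lambda>\<epsilon>. N (a' \<epsilon>)) \<longlongrightarrow> N \<omega>) (at_right 0)" unfolding N_def by (rule L2_null_limit(1)[OF L(2) n(4)])
  have "((\<lambda>\<epsilon>. (D * N (\<lambda>x. d \<epsilon> x - g1 * a \<epsilon> x - g2 * b \<epsilon> x) + B * N (\<lambda>x. b \<epsilon> x - k * a \<epsilon> x) + q * N (a \<epsilon>)) / 2 +
      (D * N (\<lambda>x. d' \<epsilon> x - g1 * a' \<epsilon> x - g2 * b' \<epsilon> x) + B * N (\<lambda>x. b' \<epsilon> x - k * a' \<epsilon> x) + q * N (a' \<epsilon>)) / 24) \<longlongrightarrow>
    (D * 0 + B * 0 + q * N f) / 2 + (D * 0 + B * N (\<lambda>x. \<beta> x - k * \<omega> x) + q * N \<omega>) / 24) (at_right 0)"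
    by (intro tendsto_intros l1 l2 l3 l4 l5 l6) simp_all
  from tendsto_ennrealI[OF this]
  have "((\<lambda>\<epsilon>. ennreal ((D * N (\<lambda>x. d \<epsilon> x - g1 * a \<epsilon> x - g2 * b \<epsilon> x) + B * N (\<lambda>x. b \<epsilon> x - k * a \<epsilon> x) + q * N (a \<epsilon>)) / 2 +
      (D * N (\<lambda>x. d' \<epsilon> x - g1 * a' \<epsilon> x - g2 * b' \<epsilon> x) + B * N (\<lambda>x. b' \<epsilon> x - k * a' \<epsilon> x) + q * N (a' \<epsilon>)) / 24)) \<longlongrightarrow>
    ennreal (q / 2 * N f + B / 24 * N (\<lambda>x. \<beta> x - k * \<omega> x) + q / 24 * N \<omega>)) (at_right 0)"
    by (simp add: add_divide_distrib add.assoc)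
  then show ?thesis
  proof (rule Lim_transform_eventually)
    show "eventually (\<lambda>\<epsilon>. ennreal ((D * N (\<lambda>x. d \<epsilon> x - g1 * a \<epsilon> x - g2 * b \<epsilon> x) + B * N (\<lambda>x. b \<epsilon> x - k * a \<epsilon> x) + q * N (a \<epsilon>)) / 2 +
      (D * N (\<lambda>x. d' \<epsilon> x - g1 * a' \<epsilon> x - g2 * b' \<epsilon> x) + B * N (\<lambda>x. b' \<epsilon> x - k * a' \<epsilon> x) + q * N (a' \<epsilon>)) / 24) = J_vK_eps Q l \<epsilon> (ys \<epsilon>) (ws \<epsilon>)) (at_right 0)"
      using eventually_pos
    proof eventually_elim
      case (elim \<epsilon>)
      show ?case
        unfolding N_def by (rule energy_eq[OF pos Q ext[OF elim] ben[OF elim] mem[OF elim], symmetric])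
    qed
  qed
qed

text \<open>\<open>P\<close> is the full correction of \<open>w\<close>. The factor \<epsilon> is
  taken out of every vertical derivative, so that \<open>R\<close>, \<open>H12\<close> and
  \<open>H22\<close> are directly the scaled gradient and Hessian entries. Uniform closeness of
  \<open>R\<close> to \<theta> serves the quadratic terms of the membrane strain, while for the
  second derivatives \<open>L2\<close> convergence suffices.\<close>

lemma plane_corrector:
  assumes l: "0 < l" and \<theta>: "\<theta> \<in> W12_0 (I_dom l)" and \<gamma>: "\<gamma> \<in> L2 (I_dom l)"
  obtains P P1 R P11 H12 H22 :: "real \<Rightarrow> real \<times> real \<Rightarrow> real" and \<eta> :: "real \<Rightarrow> real" where
    "\<And>\<epsilon>. has_weak_deriv (S_dom l) (1, 0) (P \<epsilon>) (P1 \<epsilon>)" "\<And>\<epsilon>. has_weak_deriv (S_dom l) (0, 1) (P \<epsilon>) (\<lambda>x. \<epsilon> * R \<epsilon> x)"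
    "\<And>\<epsilon>. has_weak_deriv (S_dom l) (1, 0) (P1 \<epsilon>) (P11 \<epsilon>)" "\<And>\<epsilon>. has_weak_deriv (S_dom l) (0, 1) (P1 \<epsilon>) (\<lambda>x. \<epsilon> * H12 \<epsilon> x)"
    "\<And>\<epsilon>. has_weak_deriv (S_dom l) (1, 0) (R \<epsilon>) (H12 \<epsilon>)" "\<And>\<epsilon>. has_weak_deriv (S_dom l) (0, 1) (R \<epsilon>) (\<lambda>x. \<epsilon> * H22 \<epsilon> x)"
    "\<And>\<epsilon>. integral\<^sup>L (lebesgue_on (S_dom l)) (P \<epsilon>) = 0" "\<And>\<epsilon>. integral\<^sup>L (lebesgue_on (S_dom l)) (P1 \<epsilon>) = 0"
    "\<And>\<epsilon>. integral\<^sup>L (lebesgue_on (S_dom l)) (R \<epsilon>) = 0"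
    "\<And>\<epsilon>. continuous_on UNIV (P \<epsilon>)" "\<And>\<epsilon>. continuous_on UNIV (P1 \<epsilon>)" "\<And>\<epsilon>. continuous_on UNIV (R \<epsilon>)" "\<And>\<epsilon>. continuous_on UNIV (P11 \<epsilon>)"
    "(\<eta> \<longlongrightarrow> 0) (at_right 0)"
    "\<And>\<epsilon>. 0 < \<epsilon> \<Longrightarrow> AE x in lebesgue_on (S_dom l). \<bar>P \<epsilon> x\<bar> \<le> \<eta> \<epsilon> \<and> \<bar>P1 \<epsilon> x\<bar> \<le> \<eta> \<epsilon> \<and> \<bar>P11 \<epsilon> x\<bar> \<le> \<eta> \<epsilon> \<and> \<bar>R \<epsilon> x - \<theta> (fst x)\<bar> \<le> \<eta> \<epsilon>"
    "L2_null l (\<lambda>\<epsilon> x. H12 \<epsilon> x - DI l \<theta> (fst x))" "L2_null l (\<lambda>\<epsilon> x. H22 \<epsilon> x - \<gamma> (fst x))"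
proof -
  let ?M = "lebesgue_on (S_dom l)"
  obtain T T1 T2 :: "real \<Rightarrow> real \<Rightarrow> real" and bT \<tau> :: "real \<Rightarrow> real" where
    T: "\<And>\<epsilon> t. (T \<epsilon> has_real_derivative T1 \<epsilon> t) (at t)" "\<And>\<epsilon> t. (T1 \<epsilon> has_real_derivative T2 \<epsilon> t) (at t)"
    "\<And>\<epsilon>. continuous_on UNIV (T2 \<epsilon>)" "\<And>\<epsilon>. 0 \<le> bT \<epsilon>"
    and Tb: "\<And>\<epsilon> t. t \<in> I_dom l \<Longrightarrow> \<bar>T1 \<epsilon> t\<bar> \<le> bT \<epsilon> \<and> \<bar>T2 \<epsilon> t\<bar> \<le> bT \<epsilon>"
    and Tl: "((\<lambda>\<epsilon>. integral\<^sup>L (lebesgue_on (I_dom l)) (\<lambda>t. (T1 \<epsilon> t - DI l \<theta> t)\<^sup>2)) \<longlongrightarrow> 0) (at_right 0)"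
    and bTl: "((\<lambda>\<epsilon>. \<epsilon> * bT \<epsilon>) \<longlongrightarrow> 0) (at_right 0)"
    and Tm: "\<And>\<epsilon>. integral\<^sup>L (lebesgue_on (I_dom l)) (T \<epsilon>) = 0"
    and \<tau>: "\<And>\<epsilon>. 0 \<le> \<tau> \<epsilon>" "(\<tau> \<longlongrightarrow> 0) (at_right 0)" "\<And>\<epsilon>. AE t in lebesgue_on (I_dom l). \<bar>T \<epsilon> t - \<theta> t\<bar> \<le> \<tau> \<epsilon>"
    by (rule mean_zero_family[OF l \<theta>]) (rule that)
  obtain G0 G G1 G2 :: "real \<Rightarrow> real \<Rightarrow> real" and bG :: "real \<Rightarrow> real" where
    "\<And>\<epsilon> t. (G0 \<epsilon> has_real_derivative G \<epsilon> t) (at t)" and G: "\<And>\<epsilon> t. (G \<epsilon> has_real_derivative G1 \<epsilon> t) (at t)"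
    "\<And>\<epsilon> t. (G1 \<epsilon> has_real_derivative G2 \<epsilon> t) (at t)" "\<And>\<epsilon>. continuous_on UNIV (G2 \<epsilon>)" "\<And>\<epsilon>. 0 \<le> bG \<epsilon>"
    and Gb: "\<And>\<epsilon> t. t \<in> I_dom l \<Longrightarrow> \<bar>G \<epsilon> t\<bar> \<le> bG \<epsilon> \<and> \<bar>G1 \<epsilon> t\<bar> \<le> bG \<epsilon> \<and> \<bar>G2 \<epsilon> t\<bar> \<le> bG \<epsilon>"
    and Gl: "((\<lambda>\<epsilon>. integral\<^sup>L (lebesgue_on (I_dom l)) (\<lambda>t. (G \<epsilon> t - \<gamma> t)\<^sup>2)) \<longlongrightarrow> 0) (at_right 0)"
    and bGl: "((\<lambda>\<epsilon>. \<epsilon> * bG \<epsilon>) \<longlongrightarrow> 0) (at_right 0)"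
    by (rule interval_family[OF \<gamma>]) (rule that)
  have \<theta>W: "\<theta> \<in> W12 (I_dom l)" "(LINT x:I_dom l|lebesgue. \<theta> x) = 0" using \<theta> by (auto simp: W12_0_def)
  obtain M where M: "0 \<le> M" "AE t in lebesgue_on (I_dom l). \<bar>\<theta> t\<bar> \<le> M" by (rule W12_0_interval[OF l \<theta>W]) (rule that)
  have cT: "continuous_on UNIV (T \<epsilon>)" "continuous_on UNIV (T1 \<epsilon>)" for \<epsilon>
    by (rule has_real_derivative_continuous[OF T(1)] has_real_derivative_continuous[OF T(2)])+
  have cG: "continuous_on UNIV (G \<epsilon>)" "continuous_on UNIV (G1 \<epsilon>)" for \<epsilon>
    by (rule has_real_derivative_continuous[OF G(1)] has_real_derivative_continuous[OF G(2)])+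
  (* The coefficient of G is a primitive of x2; the constant 1/24 makes its mean over the cross section vanish. *)
  define X where "X s = s\<^sup>2 / 2 - 1 / 24" for s :: real
  have ds: "((\<lambda>s::real. s) has_real_derivative 1) (at s)" "((\<lambda>s::real. 1) has_real_derivative 0) (at s)" "(X has_real_derivative s) (at s)"
    "((\<lambda>s. s^3 / 6 - s / 24) has_real_derivative X s) (at s)" "((\<lambda>s. s\<^sup>2 / 2) has_real_derivative s) (at s)" for s :: real
    unfolding X_def by (auto intro!: derivative_eq_intros simp: power2_eq_square)
  have cs: "continuous_on UNIV (\<lambda>s::real. s)" "continuous_on UNIV (\<lambda>s::real. 1::real)" "continuous_on UNIV (\<lambda>s::real. 0::real)" "continuous_on UNIV X"
    unfolding X_def by (intro continuous_intros; simp)+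
  define P where "P \<epsilon> x = \<epsilon> * (snd x * T \<epsilon> (fst x)) + \<epsilon>\<^sup>2 * (X (snd x) * G \<epsilon> (fst x))" for \<epsilon> and x :: "real \<times> real"
  define P1 where "P1 \<epsilon> x = \<epsilon> * (snd x * T1 \<epsilon> (fst x)) + \<epsilon>\<^sup>2 * (X (snd x) * G1 \<epsilon> (fst x))" for \<epsilon> and x :: "real \<times> real"
  define P11 where "P11 \<epsilon> x = \<epsilon> * (snd x * T2 \<epsilon> (fst x)) + \<epsilon>\<^sup>2 * (X (snd x) * G2 \<epsilon> (fst x))" for \<epsilon> and x :: "real \<times> real"
  define R where "R \<epsilon> x = 1 * (1 * T \<epsilon> (fst x)) + \<epsilon> * (snd x * G \<epsilon> (fst x))" for \<epsilon> and x :: "real \<times> real"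
  define H12 where "H12 \<epsilon> x = 1 * (1 * T1 \<epsilon> (fst x)) + \<epsilon> * (snd x * G1 \<epsilon> (fst x))" for \<epsilon> and x :: "real \<times> real"
  define H22 where "H22 \<epsilon> x = G \<epsilon> (fst x)" for \<epsilon> and x :: "real \<times> real"
  \<comment> \<open>One modulus for all supremum bounds, obtained by adding them. The first summand
    uses that \<open>T\<close> is within \<tau> of \<theta>, which is bounded by \<open>M\<close>;
    the others are products of \<epsilon> with slowly growing costs, and \<tau> itself.\<close>
  define \<eta> where "\<eta> \<epsilon> = \<epsilon> * (M + \<tau> \<epsilon>) + \<tau> \<epsilon> + \<epsilon> * bT \<epsilon> + \<epsilon> * bG \<epsilon> + \<epsilon> * (\<epsilon> * bG \<epsilon>)" for \<epsilon>
  have cP: "continuous_on UNIV (P \<epsilon>)" for \<epsilon> unfolding P_def by (rule two_term_continuous[OF cT(1) cs(1) cG(1) cs(4)])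
  have cP1: "continuous_on UNIV (P1 \<epsilon>)" for \<epsilon> unfolding P1_def by (rule two_term_continuous[OF cT(2) cs(1) cG(2) cs(4)])
  have cP11: "continuous_on UNIV (P11 \<epsilon>)" for \<epsilon> unfolding P11_def by (rule two_term_continuous[OF T(3) cs(1) G(3) cs(4)])
  have cR: "continuous_on UNIV (R \<epsilon>)" for \<epsilon> unfolding R_def by (rule two_term_continuous[OF cT(1) cs(2) cG(1) cs(1)])
  have cH12: "continuous_on UNIV (H12 \<epsilon>)" for \<epsilon> unfolding H12_def by (rule two_term_continuous[OF cT(2) cs(2) cG(2) cs(1)])
  have cH22: "continuous_on UNIV (H22 \<epsilon>)" for \<epsilon> unfolding H22_def by (rule continuous_on_compose2[OF cG(1)]) (auto intro: continuous_on_fst)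
  have cm: "continuous_on UNIV (\<lambda>x. \<epsilon> * u x)" if "continuous_on UNIV u" for \<epsilon> :: real and u :: "real \<times> real \<Rightarrow> real"
    by (intro continuous_on_mult continuous_on_const that)
  have dP: "(P \<epsilon> has_derivative (\<lambda>h. fst h * P1 \<epsilon> x + snd h * (\<epsilon> * R \<epsilon> x))) (at x)" for \<epsilon> x
    using two_term_derivative[where c = "\<epsilon>" and d = "\<epsilon>\<^sup>2" and x = x, OF T(1)[of \<epsilon>] ds(1) G(1)[of \<epsilon>] ds(3)]
    unfolding P_def[abs_def] P1_def R_def by (simp add: algebra_simps power2_eq_square)
  have dP1: "(P1 \<epsilon> has_derivative (\<lambda>h. fst h * P11 \<epsilon> x + snd h * (\<epsilon> * H12 \<epsilon> x))) (at x)" for \<epsilon> x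
    using two_term_derivative[where c = "\<epsilon>" and d = "\<epsilon>\<^sup>2" and x = x, OF T(2)[of \<epsilon>] ds(1) G(2)[of \<epsilon>] ds(3)]
    unfolding P1_def[abs_def] P11_def H12_def by (simp add: algebra_simps power2_eq_square)
  have dR: "(R \<epsilon> has_derivative (\<lambda>h. fst h * H12 \<epsilon> x + snd h * (\<epsilon> * H22 \<epsilon> x))) (at x)" for \<epsilon> x
    using two_term_derivative[where c = 1 and d = "\<epsilon>" and x = x, OF T(1)[of \<epsilon>] ds(2) G(1)[of \<epsilon>] ds(1)]
    unfolding R_def[abs_def] H12_def H22_def by simp
  have DL: "DI l \<theta> \<in> L2 (I_dom l)" by (rule W12D(3)[OF domains(1) \<theta>W(1)]) simp
  have S: "\<bar>snd x\<bar> \<le> 1" "\<bar>X (snd x)\<bar> \<le> 1" "fst x \<in> I_dom l" if "x \<in> S_dom l" for x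
  proof -
    have s: "\<bar>snd x\<bar> \<le> 1" "fst x \<in> I_dom l" using that by (auto simp: S_dom_def)
    have "(snd x)\<^sup>2 \<le> 1" using s(1) by (simp add: abs_square_le_1)
    then show "\<bar>X (snd x)\<bar> \<le> 1" unfolding X_def abs_le_iff using zero_le_power2[of "snd x"] by (intro conjI; linarith)
    show "\<bar>snd x\<bar> \<le> 1" "fst x \<in> I_dom l" by fact+
  qed
  have two: "\<bar>c * (s * t) + d * (z * g)\<bar> \<le> c * B1 + d * B2"
    if "0 \<le> c" "0 \<le> d" "\<bar>s\<bar> \<le> 1" "\<bar>z\<bar> \<le> 1" "\<bar>t\<bar> \<le> B1" "\<bar>g\<bar> \<le> B2" for c d s t z g B1 B2 :: real
  proof -
    have "\<bar>s * t\<bar> \<le> B1" "\<bar>z * g\<bar> \<le> B2" using mult_mono[OF that(3,5)] mult_mono[OF that(4,6)] by (auto simp: abs_mult)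
    then have "c * \<bar>s * t\<bar> \<le> c * B1" "d * \<bar>z * g\<bar> \<le> d * B2" using that(1,2) by (auto intro: mult_left_mono)
    then show ?thesis using that(1,2) abs_triangle_ineq[of "c * (s * t)" "d * (z * g)"] by (simp add: abs_mult)
  qed
  have eb: "0 \<le> \<epsilon> * (M + \<tau> \<epsilon>)" "0 \<le> \<epsilon> * bT \<epsilon>" "0 \<le> \<epsilon> * bG \<epsilon>" "0 \<le> \<epsilon> * (\<epsilon> * bG \<epsilon>)" if "0 < \<epsilon>" for \<epsilon>
    using that M(1) \<tau>(1) T(4) G(4) by (auto intro!: mult_nonneg_nonneg add_nonneg_nonneg)
  show ?thesis
  proof (rule that[of P P1 R P11 H12 H22 \<eta>])
    show "has_weak_deriv (S_dom l) (1, 0) (P \<epsilon>) (P1 \<epsilon>)" "has_weak_deriv (S_dom l) (0, 1) (P \<epsilon>) (\<lambda>x. \<epsilon> * R \<epsilon> x)" for \<epsilon>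
      by (rule plane_C1_has_weak_deriv[OF dP cP1 cm[OF cR]])+
    show "has_weak_deriv (S_dom l) (1, 0) (P1 \<epsilon>) (P11 \<epsilon>)" "has_weak_deriv (S_dom l) (0, 1) (P1 \<epsilon>) (\<lambda>x. \<epsilon> * H12 \<epsilon> x)" for \<epsilon>
      by (rule plane_C1_has_weak_deriv[OF dP1 cP11 cm[OF cH12]])+
    show "has_weak_deriv (S_dom l) (1, 0) (R \<epsilon>) (H12 \<epsilon>)" "has_weak_deriv (S_dom l) (0, 1) (R \<epsilon>) (\<lambda>x. \<epsilon> * H22 \<epsilon> x)" for \<epsilon>
      by (rule plane_C1_has_weak_deriv[OF dR cH12 cm[OF cH22]])+
    note v1 = vertical_mean_zero[OF _ cs(1) ds(5)] and v2 = vertical_mean_zero[OF _ cs(4) ds(4)]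
    show "integral\<^sup>L ?M (P \<epsilon>) = 0" for \<epsilon> unfolding P_def
      by (rule two_term_mean_zero[OF cT(1) cs(1) cG(1) cs(4) v1[OF cT(1)] v2[OF cG(1)]]) (simp_all add: power2_eq_square power3_eq_cube)
    show "integral\<^sup>L ?M (P1 \<epsilon>) = 0" for \<epsilon> unfolding P1_def
      by (rule two_term_mean_zero[OF cT(2) cs(1) cG(2) cs(4) v1[OF cT(2)] v2[OF cG(2)]]) (simp_all add: power2_eq_square power3_eq_cube)
    have "integral\<^sup>L ?M (\<lambda>x. 1 * T \<epsilon> (fst x)) = 0" for \<epsilon>
      using lift_fst(2)[OF continuous_L2[OF domains(1,2) cT(1)]] Tm by simp
    then show "integral\<^sup>L ?M (R \<epsilon>) = 0" for \<epsilon> unfolding R_def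
      by (rule two_term_mean_zero[OF cT(1) cs(2) cG(1) cs(1) _ v1[OF cG(1)]]) (simp_all add: power2_eq_square)
    show "continuous_on UNIV (P \<epsilon>)" "continuous_on UNIV (P1 \<epsilon>)" "continuous_on UNIV (R \<epsilon>)" "continuous_on UNIV (P11 \<epsilon>)" for \<epsilon>
      by (rule cP cP1 cR cP11)+
    have "(\<eta> \<longlongrightarrow> 0 * (M + 0) + 0 + 0 + 0 + 0 * 0) (at_right 0)"
      unfolding \<eta>_def by (intro tendsto_intros \<tau>(2) bTl bGl)
    then show "(\<eta> \<longlongrightarrow> 0) (at_right 0)" by simp
    show "AE x in ?M. \<bar>P \<epsilon> x\<bar> \<le> \<eta> \<epsilon> \<and> \<bar>P1 \<epsilon> x\<bar> \<le> \<eta> \<epsilon> \<and> \<bar>P11 \<epsilon> x\<bar> \<le> \<eta> \<epsilon> \<and> \<bar>R \<epsilon> x - \<theta> (fst x)\<bar> \<le> \<eta> \<epsilon>" if e: "0 < \<epsilon>" for \<epsilon>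
    proof -
      have "AE x in ?M. x \<in> S_dom l" by (rule AE_I2) simp
      then show ?thesis using AE_lift_fst[OF \<tau>(3)[of \<epsilon>]] AE_lift_fst[OF M(2)]
      proof eventually_elim
        case (elim x)
        note s = S[OF elim(1)]
        have t: "\<bar>T \<epsilon> (fst x)\<bar> \<le> M + \<tau> \<epsilon>" using elim(2,3) by linarith
        note g = Gb[OF s(3), of \<epsilon>] and tb = Tb[OF s(3), of \<epsilon>]
        have e2: "\<epsilon>\<^sup>2 * bG \<epsilon> = \<epsilon> * (\<epsilon> * bG \<epsilon>)" by (simp add: power2_eq_square)
        have "\<bar>P \<epsilon> x\<bar> \<le> \<epsilon> * (M + \<tau> \<epsilon>) + \<epsilon>\<^sup>2 * bG \<epsilon>" unfolding P_def by (rule two) (use e s t g in auto)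
        moreover have "\<bar>P1 \<epsilon> x\<bar> \<le> \<epsilon> * bT \<epsilon> + \<epsilon>\<^sup>2 * bG \<epsilon>" unfolding P1_def by (rule two) (use e s tb g in auto)
        moreover have "\<bar>P11 \<epsilon> x\<bar> \<le> \<epsilon> * bT \<epsilon> + \<epsilon>\<^sup>2 * bG \<epsilon>" unfolding P11_def by (rule two) (use e s tb g in auto)
        moreover have "\<bar>1 * (1 * (T \<epsilon> (fst x) - \<theta> (fst x))) + \<epsilon> * (snd x * G \<epsilon> (fst x))\<bar> \<le> 1 * \<tau> \<epsilon> + \<epsilon> * bG \<epsilon>"
          by (rule two) (use e s elim(2) g in auto)
        then have "\<bar>R \<epsilon> x - \<theta> (fst x)\<bar> \<le> \<tau> \<epsilon> + \<epsilon> * bG \<epsilon>" unfolding R_def by (simp add: algebra_simps)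
        ultimately show ?case using eb[OF e] \<tau>(1)[of \<epsilon>] unfolding \<eta>_def e2 by linarith
      qed
    qed
    have "L2_null l (\<lambda>\<epsilon> x. \<epsilon> * (snd x * G1 \<epsilon> (fst x)))"
    proof (rule L2_null_sup[OF _ _ bGl])
      fix \<epsilon> :: real assume e: "0 < \<epsilon>"
      show "(\<lambda>x. \<epsilon> * (snd x * G1 \<epsilon> (fst x))) \<in> borel_measurable ?M"
        by (intro continuous_measurable_strip cm separated_continuous[OF cG(2) cs(1)])
      show "AE x in ?M. \<bar>\<epsilon> * (snd x * G1 \<epsilon> (fst x))\<bar> \<le> \<epsilon> * bG \<epsilon>"
      proof (rule AE_I2)
        fix x assume "x \<in> space ?M"
        then have s: "\<bar>snd x\<bar> \<le> 1" "fst x \<in> I_dom l" using S by auto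
        have "\<bar>\<epsilon> * (snd x * G1 \<epsilon> (fst x)) + 0 * (0 * 0)\<bar> \<le> \<epsilon> * bG \<epsilon> + 0 * 0" by (rule two) (use e s Gb[OF s(2), of \<epsilon>] in auto)
        then show "\<bar>\<epsilon> * (snd x * G1 \<epsilon> (fst x))\<bar> \<le> \<epsilon> * bG \<epsilon>" by simp
      qed
    qed
    from L2_null_add[OF L2_null_lift[OF L2_diff[OF domains(1) continuous_L2[OF domains(1,2) cT(2)] DL] Tl] this]
    show "L2_null l (\<lambda>\<epsilon> x. H12 \<epsilon> x - DI l \<theta> (fst x))" by (rule L2_null_AE) (simp add: H12_def algebra_simps)
    show "L2_null l (\<lambda>\<epsilon> x. H22 \<epsilon> x - \<gamma> (fst x))"
      unfolding H22_def by (rule L2_null_lift[OF L2_diff[OF domains(1) continuous_L2[OF domains(1,2) cG(1)] \<gamma>] Gl])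
  qed
qed


lemma L2_null_product:
  assumes "\<And>\<epsilon>. 0 < \<epsilon> \<Longrightarrow> AE x in lebesgue_on (S_dom l). \<bar>g \<epsilon> x\<bar> \<le> A * \<eta> \<epsilon> + B * (\<eta> \<epsilon> * \<eta> \<epsilon>)"
    "\<And>\<epsilon>. 0 < \<epsilon> \<Longrightarrow> g \<epsilon> \<in> borel_measurable (lebesgue_on (S_dom l))" "(\<eta> \<longlongrightarrow> 0) (at_right 0)"
  shows "L2_null l g"
proof (rule L2_null_sup[OF assms(2,1)])
  have "((\<lambda>\<epsilon>. A * \<eta> \<epsilon> + B * (\<eta> \<epsilon> * \<eta> \<epsilon>)) \<longlongrightarrow> A * 0 + B * (0 * 0)) (at_right 0)"
    by (intro tendsto_intros assms(3))
  then show "((\<lambda>\<epsilon>. A * \<eta> \<epsilon> + B * (\<eta> \<epsilon> * \<eta> \<epsilon>)) \<longlongrightarrow> 0) (at_right 0)" by simp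
qed

lemma abs_mult_le: "\<bar>u\<bar> \<le> A \<Longrightarrow> \<bar>v\<bar> \<le> B \<Longrightarrow> \<bar>u * v\<bar> \<le> A * (B :: real)"
  by (simp add: abs_mult mult_mono')

lemma BN_0_AE:
  assumes "y \<in> BN_0 l"
  shows "AE x in lebesgue_on (S_dom l). fst (D2 l y x) + snd (D1 l y x) = 0 \<and> snd (D2 l y x) = 0"
proof -
  have S: "S_dom l \<inter> space lebesgue \<in> sets lebesgue" using domains(12)[of l] by (simp add: sets_completionI_sets)
  have "AE x in lebesgue_on (S_dom l). sym_grad l y x $ 1 $ 2 = 0 \<and> sym_grad l y x $ 2 $ 2 = 0"
    using assms unfolding AE_restrict_space_iff[OF S] BN_0_def by simp
  then show ?thesis
    by eventually_elim (simp add: sym_grad_def Let_def transpose_def)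
qed

text \<open>The deflection determines limits of the scaled gradient and hence of its tensor product.
  The in-plane corrector then supplies exactly what is missing from the optimal shear and transverse
  strain. Since everything converges in norm, the energies converge to the limit energy, which is
  more than the upper bound asked for.\<close>

theorem recovery_sequence:
  assumes l: "0 < l" and pos: "D > 0" "B > 0" "q > 0"
    and Q: "\<And>a b d. Q (mat22 a b b d) = D * (d - g1 * a - g2 * b)\<^sup>2 + B * (b - k * a)\<^sup>2 + q * (a::real)\<^sup>2"
    and y: "y \<in> BN_0 l" and w: "w \<in> W22_0 (I_dom l)" and \<theta>: "\<theta> \<in> W12_0 (I_dom l)"
  shows "\<exists>ys ws. (\<forall>\<epsilon>>0. ys \<epsilon> \<in> W12_0 (S_dom l)) \<and> (\<forall>\<epsilon>>0. ws \<epsilon> \<in> W22_0 (S_dom l)) \<and>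
    vK_converges l ys ws y w \<theta> \<and>
    Limsup (at_right 0) (\<lambda>\<epsilon>. J_vK_eps Q l \<epsilon> (ys \<epsilon>) (ws \<epsilon>)) \<le> J_vK Q l y w \<theta>"
proof -
  let ?M = "lebesgue_on (S_dom l)" and ?S = "S_dom l" and ?I = "I_dom l"
  define w1 where "w1 = DI l w"
  define w2 where "w2 = DI l w1"
  define \<theta>1 where "\<theta>1 = DI l \<theta>"
  have one: "(1 :: real) \<in> Basis" by simp
  have wW: "w \<in> W22 ?I" and wm: "integral\<^sup>L (lebesgue_on ?I) w = 0" and w1m: "(LINT t:?I|lebesgue. w1 t) = 0"
    using w unfolding W22_0_def w1_def by (auto simp: set_integral_lebesgue_on(1)[OF domains(1)])
  note wD = W22D[OF wW]
  have w1W: "w1 \<in> W12 ?I" unfolding w1_def by (rule wD(2)[OF one])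
  have \<theta>W: "\<theta> \<in> W12 ?I" and \<theta>m: "(LINT t:?I|lebesgue. \<theta> t) = 0" using \<theta> by (auto simp: W12_0_def)
  have yW: "y \<in> W12 ?S" and ym: "integral\<^sup>L ?M y = 0"
    using y unfolding BN_0_def W12_0_def by (auto simp: set_integral_lebesgue_on(1)[OF domains(9)])
  have LI: "w \<in> L2 ?I" "w1 \<in> L2 ?I" "w2 \<in> L2 ?I" "\<theta> \<in> L2 ?I" "\<theta>1 \<in> L2 ?I"
    unfolding w2_def \<theta>1_def
    by (rule W12D(1)[OF domains(1) wD(1)] W12D(1)[OF domains(1) w1W] W12D(3)[OF domains(1) w1W one] W12D(1)[OF domains(1) \<theta>W] W12D(3)[OF domains(1) \<theta>W one])+
  note LS = lift_fst(1)[OF LI(1)] lift_fst(1)[OF LI(2)] lift_fst(1)[OF LI(3)] lift_fst(1)[OF LI(4)] lift_fst(1)[OF LI(5)]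
  have dI: "has_weak_deriv ?I 1 w w1" "has_weak_deriv ?I 1 w1 w2" "has_weak_deriv ?I 1 \<theta> \<theta>1"
    unfolding w2_def \<theta>1_def
    by (rule W12D(2)[OF domains(1) wD(1) one, folded w1_def] W12D(2)[OF domains(1) w1W one] W12D(2)[OF domains(1) \<theta>W one])+
  note dw = has_weak_deriv_lift_fst[OF LI(1,2) dI(1)] and dw1 = has_weak_deriv_lift_fst[OF LI(2,3) dI(2)]
    and d\<theta> = has_weak_deriv_lift_fst[OF LI(4,5) dI(3)]
  obtain Mw where Mw: "0 \<le> Mw" "AE t in lebesgue_on ?I. \<bar>w1 t\<bar> \<le> Mw" by (rule W12_0_interval[OF l w1W w1m]) (rule that)
  obtain M\<theta> where M\<theta>: "0 \<le> M\<theta>" "AE t in lebesgue_on ?I. \<bar>\<theta> t\<bar> \<le> M\<theta>" by (rule W12_0_interval[OF l \<theta>W \<theta>m]) (rule that)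
  note MwS = AE_lift_fst[OF Mw(2)] and M\<theta>S = AE_lift_fst[OF M\<theta>(2)]
  have meas: "u \<in> borel_measurable ?M" if "u \<in> L2 ?S" for u :: "real \<times> real \<Rightarrow> real" using that by (simp add: L2_iff)
  define f where "f x = fst (D1 l y x) + (w1 (fst x))\<^sup>2 / 2" for x
  have fL: "f \<in> L2 ?S" using limit_strain_L2[OF l yW w] by (simp add: f_def[abs_def] w1_def)
  have cL: "(\<lambda>x. c * u x) \<in> L2 ?S" if "u \<in> L2 ?S" for c :: real and u
    using L2_cmult[OF domains(9) that, of c] by simp
  (* Shear and vertical strains minimising the form at membrane strain f, minus the limit of the
     corresponding entries of the tensor product; gamma is the minimiser in the bending density Q1. *)
  define \<alpha>0 where "\<alpha>0 x = k * f x - 1/2 * (w1 (fst x) * \<theta> (fst x))" for x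
  define \<beta>0 where "\<beta>0 x = (g1 + g2 * k) * f x - 1/2 * (\<theta> (fst x) * \<theta> (fst x))" for x
  have \<alpha>0L: "\<alpha>0 \<in> L2 ?S" unfolding \<alpha>0_def[abs_def]
    by (rule L2_diff[OF domains(9) cL[OF fL] cL[OF L2_mult_bounded(1)[OF domains(9) LS(4) meas[OF LS(2)] MwS]]])
  have \<beta>0L: "\<beta>0 \<in> L2 ?S" unfolding \<beta>0_def[abs_def]
    by (rule L2_diff[OF domains(9) cL[OF fL] cL[OF L2_mult_bounded(1)[OF domains(9) LS(4) meas[OF LS(4)] M\<theta>S]]])
  define \<gamma> where "\<gamma> t = g1 *\<^sub>R w2 t + g2 *\<^sub>R \<theta>1 t" for t
  have \<gamma>L: "\<gamma> \<in> L2 ?I" unfolding \<gamma>_def[abs_def]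
    by (rule L2_add[OF domains(1) L2_cmult[OF domains(1) LI(3)] L2_cmult[OF domains(1) LI(5)]])
  obtain Ca Ca1 qa :: "real \<Rightarrow> real \<times> real \<Rightarrow> real" where
    Ca: "\<And>\<epsilon>. has_weak_deriv ?S (1, 0) (Ca \<epsilon>) (Ca1 \<epsilon>)" "\<And>\<epsilon>. has_weak_deriv ?S (0, 1) (Ca \<epsilon>) (qa \<epsilon>)"
      "\<And>\<epsilon>. Ca \<epsilon> \<in> L2 ?S" "\<And>\<epsilon>. Ca1 \<epsilon> \<in> L2 ?S" "\<And>\<epsilon>. qa \<epsilon> \<in> L2 ?S" "\<And>\<epsilon>. integral\<^sup>L ?M (Ca \<epsilon>) = 0"
      "L2_null l (\<lambda>\<epsilon> x. \<epsilon> * Ca \<epsilon> x)" "L2_null l (\<lambda>\<epsilon> x. \<epsilon> * Ca1 \<epsilon> x)" "L2_null l (\<lambda>\<epsilon> x. \<epsilon> * qa \<epsilon> x)"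
      "L2_null l (\<lambda>\<epsilon> x. qa \<epsilon> x - \<alpha>0 x)"
    by (rule strip_corrector[OF \<alpha>0L]) (rule that)
  obtain Cb Cb1 qb :: "real \<Rightarrow> real \<times> real \<Rightarrow> real" where
    Cb: "\<And>\<epsilon>. has_weak_deriv ?S (1, 0) (Cb \<epsilon>) (Cb1 \<epsilon>)" "\<And>\<epsilon>. has_weak_deriv ?S (0, 1) (Cb \<epsilon>) (qb \<epsilon>)"
      "\<And>\<epsilon>. Cb \<epsilon> \<in> L2 ?S" "\<And>\<epsilon>. Cb1 \<epsilon> \<in> L2 ?S" "\<And>\<epsilon>. qb \<epsilon> \<in> L2 ?S" "\<And>\<epsilon>. integral\<^sup>L ?M (Cb \<epsilon>) = 0"
      "L2_null l (\<lambda>\<epsilon> x. \<epsilon> * Cb \<epsilon> x)" "L2_null l (\<lambda>\<epsilon> x. \<epsilon> * Cb1 \<epsilon> x)" "L2_null l (\<lambda>\<epsilon> x. \<epsilon> * qb \<epsilon> x)"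
      "L2_null l (\<lambda>\<epsilon> x. qb \<epsilon> x - \<beta>0 x)"
    by (rule strip_corrector[OF \<beta>0L]) (rule that)
  obtain P P1 R P11 H12 H22 :: "real \<Rightarrow> real \<times> real \<Rightarrow> real" and \<eta> :: "real \<Rightarrow> real" where
    dP: "\<And>\<epsilon>. has_weak_deriv ?S (1, 0) (P \<epsilon>) (P1 \<epsilon>)" "\<And>\<epsilon>. has_weak_deriv ?S (0, 1) (P \<epsilon>) (\<lambda>x. \<epsilon> * R \<epsilon> x)"
    and dP1: "\<And>\<epsilon>. has_weak_deriv ?S (1, 0) (P1 \<epsilon>) (P11 \<epsilon>)" "\<And>\<epsilon>. has_weak_deriv ?S (0, 1) (P1 \<epsilon>) (\<lambda>x. \<epsilon> * H12 \<epsilon> x)"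
    and dR: "\<And>\<epsilon>. has_weak_deriv ?S (1, 0) (R \<epsilon>) (H12 \<epsilon>)" "\<And>\<epsilon>. has_weak_deriv ?S (0, 1) (R \<epsilon>) (\<lambda>x. \<epsilon> * H22 \<epsilon> x)"
    and mP: "\<And>\<epsilon>. integral\<^sup>L ?M (P \<epsilon>) = 0" "\<And>\<epsilon>. integral\<^sup>L ?M (P1 \<epsilon>) = 0" "\<And>\<epsilon>. integral\<^sup>L ?M (R \<epsilon>) = 0"
    and cP: "\<And>\<epsilon>. continuous_on UNIV (P \<epsilon>)" "\<And>\<epsilon>. continuous_on UNIV (P1 \<epsilon>)" "\<And>\<epsilon>. continuous_on UNIV (R \<epsilon>)" "\<And>\<epsilon>. continuous_on UNIV (P11 \<epsilon>)"
    and \<eta>: "(\<eta> \<longlongrightarrow> 0) (at_right 0)"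
    and bP: "\<And>\<epsilon>. 0 < \<epsilon> \<Longrightarrow> AE x in ?M. \<bar>P \<epsilon> x\<bar> \<le> \<eta> \<epsilon> \<and> \<bar>P1 \<epsilon> x\<bar> \<le> \<eta> \<epsilon> \<and> \<bar>P11 \<epsilon> x\<bar> \<le> \<eta> \<epsilon> \<and> \<bar>R \<epsilon> x - \<theta> (fst x)\<bar> \<le> \<eta> \<epsilon>"
    and nH: "L2_null l (\<lambda>\<epsilon> x. H12 \<epsilon> x - DI l \<theta> (fst x))" "L2_null l (\<lambda>\<epsilon> x. H22 \<epsilon> x - \<gamma> (fst x))"
    by (rule plane_corrector[OF l \<theta> \<gamma>L]) (rule that)
  have PL: "P \<epsilon> \<in> L2 ?S" "P1 \<epsilon> \<in> L2 ?S" "R \<epsilon> \<in> L2 ?S" "P11 \<epsilon> \<in> L2 ?S" for \<epsilon>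
    by (rule continuous_L2[OF domains(9,10) cP(1)] continuous_L2[OF domains(9,10) cP(2)] continuous_L2[OF domains(9,10) cP(3)] continuous_L2[OF domains(9,10) cP(4)])+
  note HL = L2_null_limit(2)[OF LS(5)[unfolded \<theta>1_def] nH(1)] L2_null_limit(2)[OF lift_fst(1)[OF \<gamma>L] nH(2)]
  have cw: "has_weak_deriv ?S b (\<lambda>x. c * u x) (\<lambda>x. c * v x)" if "b \<in> Basis" "has_weak_deriv ?S b u v" for b c and u v :: "real \<times> real \<Rightarrow> real"
    using has_weak_deriv_cmult[OF domains(9) that, of c] by simp

  \<comment> \<open>The limit \<open>w\<close> has the second derivatives that the energy needs and
    is not smoothed; only the added term consists of approximants.\<close>
  define ws where "ws \<epsilon> x = w (fst x) + P \<epsilon> x" for \<epsilon> x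
  have ws1: "has_weak_deriv ?S (1, 0) (ws \<epsilon>) (\<lambda>x. w1 (fst x) + P1 \<epsilon> x)" for \<epsilon>
    unfolding ws_def[abs_def] by (rule has_weak_deriv_add[OF domains(9) Basis_S(1) dw(1) dP(1)])
  have ws2: "has_weak_deriv ?S (0, 1) (ws \<epsilon>) (\<lambda>x. \<epsilon> * R \<epsilon> x)" for \<epsilon>
    using has_weak_deriv_add[OF domains(9) Basis_S(2) dw(2) dP(2)[of \<epsilon>]] unfolding ws_def[abs_def] by simp
  have ws11: "has_weak_deriv ?S (1, 0) (\<lambda>x. w1 (fst x) + P1 \<epsilon> x) (\<lambda>x. w2 (fst x) + P11 \<epsilon> x)" for \<epsilon>
    by (rule has_weak_deriv_add[OF domains(9) Basis_S(1) dw1(1) dP1(1)])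
  have ws12: "has_weak_deriv ?S (0, 1) (\<lambda>x. w1 (fst x) + P1 \<epsilon> x) (\<lambda>x. \<epsilon> * H12 \<epsilon> x)" for \<epsilon>
    using has_weak_deriv_add[OF domains(9) Basis_S(2) dw1(2) dP1(2)[of \<epsilon>]] by simp
  note ws21 = cw[OF Basis_S(1) dR(1)] and ws22 = cw[OF Basis_S(2) dR(2)]
  have wsL: "ws \<epsilon> \<in> L2 ?S" "(\<lambda>x. w1 (fst x) + P1 \<epsilon> x) \<in> L2 ?S" "(\<lambda>x. w2 (fst x) + P11 \<epsilon> x) \<in> L2 ?S" for \<epsilon>
    unfolding ws_def[abs_def] by (rule L2_add[OF domains(9) LS(1) PL(1)] L2_add[OF domains(9) LS(2) PL(2)] L2_add[OF domains(9) LS(3) PL(4)])+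
  have wsW: "ws \<epsilon> \<in> W22 ?S" if e: "0 < \<epsilon>" for \<epsilon>
    by (rule W22_plane[OF wsL(1) ws1 ws2 W12_plane[OF wsL(2) ws11 ws12 wsL(3) cL[OF HL(1)[OF e]]]
        W12_plane[OF cL[OF PL(3)] ws21 ws22 cL[OF HL(1)[OF e]] cL[OF cL[OF HL(2)[OF e]]]]])
  note a1 = wderiv_eq(2)[OF domains(9) Basis_S(1) ws1] and a2 = wderiv_eq(2)[OF domains(9) Basis_S(2) ws2]
  note a11 = wderiv_wderiv_cong[OF domains(9) Basis_S(1) a1 ws11] and a12 = wderiv_wderiv_cong[OF domains(9) Basis_S(2) a1 ws12]
    and a21 = wderiv_wderiv_cong[OF domains(9) Basis_S(1) a2 ws21] and a22 = wderiv_wderiv_cong[OF domains(9) Basis_S(2) a2 ws22]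
  note int = L2_integrable(1)[OF domains(9,10)]
  have ws0: "ws \<epsilon> \<in> W22_0 ?S" if e: "0 < \<epsilon>" for \<epsilon>
  proof -
    note W = W22D(1)[OF wsW[OF e]]
    have "integral\<^sup>L ?M (ws \<epsilon>) = 0"
      unfolding ws_def using int[OF LS(1)] int[OF PL(1)] lift_fst(2)[OF LI(1)] wm mP(1) by simp
    moreover have "integral\<^sup>L ?M (D1 l (ws \<epsilon>)) = integral\<^sup>L ?M (\<lambda>x. w1 (fst x) + P1 \<epsilon> x)"
      by (rule integral_cong_AE[OF meas[OF W12D(3)[OF domains(9) W Basis_S(1)]] meas[OF wsL(2)] a1])
    moreover have "integral\<^sup>L ?M (\<lambda>x. w1 (fst x) + P1 \<epsilon> x) = 0"
      using int[OF LS(2)] int[OF PL(2)] lift_fst(2)[OF LI(2)] w1m mP(2) by (simp add: set_integral_lebesgue_on(1)[OF domains(1)])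
    moreover have "integral\<^sup>L ?M (D2 l (ws \<epsilon>)) = integral\<^sup>L ?M (\<lambda>x. \<epsilon> * R \<epsilon> x)"
      by (rule integral_cong_AE[OF meas[OF W12D(3)[OF domains(9) W Basis_S(2)]] meas[OF cL[OF PL(3)]] a2])
    moreover have "integral\<^sup>L ?M (\<lambda>x. \<epsilon> * R \<epsilon> x) = 0" using mP(3) by simp
    ultimately show ?thesis
      using wsW[OF e] by (simp add: W22_0_def set_integral_lebesgue_on(1)[OF domains(9)] Basis_plane)
  qed

  \<comment> \<open>The factor \<open>2 \<epsilon>\<close> compensates
    \<open>1/(2 \<epsilon>)\<close> in the shear and \<open>\<epsilon>^2\<close> compensates the
    scaling of the vertical strain, leaving \<open>qa\<close> and \<open>qb\<close>. The unwanted
    horizontal derivatives enter as \<open>2 \<epsilon> Ca1\<close> and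
    \<open>\<epsilon> Cb1 / 2\<close>, both vanishing; the singular terms of \<open>y\<close> cancel
    since it is Bernoulli-Navier.\<close>
  define ys where "ys \<epsilon> x = y x + (2 * (\<epsilon> * Ca \<epsilon> x), \<epsilon> * (\<epsilon> * Cb \<epsilon> x))" for \<epsilon> x
  note ca = cw[OF Basis_S(1) cw[OF Basis_S(1) Ca(1)]] cw[OF Basis_S(2) cw[OF Basis_S(2) Ca(2)]]
    and cb = cw[OF Basis_S(1) cw[OF Basis_S(1) Cb(1)]] cw[OF Basis_S(2) cw[OF Basis_S(2) Cb(2)]]
  have ys1: "has_weak_deriv ?S (1, 0) (ys \<epsilon>) (\<lambda>x. D1 l y x + (2 * (\<epsilon> * Ca1 \<epsilon> x), \<epsilon> * (\<epsilon> * Cb1 \<epsilon> x)))" for \<epsilon>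
    unfolding ys_def[abs_def]
    by (rule has_weak_deriv_add[OF domains(9) Basis_S(1) W12D(2)[OF domains(9) yW Basis_S(1)] has_weak_deriv_Pair[OF domains(9) Basis_S(1) ca(1) cb(1)]])
  have ys2: "has_weak_deriv ?S (0, 1) (ys \<epsilon>) (\<lambda>x. D2 l y x + (2 * (\<epsilon> * qa \<epsilon> x), \<epsilon> * (\<epsilon> * qb \<epsilon> x)))" for \<epsilon>
    unfolding ys_def[abs_def]
    by (rule has_weak_deriv_add[OF domains(9) Basis_S(2) W12D(2)[OF domains(9) yW Basis_S(2)] has_weak_deriv_Pair[OF domains(9) Basis_S(2) ca(2) cb(2)]])
  have cpL: "(\<lambda>x. (2 * (\<epsilon> * u x), \<epsilon> * (\<epsilon> * v x))) \<in> L2 ?S" if "u \<in> L2 ?S" "v \<in> L2 ?S" for \<epsilon> and u v :: "real \<times> real \<Rightarrow> real"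
    by (rule L2_Pair[OF domains(9) cL[OF cL[OF that(1)]] cL[OF cL[OF that(2)]]])
  have ysW: "ys \<epsilon> \<in> W12 ?S" for \<epsilon>
    unfolding ys_def[abs_def]
    by (rule W12_plane[OF L2_add[OF domains(9) W12D(1)[OF domains(9) yW] cpL[OF Ca(3) Cb(3)]] ys1[unfolded ys_def[abs_def]] ys2[unfolded ys_def[abs_def]]
          L2_add[OF domains(9) W12D(3)[OF domains(9) yW Basis_S(1)] cpL[OF Ca(4) Cb(4)]]
          L2_add[OF domains(9) W12D(3)[OF domains(9) yW Basis_S(2)] cpL[OF Ca(5) Cb(5)]]])
  have ys0: "ys \<epsilon> \<in> W12_0 ?S" for \<epsilon>
  proof -
    let ?c = "\<lambda>x. (2 * (\<epsilon> * Ca \<epsilon> x), \<epsilon> * (\<epsilon> * Cb \<epsilon> x))"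
    note ic = int[OF cpL[OF Ca(3) Cb(3)]]
    have "integral\<^sup>L ?M ?c = 0"
      using integral_bounded_linear[OF bounded_linear_fst ic[of \<epsilon> \<epsilon> \<epsilon>]] integral_bounded_linear[OF bounded_linear_snd ic[of \<epsilon> \<epsilon> \<epsilon>]] Ca(6) Cb(6)
      by (auto simp: prod_eq_iff)
    then have "integral\<^sup>L ?M (ys \<epsilon>) = 0"
      unfolding ys_def using int[OF W12D(1)[OF domains(9) yW]] ic ym by simp
    then show ?thesis using ysW by (simp add: W12_0_def set_integral_lebesgue_on(1)[OF domains(9)])
  qed
  note b1 = wderiv_eq(2)[OF domains(9) Basis_S(1) ys1] and b2 = wderiv_eq(2)[OF domains(9) Basis_S(2) ys2]

  have nsup: "L2_null l g" if "\<And>\<epsilon>. g \<epsilon> \<in> L2 ?S" "\<And>\<epsilon>. 0 < \<epsilon> \<Longrightarrow> AE x in ?M. \<bar>g \<epsilon> x\<bar> \<le> \<eta> \<epsilon>" for g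
    by (rule L2_null_sup[OF meas[OF that(1)] that(2) \<eta>])
  have nP: "L2_null l P" by (rule nsup[OF PL(1)]) (use bP in fast)
  have nP1: "L2_null l P1" by (rule nsup[OF PL(2)]) (use bP in fast)
  have nP11: "L2_null l P11" by (rule nsup[OF PL(4)]) (use bP in fast)
  have nR: "L2_null l (\<lambda>\<epsilon> x. R \<epsilon> x - \<theta> (fst x))"
    by (rule nsup[OF L2_diff[OF domains(9) PL(3) LS(4)]]) (use bP in fast)
  \<comment> \<open>The factor \<epsilon> is split into \<epsilon> times the error plus \<epsilon>
    times a fixed \<open>L2\<close> function; boundedness in \<open>L2\<close> is thus never stated
    separately.\<close>
  have shrink: "L2_null l (\<lambda>\<epsilon> x. \<epsilon> * g \<epsilon> x)" if "L2_null l (\<lambda>\<epsilon> x. g \<epsilon> x - h x)" "h \<in> L2 ?S" for g h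
    using L2_null_add[OF L2_null_shrink[OF that(1)] L2_null_const[OF that(2)]]
    by (rule L2_null_AE) (simp add: algebra_simps)
  note sR = shrink[OF nR LS(4)] and sH12 = shrink[OF nH(1) LS(5)[unfolded \<theta>1_def]] and sH22 = shrink[OF nH(2) lift_fst(1)[OF \<gamma>L]]

  have zL: "(\<lambda>x. 0 :: real) \<in> L2 ?S" by (rule const_L2[OF domains(9,10)])
  have z: "has_weak_deriv ?S (1, 0) (\<lambda>x. 0 :: real) (\<lambda>x. 0)" "has_weak_deriv ?S (0, 1) (\<lambda>x. 0 :: real) (\<lambda>x. 0)"
    using plane_C1_has_weak_deriv[of "\<lambda>x. 0" "\<lambda>x. 0" "\<lambda>x. 0" l] by auto
  have conv: "vK_converges l ys ws y w \<theta>"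
    unfolding vK_converges_def
  proof (intro conjI)
    show "weakly_converges (W12 ?S) (norm_W12 ?S) ys y (at_right 0)"
    proof (rule norm_tendsto_weakly_converges[OF W12_add(1)[OF domains(9)] W12_scale(1)[OF domains(9)] _ yW])
      show "((\<lambda>\<epsilon>. norm_W12 ?S (\<lambda>x. ys \<epsilon> x - y x)) \<longlongrightarrow> 0) (at_right 0)"
        by (rule norm_W12_pair_tendsto[OF L2_null_cmult[OF Ca(7), of 2] L2_null_shrink[OF Cb(7)] L2_null_cmult[OF Ca(8), of 2] L2_null_cmult[OF Ca(9), of 2]
              L2_null_shrink[OF Cb(8)] L2_null_shrink[OF Cb(9)] ca cb])
          (simp add: ys_def)
    qed (simp_all add: ysW)
    show "weakly_converges (W22 ?S) (norm_W22 ?S) ws (\<lambda>x. w (fst x)) (at_right 0)"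
    proof (rule norm_tendsto_weakly_converges[OF W22_add(1)[OF domains(9)] W22_scale(1)[OF domains(9)]])
      show "eventually (\<lambda>\<epsilon>. ws \<epsilon> \<in> W22 ?S) (at_right 0)" using eventually_pos by eventually_elim (rule wsW)
      show "(\<lambda>x. w (fst x)) \<in> W22 ?S"
        by (rule W22_plane[OF LS(1) dw W12_plane[OF LS(2) dw1 LS(3) zL] W12_plane[OF zL z zL zL]])
      have "((\<lambda>\<epsilon>. norm_W22 ?S (P \<epsilon>)) \<longlongrightarrow> 0) (at_right 0)"
        by (rule norm_W22_tendsto[OF nP nP1 sR nP11 sH12 L2_null_shrink[OF sH22] dP dP1 ws21 ws22])
      then show "((\<lambda>\<epsilon>. norm_W22 ?S (\<lambda>x. ws \<epsilon> x - w (fst x))) \<longlongrightarrow> 0) (at_right 0)" by (simp add: ws_def)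
    qed
    show "weakly_converges (W12 ?S) (norm_W12 ?S) (\<lambda>\<epsilon>. grad_eps l \<epsilon> (ws \<epsilon>)) (\<lambda>x. (DI l w (fst x), \<theta> (fst x))) (at_right 0)"
      unfolding w1_def[symmetric]
    proof (rule norm_tendsto_weakly_converges[OF W12_add(1)[OF domains(9)] W12_scale(1)[OF domains(9)]])
      show "eventually (\<lambda>\<epsilon>. grad_eps l \<epsilon> (ws \<epsilon>) \<in> W12 ?S) (at_right 0)"
        using eventually_pos by eventually_elim (rule grad_eps_W12[OF wsW])
      show "(\<lambda>x. (w1 (fst x), \<theta> (fst x))) \<in> W12 ?S"
        by (rule W12_plane[OF L2_Pair[OF domains(9) LS(2,4)] has_weak_deriv_Pair[OF domains(9) Basis_S(1) dw1(1) d\<theta>(1)]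
              has_weak_deriv_Pair[OF domains(9) Basis_S(2) dw1(2) d\<theta>(2)] L2_Pair[OF domains(9) LS(3,5)] L2_Pair[OF domains(9) zL zL]])
      have d1: "has_weak_deriv ?S (1, 0) (\<lambda>x. R \<epsilon> x - \<theta> (fst x)) (\<lambda>x. H12 \<epsilon> x - DI l \<theta> (fst x))" for \<epsilon>
        using has_weak_deriv_diff[OF domains(9) Basis_S(1) dR(1) d\<theta>(1)] by (simp add: \<theta>1_def)
      have d2: "has_weak_deriv ?S (0, 1) (\<lambda>x. R \<epsilon> x - \<theta> (fst x)) (\<lambda>x. \<epsilon> * H22 \<epsilon> x)" for \<epsilon>
        using has_weak_deriv_diff[OF domains(9) Basis_S(2) dR(2) d\<theta>(2)] by simp
      show "((\<lambda>\<epsilon>. norm_W12 ?S (\<lambda>x. grad_eps l \<epsilon> (ws \<epsilon>) x - (w1 (fst x), \<theta> (fst x)))) \<longlongrightarrow> 0) (at_right 0)"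
      proof (rule norm_W12_pair_tendsto[OF nP1 nR nP11 sH12 nH(1) sH22 dP1 d1 d2])
        fix \<epsilon> :: real assume e: "0 < \<epsilon>"
        show "AE x in ?M. grad_eps l \<epsilon> (ws \<epsilon>) x - (w1 (fst x), \<theta> (fst x)) = (P1 \<epsilon> x, R \<epsilon> x - \<theta> (fst x))"
          using a1[of \<epsilon>] a2[of \<epsilon>] by eventually_elim (use e in \<open>simp add: grad_eps_def\<close>)
      qed
    qed
  qed

  \<comment> \<open>The entries of the total strain after all cancellations; \<open>ext\<close>
    confirms that no negative power of \<epsilon> remains.\<close>
  define a where "a \<epsilon> x = fst (D1 l y x) + 2 * (\<epsilon> * Ca1 \<epsilon> x) + (w1 (fst x) + P1 \<epsilon> x)\<^sup>2 / 2" for \<epsilon> x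
  define b where "b \<epsilon> x = qa \<epsilon> x + 1/2 * (\<epsilon> * Cb1 \<epsilon> x) + (w1 (fst x) + P1 \<epsilon> x) * R \<epsilon> x / 2" for \<epsilon> x
  define d where "d \<epsilon> x = qb \<epsilon> x + (R \<epsilon> x)\<^sup>2 / 2" for \<epsilon> x
  have ext: "AE x in ?M. E_eps l \<epsilon> (ys \<epsilon>) x + (1/2) *\<^sub>R tensor (grad_eps l \<epsilon> (ws \<epsilon>) x) (grad_eps l \<epsilon> (ws \<epsilon>) x) = mat22 (a \<epsilon> x) (b \<epsilon> x) (b \<epsilon> x) (d \<epsilon> x)"
    if e: "0 < \<epsilon>" for \<epsilon>
    using a1[of \<epsilon>] a2[of \<epsilon>] b1[of \<epsilon>] b2[of \<epsilon>] BN_0_AE[OF y]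
  proof eventually_elim
    case (elim x)
    have "a \<epsilon> x = fst (D1 l (ys \<epsilon>) x) + (D1 l (ws \<epsilon>) x)\<^sup>2 / 2" using elim by (simp add: a_def)
    moreover have "1 / (2 * \<epsilon>) * (fst (D2 l (ys \<epsilon>) x) + snd (D1 l (ys \<epsilon>) x)) = qa \<epsilon> x + 1/2 * (\<epsilon> * Cb1 \<epsilon> x)"
    proof -
      have "fst (D2 l (ys \<epsilon>) x) + snd (D1 l (ys \<epsilon>) x) = 2 * (\<epsilon> * qa \<epsilon> x) + \<epsilon> * (\<epsilon> * Cb1 \<epsilon> x)" using elim by simp
      then show ?thesis using e by (simp add: field_simps)
    qed
    then have "b \<epsilon> x = 1 / (2 * \<epsilon>) * (fst (D2 l (ys \<epsilon>) x) + snd (D1 l (ys \<epsilon>) x)) + D1 l (ws \<epsilon>) x * (1 / \<epsilon> * D2 l (ws \<epsilon>) x) / 2"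
      using elim e by (simp add: b_def)
    moreover have "d \<epsilon> x = 1 / \<epsilon>\<^sup>2 * snd (D2 l (ys \<epsilon>) x) + (1 / \<epsilon> * D2 l (ws \<epsilon>) x)\<^sup>2 / 2"
      using elim e by (simp add: d_def power2_eq_square)
    ultimately show ?case unfolding E_eps_mat22 by simp
  qed
  have ben: "AE x in ?M. hess_eps l \<epsilon> (ws \<epsilon>) x = mat22 (w2 (fst x) + P11 \<epsilon> x) (H12 \<epsilon> x) (H12 \<epsilon> x) (H22 \<epsilon> x)" if e: "0 < \<epsilon>" for \<epsilon>
    using a11[of \<epsilon>] a12[of \<epsilon>] a21[of \<epsilon>] a22[of \<epsilon>]
    by eventually_elim (use e in \<open>simp add: hess_eps_def power2_eq_square\<close>)
  have bound: "AE x in ?M. \<bar>w1 (fst x)\<bar> \<le> Mw \<and> \<bar>\<theta> (fst x)\<bar> \<le> M\<theta> \<and> \<bar>P1 \<epsilon> x\<bar> \<le> \<eta> \<epsilon> \<and> \<bar>R \<epsilon> x - \<theta> (fst x)\<bar> \<le> \<eta> \<epsilon>" if "0 < \<epsilon>" for \<epsilon>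
    using MwS M\<theta>S bP[OF that] by eventually_elim simp
  note msr = meas[OF LS(2)] meas[OF LS(4)] meas[OF PL(2)] meas[OF PL(3)]
  \<comment> \<open>The error in half the square of \<open>w1 + P1\<close>. Products are estimated
    in the supremum norm, because two factors vanishing in \<open>L2\<close> need not have a product
    that does.\<close>
  have "L2_null l (\<lambda>\<epsilon> x. w1 (fst x) * P1 \<epsilon> x + 1/2 * (P1 \<epsilon> x * P1 \<epsilon> x))"
  proof (rule L2_null_product[OF _ _ \<eta>])
    fix \<epsilon> :: real assume e: "0 < \<epsilon>"
    show "AE x in ?M. \<bar>w1 (fst x) * P1 \<epsilon> x + 1/2 * (P1 \<epsilon> x * P1 \<epsilon> x)\<bar> \<le> Mw * \<eta> \<epsilon> + 1 * (\<eta> \<epsilon> * \<eta> \<epsilon>)"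
      using bound[OF e]
    proof eventually_elim
      case (elim x)
      then have e: "\<bar>w1 (fst x)\<bar> \<le> Mw" "\<bar>\<theta> (fst x)\<bar> \<le> M\<theta>" "\<bar>P1 \<epsilon> x\<bar> \<le> \<eta> \<epsilon>" "\<bar>R \<epsilon> x - \<theta> (fst x)\<bar> \<le> \<eta> \<epsilon>" by simp_all
      show ?case
        using abs_mult_le[OF e(1) e(3)] abs_mult_le[OF e(3) e(3)] by linarith
    qed
    show "(\<lambda>x. w1 (fst x) * P1 \<epsilon> x + 1/2 * (P1 \<epsilon> x * P1 \<epsilon> x)) \<in> borel_measurable ?M"
      by (intro borel_measurable_add borel_measurable_times borel_measurable_const msr)
  qed
  from L2_null_add[OF L2_null_cmult[OF Ca(8), of 2] this]
  have n1: "L2_null l (\<lambda>\<epsilon> x. a \<epsilon> x - f x)"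
    by (rule L2_null_AE) (simp add: a_def f_def power2_eq_square field_simps)
  \<comment> \<open>Half the difference of \<open>(w1 + P1) * R\<close> and
    \<open>w1 * \<theta>\<close>, the latter being what was subtracted from the optimal shear when
    \<open>\<alpha>0\<close> was defined. Each summand contains a uniformly small factor and a
    bounded one.\<close>
  have "L2_null l (\<lambda>\<epsilon> x. 1/2 * (w1 (fst x) * (R \<epsilon> x - \<theta> (fst x)) + P1 \<epsilon> x * (R \<epsilon> x - \<theta> (fst x)) + P1 \<epsilon> x * \<theta> (fst x)))"
  proof (rule L2_null_cmult, rule L2_null_product[OF _ _ \<eta>])
    fix \<epsilon> :: real assume e: "0 < \<epsilon>"
    show "AE x in ?M. \<bar>w1 (fst x) * (R \<epsilon> x - \<theta> (fst x)) + P1 \<epsilon> x * (R \<epsilon> x - \<theta> (fst x)) + P1 \<epsilon> x * \<theta> (fst x)\<bar> \<le> (Mw + M\<theta>) * \<eta> \<epsilon> + 1 * (\<eta> \<epsilon> * \<eta> \<epsilon>)"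
      using bound[OF e]
    proof eventually_elim
      case (elim x)
      then have e: "\<bar>w1 (fst x)\<bar> \<le> Mw" "\<bar>\<theta> (fst x)\<bar> \<le> M\<theta>" "\<bar>P1 \<epsilon> x\<bar> \<le> \<eta> \<epsilon>" "\<bar>R \<epsilon> x - \<theta> (fst x)\<bar> \<le> \<eta> \<epsilon>" by simp_all
      have "(Mw + M\<theta>) * \<eta> \<epsilon> = Mw * \<eta> \<epsilon> + \<eta> \<epsilon> * M\<theta>" by (simp add: algebra_simps)
      then show ?case
        using abs_mult_le[OF e(1) e(4)] abs_mult_le[OF e(3) e(4)]
          abs_mult_le[OF e(3) e(2)] by linarith
    qed
    show "(\<lambda>x. w1 (fst x) * (R \<epsilon> x - \<theta> (fst x)) + P1 \<epsilon> x * (R \<epsilon> x - \<theta> (fst x)) + P1 \<epsilon> x * \<theta> (fst x)) \<in> borel_measurable ?M"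
      by (intro borel_measurable_add borel_measurable_times borel_measurable_diff msr)
  qed
  from L2_null_add[OF L2_null_add[OF Ca(10) L2_null_cmult[OF Cb(8), of "1/2"]] this]
  have n2: "L2_null l (\<lambda>\<epsilon> x. b \<epsilon> x - k * f x)"
    by (rule L2_null_AE) (simp add: b_def \<alpha>0_def field_simps)
  \<comment> \<open>Half the difference of \<open>R^2\<close> and \<open>\<theta>^2\<close>,
    matching the term subtracted in \<open>\<beta>0\<close>.\<close>
  have "L2_null l (\<lambda>\<epsilon> x. 1/2 * ((R \<epsilon> x - \<theta> (fst x)) * (R \<epsilon> x - \<theta> (fst x)) + 2 * (\<theta> (fst x) * (R \<epsilon> x - \<theta> (fst x)))))"
  proof (rule L2_null_cmult, rule L2_null_product[OF _ _ \<eta>])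
    fix \<epsilon> :: real assume e: "0 < \<epsilon>"
    show "AE x in ?M. \<bar>(R \<epsilon> x - \<theta> (fst x)) * (R \<epsilon> x - \<theta> (fst x)) + 2 * (\<theta> (fst x) * (R \<epsilon> x - \<theta> (fst x)))\<bar> \<le> (2 * M\<theta>) * \<eta> \<epsilon> + 1 * (\<eta> \<epsilon> * \<eta> \<epsilon>)"
      using bound[OF e]
    proof eventually_elim
      case (elim x)
      then have e: "\<bar>w1 (fst x)\<bar> \<le> Mw" "\<bar>\<theta> (fst x)\<bar> \<le> M\<theta>" "\<bar>P1 \<epsilon> x\<bar> \<le> \<eta> \<epsilon>" "\<bar>R \<epsilon> x - \<theta> (fst x)\<bar> \<le> \<eta> \<epsilon>" by simp_all
      have "(2 * M\<theta>) * \<eta> \<epsilon> = 2 * (M\<theta> * \<eta> \<epsilon>)" by simp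
      then show ?case
        using abs_mult_le[OF e(2) e(4)] abs_mult_le[OF e(4) e(4)]
        by linarith
    qed
    show "(\<lambda>x. (R \<epsilon> x - \<theta> (fst x)) * (R \<epsilon> x - \<theta> (fst x)) + 2 * (\<theta> (fst x) * (R \<epsilon> x - \<theta> (fst x)))) \<in> borel_measurable ?M"
      by (intro borel_measurable_add borel_measurable_times borel_measurable_diff borel_measurable_const msr)
  qed
  from L2_null_add[OF Cb(10) this]
  have n3: "L2_null l (\<lambda>\<epsilon> x. d \<epsilon> x - (g1 + g2 * k) * f x)"
    by (rule L2_null_AE) (simp add: d_def \<beta>0_def power2_eq_square field_simps)
  have n4: "L2_null l (\<lambda>\<epsilon> x. (w2 (fst x) + P11 \<epsilon> x) - w2 (fst x))" using nP11 by simp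
  have n6: "L2_null l (\<lambda>\<epsilon> x. H22 \<epsilon> x - (g1 * w2 (fst x) + g2 * \<theta>1 (fst x)))" using nH(2) by (simp add: \<gamma>_def)
  have "integral\<^sup>L ?M (\<lambda>x. (\<theta>1 (fst x) - k * w2 (fst x))\<^sup>2) = integral\<^sup>L (lebesgue_on ?I) (\<lambda>t. (\<theta>1 t - k * w2 t)\<^sup>2)"
    using lift_fst(3)[OF L2_diff[OF domains(1) LI(5) L2_cmult[OF domains(1) LI(3), of k]]] by simp
  moreover note lift_fst(3)[OF LI(3)]
    and J_vK_eq[OF l pos Q yW w \<theta>W, folded w1_def, folded w2_def \<theta>1_def, folded f_def]
  moreover note energy_limit[OF pos Q ext ben fL LS(3,5) n1 n2 n3 n4 nH(1)[folded \<theta>1_def] n6]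
  ultimately have "((\<lambda>\<epsilon>. J_vK_eps Q l \<epsilon> (ys \<epsilon>) (ws \<epsilon>)) \<longlongrightarrow> J_vK Q l y w \<theta>) (at_right 0)" by simp
  then have "Limsup (at_right 0) (\<lambda>\<epsilon>. J_vK_eps Q l \<epsilon> (ys \<epsilon>) (ws \<epsilon>)) = J_vK Q l y w \<theta>"
    by (rule lim_imp_Limsup[rotated]) simp
  then show ?thesis using ys0 ws0 conv by (intro exI[of _ ys] exI[of _ ws]) simp
qed

theorem theorem2p3:
  fixes l :: real and Q2 :: "real^2^2 \<Rightarrow> real"
  assumes "l > 0" and "pos_def_quadratic_form_sym Q2"
  shows
    "(\<forall>ys ws y w \<theta>.
        (\<forall>\<epsilon>>0. ys \<epsilon> \<in> W12_0 (S_dom l)) \<and> (\<forall>\<epsilon>>0. ws \<epsilon> \<in> W22_0 (S_dom l)) \<and>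
        y \<in> BN_0 l \<and> w \<in> W22_0 (I_dom l) \<and> \<theta> \<in> W12_0 (I_dom l) \<and>
        vK_converges l ys ws y w \<theta> \<longrightarrow>
        Liminf (at_right 0) (\<lambda>\<epsilon>. J_vK_eps Q2 l \<epsilon> (ys \<epsilon>) (ws \<epsilon>)) \<ge> J_vK Q2 l y w \<theta>)
     \<and>
     (\<forall>y w \<theta>. y \<in> BN_0 l \<and> w \<in> W22_0 (I_dom l) \<and> \<theta> \<in> W12_0 (I_dom l) \<longrightarrow>
        (\<exists>ys ws.
          (\<forall>\<epsilon>>0. ys \<epsilon> \<in> W12_0 (S_dom l)) \<and> (\<forall>\<epsilon>>0. ws \<epsilon> \<in> W22_0 (S_dom l)) \<and>
          vK_converges l ys ws y w \<theta> \<and>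
          Limsup (at_right 0) (\<lambda>\<epsilon>. J_vK_eps Q2 l \<epsilon> (ys \<epsilon>) (ws \<epsilon>)) \<le> J_vK Q2 l y w \<theta>))"
proof -
  obtain D B q g1 g2 k :: real where pos: "D > 0" "B > 0" "q > 0"
    and Q: "\<And>a b d. Q2 (mat22 a b b d) = D * (d - g1 * a - g2 * b)\<^sup>2 + B * (b - k * a)\<^sup>2 + q * a\<^sup>2"
    by (rule quadratic_form_LDL[OF assms(2)]) (rule that)
  show ?thesis
  proof (intro conjI allI impI; elim conjE)
    fix ys :: "real \<Rightarrow> real \<times> real \<Rightarrow> real \<times> real" and ws :: "real \<Rightarrow> real \<times> real \<Rightarrow> real"
      and y :: "real \<times> real \<Rightarrow> real \<times> real" and w \<theta> :: "real \<Rightarrow> real"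
    assume a: "\<forall>\<epsilon>>0. ys \<epsilon> \<in> W12_0 (S_dom l)" "\<forall>\<epsilon>>0. ws \<epsilon> \<in> W22_0 (S_dom l)"
      "y \<in> BN_0 l" "w \<in> W22_0 (I_dom l)" "\<theta> \<in> W12_0 (I_dom l)" "vK_converges l ys ws y w \<theta>"
    show "J_vK Q2 l y w \<theta> \<le> Liminf (at_right 0) (\<lambda>\<epsilon>. J_vK_eps Q2 l \<epsilon> (ys \<epsilon>) (ws \<epsilon>))"
      by (rule liminf_inequality[OF assms(1) pos Q a(1,2)[rule_format] a(3-6)])
  qed (rule recovery_sequence[OF assms(1) pos Q])
qed

end
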